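(* Let $G$ be a torus acting smoothly on a manifold $M$, let $\Psi\colon M\to\mathfrak g^*$ be an abstract moment map, and let $A\in\mathcal A(M)$ be the assignment of $\Psi$. Then $\Psi$ is Hamiltonian if and only if $A\in\operatorname{im}\rho$, where $\rho\colon H^2_G(M)\to\mathcal A(M)$ is the homomorphism sending the class of an equivariantly closed two-form $\omega+\Phi$ to the assignment of $\Phi$.
   Context: $\mathfrak g$ is the Lie algebra of $G$, and $\xi_M$ is the vector field on $M$ generated by $\xi\in\mathfrak g$. For a subgroup $H\subseteq G$ with Lie algebra $\mathfrak h$ and a map $\Psi\colon M\to\mathfrak g^*$, both $\Psi^H$ and $\Psi^{\mathfrak h}$ denote the composition of $\Psi$ with the restriction $\mathfrak g^*\to\mathfrak h^*$, and $\Psi^\xi=\langle\Psi,\xi\rangle$. An abstract moment map on $M$ is a smooth $G$-equivariant map $\Psi\colon M\to\mathfrak g^*$ such that for every (Lie) subgroup $H\subseteq G$ the map $\Psi^H$ is locally constant on $M^H$. It is Hamiltonian if there is a closed $G$-invariant two-form $\omega$ on $M$ (not required to be non-degenerate) with $\iota(\xi_M)\omega=-d\Psi^\xi$ for all $\xi\in\mathfrak g$. The infinitesimal stabilizer of $m$ is $\mathfrak g_m=\{\xi\in\mathfrak g:\xi_M|_m=0\}$. The infinitesimal orbit type strata of $M$ are the connected components of the sets $\{m:\mathfrak g_m=\mathfrak h\}$, for subalgebras $\mathfrak h\subseteq\mathfrak g$; $\mathfrak g_X$ is the common infinitesimal stabilizer of the points of a stratum $X$. An assignment is a function $A$ associating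 to each stratum $X$ an element $A(X)\in\mathfrak g_X^*$ such that, whenever $X$ is contained in the closure of $Y$, $A(Y)$ is the restriction of $A(X)$ to $\mathfrak g_Y$. $\mathcal A(M)$ is the vector space of all assignments. The assignment of an abstract moment map $\Psi$ is $X\mapsto\Psi^{\mathfrak g_X}(X)$, the constant value of $\Psi^{\mathfrak g_X}$ on $X$. An equivariant two-form on $M$ is a formal sum $\omega+\Phi$ with $\omega$ a $G$-invariant two-form and $\Phi\colon M\to\mathfrak g^*$ smooth and $G$-equivariant. It is equivariantly closed if $d\omega=0$ and $\iota(\xi_M)\omega=-d\Phi^\xi$ for all $\xi$ (then $\Phi$ is an abstract moment map), and equivariantly exact if there is a $G$-invariant one-form $\mu$ with $\omega=d\mu$ and $\Phi^\xi=\mu(\xi_M)$ for all $\xi$ (then the assignment of $\Phi$ is zero). $H^2_G(M)$ is the quotient of the space of equivariantly closed two-forms by the subspace of equivariantly exact ones. *)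

theory Defs
  imports "HOL-Analysis.Analysis" "HOL-Algebra.Group_Action"
begin

section \<open>Smooth functions on subsets of Euclidean space\<close>

primrec Ck_on :: "nat \<Rightarrow> 'a::real_normed_vector set \<Rightarrow> ('a \<Rightarrow> 'b::real_normed_vector) \<Rightarrow> bool" where
  "Ck_on 0 T f \<longleftrightarrow> continuous_on T f"
| "Ck_on (Suc k) T f \<longleftrightarrow> (\<forall>x\<in>T. f differentiable (at x)) \<and>
     (\<forall>v. Ck_on k T (\<lambda>x. frechet_derivative f (at x) v))"

text \<open>
  A function on an arbitrary subset is smooth if it locally extends to a smooth function on an
  open set. On a relatively open subset of a linear subspace, and more generally on an
  embedded submanifold, this is the usual smoothness.
\<close>

definition smooth_on :: "'a::euclidean_space set \<Rightarrow> ('a \<Rightarrow> 'b::euclidean_space) \<Rightarrow> bool" where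
  "smooth_on S f \<longleftrightarrow> (\<forall>x\<in>S. \<exists>T F. open T \<and> x \<in> T \<and> (\<forall>k. Ck_on k T F) \<and> (\<forall>y\<in>S \<inter> T. F y = f y))"

text \<open>
  The space of vectors supported on the index set \<open>J\<close>, that is, $\mathbb{R}^J$. Letting \<open>J\<close> be any
  subset of the (nonempty) index type allows every finite dimension, zero included.
\<close>

definition coord_space :: "'i::finite set \<Rightarrow> (real^'i) set" where
  "coord_space J = {x. \<forall>i. i \<notin> J \<longrightarrow> x $ i = 0}"


section \<open>Smooth manifolds\<close>

text \<open>
  The manifold is a whole topological type \<open>'m\<close>; the Hausdorff property and second countability
  are expressed by its sort. A chart is a pair of its domain and its coordinate map, whose values
  outside the domain are irrelevant.
\<close>

type_synonym ('m, 'n) chart = "'m set \<times> ('m \<Rightarrow> real^'n)"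

definition smooth_atlas ::
  "'n::finite set \<Rightarrow> ('m::{t2_space, second_countable_topology}, 'n) chart set \<Rightarrow> bool" where
  "smooth_atlas J \<A> \<longleftrightarrow>
     (\<Union>(U, \<phi>)\<in>\<A>. U) = UNIV \<and>
     (\<forall>(U, \<phi>)\<in>\<A>. open U \<and> openin (top_of_set (coord_space J)) (\<phi> ` U) \<and>
        homeomorphism U (\<phi> ` U) \<phi> (inv_into U \<phi>)) \<and>
     (\<forall>(U, \<phi>)\<in>\<A>. \<forall>(V, \<psi>)\<in>\<A>. smooth_on (\<phi> ` (U \<inter> V)) (\<psi> \<circ> inv_into U \<phi>))"

definition C_infinity :: "('m, 'n::finite) chart set \<Rightarrow> ('m \<Rightarrow> real) set" where
  "C_infinity \<A> = {f. \<forall>(U, \<phi>)\<in>\<A>. smooth_on (\<phi> ` U) (f \<circ> inv_into U \<phi>)}"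

text \<open>
  Tangent vectors at \<open>m\<close> are the derivations of the algebra of smooth functions at \<open>m\<close>. They are
  made zero on non-smooth functions, so that equality of tangent vectors is equality of
  derivations.
\<close>

type_synonym 'm tvec = "('m \<Rightarrow> real) \<Rightarrow> real"

definition tangent_space :: "('m, 'n::finite) chart set \<Rightarrow> 'm \<Rightarrow> 'm tvec set" where
  "tangent_space \<A> m = {v.
     (\<forall>f\<in>C_infinity \<A>. \<forall>g\<in>C_infinity \<A>.
        v (\<lambda>p. f p + g p) = v f + v g \<and> v (\<lambda>p. f p * g p) = f m * v g + g m * v f) \<and>
     (\<forall>c. \<forall>f\<in>C_infinity \<A>. v (\<lambda>p. c * f p) = c * v f) \<and>
     (\<forall>f. f \<notin> C_infinity \<A> \<longrightarrow> v f = 0)}"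

definition vector_field :: "('m, 'n::finite) chart set \<Rightarrow> ('m \<Rightarrow> 'm tvec) \<Rightarrow> bool" where
  "vector_field \<A> X \<longleftrightarrow> (\<forall>m. X m \<in> tangent_space \<A> m) \<and>
     (\<forall>f\<in>C_infinity \<A>. (\<lambda>m. X m f) \<in> C_infinity \<A>)"

definition lie_bracket :: "('m \<Rightarrow> 'm tvec) \<Rightarrow> ('m \<Rightarrow> 'm tvec) \<Rightarrow> 'm \<Rightarrow> 'm tvec" where
  "lie_bracket X Y m = (\<lambda>f. X m (\<lambda>p. Y p f) - Y m (\<lambda>p. X p f))"

definition push_forward ::
  "('m, 'n::finite) chart set \<Rightarrow> ('m \<Rightarrow> 'm) \<Rightarrow> 'm tvec \<Rightarrow> 'm tvec" where
  "push_forward \<A> F v = (\<lambda>f. if f \<in> C_infinity \<A> then v (f \<circ> F) else 0)"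


section \<open>Differential forms\<close>

text \<open>Only the values of a form on tangent vectors are meaningful.\<close>

definition one_form :: "('m, 'n::finite) chart set \<Rightarrow> ('m \<Rightarrow> 'm tvec \<Rightarrow> real) \<Rightarrow> bool" where
  "one_form \<A> \<mu> \<longleftrightarrow>
     (\<forall>m. \<forall>u\<in>tangent_space \<A> m. \<forall>v\<in>tangent_space \<A> m.
        \<mu> m (\<lambda>f. u f + v f) = \<mu> m u + \<mu> m v) \<and>
     (\<forall>m. \<forall>v\<in>tangent_space \<A> m. \<forall>c. \<mu> m (\<lambda>f. c * v f) = c * \<mu> m v) \<and>
     (\<forall>X. vector_field \<A> X \<longrightarrow> (\<lambda>m. \<mu> m (X m)) \<in> C_infinity \<A>)"

definition two_form :: "('m, 'n::finite) chart set \<Rightarrow> ('m \<Rightarrow> 'm tvec \<Rightarrow> 'm tvec \<Rightarrow> real) \<Rightarrow> bool" where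
  "two_form \<A> \<omega> \<longleftrightarrow>
     (\<forall>m. \<forall>u\<in>tangent_space \<A> m. \<forall>v\<in>tangent_space \<A> m. \<forall>w\<in>tangent_space \<A> m.
        \<omega> m (\<lambda>f. u f + v f) w = \<omega> m u w + \<omega> m v w) \<and>
     (\<forall>m. \<forall>v\<in>tangent_space \<A> m. \<forall>w\<in>tangent_space \<A> m. \<forall>c.
        \<omega> m (\<lambda>f. c * v f) w = c * \<omega> m v w) \<and>
     (\<forall>m. \<forall>v\<in>tangent_space \<A> m. \<forall>w\<in>tangent_space \<A> m. \<omega> m v w = - \<omega> m w v) \<and>
     (\<forall>X Y. vector_field \<A> X \<and> vector_field \<A> Y \<longrightarrow> (\<lambda>m. \<omega> m (X m) (Y m)) \<in> C_infinity \<A>)"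

text \<open>Exterior derivatives, evaluated on vector fields by the coordinate-free formula.\<close>

definition d_one_form ::
  "('m \<Rightarrow> 'm tvec \<Rightarrow> real) \<Rightarrow> ('m \<Rightarrow> 'm tvec) \<Rightarrow> ('m \<Rightarrow> 'm tvec) \<Rightarrow> 'm \<Rightarrow> real" where
  "d_one_form \<mu> X Y m =
     X m (\<lambda>p. \<mu> p (Y p)) - Y m (\<lambda>p. \<mu> p (X p)) - \<mu> m (lie_bracket X Y m)"

definition d_two_form ::
  "('m \<Rightarrow> 'm tvec \<Rightarrow> 'm tvec \<Rightarrow> real) \<Rightarrow>
   ('m \<Rightarrow> 'm tvec) \<Rightarrow> ('m \<Rightarrow> 'm tvec) \<Rightarrow> ('m \<Rightarrow> 'm tvec) \<Rightarrow> 'm \<Rightarrow> real" where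
  "d_two_form \<omega> X Y Z m =
     X m (\<lambda>p. \<omega> p (Y p) (Z p)) - Y m (\<lambda>p. \<omega> p (X p) (Z p)) + Z m (\<lambda>p. \<omega> p (X p) (Y p))
     - \<omega> m (lie_bracket X Y m) (Z m) + \<omega> m (lie_bracket X Z m) (Y m)
     - \<omega> m (lie_bracket Y Z m) (X m)"

definition closed_two_form ::
  "('m, 'n::finite) chart set \<Rightarrow> ('m \<Rightarrow> 'm tvec \<Rightarrow> 'm tvec \<Rightarrow> real) \<Rightarrow> bool" where
  "closed_two_form \<A> \<omega> \<longleftrightarrow> two_form \<A> \<omega> \<and>
     (\<forall>X Y Z m. vector_field \<A> X \<and> vector_field \<A> Y \<and> vector_field \<A> Z \<longrightarrow>
        d_two_form \<omega> X Y Z m = 0)"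


section \<open>Tori and their actions\<close>

text \<open>
  The torus $(S^1)^I$, with \<open>I\<close> a (possibly empty) subset of a finite type, under componentwise
  multiplication. Its Lie algebra is \<^term>\<open>coord_space I\<close> with zero bracket.
\<close>

definition torus :: "'k::finite set \<Rightarrow> (complex^'k) monoid" where
  "torus I = \<lparr>carrier = {z. \<forall>i. cmod (z $ i) = 1 \<and> (i \<notin> I \<longrightarrow> z $ i = 1)}, mult = (*), one = 1\<rparr>"

lemma group_torus: "group (torus I)"
proof (rule groupI)
  fix x assume "x \<in> carrier (torus I)"
  then have x: "cmod (x $ i) = 1" "i \<notin> I \<Longrightarrow> x $ i = 1" for i
    by (auto simp: torus_def)
  then have "x $ i \<noteq> 0" for i
    by (metis norm_zero zero_neq_one)
  with x show "\<exists>y\<in>carrier (torus I). y \<otimes>\<^bsub>torus I\<^esub> x = \<one>\<^bsub>torus I\<^esub>"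
    by (intro bexI[of _ "\<chi> i. inverse (x $ i)"]) (auto simp: torus_def vec_eq_iff norm_inverse)
qed (auto simp: torus_def norm_mult mult.assoc)

definition torus_exp :: "real^'k \<Rightarrow> complex^'k" where
  "torus_exp \<xi> = (\<chi> i. cis (\<xi> $ i))"

text \<open>
  Smoothness of the action map: the pullback of each smooth function is smooth on the product
  of the embedded submanifold \<^term>\<open>carrier (torus I)\<close> with each chart.
\<close>

definition smooth_torus_action ::
  "'k::finite set \<Rightarrow> ('m, 'n::finite) chart set \<Rightarrow> (complex^'k \<Rightarrow> 'm \<Rightarrow> 'm) \<Rightarrow> bool" where
  "smooth_torus_action I \<A> act \<longleftrightarrow> group_action (torus I) UNIV act \<and>
     (\<forall>f\<in>C_infinity \<A>. \<forall>(U, \<phi>)\<in>\<A>.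
        smooth_on (carrier (torus I) \<times> \<phi> ` U) (\<lambda>(g, x). f (act g (inv_into U \<phi> x))))"

definition generating_field ::
  "('m, 'n::finite) chart set \<Rightarrow> (complex^'k \<Rightarrow> 'm \<Rightarrow> 'm) \<Rightarrow> real^'k \<Rightarrow> 'm \<Rightarrow> 'm tvec" where
  "generating_field \<A> act \<xi> m = (\<lambda>f. if f \<in> C_infinity \<A>
     then deriv (\<lambda>t. f (act (torus_exp (t *\<^sub>R \<xi>)) m)) 0 else 0)"

definition inf_stabilizer ::
  "'k::finite set \<Rightarrow> ('m, 'n::finite) chart set \<Rightarrow> (complex^'k \<Rightarrow> 'm \<Rightarrow> 'm) \<Rightarrow> 'm \<Rightarrow> (real^'k) set" where
  "inf_stabilizer I \<A> act m = {\<xi>\<in>coord_space I. generating_field \<A> act \<xi> m = (\<lambda>f. 0)}"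

definition fixed_set :: "(complex^'k \<Rightarrow> 'm \<Rightarrow> 'm) \<Rightarrow> (complex^'k) set \<Rightarrow> 'm set" where
  "fixed_set act H = {m. \<forall>h\<in>H. act h m = m}"

definition lie_algebra_of :: "'k::finite set \<Rightarrow> (complex^'k) set \<Rightarrow> (real^'k) set" where
  "lie_algebra_of I H = {\<xi>\<in>coord_space I. \<forall>t. torus_exp (t *\<^sub>R \<xi>) \<in> H}"

text \<open>
  The dual of a linear subspace \<open>V\<close>; its elements are undefined outside \<open>V\<close>, so the restriction map
  of dual spaces is \<^const>\<open>restrict\<close>.
\<close>

definition dual_space :: "(real^'k) set \<Rightarrow> (real^'k \<Rightarrow> real) set" where
  "dual_space V = {l\<in>extensional V.
     (\<forall>x\<in>V. \<forall>y\<in>V. l (x + y) = l x + l y) \<and> (\<forall>c. \<forall>x\<in>V. l (c *\<^sub>R x) = c * l x)}"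

text \<open>Equivariance is invariance here, since the coadjoint action of a torus is trivial.\<close>

definition smooth_equivariant_map ::
  "'k::finite set \<Rightarrow> ('m, 'n::finite) chart set \<Rightarrow> (complex^'k \<Rightarrow> 'm \<Rightarrow> 'm) \<Rightarrow>
   ('m \<Rightarrow> real^'k \<Rightarrow> real) \<Rightarrow> bool" where
  "smooth_equivariant_map I \<A> act \<Psi> \<longleftrightarrow>
     (\<forall>m. \<Psi> m \<in> dual_space (coord_space I)) \<and>
     (\<forall>\<xi>\<in>coord_space I. (\<lambda>m. \<Psi> m \<xi>) \<in> C_infinity \<A>) \<and>
     (\<forall>g\<in>carrier (torus I). \<forall>m. \<Psi> (act g m) = \<Psi> m)"

definition abstract_moment_map ::
  "'k::finite set \<Rightarrow> ('m::topological_space, 'n::finite) chart set \<Rightarrow> (complex^'k \<Rightarrow> 'm \<Rightarrow> 'm) \<Rightarrow>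
   ('m \<Rightarrow> real^'k \<Rightarrow> real) \<Rightarrow> bool" where
  "abstract_moment_map I \<A> act \<Psi> \<longleftrightarrow> smooth_equivariant_map I \<A> act \<Psi> \<and>
     (\<forall>H. subgroup H (torus I) \<longrightarrow>
        locally (\<lambda>W. (\<lambda>m. restrict (\<Psi> m) (lie_algebra_of I H)) constant_on W) (fixed_set act H))"


section \<open>Invariant and equivariant forms\<close>

definition invariant_one_form ::
  "'k::finite set \<Rightarrow> ('m, 'n::finite) chart set \<Rightarrow> (complex^'k \<Rightarrow> 'm \<Rightarrow> 'm) \<Rightarrow>
   ('m \<Rightarrow> 'm tvec \<Rightarrow> real) \<Rightarrow> bool" where
  "invariant_one_form I \<A> act \<mu> \<longleftrightarrow> one_form \<A> \<mu> \<and>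
     (\<forall>g\<in>carrier (torus I). \<forall>m. \<forall>v\<in>tangent_space \<A> m.
        \<mu> (act g m) (push_forward \<A> (act g) v) = \<mu> m v)"

definition invariant_two_form ::
  "'k::finite set \<Rightarrow> ('m, 'n::finite) chart set \<Rightarrow> (complex^'k \<Rightarrow> 'm \<Rightarrow> 'm) \<Rightarrow>
   ('m \<Rightarrow> 'm tvec \<Rightarrow> 'm tvec \<Rightarrow> real) \<Rightarrow> bool" where
  "invariant_two_form I \<A> act \<omega> \<longleftrightarrow> two_form \<A> \<omega> \<and>
     (\<forall>g\<in>carrier (torus I). \<forall>m. \<forall>v\<in>tangent_space \<A> m. \<forall>w\<in>tangent_space \<A> m.
        \<omega> (act g m) (push_forward \<A> (act g) v) (push_forward \<A> (act g) w) = \<omega> m v w)"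

text \<open>The equation $\iota(\xi_M)\omega = -d\Psi^\xi$ for all $\xi$, where $d\Psi^\xi(v) = v(\Psi^\xi)$.\<close>

definition moment_equation ::
  "'k::finite set \<Rightarrow> ('m, 'n::finite) chart set \<Rightarrow> (complex^'k \<Rightarrow> 'm \<Rightarrow> 'm) \<Rightarrow>
   ('m \<Rightarrow> 'm tvec \<Rightarrow> 'm tvec \<Rightarrow> real) \<Rightarrow> ('m \<Rightarrow> real^'k \<Rightarrow> real) \<Rightarrow> bool" where
  "moment_equation I \<A> act \<omega> \<Psi> \<longleftrightarrow>
     (\<forall>\<xi>\<in>coord_space I. \<forall>m. \<forall>v\<in>tangent_space \<A> m.
        \<omega> m (generating_field \<A> act \<xi> m) v = - v (\<lambda>p. \<Psi> p \<xi>))"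

definition hamiltonian ::
  "'k::finite set \<Rightarrow> ('m, 'n::finite) chart set \<Rightarrow> (complex^'k \<Rightarrow> 'm \<Rightarrow> 'm) \<Rightarrow>
   ('m \<Rightarrow> real^'k \<Rightarrow> real) \<Rightarrow> bool" where
  "hamiltonian I \<A> act \<Psi> \<longleftrightarrow>
     (\<exists>\<omega>. closed_two_form \<A> \<omega> \<and> invariant_two_form I \<A> act \<omega> \<and> moment_equation I \<A> act \<omega> \<Psi>)"

type_synonym ('m, 'k) eq_two_form =
  "('m \<Rightarrow> 'm tvec \<Rightarrow> 'm tvec \<Rightarrow> real) \<times> ('m \<Rightarrow> real^'k \<Rightarrow> real)"

definition eq_closed_two_forms ::
  "'k::finite set \<Rightarrow> ('m, 'n::finite) chart set \<Rightarrow> (complex^'k \<Rightarrow> 'm \<Rightarrow> 'm) \<Rightarrow>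
   ('m, 'k) eq_two_form set" where
  "eq_closed_two_forms I \<A> act = {(\<omega>, \<Phi>).
     invariant_two_form I \<A> act \<omega> \<and> smooth_equivariant_map I \<A> act \<Phi> \<and>
     closed_two_form \<A> \<omega> \<and> moment_equation I \<A> act \<omega> \<Phi>}"

definition eq_exact_two_form ::
  "'k::finite set \<Rightarrow> ('m, 'n::finite) chart set \<Rightarrow> (complex^'k \<Rightarrow> 'm \<Rightarrow> 'm) \<Rightarrow>
   ('m, 'k) eq_two_form \<Rightarrow> bool" where
  "eq_exact_two_form I \<A> act = (\<lambda>(\<omega>, \<Phi>). \<exists>\<mu>. invariant_one_form I \<A> act \<mu> \<and>
     (\<forall>X Y m. vector_field \<A> X \<and> vector_field \<A> Y \<longrightarrow> \<omega> m (X m) (Y m) = d_one_form \<mu> X Y m) \<and>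
     (\<forall>\<xi>\<in>coord_space I. \<forall>m. \<Phi> m \<xi> = \<mu> m (generating_field \<A> act \<xi> m)))"

definition eq_diff ::
  "'k::finite set \<Rightarrow> ('m, 'k) eq_two_form \<Rightarrow> ('m, 'k) eq_two_form \<Rightarrow> ('m, 'k) eq_two_form" where
  "eq_diff I = (\<lambda>(\<omega>, \<Phi>) (\<omega>', \<Phi>').
     (\<lambda>m v w. \<omega> m v w - \<omega>' m v w, \<lambda>m. \<lambda>\<xi>\<in>coord_space I. \<Phi> m \<xi> - \<Phi>' m \<xi>))"

definition H2_equivariant ::
  "'k::finite set \<Rightarrow> ('m, 'n::finite) chart set \<Rightarrow> (complex^'k \<Rightarrow> 'm \<Rightarrow> 'm) \<Rightarrow>
   ('m, 'k) eq_two_form set set" where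
  "H2_equivariant I \<A> act = eq_closed_two_forms I \<A> act //
     {(\<alpha>, \<beta>). \<alpha> \<in> eq_closed_two_forms I \<A> act \<and> \<beta> \<in> eq_closed_two_forms I \<A> act \<and>
        eq_exact_two_form I \<A> act (eq_diff I \<alpha> \<beta>)}"


section \<open>Strata and assignments\<close>

definition strata ::
  "'k::finite set \<Rightarrow> ('m::topological_space, 'n::finite) chart set \<Rightarrow> (complex^'k \<Rightarrow> 'm \<Rightarrow> 'm) \<Rightarrow>
   'm set set" where
  "strata I \<A> act = (\<Union>\<hh>\<in>{\<hh>. subspace \<hh> \<and> \<hh> \<subseteq> coord_space I}.
     components {m. inf_stabilizer I \<A> act m = \<hh>})"

definition stratum_stabilizer ::
  "'k::finite set \<Rightarrow> ('m, 'n::finite) chart set \<Rightarrow> (complex^'k \<Rightarrow> 'm \<Rightarrow> 'm) \<Rightarrow>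
   'm set \<Rightarrow> (real^'k) set" where
  "stratum_stabilizer I \<A> act X = the_elem (inf_stabilizer I \<A> act ` X)"

definition assignments ::
  "'k::finite set \<Rightarrow> ('m::topological_space, 'n::finite) chart set \<Rightarrow> (complex^'k \<Rightarrow> 'm \<Rightarrow> 'm) \<Rightarrow>
   ('m set \<Rightarrow> real^'k \<Rightarrow> real) set" where
  "assignments I \<A> act = {A\<in>extensional (strata I \<A> act).
     (\<forall>X\<in>strata I \<A> act. A X \<in> dual_space (stratum_stabilizer I \<A> act X)) \<and>
     (\<forall>X\<in>strata I \<A> act. \<forall>Y\<in>strata I \<A> act. X \<subseteq> closure Y \<longrightarrow>
        A Y = restrict (A X) (stratum_stabilizer I \<A> act Y))}"

definition assignment_of ::
  "'k::finite set \<Rightarrow> ('m::topological_space, 'n::finite) chart set \<Rightarrow> (complex^'k \<Rightarrow> 'm \<Rightarrow> 'm) \<Rightarrow>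
   ('m \<Rightarrow> real^'k \<Rightarrow> real) \<Rightarrow> 'm set \<Rightarrow> real^'k \<Rightarrow> real" where
  "assignment_of I \<A> act \<Psi> = (\<lambda>X\<in>strata I \<A> act.
     the_elem ((\<lambda>m. restrict (\<Psi> m) (stratum_stabilizer I \<A> act X)) ` X))"

text \<open>
  The map $\rho$ on cohomology classes; representatives of one class have the same assignment, so
  the image below is a singleton.
\<close>

definition rho ::
  "'k::finite set \<Rightarrow> ('m::topological_space, 'n::finite) chart set \<Rightarrow> (complex^'k \<Rightarrow> 'm \<Rightarrow> 'm) \<Rightarrow>
   ('m, 'k) eq_two_form set \<Rightarrow> 'm set \<Rightarrow> real^'k \<Rightarrow> real" where
  "rho I \<A> act c = the_elem ((\<lambda>(\<omega>, \<Phi>). assignment_of I \<A> act \<Phi>) ` c)"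

end

theory Submission
  imports Defs
begin

text \<open>
  If \<Psi> satisfies the moment equation for a closed invariant form \<omega>, then $\omega + \Psi$ is equivariantly closed and
  \<open>rho\<close> maps its class to the assignment of \<Psi>. The content is the converse. Let $\omega + \Phi$ be
  equivariantly closed with the same assignment as \<Psi>, and let $\Theta = \Psi - \Phi$. Equality of
  the assignments means that $\Theta^\xi(m) = 0$ whenever $\xi_M$ vanishes at \<open>m\<close>
  (\<open>assignment_of_eqD\<close>). It suffices to find an invariant one-form \<mu> with
  $\mu(\xi_M) = \Theta^\xi$ for all \<xi>: invariance gives $\iota(\xi_M) d\mu = - d\Theta^\xi$, so that
  $\omega + d\mu$ is a closed invariant form with moment map \<Psi>.

  The form \<mu> is a locally finite sum of terms $\mathrm{Re}(\bar a \, dz)$ in which \<open>a\<close> and \<open>z\<close> are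
  complex functions that transform under the torus with one and the same weight \<beta>. Such a term is
  invariant and has the value $\langle\beta, \xi\rangle \, \mathrm{Re}(i \bar a z)$ on $\xi_M$. So
  $\Theta^\xi$ has to be written as a locally finite sum of these values (\<open>global_solution\<close>).

  Equivariant functions are plentiful because the Fourier coefficients of a function under the torus
  are equivariant; they separate tangent vectors (\<open>equivariant_functions_separate\<close>). Hence the
  infinitesimal stabilizer of \<open>m\<close> is the annihilator of the weights of those equivariant functions
  that do not vanish at \<open>m\<close> (\<open>inf_stabilizer_iff\<close>), and near a point \<open>p\<close> there are coordinates that
  consist of equivariant functions whose weights are nonzero on the stabilizer algebra of \<open>p\<close>, and
  of functions invariant under that algebra (\<open>local_coordinates\<close>). These replace the slice theorem.
  In them, the zero set of $\xi_M$, for \<xi> in the stabilizer algebra of \<open>p\<close>, is a coordinate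
  subspace, and the vanishing of $\Theta^\xi$ there allows $\Theta$, restricted to that algebra, to be
  divided by the coordinates (\<open>weight_decomposition\<close>). What is left of $\Theta$ vanishes on the
  stabilizer algebra of \<open>p\<close>, so it is a combination of weights of equivariant functions without zeros
  near \<open>p\<close>, by which one can simply divide (\<open>local_solution\<close>). Averaging and an invariant partition
  of unity make the local solutions global.

  Assignments can be compared point by point because $\Psi^\xi$ and $\Phi^\xi$ are locally constant
  on the zero set of $\xi_M$. For \<Psi> this is the defining property of an abstract moment map for the
  subgroup of all $\exp(t\xi)$. For \<Phi> the moment equation makes the differential of $\Phi^\xi$
  vanish on that set, which in the coordinates above is star-shaped (\<open>constant_on_zeros_near\<close>).
\<close>

section \<open>Smooth maps on open sets\<close>

lemma frechet_derivative_eq: "(f has_derivative D) (at x) \<Longrightarrow> frechet_derivative f (at x) v = D v"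
  by (drule frechet_derivative_at) simp

lemma Ck_on_cong:
  assumes "open T" "\<And>x. x \<in> T \<Longrightarrow> f x = g x" "Ck_on k T f"
  shows "Ck_on k T g"
  using assms(2,3)
proof (induction k arbitrary: f g)
  case 0
  then show ?case using continuous_on_cong by force
next
  case (Suc k)
  have tr: "(g has_derivative D) (at x)" if "x \<in> T" "(f has_derivative D) (at x)" for x D
    using has_derivative_transform_within_open[OF that(2) assms(1) that(1)] Suc.prems(1) by blast
  have f: "(f has_derivative frechet_derivative f (at x)) (at x)" if "x \<in> T" for x
    using Suc.prems(2) that by (simp add: frechet_derivative_works[symmetric])
  have d: "g differentiable (at x)" if "x \<in> T" for x
    using tr[OF that f[OF that]] by (auto simp: differentiable_def)
  have e: "frechet_derivative f (at x) v = frechet_derivative g (at x) v" if "x \<in> T" for x v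
    using frechet_derivative_at[OF tr[OF that f[OF that]]] by simp
  have "Ck_on k T (\<lambda>x. frechet_derivative g (at x) v)" for v
    by (rule Suc.IH[of "\<lambda>x. frechet_derivative f (at x) v"]) (use e Suc.prems in auto)
  then show ?case using d by auto
qed

lemma Ck_on_subset: "Ck_on k T f \<Longrightarrow> U \<subseteq> T \<Longrightarrow> Ck_on k U f"
  by (induction k arbitrary: f) (auto intro: continuous_on_subset)

lemma Ck_on_local:
  assumes "\<And>x. x \<in> T \<Longrightarrow> \<exists>U. open U \<and> x \<in> U \<and> Ck_on k (T \<inter> U) f"
  shows "Ck_on k T f"
  using assms
proof (induction k arbitrary: f)
  case 0
  have "continuous (at x within T) f" if x: "x \<in> T" for x
  proof -
    obtain U where U: "open U" "x \<in> U" "continuous_on (T \<inter> U) f"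
      using 0[OF x] by auto
    then have "continuous (at x within T \<inter> U) f"
      using x by (simp add: continuous_on_eq_continuous_within)
    then show ?thesis
      using at_within_nhd[OF U(2,1), of "T \<inter> U" T] by (simp add: continuous_within Int_assoc)
  qed
  then show ?case by (simp add: continuous_on_eq_continuous_within)
next
  case (Suc k)
  have "f differentiable (at x)" if "x \<in> T" for x
    using Suc.prems[OF that] that by auto
  moreover have "Ck_on k T (\<lambda>x. frechet_derivative f (at x) v)" for v
    by (rule Suc.IH) (use Suc.prems in fastforce)
  ultimately show ?case by auto
qed

lemma Ck_on_continuous: "Ck_on k T f \<Longrightarrow> continuous_on T f"
proof (cases k)
  case (Suc j)
  assume "Ck_on k T f"
  then have "f differentiable_on T"
    using Suc by (auto simp: differentiable_on_def intro: differentiable_at_withinI)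
  then show ?thesis by (rule differentiable_imp_continuous_on)
qed auto

lemma Ck_on_Suc_D: "Ck_on (Suc k) T f \<Longrightarrow> Ck_on k T f"
proof (induction k arbitrary: f)
  case 0
  then show ?case using Ck_on_continuous by fastforce
qed auto

lemma Ck_on_const: "Ck_on k T (\<lambda>x. c)"
proof (induction k arbitrary: c)
  case (Suc k)
  then show ?case by (simp add: frechet_derivative_const)
qed auto

lemma Ck_on_bounded_linear_compose:
  assumes L: "bounded_linear L" and T: "open T"
  shows "Ck_on k T f \<Longrightarrow> Ck_on k T (\<lambda>x. L (f x))"
proof (induction k arbitrary: f)
  case 0
  then show ?case by (simp add: L linear_continuous_on_compose bounded_linear.linear bounded_linear.continuous_on)
next
  case (Suc k)
  have D: "((\<lambda>x. L (f x)) has_derivative (\<lambda>v. L (frechet_derivative f (at x) v))) (at x)" if "x \<in> T" for x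
    by (rule bounded_linear.has_derivative[OF L]) (use Suc.prems that in \<open>simp add: frechet_derivative_works[symmetric]\<close>)
  have "Ck_on k T (\<lambda>x. frechet_derivative (\<lambda>x. L (f x)) (at x) v)" for v
    by (rule Ck_on_cong[OF T _ Suc.IH[of "\<lambda>x. frechet_derivative f (at x) v"]])
       (use Suc.prems in \<open>simp_all add: frechet_derivative_eq[OF D]\<close>)
  then show ?case using D unfolding Ck_on.simps differentiable_def by blast
qed

lemma Ck_on_bounded_linear: assumes "bounded_linear L" shows "Ck_on k T L"
proof (cases k)
  case 0
  then show ?thesis by (simp add: assms linear_continuous_on)
next
  case (Suc j)
  have "frechet_derivative L (at x) = L" for x
    using frechet_derivative_at[OF bounded_linear_imp_has_derivative[OF assms]] by auto
  then show ?thesis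
    using Suc Ck_on_const bounded_linear_imp_differentiable[OF assms] by auto
qed

lemma Ck_on_add:
  assumes T: "open T"
  shows "Ck_on k T f \<Longrightarrow> Ck_on k T g \<Longrightarrow> Ck_on k T (\<lambda>x. f x + g x)"
proof (induction k arbitrary: f g)
  case (Suc k)
  have D: "((\<lambda>x. f x + g x) has_derivative (\<lambda>v. frechet_derivative f (at x) v + frechet_derivative g (at x) v)) (at x)"
    if "x \<in> T" for x
    by (rule has_derivative_add) (use Suc.prems that in \<open>simp_all add: frechet_derivative_works[symmetric]\<close>)
  have "Ck_on k T (\<lambda>x. frechet_derivative (\<lambda>x. f x + g x) (at x) v)" for v
    by (rule Ck_on_cong[OF T _ Suc.IH[of "\<lambda>x. frechet_derivative f (at x) v" "\<lambda>x. frechet_derivative g (at x) v"]])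
       (use Suc.prems in \<open>simp_all add: frechet_derivative_eq[OF D]\<close>)
  then show ?case using D unfolding Ck_on.simps differentiable_def by blast
qed (auto intro: continuous_intros)

text \<open>The product rule turns the claim of order \<open>k + 1\<close> into claims of order \<open>k\<close> for the factors and
  their derivatives, so all bilinear products are treated at once by induction on the order.\<close>

lemma Ck_on_bilinear:
  assumes B: "bounded_bilinear prd" and T: "open T"
  shows "Ck_on k T f \<Longrightarrow> Ck_on k T g \<Longrightarrow> Ck_on k T (\<lambda>x. prd (f x) (g x))"
proof (induction k arbitrary: f g)
  case 0
  then show ?case by (simp add: bounded_bilinear.continuous_on[OF B])
next
  case (Suc k)
  have D: "((\<lambda>x. prd (f x) (g x)) has_derivative
     (\<lambda>v. prd (f x) (frechet_derivative g (at x) v) + prd (frechet_derivative f (at x) v) (g x))) (at x)"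
    if "x \<in> T" for x
    by (rule bounded_bilinear.FDERIV[OF B])
       (use Suc.prems that in \<open>simp_all add: frechet_derivative_works[symmetric]\<close>)
  have "Ck_on k T (\<lambda>x. frechet_derivative (\<lambda>x. prd (f x) (g x)) (at x) v)" for v
  proof (rule Ck_on_cong[OF T])
    show "Ck_on k T (\<lambda>x. prd (f x) (frechet_derivative g (at x) v) + prd (frechet_derivative f (at x) v) (g x))"
      using Suc.prems by (intro Ck_on_add[OF T] Suc.IH) (auto intro: Ck_on_Suc_D)
  qed (simp add: frechet_derivative_eq[OF D])
  then show ?case using D unfolding Ck_on.simps differentiable_def by blast
qed

lemma Ck_on_sum:
  assumes T: "open T" and "\<And>i. i \<in> A \<Longrightarrow> Ck_on k T (f i)"
  shows "Ck_on k T (\<lambda>x. \<Sum>i\<in>A. f i x)"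
  using assms(2) by (induction A rule: infinite_finite_induct) (auto intro: Ck_on_const Ck_on_add[OF T])

text \<open>The derivative of a composition is a sum, over a basis of the middle space, of partial derivatives
  of the outer map at the inner one, times coordinates of the derivative of the inner map; so the
  order drops by one in each factor.\<close>

lemma Ck_on_compose:
  fixes f :: "'a::euclidean_space \<Rightarrow> 'b::real_normed_vector" and g :: "'c::real_normed_vector \<Rightarrow> 'a"
  assumes T: "open T"
  shows "Ck_on k S f \<Longrightarrow> Ck_on k T g \<Longrightarrow> g ` T \<subseteq> S \<Longrightarrow> Ck_on k T (\<lambda>x. f (g x))"
proof (induction k arbitrary: f g)
  case 0
  then show ?case by (auto intro: continuous_on_compose2)
next
  case (Suc k)
  have df: "(f has_derivative frechet_derivative f (at (g x))) (at (g x))" if "x \<in> T" for x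
    using Suc.prems that by (auto simp: frechet_derivative_works[symmetric])
  have dg: "(g has_derivative frechet_derivative g (at x)) (at x)" if "x \<in> T" for x
    using Suc.prems that by (auto simp: frechet_derivative_works[symmetric])
  have D: "((\<lambda>x. f (g x)) has_derivative (\<lambda>v. frechet_derivative f (at (g x)) (frechet_derivative g (at x) v))) (at x)"
    if "x \<in> T" for x
    using diff_chain_at[OF dg[OF that] df[OF that]] by (simp add: o_def)
  have E: "frechet_derivative (\<lambda>x. f (g x)) (at x) v =
      (\<Sum>b\<in>Basis. (frechet_derivative g (at x) v \<bullet> b) *\<^sub>R frechet_derivative f (at (g x)) b)" if "x \<in> T" for x v
  proof -
    have lin: "linear (frechet_derivative f (at (g x)))"
      by (rule has_derivative_linear[OF df[OF that]])
    have "frechet_derivative f (at (g x)) w = (\<Sum>b\<in>Basis. (w \<bullet> b) *\<^sub>R frechet_derivative f (at (g x)) b)" for w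
      by (subst euclidean_representation[of w, symmetric])
         (simp only: linear_sum[OF lin] linear_scale[OF lin])
    then show ?thesis
      unfolding frechet_derivative_eq[OF D[OF that]] .
  qed
  have "Ck_on k T (\<lambda>x. frechet_derivative (\<lambda>x. f (g x)) (at x) v)" for v
  proof (rule Ck_on_cong[OF T])
    show "Ck_on k T (\<lambda>x. \<Sum>b\<in>Basis. (frechet_derivative g (at x) v \<bullet> b) *\<^sub>R frechet_derivative f (at (g x)) b)"
    proof (intro Ck_on_sum T Ck_on_bilinear[OF bounded_bilinear_scaleR]
        Ck_on_bounded_linear_compose[OF bounded_linear_inner_left])
      show "Ck_on k T (\<lambda>x. frechet_derivative g (at x) v)"
        using Suc.prems(2) by (simp only: Ck_on.simps)
      show "Ck_on k T (\<lambda>x. frechet_derivative f (at (g x)) b)" for b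
        by (rule Suc.IH[OF _ Ck_on_Suc_D[OF Suc.prems(2)] Suc.prems(3)])
           (use Suc.prems(1) in \<open>simp only: Ck_on.simps\<close>)
    qed
  qed (use E in auto)
  then show ?case using D unfolding Ck_on.simps differentiable_def by blast
qed

lemma Ck_on_Suc_real:
  fixes f :: "real \<Rightarrow> 'b::real_normed_vector"
  assumes T: "open T" and D: "\<And>x. x \<in> T \<Longrightarrow> (f has_vector_derivative f' x) (at x)" and f': "Ck_on k T f'"
  shows "Ck_on (Suc k) T f"
proof -
  have D': "(f has_derivative (\<lambda>v. v *\<^sub>R f' x)) (at x)" if "x \<in> T" for x
    using D[OF that] by (simp add: has_vector_derivative_def)
  have "Ck_on k T (\<lambda>x. frechet_derivative f (at x) v)" for v
    by (rule Ck_on_cong[OF T _ Ck_on_bounded_linear_compose[OF bounded_linear_scaleR_right[of v] T f']])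
       (simp add: frechet_derivative_eq[OF D'])
  then show ?thesis using D' unfolding Ck_on.simps differentiable_def by blast
qed

definition Cinf :: "'a::real_normed_vector set \<Rightarrow> ('a \<Rightarrow> 'b::real_normed_vector) \<Rightarrow> bool" where
  "Cinf T f \<longleftrightarrow> (\<forall>k. Ck_on k T f)"

lemma smooth_on_Cinf:
  "smooth_on S f \<longleftrightarrow> (\<forall>x\<in>S. \<exists>T F. open T \<and> x \<in> T \<and> Cinf T F \<and> (\<forall>y\<in>S \<inter> T. F y = f y))"
  by (simp add: smooth_on_def Cinf_def)

lemma Cinf_cong: "\<lbrakk>Cinf T f; open T; \<And>x. x \<in> T \<Longrightarrow> f x = g x\<rbrakk> \<Longrightarrow> Cinf T g"
  unfolding Cinf_def by (intro allI, rule Ck_on_cong[of T f]) auto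

lemma Cinf_subset: "\<lbrakk>Cinf T f; U \<subseteq> T\<rbrakk> \<Longrightarrow> Cinf U f"
  unfolding Cinf_def by (intro allI, rule Ck_on_subset) auto

lemma Cinf_local:
  assumes "\<And>x. x \<in> T \<Longrightarrow> \<exists>U. open U \<and> x \<in> U \<and> Cinf (T \<inter> U) f"
  shows "Cinf T f"
  unfolding Cinf_def by (intro allI, rule Ck_on_local, drule assms[unfolded Cinf_def]) auto

lemma Cinf_continuous: "Cinf T f \<Longrightarrow> continuous_on T f"
  unfolding Cinf_def by (rule Ck_on_continuous) auto

lemma Cinf_const: "Cinf T (\<lambda>x. c)"
  by (simp add: Cinf_def Ck_on_const)

lemma Cinf_bounded_linear: "bounded_linear L \<Longrightarrow> Cinf T L"
  by (simp add: Cinf_def Ck_on_bounded_linear)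

lemma Cinf_bounded_linear_compose: "\<lbrakk>bounded_linear L; open T; Cinf T f\<rbrakk> \<Longrightarrow> Cinf T (\<lambda>x. L (f x))"
  by (simp add: Cinf_def Ck_on_bounded_linear_compose)

lemma Cinf_bilinear:
  "\<lbrakk>bounded_bilinear prd; open T; Cinf T f; Cinf T g\<rbrakk> \<Longrightarrow> Cinf T (\<lambda>x. prd (f x) (g x))"
  by (simp add: Cinf_def Ck_on_bilinear)

lemma Cinf_add: "\<lbrakk>open T; Cinf T f; Cinf T g\<rbrakk> \<Longrightarrow> Cinf T (\<lambda>x. f x + g x)"
  by (simp add: Cinf_def Ck_on_add)

lemma Cinf_minus: "\<lbrakk>open T; Cinf T f\<rbrakk> \<Longrightarrow> Cinf T (\<lambda>x. - f x)"
  by (rule Cinf_bounded_linear_compose[OF bounded_linear_minus[OF bounded_linear_ident]])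

lemma Cinf_diff: "\<lbrakk>open T; Cinf T f; Cinf T g\<rbrakk> \<Longrightarrow> Cinf T (\<lambda>x. f x - g x)"
  using Cinf_add[of T f "\<lambda>x. - g x"] Cinf_minus by auto

lemma Cinf_mult:
  fixes f :: "'a::real_normed_vector \<Rightarrow> 'b::real_normed_algebra"
  shows "\<lbrakk>open T; Cinf T f; Cinf T g\<rbrakk> \<Longrightarrow> Cinf T (\<lambda>x. f x * g x)"
  by (rule Cinf_bilinear[OF bounded_bilinear_mult])

lemma Cinf_scaleR: "\<lbrakk>open T; Cinf T f; Cinf T g\<rbrakk> \<Longrightarrow> Cinf T (\<lambda>x. f x *\<^sub>R g x)"
  by (rule Cinf_bilinear[OF bounded_bilinear_scaleR])

lemma Cinf_sum: "\<lbrakk>open T; \<And>i. i \<in> A \<Longrightarrow> Cinf T (f i)\<rbrakk> \<Longrightarrow> Cinf T (\<lambda>x. \<Sum>i\<in>A. f i x)"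
  by (simp add: Cinf_def Ck_on_sum)

lemma Cinf_prod:
  fixes f :: "'i \<Rightarrow> 'a::real_normed_vector \<Rightarrow> real"
  shows "\<lbrakk>open T; \<And>i. i \<in> A \<Longrightarrow> Cinf T (f i)\<rbrakk> \<Longrightarrow> Cinf T (\<lambda>x. \<Prod>i\<in>A. f i x)"
  by (induction A rule: infinite_finite_induct) (auto intro: Cinf_const Cinf_mult)

lemma Cinf_Pair: "\<lbrakk>open T; Cinf T f; Cinf T g\<rbrakk> \<Longrightarrow> Cinf T (\<lambda>x. (f x, g x))"
proof -
  assume a: "open T" "Cinf T f" "Cinf T g"
  have l: "bounded_linear (\<lambda>u::'b. (u, 0::'c))" "bounded_linear (\<lambda>u::'c. (0::'b, u))"
    by (intro bounded_linear_Pair bounded_linear_ident bounded_linear_zero)+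
  show ?thesis
    using Cinf_add[OF a(1) Cinf_bounded_linear_compose[OF l(1) a(1,2)] Cinf_bounded_linear_compose[OF l(2) a(1,3)]]
    by simp
qed

lemma Cinf_compose:
  fixes f :: "'a::euclidean_space \<Rightarrow> 'b::real_normed_vector"
  shows "\<lbrakk>Cinf S f; Cinf T g; open T; g ` T \<subseteq> S\<rbrakk> \<Longrightarrow> Cinf T (\<lambda>x. f (g x))"
  unfolding Cinf_def by (intro allI, rule Ck_on_compose) auto

lemma Cinf_has_derivative:
  "\<lbrakk>Cinf T f; x \<in> T\<rbrakk> \<Longrightarrow> (f has_derivative frechet_derivative f (at x)) (at x)"
proof -
  assume "Cinf T f" "x \<in> T"
  then have "Ck_on (Suc 0) T f" by (simp only: Cinf_def)
  with \<open>x \<in> T\<close> show ?thesis by (simp add: frechet_derivative_works[symmetric])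
qed

lemma Cinf_frechet_derivative: "Cinf T f \<Longrightarrow> Cinf T (\<lambda>x. frechet_derivative f (at x) v)"
  unfolding Cinf_def
proof
  fix k assume "\<forall>k. Ck_on k T f"
  then have "Ck_on (Suc k) T f" by blast
  then show "Ck_on k T (\<lambda>x. frechet_derivative f (at x) v)" by simp
qed

text \<open>If all members of the family are differentiable of order \<open>k\<close>, then so are their derivatives, as
  combinations of members. Exponentials, powers and their products come in such families.\<close>

lemma Cinf_coinduct_real:
  fixes f :: "'i \<Rightarrow> real \<Rightarrow> 'b::real_normed_vector"
  assumes T: "open T"
    and D: "\<And>i x. x \<in> T \<Longrightarrow> (f i has_vector_derivative (\<Sum>j\<in>N i. c i j *\<^sub>R f j x)) (at x)"
  shows "Cinf T (f i)"
proof -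
  have "Ck_on k T (f i)" for k i
  proof (induction k arbitrary: i)
    case 0
    show ?case unfolding Ck_on.simps
      by (intro continuous_at_imp_continuous_on ballI has_vector_derivative_continuous[OF D])
  next
    case (Suc k)
    show ?case
      by (rule Ck_on_Suc_real[OF T D])
         (auto intro!: Ck_on_sum[OF T] Ck_on_bounded_linear_compose[OF bounded_linear_scaleR_right T Suc])
  qed
  then show ?thesis by (simp add: Cinf_def)
qed

lemma Cinf_cis: "Cinf UNIV cis"
proof -
  have "Cinf UNIV ((\<lambda>i::nat. \<lambda>t. \<i> ^ i * cis t) 0)"
  proof (rule Cinf_coinduct_real[where f = "\<lambda>i t. \<i> ^ i * cis t" and i = 0 and N = "\<lambda>i. {Suc i}" and c = "\<lambda>i j. 1"])
    fix i :: nat and x :: real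
    show "((\<lambda>t. \<i> ^ i * cis t) has_vector_derivative (\<Sum>j\<in>{Suc i}. 1 *\<^sub>R (\<i> ^ j * cis x))) (at x)"
      unfolding has_vector_derivative_def
      by (auto intro!: derivative_eq_intros simp: fun_eq_iff scaleR_conv_of_real)
  qed simp
  then show ?thesis by simp
qed

lemma Cinf_inverse: "Cinf {x::real. x \<noteq> 0} inverse"
proof -
  have op: "open {x::real. x \<noteq> 0}" by (simp add: open_Collect_neq)
  have "Cinf {x::real. x \<noteq> 0} ((\<lambda>i::nat. \<lambda>x::real. inverse x ^ Suc i) 0)"
  proof (rule Cinf_coinduct_real[OF op, where f = "\<lambda>i x. inverse x ^ Suc i" and i = 0 and N = "\<lambda>i. {Suc i}" and c = "\<lambda>i j. - real (Suc i)"])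
    fix i :: nat and x :: real
    assume "x \<in> {x::real. x \<noteq> 0}"
    then have "(inverse has_real_derivative - (inverse x ^ Suc (Suc 0))) (at x)"
      by (intro DERIV_inverse) simp
    from DERIV_power_Suc[OF this, of i]
    show "((\<lambda>x. inverse x ^ Suc i) has_vector_derivative (\<Sum>j\<in>{Suc i}. (- real (Suc i)) *\<^sub>R inverse x ^ Suc j)) (at x)"
      unfolding has_real_derivative_iff_has_vector_derivative[symmetric]
      by (simp add: algebra_simps)
  qed
  then show ?thesis by simp
qed

lemma Cinf_divide:
  fixes f g :: "'a::real_normed_vector \<Rightarrow> real"
  assumes "open T" "Cinf T f" "Cinf T g" "\<And>x. x \<in> T \<Longrightarrow> g x \<noteq> 0"
  shows "Cinf T (\<lambda>x. f x / g x)"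
proof -
  have "Cinf T (\<lambda>x. inverse (g x))"
    by (rule Cinf_compose[OF Cinf_inverse assms(3,1)]) (use assms(4) in auto)
  then show ?thesis using Cinf_mult[OF assms(1,2)] by (simp add: divide_inverse)
qed

lemma Cinf_componentwise:
  fixes f :: "'a::real_normed_vector \<Rightarrow> 'b::euclidean_space"
  assumes "open T" "\<And>b. b \<in> Basis \<Longrightarrow> Cinf T (\<lambda>x. f x \<bullet> b)"
  shows "Cinf T f"
proof -
  have "Cinf T (\<lambda>x. \<Sum>b\<in>Basis. (f x \<bullet> b) *\<^sub>R b)"
    by (rule Cinf_sum[OF assms(1) Cinf_scaleR[OF assms Cinf_const]])
  then show ?thesis by (simp add: euclidean_representation)
qed

lemma Cinf_vec:
  fixes f :: "'a::real_normed_vector \<Rightarrow> real^'n"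
  assumes "open T" "\<And>k. Cinf T (\<lambda>x. f x $ k)"
  shows "Cinf T f"
  by (rule Cinf_componentwise[OF assms(1)]) (auto simp: Basis_vec_def inner_axis assms(2))

lemma Cinf_det:
  fixes A :: "'a::real_normed_vector \<Rightarrow> real^'n^'n"
  assumes "open T" "\<And>i j. Cinf T (\<lambda>x. A x $ i $ j)"
  shows "Cinf T (\<lambda>x. det (A x))"
  unfolding det_def
  by (rule Cinf_sum[OF assms(1) Cinf_mult[OF assms(1) Cinf_const Cinf_prod[OF assms(1) assms(2)]]])

section \<open>A smooth cutoff function\<close>

text \<open>The exponential decay of $e^{-1/x}$ beats every power of $1/x$, so the function is flat at zero.
  All powers are needed since they appear in the higher derivatives of $e^{-1/x}$.\<close>

lemma flat_power_deriv_0: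
  "((\<lambda>x::real. if x > 0 then inverse x ^ i * exp (- inverse x) else 0) has_real_derivative 0) (at 0)"
proof -
  let ?f = "\<lambda>i x::real. if x > 0 then inverse x ^ i * exp (- inverse x) else 0"
  have "((\<lambda>h. ?f i h / h) \<longlongrightarrow> 0) (at_left 0)"
    by (rule Lim_transform_eventually[OF tendsto_const])
       (auto simp: eventually_at_filter)
  moreover have "((\<lambda>h. ?f i h / h) \<longlongrightarrow> 0) (at_right 0)"
  proof (rule Lim_transform_eventually)
    show "((\<lambda>h::real. inverse h ^ Suc i / exp (inverse h)) \<longlongrightarrow> 0) (at_right 0)"
      by (rule filterlim_compose[OF tendsto_power_div_exp_0 filterlim_inverse_at_top_right])
    show "\<forall>\<^sub>F h in at_right 0. inverse h ^ Suc i / exp (inverse h) = ?f i h / h"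
      by (auto simp: eventually_at_filter exp_minus divide_simps)
  qed
  ultimately have "((\<lambda>h. ?f i h / h) \<longlongrightarrow> 0) (at 0)"
    by (simp add: filterlim_split_at)
  then show ?thesis unfolding DERIV_def add_0 by simp
qed

definition flat :: "real \<Rightarrow> real" where
  "flat x = (if x > 0 then exp (- inverse x) else 0)"

lemma Cinf_flat: "Cinf UNIV flat"
proof -
  let ?f = "\<lambda>(i::nat) x::real. if x > 0 then inverse x ^ i * exp (- inverse x) else 0"
  let ?c = "\<lambda>i j. if j = Suc i then - real i else 1"
  have "Cinf UNIV (?f 0)"
  proof (rule Cinf_coinduct_real[where f = ?f and i = 0 and N = "\<lambda>i. {Suc i, i + 2}" and c = ?c])
    fix i :: nat and x :: real
    have S: "(\<Sum>j\<in>{Suc i, i + 2}. ?c i j *\<^sub>R ?f j x) = - real i * ?f (Suc i) x + ?f (i + 2) x" by simp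
    have "(?f i has_real_derivative - real i * ?f (Suc i) x + ?f (i + 2) x) (at x)"
    proof (cases x "0::real" rule: linorder_cases)
      case less
      have "(?f i has_real_derivative 0) (at x)"
        by (rule has_field_derivative_transform_within_open[OF DERIV_const, where S = "{..<0}"]) (use less in auto)
      then show ?thesis using less by simp
    next
      case equal
      then show ?thesis using flat_power_deriv_0[of i] by simp
    next
      case greater
      have "((\<lambda>x. inverse x ^ i * exp (- inverse x)) has_real_derivative
         - real i * ?f (Suc i) x + ?f (i + 2) x) (at x)"
      proof -
        have v: "(inverse has_real_derivative - (inverse x ^ Suc (Suc 0))) (at x)"
          using greater by (intro DERIV_inverse) simp
        have p: "((\<lambda>x. inverse x ^ i) has_real_derivative - real i * inverse x ^ Suc i) (at x)"
        proof (cases i)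
          case (Suc n)
          then show ?thesis using DERIV_power_Suc[OF v, of n] by (simp add: algebra_simps)
        qed simp
        have e: "((\<lambda>x. exp (- inverse x)) has_real_derivative exp (- inverse x) * inverse x ^ Suc (Suc 0)) (at x)"
          using DERIV_chain2[OF DERIV_exp DERIV_minus[OF v]] by simp
        show ?thesis using DERIV_mult[OF p e] greater by (simp add: algebra_simps)
      qed
      then show ?thesis
        by (rule has_field_derivative_transform_within_open[where S = "{0<..}"]) (use greater in auto)
    qed
    then show "(?f i has_vector_derivative (\<Sum>j\<in>{Suc i, i + 2}. ?c i j *\<^sub>R ?f j x)) (at x)"
      unfolding S by (simp only: has_real_derivative_iff_has_vector_derivative)
  qed simp
  moreover have "?f 0 = flat" by (simp add: flat_def fun_eq_iff)
  ultimately show ?thesis by simp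
qed

lemma flat_pos: "x > 0 \<Longrightarrow> flat x > 0" and flat_nonneg: "flat x \<ge> 0" and flat_0: "x \<le> 0 \<Longrightarrow> flat x = 0"
  by (auto simp: flat_def)

text \<open>The usual smooth step; it is constant near both 0 and 1, which leaves room for dividing it by its
  argument.\<close>

definition cutoff :: "real \<Rightarrow> real" where
  "cutoff x = flat (x - 1/3) / (flat (x - 1/3) + flat (2/3 - x))"

lemma cutoff_denominator_pos: "flat (x - 1/3) + flat (2/3 - x) > 0"
proof (cases "x > 1/3")
  case True
  then show ?thesis using flat_pos[of "x - 1/3"] flat_nonneg[of "2/3 - x"] by linarith
next
  case False
  then show ?thesis using flat_pos[of "2/3 - x"] flat_nonneg[of "x - 1/3"] by linarith
qed

lemma Cinf_cutoff: "Cinf UNIV cutoff"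
proof -
  have a: "Cinf UNIV (\<lambda>x::real. x - 1/3)" "Cinf UNIV (\<lambda>x::real. 2/3 - x)"
    by (rule Cinf_diff[OF open_UNIV Cinf_bounded_linear[OF bounded_linear_ident] Cinf_const]
        Cinf_diff[OF open_UNIV Cinf_const Cinf_bounded_linear[OF bounded_linear_ident]])+
  have b: "Cinf UNIV (\<lambda>x. flat (x - 1/3))" "Cinf UNIV (\<lambda>x. flat (2/3 - x))"
    using Cinf_compose[OF Cinf_flat a(1)] Cinf_compose[OF Cinf_flat a(2)] by auto
  have "Cinf UNIV (\<lambda>x. flat (x - 1/3) / (flat (x - 1/3) + flat (2/3 - x)))"
    by (rule Cinf_divide[OF open_UNIV b(1) Cinf_add[OF open_UNIV b]])
       (use cutoff_denominator_pos less_irrefl in metis)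
  then show ?thesis by (simp add: cutoff_def[abs_def])
qed

lemma cutoff_bounds: "0 \<le> cutoff x" "cutoff x \<le> 1"
  using cutoff_denominator_pos[of x] flat_nonneg[of "x - 1/3"] flat_nonneg[of "2/3 - x"]
  by (auto simp: cutoff_def divide_simps)

lemma cutoff_eq_0: "x \<le> 1/3 \<Longrightarrow> cutoff x = 0"
  by (simp add: cutoff_def flat_0)

lemma cutoff_eq_1: "2/3 \<le> x \<Longrightarrow> cutoff x = 1"
  using cutoff_denominator_pos[of x] by (simp add: cutoff_def flat_0)

section \<open>Smooth dependence of integrals on parameters\<close>

text \<open>Differentiation under the integral sign: the integrand is jointly smooth, so its derivative in the
  parameter is continuous as a map into the bounded linear operators.\<close>

lemma has_derivative_parametric_integral:
  fixes G :: "real \<Rightarrow> 'a::euclidean_space \<Rightarrow> 'b::euclidean_space"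
  assumes W: "open W" "Cinf W (\<lambda>(s, x). G s x)" "{a..b} \<times> B \<subseteq> W" and B: "open B" and x: "x \<in> B"
  defines "DG \<equiv> \<lambda>s x v. frechet_derivative (\<lambda>(s, x). G s x) (at (s, x)) (0, v)"
  shows "((\<lambda>x. integral {a..b} (\<lambda>s. G s x)) has_derivative (\<lambda>v. integral {a..b} (\<lambda>s. DG s x v))) (at x)"
proof -
  have D: "(G s has_derivative DG s y) (at y)" if "(s, y) \<in> W" for s y
  proof -
    have 1: "((\<lambda>y. (s, y)) has_derivative (\<lambda>v. (0, v))) (at y)"
      by (auto intro!: derivative_eq_intros)
    show ?thesis
      using diff_chain_at[OF 1 Cinf_has_derivative[OF W(2) that]] by (simp add: o_def DG_def)
  qed
  have cont: "continuous_on W (\<lambda>(s, y). DG s y v)" for v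
    using Cinf_continuous[OF Cinf_frechet_derivative[OF W(2), of "(0, v)"]] by (simp add: DG_def case_prod_beta)
  define fx where "fx = (\<lambda>y s. Blinfun (DG s y))"
  have fx: "blinfun_apply (fx y s) = DG s y" if "(s, y) \<in> W" for s y
    unfolding fx_def by (rule bounded_linear_Blinfun_apply) (rule has_derivative_bounded_linear[OF D[OF that]])
  obtain r where r: "r > 0" "ball x r \<subseteq> B" using B x open_contains_ball by blast
  let ?U = "ball x r"
  have inW: "(s, y) \<in> W" if "y \<in> ?U" "s \<in> {a..b}" for s y
    using W(3) r(2) that by (meson SigmaI subsetD)
  have xU: "x \<in> ?U" using r by simp
  have contfx: "continuous_on (?U \<times> cbox a b) (\<lambda>(y, s). fx y s)"
  proof (rule continuous_on_blinfun_componentwise)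
    fix i :: 'a assume "i \<in> Basis"
    have "continuous_on (?U \<times> cbox a b) (\<lambda>p. (\<lambda>(s, y). DG s y i) (snd p, fst p))"
      by (rule continuous_on_compose2[OF cont]) (auto intro!: continuous_intros inW)
    then show "continuous_on (?U \<times> cbox a b) (\<lambda>p. blinfun_apply (case p of (y, s) \<Rightarrow> fx y s) i)"
      by (rule continuous_on_eq) (auto simp: fx inW)
  qed
  have cG: "continuous_on {a..b} (\<lambda>s. G s y)" if "y \<in> ?U" for y
  proof -
    have "(\<lambda>s. (s, y)) ` {a..b} \<subseteq> W" using inW[OF that] by auto
    from continuous_on_compose2[OF Cinf_continuous[OF W(2)] _ this]
    show ?thesis by (simp add: continuous_on_Pair continuous_on_const continuous_on_id)
  qed
  have "((\<lambda>x. integral (cbox a b) (\<lambda>s. G s x)) has_derivative integral (cbox a b) (fx x)) (at x within ?U)"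
  proof (rule leibniz_rule[OF _ _ contfx xU])
    fix y s assume "y \<in> ?U" "s \<in> cbox a b"
    then have "(s, y) \<in> W" by (intro inW) auto
    then show "(G s has_derivative blinfun_apply (fx y s)) (at y within ?U)"
      unfolding fx[OF \<open>(s, y) \<in> W\<close>] by (rule has_derivative_at_withinI[OF D])
  next
    fix y assume "y \<in> ?U"
    show "(\<lambda>s. G s y) integrable_on cbox a b"
      using integrable_continuous_interval[OF cG[OF \<open>y \<in> ?U\<close>]] by simp
  qed (rule convex_ball)
  moreover
  have "blinfun_apply (integral (cbox a b) (fx x)) v = integral {a..b} (\<lambda>s. DG s x v)" for v
  proof -
    have "continuous_on (cbox a b) (\<lambda>s. case (x, s) of (y, s) \<Rightarrow> fx y s)"
      by (rule continuous_on_compose2[OF contfx]) (use r in \<open>auto intro!: continuous_intros\<close>)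
    then have "fx x integrable_on cbox a b" by (simp add: integrable_continuous_interval)
    then have "blinfun_apply (integral (cbox a b) (fx x)) v = integral (cbox a b) (\<lambda>s. blinfun_apply (fx x s) v)"
      using integral_linear[OF _ blinfun.bounded_linear_left, of "fx x" "cbox a b" v] by (simp add: o_def)
    also have "\<dots> = integral {a..b} (\<lambda>s. DG s x v)"
      using inW[OF xU] by (auto intro!: integral_cong simp: fx)
    finally show ?thesis .
  qed
  then have "blinfun_apply (integral (cbox a b) (fx x)) = (\<lambda>v. integral {a..b} (\<lambda>s. DG s x v))" ..
  ultimately show ?thesis
    using at_within_open[OF xU open_ball] by simp
qed

text \<open>The derivative of a parametric integral is again one, with a smooth integrand.\<close>

lemma Cinf_parametric_integral:
  fixes G :: "real \<Rightarrow> 'a::euclidean_space \<Rightarrow> 'b::euclidean_space"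
  assumes W: "open W" "Cinf W (\<lambda>(s, x). G s x)" "{a..b} \<times> B \<subseteq> W" and B: "open B"
  shows "Cinf B (\<lambda>x. integral {a..b} (\<lambda>s. G s x))"
proof -
  have "Ck_on k B (\<lambda>x. integral {a..b} (\<lambda>s. G s x))" if "Cinf W (\<lambda>(s, x). G s x)" for k and G :: "real \<Rightarrow> 'a \<Rightarrow> 'b"
    using that
  proof (induction k arbitrary: G)
    case 0
    have "continuous (at x) (\<lambda>x. integral {a..b} (\<lambda>s. G s x))" if "x \<in> B" for x
      using has_derivative_continuous[OF has_derivative_parametric_integral[OF W(1) 0 W(3) B that]] .
    then show ?case by (simp add: continuous_at_imp_continuous_on)
  next
    case (Suc k)
    let ?DG = "\<lambda>v s x. frechet_derivative (\<lambda>(s, x). G s x) (at (s, x)) (0, v)"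
    note D = has_derivative_parametric_integral[OF W(1) Suc.prems W(3) B]
    have "Ck_on k B (\<lambda>x. frechet_derivative (\<lambda>x. integral {a..b} (\<lambda>s. G s x)) (at x) v)" for v
    proof (rule Ck_on_cong[OF B])
      show "Ck_on k B (\<lambda>x. integral {a..b} (\<lambda>s. ?DG v s x))"
      proof (rule Suc.IH)
        have "(\<lambda>(s, x). ?DG v s x) = (\<lambda>p. frechet_derivative (\<lambda>(s, x). G s x) (at p) (0, v))"
          by (auto simp: fun_eq_iff)
        then show "Cinf W (\<lambda>(s, x). ?DG v s x)"
          using Cinf_frechet_derivative[OF Suc.prems, of "(0, v)"] by simp
      qed
    qed (simp add: frechet_derivative_eq[OF D])
    then show ?case using D unfolding Ck_on.simps differentiable_def by blast
  qed
  then show ?thesis using W(2) by (simp add: Cinf_def)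
qed

lemma frechet_derivative_parametric_integral:
  fixes G :: "real \<Rightarrow> 'a::euclidean_space \<Rightarrow> 'b::euclidean_space"
  assumes W: "open W" "Cinf W (\<lambda>(s, x). G s x)" "{a..b} \<times> B \<subseteq> W" and B: "open B" and x: "x \<in> B"
  shows "frechet_derivative (\<lambda>x. integral {a..b} (\<lambda>s. G s x)) (at x) v =
     integral {a..b} (\<lambda>s. frechet_derivative (G s) (at x) v)"
proof -
  have "frechet_derivative (G s) (at x) v = frechet_derivative (\<lambda>(s, x). G s x) (at (s, x)) (0, v)"
    if "s \<in> {a..b}" for s
  proof -
    have 1: "((\<lambda>y. (s, y)) has_derivative (\<lambda>v. (0, v))) (at x)"
      by (auto intro!: derivative_eq_intros)
    have "(s, x) \<in> W" using W(3) x that by auto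
    then have "(G s has_derivative (\<lambda>v. frechet_derivative (\<lambda>(s, x). G s x) (at (s, x)) (0, v))) (at x)"
      using diff_chain_at[OF 1 Cinf_has_derivative[OF W(2)]] by (simp add: o_def)
    then show ?thesis by (rule frechet_derivative_eq)
  qed
  then have "integral {a..b} (\<lambda>s. frechet_derivative (G s) (at x) v) =
     integral {a..b} (\<lambda>s. frechet_derivative (\<lambda>(s, x). G s x) (at (s, x)) (0, v))"
    by (intro integral_cong) auto
  then show ?thesis
    using frechet_derivative_eq[OF has_derivative_parametric_integral[OF W B x]] by simp
qed

section \<open>The smooth inverse function theorem\<close>

text \<open>The inverse of a \<open>C\<^sup>1\<close> map with invertible derivative is differentiable, and its derivative is the
  inverse matrix at the inverse map. Cramer's rule makes that a smooth function of the inverse map,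
  so that each order of differentiability of the inverse yields the next one.\<close>

lemma Cinf_inverse_function:
  fixes \<psi> :: "real^'n \<Rightarrow> real^'n"
  assumes U: "open U" "Cinf U \<psi>" "x0 \<in> U" and id: "\<And>v. frechet_derivative \<psi> (at x0) v = v"
  obtains N V \<kappa> where "open N" "N \<subseteq> U" "x0 \<in> N" "open V" "homeomorphism N V \<psi> \<kappa>" "Cinf V \<kappa>"
    "\<And>y. y \<in> N \<Longrightarrow> inj (frechet_derivative \<psi> (at y))"
proof -
  let ?D = "\<lambda>x. frechet_derivative \<psi> (at x)"
  define f' where "f' x = Blinfun (?D x)" for x
  have f': "blinfun_apply (f' x) = ?D x" if "x \<in> U" for x
    unfolding f'_def
    by (rule bounded_linear_Blinfun_apply) (rule has_derivative_bounded_linear[OF Cinf_has_derivative[OF U(2) that]])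
  have 1: "(\<psi> has_derivative blinfun_apply (f' x)) (at x)" if "x \<in> U" for x
    using Cinf_has_derivative[OF U(2) that] f'[OF that] by simp
  have 2: "continuous_on U f'"
  proof (rule continuous_on_blinfun_componentwise)
    fix i show "continuous_on U (\<lambda>x. blinfun_apply (f' x) i)"
      using Cinf_continuous[OF Cinf_frechet_derivative[OF U(2), of i]] by (rule continuous_on_eq) (simp add: f')
  qed
  have 3: "id_blinfun o\<^sub>L f' x0 = id_blinfun"
    by (rule blinfun_eqI) (simp add: f' U id)
  obtain N V \<kappa> dk where o: "open N" "N \<subseteq> U" "x0 \<in> N" "open V" "\<psi> x0 \<in> V" "homeomorphism N V \<psi> \<kappa>"
    and d: "\<And>y. y \<in> V \<Longrightarrow> (\<kappa> has_derivative (dk y)) (at y)"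
    and i: "\<And>y. y \<in> V \<Longrightarrow> dk y = inv_into UNIV (blinfun_apply (f'(\<kappa> y)))"
    and b: "\<And>y. y \<in> V \<Longrightarrow> bij (blinfun_apply (f'(\<kappa> y)))"
    using inverse_function_theorem[OF U(1) 1 2 U(3) 3] by metis
  have \<kappa>: "\<kappa> y \<in> N" if "y \<in> V" for y using o(6) that by (auto simp: homeomorphism_def)
  have bij: "bij (?D x)" if "x \<in> N" for x
  proof -
    have "\<psi> x \<in> V" "\<kappa> (\<psi> x) = x" using o(6) that by (auto simp: homeomorphism_def)
    then show ?thesis using b[of "\<psi> x"] f'[of x] o(2) that by auto
  qed
  define A where "A x = matrix (?D x)" for x
  have lin: "linear (?D x)" if "x \<in> N" for x
    by (rule has_derivative_linear[OF Cinf_has_derivative[OF U(2)]]) (use o(2) that in auto)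
  have AD: "A x *v v = ?D x v" if "x \<in> N" for x v
    unfolding A_def using fun_cong[OF matrix_vector_mul(2)[OF lin[OF that]]] by simp
  have det: "det (A x) \<noteq> 0" if "x \<in> N" for x
    unfolding A_def using det_nz_iff_inj[OF lin[OF that]] bij_is_inj[OF bij[OF that]] by blast
  define H where "H v x = (\<chi> k. det (\<chi> i j. if j = k then v $ i else A x $ i $ j) / det (A x))" for v x
  have H: "?D x (H v x) = v" if "x \<in> N" for x v
    using cramer[OF det[OF that], of "H v x" v] AD[OF that] by (simp add: H_def)
  have cA: "Cinf N (\<lambda>x. A x $ i $ j)" for i j
  proof -
    have "Cinf N (\<lambda>x. ?D x (axis j 1) $ i)"
      using Cinf_subset[OF Cinf_frechet_derivative[OF U(2)] o(2)]
      by (intro Cinf_bounded_linear_compose[OF bounded_linear_vec_nth o(1)])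
    then show ?thesis by (simp add: A_def matrix_def)
  qed
  have cH: "Cinf N (H v)" for v
  proof (rule Cinf_vec[OF o(1)])
    fix k
    have e: "Cinf N (\<lambda>x. (\<chi> i j. if j = k then v $ i else A x $ i $ j) $ i $ j)" for i j
      by (cases "j = k") (simp_all add: Cinf_const cA)
    show "Cinf N (\<lambda>x. H v x $ k)"
      unfolding H_def vec_lambda_beta by (intro Cinf_divide o(1) Cinf_det cA e det)
  qed
  have dk: "dk y v = H v (\<kappa> y)" if "y \<in> V" for y v
  proof -
    have "?D (\<kappa> y) (dk y v) = v"
      using i[OF that] surj_f_inv_f[OF bij_is_surj[OF b[OF that]], of v] f'[of "\<kappa> y"] o(2) \<kappa>[OF that] by auto
    then show ?thesis using H[OF \<kappa>[OF that], of v] injD[OF bij_is_inj[OF bij[OF \<kappa>[OF that]]]] by simp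
  qed
  have "Ck_on k V \<kappa>" for k
  proof (induction k)
    case 0
    then show ?case using o(6) by (simp add: homeomorphism_def)
  next
    case (Suc k)
    have "Ck_on k V (\<lambda>x. frechet_derivative \<kappa> (at x) v)" for v
    proof (rule Ck_on_cong[OF o(4)])
      show "Ck_on k V (\<lambda>x. H v (\<kappa> x))"
        by (rule Ck_on_compose[OF o(4) _ Suc, of N]) (use cH \<kappa> in \<open>auto simp: Cinf_def\<close>)
    qed (simp add: frechet_derivative_eq[OF d] dk)
    then show ?case using d unfolding Ck_on.simps differentiable_def by blast
  qed
  then show ?thesis using that[OF o(1-4,6)] bij by (auto simp: Cinf_def bij_is_inj)
qed

section \<open>Integrals along segments\<close>

lemma frechet_derivative_bounded_linear_compose:
  assumes "bounded_linear L" "Cinf T f" "x \<in> T"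
  shows "frechet_derivative (\<lambda>x. L (f x)) (at x) v = L (frechet_derivative f (at x) v)"
  using frechet_derivative_eq[OF bounded_linear.has_derivative[OF assms(1) Cinf_has_derivative[OF assms(2,3)]]] .

text \<open>The coefficients in Hadamard's lemma for segments that depend smoothly on a point.\<close>

lemma Cinf_segment_integral:
  fixes F :: "'a::euclidean_space \<Rightarrow> 'b::euclidean_space"
  assumes B: "open B" "Cinf B F" and a: "Cinf B a" "Cinf B u"
    and seg: "\<And>x s. x \<in> B \<Longrightarrow> s \<in> {0..1} \<Longrightarrow> a x + s *\<^sub>R u x \<in> B"
  shows "Cinf B (\<lambda>x. integral {0..1} (\<lambda>s. frechet_derivative F (at (a x + s *\<^sub>R u x)) e))"
proof -
  let ?p = "\<lambda>z::real \<times> 'a. a (snd z) + fst z *\<^sub>R u (snd z)"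
  have o: "open (UNIV \<times> B :: (real \<times> 'a) set)" using B(1) by (simp add: open_Times)
  have s: "Cinf ((UNIV::real set) \<times> B) (\<lambda>z. a (snd z))" "Cinf ((UNIV::real set) \<times> B) (\<lambda>z. u (snd z))"
  proof -
    show "Cinf ((UNIV::real set) \<times> B) (\<lambda>z. a (snd z))"
      by (rule Cinf_compose[OF a(1) Cinf_bounded_linear[OF bounded_linear_snd] o]) auto
    show "Cinf ((UNIV::real set) \<times> B) (\<lambda>z. u (snd z))"
      by (rule Cinf_compose[OF a(2) Cinf_bounded_linear[OF bounded_linear_snd] o]) auto
  qed
  have p: "Cinf (UNIV \<times> B) ?p"
    by (rule Cinf_add[OF o s(1) Cinf_scaleR[OF o Cinf_bounded_linear[OF bounded_linear_fst] s(2)]])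
  define W where "W = (UNIV \<times> B) \<inter> ?p -` B"
  have W: "open W" unfolding W_def
    by (rule continuous_open_preimage[OF Cinf_continuous[OF p] o B(1)])
  have cW: "Cinf W (\<lambda>z. frechet_derivative F (at (?p z)) e)"
    by (rule Cinf_compose[OF Cinf_frechet_derivative[OF B(2)] Cinf_subset[OF p] W]) (auto simp: W_def)
  have "Cinf W (\<lambda>(s, x). frechet_derivative F (at (a x + s *\<^sub>R u x)) e)"
    using cW by (simp only: case_prod_unfold)
  moreover have "{0..1} \<times> B \<subseteq> W" using seg by (auto simp: W_def)
  ultimately show ?thesis by (rule Cinf_parametric_integral[OF W _ _ B(1)])
qed

text \<open>Hadamard's lemma: the fundamental theorem of calculus along the segment, with the derivative in the
  direction \<open>u\<close> expanded linearly.\<close>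

lemma segment_integral:
  fixes F :: "'a::euclidean_space \<Rightarrow> 'b::euclidean_space"
  assumes B: "open B" "Cinf B F" and seg: "\<And>s. s \<in> {0..1} \<Longrightarrow> a + s *\<^sub>R u \<in> B"
    and u: "u = (\<Sum>i\<in>N. c i *\<^sub>R e i)" and N: "finite N"
  shows "F (a + u) = F a + (\<Sum>i\<in>N. c i *\<^sub>R integral {0..1} (\<lambda>s. frechet_derivative F (at (a + s *\<^sub>R u)) (e i)))"
proof -
  let ?D = "\<lambda>s. frechet_derivative F (at (a + s *\<^sub>R u))"
  have D: "((\<lambda>s. F (a + s *\<^sub>R u)) has_vector_derivative ?D s u) (at s within {0..1})" if "s \<in> {0..1}" for s
  proof -
    have 1: "((\<lambda>s. a + s *\<^sub>R u) has_derivative (\<lambda>t. t *\<^sub>R u)) (at s)"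
      by (auto intro!: derivative_eq_intros)
    have "((\<lambda>s. F (a + s *\<^sub>R u)) has_derivative (\<lambda>t. ?D s (t *\<^sub>R u))) (at s)"
      using diff_chain_at[OF 1 Cinf_has_derivative[OF B(2) seg[OF that]]] by (simp add: o_def)
    then show ?thesis
      using has_derivative_linear[OF Cinf_has_derivative[OF B(2) seg[OF that]]]
      by (simp add: has_vector_derivative_def linear_scale has_derivative_at_withinI)
  qed
  have i: "((\<lambda>s. ?D s u) has_integral F (a + 1 *\<^sub>R u) - F (a + 0 *\<^sub>R u)) {0..1}"
    by (rule fundamental_theorem_of_calculus) (use D in auto)
  have cont: "continuous_on {0..1} (\<lambda>s. ?D s (e i))" for i
    by (rule continuous_on_compose2[OF Cinf_continuous[OF Cinf_frechet_derivative[OF B(2)]]])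
       (auto intro!: continuous_intros seg)
  have "integral {0..1} (\<lambda>s. ?D s u) = integral {0..1} (\<lambda>s. \<Sum>i\<in>N. c i *\<^sub>R ?D s (e i))"
  proof (rule integral_cong)
    fix s :: real assume "s \<in> {0..1}"
    then have l: "linear (?D s)" using has_derivative_linear[OF Cinf_has_derivative[OF B(2) seg]] by blast
    show "?D s u = (\<Sum>i\<in>N. c i *\<^sub>R ?D s (e i))"
      by (subst (2) u) (simp only: linear_sum[OF l] linear_scale[OF l])
  qed
  also have "\<dots> = (\<Sum>i\<in>N. integral {0..1} (\<lambda>s. c i *\<^sub>R ?D s (e i)))"
    by (rule integral_sum[OF N]) (intro integrable_continuous_interval continuous_on_scaleR continuous_on_const cont)
  also have "\<dots> = (\<Sum>i\<in>N. c i *\<^sub>R integral {0..1} (\<lambda>s. ?D s (e i)))"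
    by simp
  finally show ?thesis using integral_unique[OF i] by (simp add: algebra_simps)
qed

section \<open>Charts\<close>

definition proj :: "'n::finite set \<Rightarrow> real^'n \<Rightarrow> real^'n" where
  "proj J x = (\<chi> i. if i \<in> J then x $ i else 0)"

lemma proj_in: "proj J x \<in> coord_space J"
  by (simp add: proj_def coord_space_def)

lemma proj_id: "x \<in> coord_space J \<Longrightarrow> proj J x = x"
  by (auto simp: proj_def coord_space_def vec_eq_iff)

lemma bounded_linear_proj: "bounded_linear (proj J)"
  by (rule linear_conv_bounded_linear[THEN iffD1], rule linearI) (auto simp: proj_def vec_eq_iff)

lemma Cinf_proj: "Cinf T (proj J)"
  by (rule Cinf_bounded_linear[OF bounded_linear_proj])

lemma continuous_on_proj: "continuous_on T (proj J)"
  by (rule linear_continuous_on[OF bounded_linear_proj])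

lemma subspace_coord_space: "subspace (coord_space J)"
  by (auto simp: subspace_def coord_space_def)

text \<open>The inverse of a chart, extended from its image in \<^term>\<open>coord_space J\<close> to an open subset of
  the whole coordinate space by composition with the projection.\<close>

definition cdom :: "'n::finite set \<Rightarrow> ('m, 'n) chart \<Rightarrow> (real^'n) set" where
  "cdom J c = proj J -` (snd c ` fst c)"

definition cpar :: "'n::finite set \<Rightarrow> ('m, 'n) chart \<Rightarrow> real^'n \<Rightarrow> 'm" where
  "cpar J c y = inv_into (fst c) (snd c) (proj J y)"

locale manifold =
  fixes J :: "'n::finite set" and \<A> :: "('m::{t2_space, second_countable_topology}, 'n) chart set"
  assumes atlas: "smooth_atlas J \<A>"
begin

lemma chart_ex: obtains c where "c \<in> \<A>" "m \<in> fst c"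
proof -
  have "m \<in> (\<Union>(U, \<phi>)\<in>\<A>. U)" using atlas by (simp add: smooth_atlas_def)
  then show ?thesis using that by force
qed

lemma chart:
  assumes "c \<in> \<A>"
  shows "open (fst c)" "openin (top_of_set (coord_space J)) (snd c ` fst c)"
    "homeomorphism (fst c) (snd c ` fst c) (snd c) (inv_into (fst c) (snd c))"
  using atlas assms by (auto simp: smooth_atlas_def)

lemma transition:
  assumes "c \<in> \<A>" "c' \<in> \<A>"
  shows "smooth_on (snd c ` (fst c \<inter> fst c')) (snd c' \<circ> inv_into (fst c) (snd c))"
proof -
  have "\<forall>(U, \<phi>)\<in>\<A>. \<forall>(V, \<psi>)\<in>\<A>. smooth_on (\<phi> ` (U \<inter> V)) (\<psi> \<circ> inv_into U \<phi>)"
    using atlas by (simp add: smooth_atlas_def)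
  from bspec[OF this assms(1)] assms(2) show ?thesis by (auto simp: case_prod_unfold)
qed

lemma open_cdom: assumes "c \<in> \<A>" shows "open (cdom J c)"
proof -
  obtain T where T: "open T" "snd c ` fst c = coord_space J \<inter> T"
    using chart(2)[OF assms] by (auto simp: openin_open)
  then have "cdom J c = proj J -` T" by (auto simp: cdom_def proj_in)
  then show ?thesis
    using continuous_open_preimage[OF continuous_on_proj open_UNIV T(1)] by simp
qed

lemma chart_coord: "c \<in> \<A> \<Longrightarrow> m \<in> fst c \<Longrightarrow> snd c m \<in> coord_space J"
  using openin_imp_subset[OF chart(2)] by blast

lemma chart_in_cdom: "c \<in> \<A> \<Longrightarrow> m \<in> fst c \<Longrightarrow> snd c m \<in> cdom J c"
  by (simp add: cdom_def proj_id chart_coord)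

lemma cpar_chart: assumes "c \<in> \<A>" "m \<in> fst c" shows "cpar J c (snd c m) = m"
  using homeomorphism_apply1[OF chart(3)[OF assms(1)] assms(2)]
  by (simp add: cpar_def proj_id chart_coord assms)

lemma chart_cpar: assumes "c \<in> \<A>" "y \<in> cdom J c" shows "snd c (cpar J c y) = proj J y"
  using homeomorphism_apply2[OF chart(3)[OF assms(1)]] assms(2) by (simp add: cpar_def cdom_def)

lemma cpar_in: assumes "c \<in> \<A>" "y \<in> cdom J c" shows "cpar J c y \<in> fst c"
  using homeomorphism_image2[OF chart(3)[OF assms(1)]] assms(2) by (auto simp: cpar_def cdom_def)

lemma cpar_proj: "cpar J c (proj J y) = cpar J c y"
  by (simp add: cpar_def proj_id proj_in)

lemma proj_in_cdom: "y \<in> cdom J c \<Longrightarrow> proj J y \<in> cdom J c"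
  by (simp add: cdom_def proj_id proj_in)

lemma continuous_on_chart: "c \<in> \<A> \<Longrightarrow> continuous_on (fst c) (snd c)"
  using homeomorphism_cont1[OF chart(3)] .

lemma continuous_on_cpar: "c \<in> \<A> \<Longrightarrow> continuous_on (cdom J c) (cpar J c)"
  unfolding cpar_def
  by (rule continuous_on_compose2[OF homeomorphism_cont2[OF chart(3)] continuous_on_proj]) (auto simp: cdom_def)

lemma open_cpar_preimage: "c \<in> \<A> \<Longrightarrow> open W \<Longrightarrow> open (cdom J c \<inter> cpar J c -` W)"
  by (rule continuous_open_preimage[OF continuous_on_cpar open_cdom])

lemma open_chart_preimage: "c \<in> \<A> \<Longrightarrow> open T \<Longrightarrow> open (fst c \<inter> snd c -` T)"
  by (rule continuous_open_preimage[OF continuous_on_chart chart(1)])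

section \<open>Smooth maps from the manifold to Euclidean spaces\<close>

text \<open>Maps are tested in the open set \<open>cdom J c\<close> of the full coordinate space instead of the image of a
  chart in \<open>coord_space J\<close>, so that ordinary Frechet derivatives can be used.\<close>

definition smooth_at :: "('m \<Rightarrow> 'b::euclidean_space) \<Rightarrow> 'm \<Rightarrow> bool" where
  "smooth_at f m \<longleftrightarrow> (\<exists>c\<in>\<A>. m \<in> fst c \<and>
     (\<exists>T. open T \<and> snd c m \<in> T \<and> T \<subseteq> cdom J c \<and> Cinf T (\<lambda>y. f (cpar J c y))))"

definition msmooth :: "('m \<Rightarrow> 'b::euclidean_space) \<Rightarrow> bool" where
  "msmooth f \<longleftrightarrow> (\<forall>m. smooth_at f m)"

lemma smooth_atI:
  assumes "c \<in> \<A>" "m \<in> fst c" "open T" "snd c m \<in> T" "T \<subseteq> cdom J c" "Cinf T (\<lambda>y. f (cpar J c y))"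
  shows "smooth_at f m"
  unfolding smooth_at_def by (intro bexI[OF _ assms(1)] conjI exI[of _ T] assms(2-))

text \<open>Smoothness at a point may be tested in any one chart, because transition maps are smooth.\<close>

lemma smooth_at_chart:
  assumes "smooth_at f m" and c: "c \<in> \<A>" "m \<in> fst c"
  obtains T where "open T" "snd c m \<in> T" "T \<subseteq> cdom J c" "Cinf T (\<lambda>y. f (cpar J c y))"
proof -
  obtain c' T' where c': "c' \<in> \<A>" "m \<in> fst c'"
    and T': "open T'" "snd c' m \<in> T'" "T' \<subseteq> cdom J c'" "Cinf T' (\<lambda>y. f (cpar J c' y))"
    using assms(1) unfolding smooth_at_def by blast
  have "snd c m \<in> snd c ` (fst c \<inter> fst c')" using c c' by blast
  then obtain T0 F where T0: "open T0" "snd c m \<in> T0" "Cinf T0 F"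
    and F: "\<And>y. y \<in> snd c ` (fst c \<inter> fst c') \<inter> T0 \<Longrightarrow> F y = (snd c' \<circ> inv_into (fst c) (snd c)) y"
    using transition[OF c(1) c'(1), unfolded smooth_on_Cinf] by meson
  define N0 where "N0 = proj J -` T0"
  have N0: "open N0"
    unfolding N0_def using continuous_open_preimage[OF continuous_on_proj open_UNIV T0(1)] by simp
  have g: "Cinf N0 (\<lambda>y. F (proj J y))"
    by (rule Cinf_compose[OF T0(3) Cinf_proj N0]) (auto simp: N0_def)
  define T where "T = (cdom J c \<inter> cpar J c -` fst c') \<inter> (N0 \<inter> (\<lambda>y. F (proj J y)) -` T')"
  have oT: "open T" unfolding T_def
    by (rule open_Int[OF open_cpar_preimage[OF c(1) chart(1)[OF c'(1)]]
          continuous_open_preimage[OF Cinf_continuous[OF g] N0 T'(1)]])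
  have eq: "F (proj J y) = snd c' (cpar J c y)" if "y \<in> cdom J c" "cpar J c y \<in> fst c'" "y \<in> N0" for y
  proof -
    have "proj J y \<in> snd c ` (fst c \<inter> fst c') \<inter> T0"
      using that chart_cpar[OF c(1) that(1)] cpar_in[OF c(1) that(1)]
      by (metis IntI N0_def image_eqI vimageD)
    then show ?thesis using F by (simp add: cpar_def)
  qed
  have y0: "snd c m \<in> cdom J c" "cpar J c (snd c m) = m" "snd c m \<in> N0"
    using chart_in_cdom[OF c] cpar_chart[OF c] T0(2) by (auto simp: N0_def proj_id chart_coord[OF c])
  have mT: "snd c m \<in> T"
    using y0 c' T'(2) eq[OF y0(1) _ y0(3)] by (simp add: T_def)
  have "Cinf T (\<lambda>y. f (cpar J c' (F (proj J y))))"
    by (rule Cinf_compose[OF T'(4) Cinf_subset[OF g] oT]) (auto simp: T_def)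
  then have "Cinf T (\<lambda>y. f (cpar J c y))"
  proof (rule Cinf_cong[OF _ oT])
    fix y assume "y \<in> T"
    then have "y \<in> cdom J c" "cpar J c y \<in> fst c'" "y \<in> N0" by (auto simp: T_def)
    then show "f (cpar J c' (F (proj J y))) = f (cpar J c y)"
      using eq cpar_chart[OF c'(1)] by simp
  qed
  then show ?thesis using that[OF oT mT] by (auto simp: T_def)
qed

text \<open>The function is constant along the fibres of the projection to \<open>coord_space J\<close>, so smoothness near
  a point of that space carries over to the whole fibre.\<close>

lemma msmooth_Cinf:
  assumes f: "msmooth f" and c: "c \<in> \<A>"
  shows "Cinf (cdom J c) (\<lambda>y. f (cpar J c y))"
proof (rule Cinf_local)
  fix y assume y: "y \<in> cdom J c"
  note m = cpar_in[OF c y]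
  obtain T where T: "open T" "snd c (cpar J c y) \<in> T" "T \<subseteq> cdom J c" "Cinf T (\<lambda>y. f (cpar J c y))"
    using smooth_at_chart[OF _ c m, of f] f unfolding msmooth_def by metis
  let ?U = "proj J -` T"
  have U: "open ?U"
    using continuous_open_preimage[OF continuous_on_proj open_UNIV T(1)] by simp
  have "Cinf ?U (\<lambda>y. f (cpar J c (proj J y)))"
    by (rule Cinf_compose[OF T(4) Cinf_proj U]) auto
  then have "Cinf ?U (\<lambda>y. f (cpar J c y))" by (simp add: cpar_proj)
  then show "\<exists>U. open U \<and> y \<in> U \<and> Cinf (cdom J c \<inter> U) (\<lambda>y. f (cpar J c y))"
    using U T(2) chart_cpar[OF c y] by (intro exI[of _ ?U]) (auto elim: Cinf_subset)
qed

text \<open>The two notions differ in how a function on the image of a chart is extended to an open set: by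
  any local extension, or by the one that is constant along the fibres of the projection.\<close>

lemma C_infinity_iff: "f \<in> C_infinity \<A> \<longleftrightarrow> msmooth f"
proof
  assume f: "f \<in> C_infinity \<A>"
  show "msmooth f" unfolding msmooth_def
  proof
    fix m
    obtain c where c: "c \<in> \<A>" "m \<in> fst c" by (rule chart_ex)
    have "smooth_on (snd c ` fst c) (f \<circ> inv_into (fst c) (snd c))"
      using f c by (auto simp: C_infinity_def)
    then obtain T F where T: "open T" "snd c m \<in> T" "Cinf T F"
      and F: "\<And>y. y \<in> snd c ` fst c \<inter> T \<Longrightarrow> F y = (f \<circ> inv_into (fst c) (snd c)) y"
      using imageI[OF c(2), of "snd c"] unfolding smooth_on_Cinf by meson
    let ?U = "cdom J c \<inter> proj J -` T"
    have U: "open ?U"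
      using continuous_open_preimage[OF continuous_on_proj open_cdom[OF c(1)] T(1)] .
    have "Cinf ?U (\<lambda>y. F (proj J y))"
      by (rule Cinf_compose[OF T(3) Cinf_proj U]) auto
    then have "Cinf ?U (\<lambda>y. f (cpar J c y))"
      by (rule Cinf_cong[OF _ U]) (auto simp: F cdom_def cpar_def)
    then show "smooth_at f m"
      by (intro smooth_atI[OF c U]) (auto simp: chart_in_cdom c T(2) proj_id chart_coord)
  qed
next
  assume f: "msmooth f"
  have "smooth_on (snd c ` fst c) (f \<circ> inv_into (fst c) (snd c))" if c: "c \<in> \<A>" for c
    unfolding smooth_on_Cinf
  proof
    fix x assume x: "x \<in> snd c ` fst c"
    then have "x \<in> cdom J c" using chart_in_cdom[OF c] by auto
    moreover have "proj J y = y" if "y \<in> snd c ` fst c" for y using that proj_id chart_coord[OF c] by auto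
    ultimately show "\<exists>T F. open T \<and> x \<in> T \<and> Cinf T F \<and>
        (\<forall>y\<in>snd c ` fst c \<inter> T. F y = (f \<circ> inv_into (fst c) (snd c)) y)"
      using open_cdom[OF c] msmooth_Cinf[OF f c]
      by (intro exI[of _ "cdom J c"] exI[of _ "\<lambda>y. f (cpar J c y)"]) (auto simp: cpar_def)
  qed
  then show "f \<in> C_infinity \<A>" by (auto simp: C_infinity_def)
qed

lemma smooth_at_cong:
  assumes f: "smooth_at f m" and W: "open W" "m \<in> W" and eq: "\<And>q. q \<in> W \<Longrightarrow> f q = g q"
  shows "smooth_at g m"
proof -
  obtain c where c: "c \<in> \<A>" "m \<in> fst c" by (rule chart_ex)
  obtain T where T: "open T" "snd c m \<in> T" "T \<subseteq> cdom J c" "Cinf T (\<lambda>y. f (cpar J c y))"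
    by (rule smooth_at_chart[OF f c])
  let ?T = "T \<inter> (cdom J c \<inter> cpar J c -` W)"
  have o: "open ?T" by (rule open_Int[OF T(1) open_cpar_preimage[OF c(1) W(1)]])
  have "Cinf ?T (\<lambda>y. g (cpar J c y))"
    by (rule Cinf_cong[OF Cinf_subset[OF T(4)] o]) (auto simp: eq)
  then show ?thesis
    by (intro smooth_atI[OF c o]) (auto simp: T(2) chart_in_cdom[OF c] cpar_chart[OF c] W(2))
qed

lemma smooth_at_chart_function:
  assumes c: "c \<in> \<A>" "m \<in> fst c" and h: "open T" "snd c m \<in> T" "Cinf T h"
  shows "smooth_at (\<lambda>q. h (snd c q)) m"
proof -
  let ?U = "cdom J c \<inter> proj J -` T"
  have U: "open ?U"
    using continuous_open_preimage[OF continuous_on_proj open_cdom[OF c(1)] h(1)] .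
  have "Cinf ?U (\<lambda>y. h (proj J y))"
    by (rule Cinf_compose[OF h(3) Cinf_proj U]) auto
  then have "Cinf ?U (\<lambda>y. h (snd c (cpar J c y)))"
    by (rule Cinf_cong[OF _ U]) (auto simp: chart_cpar[OF c(1)])
  then show ?thesis
    by (intro smooth_atI[OF c U]) (auto simp: chart_in_cdom[OF c] h(2) proj_id chart_coord[OF c])
qed

lemma isCont_smooth_at:
  assumes "smooth_at f m" shows "isCont f m"
proof -
  obtain c where c: "c \<in> \<A>" "m \<in> fst c" by (rule chart_ex)
  obtain T where T: "open T" "snd c m \<in> T" "T \<subseteq> cdom J c" "Cinf T (\<lambda>y. f (cpar J c y))"
    by (rule smooth_at_chart[OF assms c])
  let ?W = "fst c \<inter> snd c -` T"
  have "continuous_on ?W (\<lambda>q. f (cpar J c (snd c q)))"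
    by (rule continuous_on_compose2[OF Cinf_continuous[OF T(4)] continuous_on_subset[OF continuous_on_chart[OF c(1)]]]) auto
  then have "continuous_on ?W f"
    by (rule continuous_on_eq) (simp add: cpar_chart[OF c(1)])
  then show ?thesis
    using open_chart_preimage[OF c(1) T(1)] c T(2) by (simp add: continuous_on_eq_continuous_at)
qed

lemma continuous_on_msmooth: "msmooth f \<Longrightarrow> continuous_on UNIV f"
  unfolding msmooth_def by (intro continuous_at_imp_continuous_on ballI isCont_smooth_at) auto

lemma smooth_at_compose:
  assumes f: "smooth_at f m" and G: "open S" "f m \<in> S" "Cinf S G"
  shows "smooth_at (\<lambda>q. G (f q)) m"
proof -
  obtain c where c: "c \<in> \<A>" "m \<in> fst c" by (rule chart_ex)
  obtain T where T: "open T" "snd c m \<in> T" "T \<subseteq> cdom J c" "Cinf T (\<lambda>y. f (cpar J c y))"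
    by (rule smooth_at_chart[OF f c])
  let ?T = "T \<inter> (\<lambda>y. f (cpar J c y)) -` S"
  have o: "open ?T" by (rule continuous_open_preimage[OF Cinf_continuous[OF T(4)] T(1) G(1)])
  have "Cinf ?T (\<lambda>y. G (f (cpar J c y)))"
    by (rule Cinf_compose[OF G(3) Cinf_subset[OF T(4)] o]) auto
  then show ?thesis
    using T(2,3) G(2) by (intro smooth_atI[OF c o]) (auto simp: cpar_chart[OF c])
qed

lemma smooth_at_const: "smooth_at (\<lambda>q. a) m"
proof -
  obtain c where c: "c \<in> \<A>" "m \<in> fst c" by (rule chart_ex)
  show ?thesis
    by (rule smooth_atI[OF c open_cdom[OF c(1)] chart_in_cdom[OF c] order_refl Cinf_const])
qed

lemma smooth_at_Pair:
  assumes f: "smooth_at f m" and g: "smooth_at g m"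
  shows "smooth_at (\<lambda>q. (f q, g q)) m"
proof -
  obtain c where c: "c \<in> \<A>" "m \<in> fst c" by (rule chart_ex)
  obtain T where T: "open T" "snd c m \<in> T" "T \<subseteq> cdom J c" "Cinf T (\<lambda>y. f (cpar J c y))"
    by (rule smooth_at_chart[OF f c])
  obtain S where S: "open S" "snd c m \<in> S" "S \<subseteq> cdom J c" "Cinf S (\<lambda>y. g (cpar J c y))"
    by (rule smooth_at_chart[OF g c])
  show ?thesis
    by (rule smooth_atI[OF c open_Int[OF T(1) S(1)] _ _ Cinf_Pair[OF open_Int[OF T(1) S(1)] Cinf_subset[OF T(4)] Cinf_subset[OF S(4)]]])
       (use T(2,3) S(2) in auto)
qed

lemma smooth_at_bilinear:
  assumes B: "bounded_bilinear prd" and "smooth_at f m" "smooth_at g m"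
  shows "smooth_at (\<lambda>q. prd (f q) (g q)) m"
  using smooth_at_compose[OF smooth_at_Pair[OF assms(2,3)] open_UNIV UNIV_I
    Cinf_bilinear[OF B open_UNIV Cinf_bounded_linear[OF bounded_linear_fst] Cinf_bounded_linear[OF bounded_linear_snd]]]
  by simp

lemma smooth_at_linear: "bounded_linear L \<Longrightarrow> smooth_at f m \<Longrightarrow> smooth_at (\<lambda>q. L (f q)) m"
  using smooth_at_compose[OF _ open_UNIV UNIV_I Cinf_bounded_linear] .

lemma smooth_at_add: "smooth_at f m \<Longrightarrow> smooth_at g m \<Longrightarrow> smooth_at (\<lambda>q. f q + g q) m"
  using smooth_at_compose[OF smooth_at_Pair open_UNIV UNIV_I
    Cinf_add[OF open_UNIV Cinf_bounded_linear[OF bounded_linear_fst] Cinf_bounded_linear[OF bounded_linear_snd]]]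
  by simp

lemma smooth_at_minus: "smooth_at f m \<Longrightarrow> smooth_at (\<lambda>q. - f q) m"
  by (rule smooth_at_linear[OF bounded_linear_minus[OF bounded_linear_ident]])

lemma smooth_at_diff: "smooth_at f m \<Longrightarrow> smooth_at g m \<Longrightarrow> smooth_at (\<lambda>q. f q - g q) m"
  using smooth_at_add[OF _ smooth_at_minus, of f m g] by simp

lemma smooth_at_sum: "(\<And>i. i \<in> N \<Longrightarrow> smooth_at (f i) m) \<Longrightarrow> smooth_at (\<lambda>q. \<Sum>i\<in>N. f i q) m"
  by (induction N rule: infinite_finite_induct) (auto intro: smooth_at_const smooth_at_add)

lemmas smooth_at_mult = smooth_at_bilinear[OF bounded_bilinear_mult]
lemmas smooth_at_scaleR = smooth_at_bilinear[OF bounded_bilinear_scaleR]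

lemma smooth_at_prod:
  fixes f :: "'i \<Rightarrow> 'm \<Rightarrow> real"
  shows "(\<And>i. i \<in> N \<Longrightarrow> smooth_at (f i) m) \<Longrightarrow> smooth_at (\<lambda>q. \<Prod>i\<in>N. f i q) m"
  by (induction N rule: infinite_finite_induct) (auto intro: smooth_at_const smooth_at_mult)

lemma msmooth_const: "msmooth (\<lambda>q. a)" by (simp add: msmooth_def smooth_at_const)
lemma msmooth_add: "msmooth f \<Longrightarrow> msmooth g \<Longrightarrow> msmooth (\<lambda>q. f q + g q)"
  by (simp add: msmooth_def smooth_at_add)
lemma msmooth_diff: "msmooth f \<Longrightarrow> msmooth g \<Longrightarrow> msmooth (\<lambda>q. f q - g q)"
  by (simp add: msmooth_def smooth_at_diff)
lemma msmooth_minus: "msmooth f \<Longrightarrow> msmooth (\<lambda>q. - f q)"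
  by (simp add: msmooth_def smooth_at_minus)
lemma msmooth_sum: "(\<And>i. i \<in> N \<Longrightarrow> msmooth (f i)) \<Longrightarrow> msmooth (\<lambda>q. \<Sum>i\<in>N. f i q)"
  by (simp add: msmooth_def smooth_at_sum)
lemma msmooth_linear: "bounded_linear L \<Longrightarrow> msmooth f \<Longrightarrow> msmooth (\<lambda>q. L (f q))"
  by (simp add: msmooth_def smooth_at_linear)
lemma msmooth_mult:
  fixes f g :: "'m \<Rightarrow> 'b::{euclidean_space, real_normed_algebra}"
  shows "msmooth f \<Longrightarrow> msmooth g \<Longrightarrow> msmooth (\<lambda>q. f q * g q)"
  by (simp add: msmooth_def smooth_at_mult)
lemma msmooth_prod:
  fixes f :: "'i \<Rightarrow> 'm \<Rightarrow> real"
  shows "(\<And>i. i \<in> N \<Longrightarrow> msmooth (f i)) \<Longrightarrow> msmooth (\<lambda>q. \<Prod>i\<in>N. f i q)"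
  by (simp add: msmooth_def smooth_at_prod)
lemma msmooth_compose: "msmooth f \<Longrightarrow> Cinf UNIV G \<Longrightarrow> msmooth (\<lambda>q. G (f q))"
  unfolding msmooth_def using smooth_at_compose[OF _ open_UNIV UNIV_I] by blast
lemma msmooth_complex: "msmooth z \<longleftrightarrow> msmooth (\<lambda>q. Re (z q)) \<and> msmooth (\<lambda>q. Im (z q))"
proof
  assume "msmooth (\<lambda>q. Re (z q)) \<and> msmooth (\<lambda>q. Im (z q))"
  then have "msmooth (\<lambda>q. of_real (Re (z q)) + \<i> * of_real (Im (z q)))"
    by (intro msmooth_add msmooth_mult msmooth_const) (auto intro: msmooth_linear[OF bounded_linear_of_real])
  then show "msmooth z" by (simp add: complex_eq[symmetric])
qed (auto intro: msmooth_linear bounded_linear_Re bounded_linear_Im)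

section \<open>Bump functions\<close>

text \<open>A cutoff of the distance in a chart. Its support is the image of a closed ball, hence compact and
  therefore closed in the Hausdorff space \<open>'m\<close>, so that extension by zero is smooth.\<close>

lemma bump:
  assumes W: "open W" "p \<in> W"
  obtains \<eta> :: "'m \<Rightarrow> real" and N where "msmooth \<eta>" "\<And>q. 0 \<le> \<eta> q \<and> \<eta> q \<le> 1"
    "open N" "p \<in> N" "N \<subseteq> W" "\<And>q. q \<in> N \<Longrightarrow> \<eta> q = 1"
    "\<And>q. q \<notin> W \<Longrightarrow> \<exists>N'. open N' \<and> q \<in> N' \<and> (\<forall>q'\<in>N'. \<eta> q' = 0)"
proof -
  obtain c where c: "c \<in> \<A>" "p \<in> fst c" by (rule chart_ex)
  define y0 where "y0 = snd c p"
  have V: "open (cdom J c \<inter> cpar J c -` W)" by (rule open_cpar_preimage[OF c(1) W(1)])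
  have "y0 \<in> cdom J c \<inter> cpar J c -` W"
    using chart_in_cdom[OF c] cpar_chart[OF c] W(2) by (auto simp: y0_def)
  then obtain r where r: "r > 0" "cball y0 r \<subseteq> cdom J c \<inter> cpar J c -` W"
    using V open_contains_cball by blast
  define h where "h y = cutoff (1 - ((y - y0) \<bullet> (y - y0)) / r\<^sup>2)" for y
  have hC: "Cinf UNIV h"
  proof -
    have d: "Cinf UNIV (\<lambda>y. y - y0)"
      by (rule Cinf_diff[OF open_UNIV Cinf_bounded_linear[OF bounded_linear_ident] Cinf_const])
    have "Cinf UNIV (\<lambda>y. 1 - ((y - y0) \<bullet> (y - y0)) * (1 / r\<^sup>2))"
      by (rule Cinf_diff[OF open_UNIV Cinf_const Cinf_mult[OF open_UNIV Cinf_bilinear[OF bounded_bilinear_inner open_UNIV d d] Cinf_const]])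
    from Cinf_compose[OF Cinf_cutoff this open_UNIV] show ?thesis by (simp add: h_def[abs_def])
  qed
  define \<eta> where "\<eta> q = (if q \<in> fst c then h (snd c q) else 0)" for q
  define K where "K = cpar J c ` (cball y0 r \<inter> coord_space J)"
  have "compact (cball y0 r \<inter> coord_space J)"
    by (rule compact_Int_closed[OF compact_cball closed_subspace[OF subspace_coord_space]])
  then have "compact K" unfolding K_def
    by (rule compact_continuous_image[rotated]) (rule continuous_on_subset[OF continuous_on_cpar[OF c(1)]], use r(2) in auto)
  then have K: "closed K" by (rule compact_imp_closed)
  have KW: "K \<subseteq> W" "K \<subseteq> fst c" using r(2) cpar_in[OF c(1)] by (auto simp: K_def)
  have inK: "q \<in> K" if "q \<in> fst c" "dist y0 (snd c q) \<le> r" for q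
    unfolding K_def using that chart_coord[OF c(1)] cpar_chart[OF c(1) that(1)] by (intro image_eqI[of _ _ "snd c q"]) auto
  have sq: "(y - y0) \<bullet> (y - y0) = (dist y0 y)\<^sup>2" for y
    by (subst dist_commute) (simp add: dist_norm power2_norm_eq_inner)
  have out: "\<eta> q = 0" if "q \<notin> K" for q
  proof (cases "q \<in> fst c")
    case True
    then have "r < dist y0 (snd c q)" using inK that by force
    then have "1 \<le> (dist y0 (snd c q))\<^sup>2 / r\<^sup>2" using r(1) by (simp add: le_divide_eq_1_pos)
    then have "1 - (dist y0 (snd c q))\<^sup>2 / r\<^sup>2 \<le> 1/3" by linarith
    then show ?thesis using True by (simp add: \<eta>_def h_def sq cutoff_eq_0)
  qed (simp add: \<eta>_def)
  have zero: "\<exists>N'. open N' \<and> q \<in> N' \<and> (\<forall>q'\<in>N'. \<eta> q' = 0)" if "q \<notin> K" for q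
    using K that out by (intro exI[of _ "- K"]) auto
  have sm: "msmooth \<eta>" unfolding msmooth_def
  proof
    fix q show "smooth_at \<eta> q"
    proof (cases "q \<in> fst c")
      case True
      show ?thesis
        by (rule smooth_at_cong[OF smooth_at_chart_function[OF c(1) True open_UNIV UNIV_I hC] chart(1)[OF c(1)] True])
           (simp add: \<eta>_def)
    next
      case False
      then obtain N' where "open N'" "q \<in> N'" "\<forall>q'\<in>N'. \<eta> q' = 0" using zero KW(2) by blast
      then show ?thesis by (intro smooth_at_cong[OF smooth_at_const]) auto
    qed
  qed
  define N where "N = fst c \<inter> snd c -` ball y0 (r/2)"
  have NK: "N \<subseteq> K" using inK r(1) by (force simp: N_def)
  have one: "\<eta> q = 1" if "q \<in> N" for q
  proof -
    have "(dist y0 (snd c q))\<^sup>2 \<le> (r/2)\<^sup>2" using that by (intro power_mono) (auto simp: N_def)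
    then have "(dist y0 (snd c q))\<^sup>2 / r\<^sup>2 \<le> (r/2)\<^sup>2 / r\<^sup>2" by (rule divide_right_mono) simp
    moreover have "(r/2)\<^sup>2 / r\<^sup>2 = 1/4" using r(1) by (simp add: power_divide)
    ultimately have "2/3 \<le> 1 - (dist y0 (snd c q))\<^sup>2 / r\<^sup>2" by linarith
    then show ?thesis using that by (simp add: \<eta>_def h_def sq cutoff_eq_1 N_def)
  qed
  show ?thesis
  proof (rule that[OF sm])
    show "open N" unfolding N_def by (rule open_chart_preimage[OF c(1) open_ball])
    show "p \<in> N" using c r(1) by (simp add: N_def y0_def)
    show "0 \<le> \<eta> q \<and> \<eta> q \<le> 1" for q by (simp add: \<eta>_def h_def cutoff_bounds)
    show "N \<subseteq> W" using NK KW by blast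
    show "\<exists>N'. open N' \<and> q \<in> N' \<and> (\<forall>q'\<in>N'. \<eta> q' = 0)" if "q \<notin> W" for q using zero KW that by blast
  qed (rule one)
qed

text \<open>Tangent vectors only accept functions defined and smooth on the whole manifold; this lets them act
  on germs.\<close>

lemma extend_smooth:
  fixes f :: "'m \<Rightarrow> 'b::euclidean_space"
  assumes W: "open W" "p \<in> W" and f: "\<And>q. q \<in> W \<Longrightarrow> smooth_at f q"
  obtains g N where "msmooth g" "open N" "p \<in> N" "N \<subseteq> W" "\<And>q. q \<in> N \<Longrightarrow> g q = f q"
proof -
  obtain \<eta> :: "'m \<Rightarrow> real" and N where \<eta>: "msmooth \<eta>" "open N" "p \<in> N" "N \<subseteq> W" "\<And>q. q \<in> N \<Longrightarrow> \<eta> q = 1"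
    "\<And>q. q \<notin> W \<Longrightarrow> \<exists>N'. open N' \<and> q \<in> N' \<and> (\<forall>q'\<in>N'. \<eta> q' = 0)"
    by (rule bump[OF W]) blast
  have "smooth_at (\<lambda>q. \<eta> q *\<^sub>R f q) q" for q
  proof (cases "q \<in> W")
    case True
    then show ?thesis using \<eta>(1) by (intro smooth_at_scaleR f) (auto simp: msmooth_def)
  next
    case False
    then obtain N' where "open N'" "q \<in> N'" "\<forall>q'\<in>N'. \<eta> q' = 0" using \<eta>(6) by blast
    then show ?thesis by (intro smooth_at_cong[OF smooth_at_const[of 0], where W = N']) auto
  qed
  then show ?thesis
    using \<eta> by (intro that[of "\<lambda>q. \<eta> q *\<^sub>R f q" N]) (auto simp: msmooth_def)
qed

section \<open>Tangent vectors\<close>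

lemma tan_add: "v \<in> tangent_space \<A> m \<Longrightarrow> msmooth f \<Longrightarrow> msmooth g \<Longrightarrow> v (\<lambda>p. f p + g p) = v f + v g"
  by (simp add: tangent_space_def C_infinity_iff)

lemma tan_mult: "v \<in> tangent_space \<A> m \<Longrightarrow> msmooth f \<Longrightarrow> msmooth g \<Longrightarrow>
    v (\<lambda>p. f p * g p) = f m * v g + g m * v f"
  by (simp add: tangent_space_def C_infinity_iff)

lemma tan_scale: "v \<in> tangent_space \<A> m \<Longrightarrow> msmooth f \<Longrightarrow> v (\<lambda>p. a * f p) = a * v f"
  by (simp add: tangent_space_def C_infinity_iff)

lemma tan_not_smooth: "v \<in> tangent_space \<A> m \<Longrightarrow> \<not> msmooth f \<Longrightarrow> v f = 0"
  by (simp add: tangent_space_def C_infinity_iff)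

lemma tangentI:
  assumes "\<And>f g. msmooth f \<Longrightarrow> msmooth g \<Longrightarrow> v (\<lambda>p. f p + g p) = v f + v g"
    "\<And>f g. msmooth f \<Longrightarrow> msmooth g \<Longrightarrow> v (\<lambda>p. f p * g p) = f m * v g + g m * v f"
    "\<And>a f. msmooth f \<Longrightarrow> v (\<lambda>p. a * f p) = a * v f"
    "\<And>f. \<not> msmooth f \<Longrightarrow> v f = 0"
  shows "v \<in> tangent_space \<A> m"
  using assms by (simp add: tangent_space_def C_infinity_iff)

lemma tan_const: assumes v: "v \<in> tangent_space \<A> m" shows "v (\<lambda>p. a) = 0"
proof -
  have "v (\<lambda>p. 1 * 1) = 1 * v (\<lambda>p. 1) + 1 * v (\<lambda>p. 1)"
    by (rule tan_mult[OF v]) (rule msmooth_const)+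
  then have "v (\<lambda>p. 1) = 0" by simp
  then show ?thesis using tan_scale[OF v msmooth_const, of a 1] by simp
qed

lemma tan_minus: assumes v: "v \<in> tangent_space \<A> m" and "msmooth f" shows "v (\<lambda>p. - f p) = - v f"
  using tan_scale[OF assms, of "-1"] by simp

lemma tan_diff: assumes v: "v \<in> tangent_space \<A> m" and "msmooth f" "msmooth g"
  shows "v (\<lambda>p. f p - g p) = v f - v g"
  using tan_add[OF v assms(2) msmooth_minus[OF assms(3)]] tan_minus[OF v assms(3)] by simp

lemma tan_sum:
  assumes v: "v \<in> tangent_space \<A> m" and "\<And>i. i \<in> N \<Longrightarrow> msmooth (f i)"
  shows "v (\<lambda>p. \<Sum>i\<in>N. f i p) = (\<Sum>i\<in>N. v (f i))"
  using assms(2)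
proof (induction N rule: infinite_finite_induct)
  case (insert i N)
  then show ?case using tan_add[OF v, of "f i" "\<lambda>p. \<Sum>i\<in>N. f i p"] by (simp add: msmooth_sum)
qed (simp_all add: tan_const[OF v])

text \<open>The product of the difference \<open>f - g\<close> with a bump function is zero, and of the product rule for it only
  the derivative of the difference is left, since the difference vanishes at \<open>m\<close>.\<close>

lemma tan_local:
  assumes v: "v \<in> tangent_space \<A> m" and f: "msmooth f" "msmooth g"
    and N: "open N" "m \<in> N" "\<And>q. q \<in> N \<Longrightarrow> f q = g q"
  shows "v f = v g"
proof -
  obtain \<eta> :: "'m \<Rightarrow> real" and N1 where \<eta>: "msmooth \<eta>" "m \<in> N1" "\<And>q. q \<in> N1 \<Longrightarrow> \<eta> q = 1"
    "\<And>q. q \<notin> N \<Longrightarrow> \<exists>N'. open N' \<and> q \<in> N' \<and> (\<forall>q'\<in>N'. \<eta> q' = 0)"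
    by (rule bump[OF N(1,2)]) blast
  have d: "msmooth (\<lambda>q. f q - g q)" by (rule msmooth_diff[OF f])
  have "(\<lambda>q. \<eta> q * (f q - g q)) = (\<lambda>q. 0)"
  proof
    fix q show "\<eta> q * (f q - g q) = 0"
      using N(3)[of q] \<eta>(4)[of q] by (cases "q \<in> N") auto
  qed
  then have "v (\<lambda>q. \<eta> q * (f q - g q)) = 0" by (simp add: tan_const[OF v])
  then have "v (\<lambda>q. f q - g q) = 0"
    using tan_mult[OF v \<eta>(1) d] \<eta>(2,3) N by simp
  then show ?thesis using tan_diff[OF v f] by simp
qed

lemma zero_tangent: "(\<lambda>f. 0) \<in> tangent_space \<A> m"
  by (rule tangentI) auto

text \<open>The velocity of a map into the manifold in a direction of its domain is a derivation by the product
  rule; the map needs to be smooth only when tested by smooth functions.\<close>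

lemma tangent_of_map:
  fixes \<tau> :: "'a::real_normed_vector \<Rightarrow> 'm"
  assumes d: "\<And>f :: 'm \<Rightarrow> real. msmooth f \<Longrightarrow> (\<lambda>t. f (\<tau> t)) differentiable (at x)"
  shows "(\<lambda>f. if f \<in> C_infinity \<A> then frechet_derivative (\<lambda>t. f (\<tau> t)) (at x) u else 0) \<in> tangent_space \<A> (\<tau> x)"
proof -
  have D: "((\<lambda>t. f (\<tau> t)) has_derivative frechet_derivative (\<lambda>t. f (\<tau> t)) (at x)) (at x)" if "msmooth f" for f :: "'m \<Rightarrow> real"
    using d[OF that] by (simp add: frechet_derivative_works)
  show ?thesis
  proof (rule tangentI)
    fix f g :: "'m \<Rightarrow> real" and a :: real assume f: "msmooth f" and g: "msmooth g"
    show "(if (\<lambda>p. f p + g p) \<in> C_infinity \<A> then frechet_derivative (\<lambda>t. f (\<tau> t) + g (\<tau> t)) (at x) u else 0) =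
        (if f \<in> C_infinity \<A> then frechet_derivative (\<lambda>t. f (\<tau> t)) (at x) u else 0) +
        (if g \<in> C_infinity \<A> then frechet_derivative (\<lambda>t. g (\<tau> t)) (at x) u else 0)"
      using frechet_derivative_eq[OF has_derivative_add[OF D[OF f] D[OF g]]] f g
      by (simp add: C_infinity_iff msmooth_add)
    show "(if (\<lambda>p. f p * g p) \<in> C_infinity \<A> then frechet_derivative (\<lambda>t. f (\<tau> t) * g (\<tau> t)) (at x) u else 0) =
        f (\<tau> x) * (if g \<in> C_infinity \<A> then frechet_derivative (\<lambda>t. g (\<tau> t)) (at x) u else 0) +
        g (\<tau> x) * (if f \<in> C_infinity \<A> then frechet_derivative (\<lambda>t. f (\<tau> t)) (at x) u else 0)"
      using frechet_derivative_eq[OF has_derivative_mult[OF D[OF f] D[OF g]]] f g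
      by (simp add: C_infinity_iff msmooth_mult)
    show "(if (\<lambda>p. a * f p) \<in> C_infinity \<A> then frechet_derivative (\<lambda>t. a * f (\<tau> t)) (at x) u else 0) =
        a * (if f \<in> C_infinity \<A> then frechet_derivative (\<lambda>t. f (\<tau> t)) (at x) u else 0)"
      using frechet_derivative_eq[OF has_derivative_mult_right[OF D[OF f]]] f
      by (simp add: C_infinity_iff msmooth_mult msmooth_const)
  qed (simp add: C_infinity_iff)
qed

text \<open>A function in the parametrisation \<open>cpar J c\<close> is constant along the fibres of the projection, so only
  the projected point and direction matter.\<close>

lemma frechet_cpar_proj:
  assumes c: "c \<in> \<A>" and f: "msmooth f" and y: "y \<in> cdom J c"
  shows "frechet_derivative (\<lambda>y. f (cpar J c y)) (at y) w =
    frechet_derivative (\<lambda>y. f (cpar J c y)) (at (proj J y)) (proj J w)"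
proof -
  have "((\<lambda>y. f (cpar J c (proj J y))) has_derivative
      (\<lambda>w. frechet_derivative (\<lambda>y. f (cpar J c y)) (at (proj J y)) (proj J w))) (at y)"
    using diff_chain_at[OF bounded_linear_imp_has_derivative[OF bounded_linear_proj]
        Cinf_has_derivative[OF msmooth_Cinf[OF f c] proj_in_cdom[OF y]]] by (simp add: o_def)
  then show ?thesis using frechet_derivative_eq by (simp add: cpar_proj)
qed

text \<open>Every derivation is a directional derivative in a chart: by Hadamard's lemma a function is near
  the base point its value there plus a combination of the centred coordinate functions.\<close>

lemma tangent_repr:
  assumes v: "v \<in> tangent_space \<A> (cpar J c y)" and c: "c \<in> \<A>" and y: "y \<in> cdom J c"
  obtains w where "w \<in> coord_space J"
    "\<And>f. msmooth f \<Longrightarrow> v f = frechet_derivative (\<lambda>y. f (cpar J c y)) (at y) w"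
proof -
  define m where "m = cpar J c y"
  define y0 where "y0 = proj J y"
  have m: "m \<in> fst c" "snd c m = y0" using cpar_in[OF c y] chart_cpar[OF c y] by (auto simp: m_def y0_def)
  have y0: "y0 \<in> cdom J c" using proj_in_cdom[OF y] by (simp add: y0_def)
  obtain r where r: "r > 0" "ball y0 r \<subseteq> cdom J c" using open_contains_ball y0 open_cdom[OF c] by blast
  let ?W = "fst c \<inter> snd c -` ball y0 r"
  have W: "open ?W" "m \<in> ?W" using open_chart_preimage[OF c open_ball] m r(1) by auto
  have "\<exists>x N. msmooth x \<and> open N \<and> m \<in> N \<and> N \<subseteq> ?W \<and> (\<forall>q\<in>N. x q = (snd c q - y0) $ i)" for i
  proof -
    have "Cinf UNIV (\<lambda>y. (y - y0) $ i)"
      by (rule Cinf_bounded_linear_compose[OF bounded_linear_vec_nth open_UNIV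
            Cinf_diff[OF open_UNIV Cinf_bounded_linear[OF bounded_linear_ident] Cinf_const]])
    then have sm: "smooth_at (\<lambda>q. (snd c q - y0) $ i) q" if "q \<in> ?W" for q
      using that by (intro smooth_at_chart_function[OF c _ open_UNIV UNIV_I]) auto
    obtain x N where "msmooth x" "open N" "m \<in> N" "N \<subseteq> ?W" "\<And>q. q \<in> N \<Longrightarrow> x q = (snd c q - y0) $ i"
      by (rule extend_smooth[OF W sm], assumption, rule that)
    then show ?thesis by (intro exI[of _ x] exI[of _ N]) simp
  qed
  then obtain X N where X: "\<And>i. msmooth (X i)" "\<And>i. open (N i)" "\<And>i. m \<in> N i" "\<And>i. N i \<subseteq> ?W"
    "\<And>i q. q \<in> N i \<Longrightarrow> X i q = (snd c q - y0) $ i"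
    by metis
  define w where "w = (\<chi> i. v (X i))"
  have v: "v \<in> tangent_space \<A> m" using v by (simp add: m_def)
  have w: "w \<in> coord_space J"
  proof -
    have "v (X i) = 0" if "i \<notin> J" for i
    proof -
      have "X i q = 0" if "q \<in> N i" for q
      proof -
        have "snd c q \<in> coord_space J" using X(4) that by (intro chart_coord[OF c]) auto
        moreover have "y0 \<in> coord_space J" by (simp add: y0_def proj_in)
        ultimately show ?thesis using X(5)[OF that] \<open>i \<notin> J\<close> by (simp add: coord_space_def)
      qed
      then have "v (X i) = v (\<lambda>q. 0)"
        by (rule tan_local[OF v X(1) msmooth_const X(2,3)])
      then show ?thesis by (simp add: tan_const[OF v])
    qed
    then show ?thesis by (simp add: coord_space_def w_def)
  qed
  have "v f = frechet_derivative (\<lambda>y. f (cpar J c y)) (at y) w" if f: "msmooth f" for f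
  proof -
    let ?F = "\<lambda>y. f (cpar J c y)"
    have F: "Cinf (ball y0 r) ?F" by (rule Cinf_subset[OF msmooth_Cinf[OF f c] r(2)])
    have seg: "y0 + s *\<^sub>R (x - y0) \<in> ball y0 r" if "x \<in> ball y0 r" "s \<in> {0..1}" for x s
      using that mult_left_le_one_le[of "norm (x - y0)" s]
      by (simp add: dist_norm) (smt (verit) norm_minus_commute)
    define g where "g i x = integral {0..1} (\<lambda>s. frechet_derivative ?F (at (y0 + s *\<^sub>R (x - y0))) (axis i 1))" for i x
    have g: "Cinf (ball y0 r) (g i)" for i unfolding g_def
      by (rule Cinf_segment_integral[OF open_ball F Cinf_const])
         (rule Cinf_diff[OF open_ball Cinf_bounded_linear[OF bounded_linear_ident] Cinf_const], rule seg)
    have Fx: "?F x = ?F y0 + (\<Sum>i\<in>UNIV. (x - y0) $ i * g i x)" if "x \<in> ball y0 r" for x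
    proof -
      have "x - y0 = (\<Sum>i\<in>UNIV. (x - y0) $ i *\<^sub>R axis i 1)"
        using basis_expansion[of "x - y0"] by (simp add: scalar_mult_eq_scaleR)
      from segment_integral[OF open_ball F seg[OF that] this]
      show ?thesis by (simp add: g_def)
    qed
    have "\<exists>x N. msmooth x \<and> open N \<and> m \<in> N \<and> N \<subseteq> ?W \<and> (\<forall>q\<in>N. x q = g i (snd c q))" for i
    proof -
      have sm: "smooth_at (\<lambda>q. g i (snd c q)) q" if "q \<in> ?W" for q
        using that by (intro smooth_at_chart_function[OF c _ open_ball _ g]) auto
      obtain x N where "msmooth x" "open N" "m \<in> N" "N \<subseteq> ?W" "\<And>q. q \<in> N \<Longrightarrow> x q = g i (snd c q)"
        by (rule extend_smooth[OF W sm], assumption, rule that)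
      then show ?thesis by (intro exI[of _ x] exI[of _ N]) simp
    qed
    then obtain G N' where G: "\<And>i. msmooth (G i)" "\<And>i. open (N' i)" "\<And>i. m \<in> N' i" "\<And>i. N' i \<subseteq> ?W"
      "\<And>i q. q \<in> N' i \<Longrightarrow> G i q = g i (snd c q)"
      by metis
    let ?N = "?W \<inter> (\<Inter>i. N i \<inter> N' i)"
    have N: "open ?N" "m \<in> ?N" using W X(2,3) G(2,3) by (auto intro!: open_Int open_INT)
    have "v f = v (\<lambda>q. f m + (\<Sum>i\<in>UNIV. X i q * G i q))"
    proof (rule tan_local[OF v f _ N])
      fix q assume q: "q \<in> ?N"
      have "f q = ?F (snd c q)" using q by (simp add: cpar_chart[OF c])
      also have "\<dots> = ?F y0 + (\<Sum>i\<in>UNIV. (snd c q - y0) $ i * g i (snd c q))" by (rule Fx) (use q in auto)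
      finally show "f q = f m + (\<Sum>i\<in>UNIV. X i q * G i q)"
        using q by (simp add: X(5) G(5) y0_def cpar_proj m_def)
    qed (intro msmooth_add msmooth_const msmooth_sum msmooth_mult X(1) G(1))
    also have "\<dots> = (\<Sum>i\<in>UNIV. X i m * v (G i) + G i m * v (X i))"
      using tan_add[OF v msmooth_const msmooth_sum[where N = UNIV and f = "\<lambda>i q. X i q * G i q", OF msmooth_mult[OF X(1) G(1)]]]
        tan_sum[OF v msmooth_mult[OF X(1) G(1)], where N = UNIV] tan_mult[OF v X(1) G(1)] by (simp add: tan_const[OF v])
    also have "\<dots> = (\<Sum>i\<in>UNIV. w $ i * frechet_derivative ?F (at y0) (axis i 1))"
      using X(5)[OF X(3)] G(5)[OF G(3)] m(2) by (simp add: w_def g_def mult.commute)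
    also have "\<dots> = frechet_derivative ?F (at y0) (\<Sum>i\<in>UNIV. w $ i *\<^sub>R axis i 1)"
    proof -
      have l: "linear (frechet_derivative ?F (at y0))"
        by (rule has_derivative_linear[OF Cinf_has_derivative[OF F]]) (use r(1) in simp)
      show ?thesis by (simp add: linear_sum[OF l] linear_scale[OF l])
    qed
    also have "\<dots> = frechet_derivative ?F (at y) w"
      using basis_expansion[of w] frechet_cpar_proj[OF c f y] proj_id[OF w]
      by (simp add: scalar_mult_eq_scaleR y0_def)
    finally show ?thesis .
  qed
  then show ?thesis using that w by blast
qed

text \<open>The complex-linear extension of a derivation to complex-valued functions.\<close>

definition vc :: "'m tvec \<Rightarrow> ('m \<Rightarrow> complex) \<Rightarrow> complex" where
  "vc v z = Complex (v (\<lambda>q. Re (z q))) (v (\<lambda>q. Im (z q)))"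

lemma vc_repr:
  assumes c: "c \<in> \<A>" and y: "y \<in> cdom J c" and z: "msmooth z"
    and w: "\<And>f. msmooth f \<Longrightarrow> v f = frechet_derivative (\<lambda>y. f (cpar J c y)) (at y) w"
  shows "vc v z = frechet_derivative (\<lambda>y. z (cpar J c y)) (at y) w"
  using z w[of "\<lambda>q. Re (z q)"] w[of "\<lambda>q. Im (z q)"]
    frechet_derivative_bounded_linear_compose[OF bounded_linear_Re msmooth_Cinf[OF z c] y]
    frechet_derivative_bounded_linear_compose[OF bounded_linear_Im msmooth_Cinf[OF z c] y]
  by (simp add: vc_def msmooth_complex complex_eq_iff)

lemma vc_mult:
  assumes v: "v \<in> tangent_space \<A> m" and z: "msmooth z" "msmooth z'"
  shows "vc v (\<lambda>q. z q * z' q) = z m * vc v z' + z' m * vc v z"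
proof -
  have s: "msmooth (\<lambda>q. Re (z q))" "msmooth (\<lambda>q. Im (z q))" "msmooth (\<lambda>q. Re (z' q))" "msmooth (\<lambda>q. Im (z' q))"
    using z by (auto simp: msmooth_complex)
  show ?thesis
    using tan_diff[OF v msmooth_mult[OF s(1,3)] msmooth_mult[OF s(2,4)]]
      tan_add[OF v msmooth_mult[OF s(1,4)] msmooth_mult[OF s(2,3)]]
    by (simp add: vc_def complex_eq_iff tan_mult[OF v] s algebra_simps)
qed

lemma vc_scale:
  assumes v: "v \<in> tangent_space \<A> m" and z: "msmooth z"
  shows "vc v (\<lambda>q. a * z q) = a * vc v z"
  using vc_mult[OF v msmooth_const z, of a] by (simp add: vc_def[of v "\<lambda>q. a"] tan_const[OF v] zero_complex.code[symmetric])

end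

section \<open>Uniqueness of Fourier coefficients\<close>

text \<open>Functions on a period all of whose Fourier coefficients vanish. This class is stable under
  multiplication by real polynomials in $e^{it}$, which are dense by Stone-Weierstrass.\<close>

definition fourier_null :: "(real \<Rightarrow> complex) \<Rightarrow> bool" where
  "fourier_null u \<longleftrightarrow> continuous_on {0..2*pi} u \<and>
     (\<forall>b\<in>\<int>. integral {0..2*pi} (\<lambda>t. cis (- (t * b)) * u t) = 0)"

lemma fourier_null_add:
  assumes "fourier_null u" "fourier_null w" shows "fourier_null (\<lambda>t. u t + w t)"
proof -
  have i: "(\<lambda>t. cis (- (t * b)) * x t) integrable_on {0..2*pi}" if "fourier_null x" for x b
    using that unfolding fourier_null_def
    by (intro integrable_continuous_interval continuous_intros) auto
  have "continuous_on {0..2*pi} (\<lambda>t. u t + w t)"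
    using assms by (intro continuous_on_add) (simp_all add: fourier_null_def)
  moreover have "integral {0..2*pi} (\<lambda>t. cis (- (t * b)) * (u t + w t)) = 0" if "b \<in> \<int>" for b
    using integral_add[OF i[OF assms(1), of b] i[OF assms(2), of b]] assms that
    by (simp add: fourier_null_def distrib_left)
  ultimately show ?thesis by (simp add: fourier_null_def)
qed

lemma fourier_null_scale:
  assumes "fourier_null u" shows "fourier_null (\<lambda>t. a * u t)"
proof -
  have "(\<lambda>t. cis (- (t * b)) * (a * u t)) = (\<lambda>t. a * (cis (- (t * b)) * u t))" for b
    by (simp add: fun_eq_iff)
  then have "integral {0..2*pi} (\<lambda>t. cis (- (t * b)) * (a * u t)) = a * integral {0..2*pi} (\<lambda>t. cis (- (t * b)) * u t)" for b
    by (simp only: integral_mult_right)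
  then show ?thesis using assms by (simp add: fourier_null_def continuous_on_mult_left)
qed

lemma fourier_null_cis:
  assumes "fourier_null u" "a \<in> \<int>" shows "fourier_null (\<lambda>t. cis (t * a) * u t)"
proof -
  have "integral {0..2*pi} (\<lambda>t. cis (- (t * b)) * (cis (t * a) * u t)) = 0" if "b \<in> \<int>" for b
  proof -
    have "(\<lambda>t. cis (- (t * b)) * (cis (t * a) * u t)) = (\<lambda>t. cis (- (t * (b - a))) * u t)"
      by (simp add: fun_eq_iff mult.assoc[symmetric] cis_mult right_diff_distrib)
    moreover have "b - a \<in> \<int>" using assms(2) that by simp
    ultimately show ?thesis using assms(1) by (simp only: fourier_null_def)
  qed
  moreover have "continuous_on {0..2*pi} (\<lambda>t. cis (t * a) * u t)"
    using assms(1) unfolding fourier_null_def by (intro continuous_intros) simp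
  ultimately show ?thesis by (simp add: fourier_null_def)
qed

text \<open>A linear function of $e^{it}$ is a combination of $e^{it}$ and $e^{-it}$, which only shift the
  Fourier coefficients; sums and products follow by induction.\<close>

lemma fourier_null_polynomial:
  assumes "real_polynomial_function p" "fourier_null u"
  shows "fourier_null (\<lambda>t. of_real (p (cis t)) * u t)"
  using assms
proof (induction arbitrary: u)
  case (linear f)
  have f: "complex_of_real (f (cis t)) = of_real (f 1) * (cis (t * 1) + cis (t * (-1))) / 2
      + of_real (f \<i>) * (cis (t * 1) - cis (t * (-1))) / (2 * \<i>)" for t
  proof -
    have "cis t = cos t *\<^sub>R 1 + sin t *\<^sub>R \<i>" by (simp add: complex_eq_iff)
    then have "f (cis t) = cos t * f 1 + sin t * f \<i>"
      using linear.hyps by (simp only: linear_simps real_scaleR_def)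
    moreover have "cis t + cis (- t) = 2 * of_real (cos t)" "cis t - cis (- t) = 2 * \<i> * of_real (sin t)"
      by (simp_all add: complex_eq_iff)
    ultimately show ?thesis by (simp add: complex_eq_iff)
  qed
  have "fourier_null (\<lambda>t. (of_real (f 1) / 2 + of_real (f \<i>) / (2 * \<i>)) * (cis (t * 1) * u t) +
      (of_real (f 1) / 2 - of_real (f \<i>) / (2 * \<i>)) * (cis (t * (-1)) * u t))"
    by (intro fourier_null_add fourier_null_scale fourier_null_cis linear) auto
  moreover have "(of_real (f 1) / 2 + of_real (f \<i>) / (2 * \<i>)) * (cis (t * 1) * u t) +
      (of_real (f 1) / 2 - of_real (f \<i>) / (2 * \<i>)) * (cis (t * (-1)) * u t) = of_real (f (cis t)) * u t" for t
    unfolding f by (simp add: field_simps)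
  ultimately show ?case by simp
next
  case (const c)
  then show ?case by (rule fourier_null_scale)
next
  case (add f g)
  have "fourier_null (\<lambda>t. of_real (f (cis t)) * u t + of_real (g (cis t)) * u t)"
    by (rule fourier_null_add[OF add.IH[OF add.prems]])
  then show ?case by (simp add: distrib_right)
next
  case (mult f g)
  from mult.IH(1)[OF mult.IH(2)[OF mult.prems]] show ?case by (simp add: mult.assoc)
qed

text \<open>Such a function \<open>u\<close>, seen as a continuous function on the circle, is orthogonal to all polynomials
  on the circle. As its conjugate is a uniform limit of polynomials, \<open>u\<close> is orthogonal to itself.\<close>

lemma fourier_null_imp_0:
  assumes u: "fourier_null u" and per: "u (2*pi) = u 0" and t: "t \<in> {0..2*pi}"
  shows "u t = 0"
proof -
  have cu: "continuous_on {0..2*pi} u" using u by (simp add: fourier_null_def)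
  define U where "U w = u (SOME t. t \<in> {0..2*pi} \<and> cis t = w)" for w
  have U: "U (cis t) = u t" if "t \<in> {0..2*pi}" for t
  proof -
    define s where "s = (SOME s. s \<in> {0..2*pi} \<and> cis s = cis t)"
    have s: "s \<in> {0..2*pi} \<and> cis s = cis t" unfolding s_def by (rule someI[of _ t]) (use that in auto)
    then have "sin s = sin t \<and> cos s = cos t" by (simp add: complex_eq_iff)
    then obtain n :: int where n: "s = t + 2 * pi * n"
      unfolding sin_cos_eq_iff by blast
    have "\<bar>2 * pi * n\<bar> \<le> 2 * pi" using s that n unfolding atLeastAtMost_iff by linarith
    then have "\<bar>of_int n :: real\<bar> \<le> 1" by (simp add: abs_mult)
    then have "n = 0 \<or> n = 1 \<or> n = -1" by linarith
    moreover have "s = 2 * pi \<and> t = 0" if "n = 1" using s \<open>t \<in> _\<close> n that by simp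
    moreover have "s = 0 \<and> t = 2 * pi" if "n = -1" using s \<open>t \<in> _\<close> n that by simp
    ultimately have "s = t \<or> (s = 2 * pi \<and> t = 0) \<or> (s = 0 \<and> t = 2 * pi)"
      using n by auto
    then show ?thesis unfolding U_def s_def[symmetric] using per by auto
  qed
  \<comment> \<open>The circle is the continuous image of a compact interval, so \<open>U\<close> is continuous as \<open>u\<close> is.\<close>
  have sph: "sphere 0 1 = cis ` {0..2*pi}"
  proof -
    have "w \<in> cis ` {0..2*pi}" if "norm w = 1" for w
      using that Arg2pi[of w] by (intro image_eqI[of _ _ "Arg2pi w"]) (auto simp: cis_conv_exp less_imp_le is_Arg_def)
    then show ?thesis by auto
  qed
  have cU: "continuous_on (sphere 0 1) U"
    unfolding continuous_on_closed_vimage[OF closed_sphere]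
  proof (intro allI impI)
    fix C :: "complex set" assume C: "closed C"
    have "U -` C \<inter> sphere 0 1 = cis ` ({0..2*pi} \<inter> u -` C)"
      unfolding sph using U by auto
    moreover have "closed ({0..2*pi} \<inter> u -` C)"
      by (rule continuous_closed_preimage[OF cu _ C]) simp
    then have "compact ({0..2*pi} \<inter> u -` C)"
      using bounded_subset[OF bounded_closed_interval, of "{0..2*pi} \<inter> u -` C" 0 "2*pi"] by (simp add: compact_eq_bounded_closed)
    then have "compact (cis ` ({0..2*pi} \<inter> u -` C))"
      by (rule compact_continuous_image[rotated]) (intro continuous_intros)
    ultimately show "closed (U -` C \<inter> sphere 0 1)" by (simp add: compact_imp_closed)
  qed
  have iu: "(\<lambda>t. x t * u t) integrable_on {0..2*pi}" if "continuous_on {0..2*pi} x" for x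
    by (intro integrable_continuous_interval continuous_intros cu that)
  let ?N = "integral {0..2*pi} (\<lambda>t. cnj (u t) * u t)"
  let ?M = "integral {0..2*pi} (\<lambda>t. norm (u t))"
  have est: "norm ?N \<le> e * ?M" if e: "e > 0" for e
  proof -
    have "continuous_on (sphere 0 1) (\<lambda>w. cnj (U w))" by (intro continuous_intros cU)
    from Stone_Weierstrass_polynomial_function[OF compact_sphere this e]
    obtain g where g: "polynomial_function g" "\<And>w. w \<in> sphere 0 1 \<Longrightarrow> norm (cnj (U w) - g w) < e"
      by auto
    have p: "real_polynomial_function (\<lambda>w. Re (g w))" "real_polynomial_function (\<lambda>w. Im (g w))"
      using g(1) bounded_linear_Re bounded_linear_Im by (simp_all add: polynomial_function_def o_def)
    have "fourier_null (\<lambda>t. of_real (Re (g (cis t))) * u t + \<i> * (of_real (Im (g (cis t))) * u t))"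
      by (rule fourier_null_add[OF fourier_null_polynomial[OF p(1) u]
            fourier_null_scale[OF fourier_null_polynomial[OF p(2) u]]])
    moreover have "of_real (Re (g (cis t))) * u t + \<i> * (of_real (Im (g (cis t))) * u t) = g (cis t) * u t" for t
      by (simp add: algebra_simps complex_eq_iff)
    ultimately have "fourier_null (\<lambda>t. g (cis t) * u t)" by simp
    then have "\<forall>b\<in>\<int>. integral {0..2*pi} (\<lambda>t. cis (- (t * b)) * (g (cis t) * u t)) = 0"
      by (simp add: fourier_null_def)
    from bspec[OF this Ints_0] have z: "integral {0..2*pi} (\<lambda>t. g (cis t) * u t) = 0" by simp
    have cg: "continuous_on {0..2*pi} (\<lambda>t. g (cis t))"
      by (rule continuous_on_compose2[OF continuous_on_polymonial_function[OF g(1), of UNIV] continuous_on_cis[OF continuous_on_id]]) simp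
    have ccu: "continuous_on {0..2*pi} (\<lambda>t. cnj (u t))" by (intro continuous_intros cu)
    have "?N = integral {0..2*pi} (\<lambda>t. (cnj (u t) - g (cis t)) * u t)"
      using integral_diff[OF iu[OF ccu] iu[OF cg]] z by (simp add: left_diff_distrib)
    also have "norm \<dots> \<le> integral {0..2*pi} (\<lambda>t. e * norm (u t))"
    proof (rule integral_norm_bound_integral)
      show "(\<lambda>t. (cnj (u t) - g (cis t)) * u t) integrable_on {0..2*pi}"
        by (intro iu continuous_intros ccu cg)
      show "(\<lambda>t. e * norm (u t)) integrable_on {0..2*pi}"
        by (intro integrable_continuous_interval continuous_intros cu)
      fix t assume t: "t \<in> {0..2*pi}"
      then have "norm (cnj (u t) - g (cis t)) < e" using g(2)[of "cis t"] U[OF t] by simp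
      then show "norm ((cnj (u t) - g (cis t)) * u t) \<le> e * norm (u t)"
        by (simp add: norm_mult mult_right_mono)
    qed
    finally show ?thesis by simp
  qed
  have M: "?M \<ge> 0" 
    by (rule integral_nonneg) (intro integrable_continuous_interval continuous_intros cu, simp)
  have N0: "norm ?N = 0"
  proof (rule ccontr)
    assume "norm ?N \<noteq> 0"
    then have pos: "norm ?N > 0" by simp
    have "norm ?N \<le> norm ?N / (2 * (?M + 1)) * ?M"
      by (rule est) (use pos M in simp)
    also have "\<dots> \<le> norm ?N / 2"
      using pos M by (simp add: divide_simps mult_left_mono)
    finally show False using pos by simp
  qed
  have "(\<lambda>t. cnj (u t) * u t) = (\<lambda>t. of_real ((norm (u t))\<^sup>2))"
    by (rule ext) (simp only: complex_norm_square mult.commute)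
  moreover have "(\<lambda>t. (norm (u t))\<^sup>2) integrable_on {0..2*pi}"
    by (intro integrable_continuous_interval continuous_intros cu)
  ultimately have "?N = of_real (integral {0..2*pi} (\<lambda>t. (norm (u t))\<^sup>2))"
    using integral_linear[OF _ bounded_linear_of_real, of "\<lambda>t. (norm (u t))\<^sup>2" "{0..2*pi}"] by (simp add: o_def)
  then have "integral {0..2*pi} (\<lambda>t. (norm (u t))\<^sup>2) = 0" using N0 by simp
  moreover have "continuous_on {0..2*pi} (\<lambda>t. (norm (u t))\<^sup>2)" by (intro continuous_intros cu)
  ultimately have "(norm (u t))\<^sup>2 = 0"
    using integral_eq_0_iff[of 0 "2*pi" "\<lambda>t. (norm (u t))\<^sup>2"] t by simp
  then show ?thesis by simp
qed

text \<open>The derivative of the left-hand side in \<open>s\<close> is the integral of a derivative over a full period, hence zero.\<close>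

lemma integral_periodic_shift:
  fixes h :: "real \<Rightarrow> complex"
  assumes h: "Cinf UNIV h" and per: "\<And>t. h (t + 2*pi) = h t"
  shows "integral {0..2*pi} (\<lambda>t. h (t + s)) = integral {0..2*pi} h"
proof -
  have C: "Cinf UNIV (\<lambda>(t, s). h (t + s))"
    using Cinf_compose[OF h Cinf_add[OF open_UNIV Cinf_bounded_linear[OF bounded_linear_fst] Cinf_bounded_linear[OF bounded_linear_snd]]]
    by (simp add: case_prod_unfold)
  have D: "(h has_derivative frechet_derivative h (at x)) (at x)" for x by (rule Cinf_has_derivative[OF h]) simp
  have F: "frechet_derivative (\<lambda>(t, s). h (t + s)) (at (t, s)) (0, v) = v *\<^sub>R frechet_derivative h (at (t + s)) 1" for t s v
  proof -
    have 1: "((\<lambda>p. fst p + snd p) has_derivative (\<lambda>p. fst p + snd p)) (at (t, s))"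
      by (rule bounded_linear_imp_has_derivative[OF bounded_linear_add[OF bounded_linear_fst bounded_linear_snd]])
    have "((\<lambda>p. h (fst p + snd p)) has_derivative (\<lambda>p. frechet_derivative h (at (t + s)) (fst p + snd p))) (at (t, s))"
      using diff_chain_at[OF 1, of h "frechet_derivative h (at (t + s))"] D[of "t + s"] by (simp add: o_def)
    from frechet_derivative_eq[OF this, of "(0, v)"] show ?thesis
      using linear_scale[OF has_derivative_linear[OF D], of "t + s" v 1] by (simp add: case_prod_unfold)
  qed
  have K: "((\<lambda>s. integral {0..2*pi} (\<lambda>t. h (t + s))) has_derivative (\<lambda>v. 0)) (at s)" for s
  proof -
    have 1: "((\<lambda>t. h (t + s)) has_vector_derivative frechet_derivative h (at (t + s)) 1) (at t within {0..2*pi})" for t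
    proof -
      have 2: "((\<lambda>t. t + s) has_derivative (\<lambda>v. v)) (at t)"
        using has_derivative_add[OF has_derivative_ident has_derivative_const] by simp
      have "((\<lambda>t. h (t + s)) has_derivative (\<lambda>v. frechet_derivative h (at (t + s)) v)) (at t)"
        using diff_chain_at[OF 2 D] by (simp add: o_def)
      moreover have "frechet_derivative h (at (t + s)) v = v *\<^sub>R frechet_derivative h (at (t + s)) 1" for v
        using linear_scale[OF has_derivative_linear[OF D], of "t + s" v 1] by simp
      ultimately show ?thesis
        unfolding has_vector_derivative_def by (metis (no_types, lifting) ext has_derivative_at_withinI)
    qed
    have "((\<lambda>t. frechet_derivative h (at (t + s)) 1) has_integral h (2*pi + s) - h (0 + s)) {0..2*pi}"
      by (rule fundamental_theorem_of_calculus[OF _ 1]) simp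
    then have 0: "integral {0..2*pi} (\<lambda>t. frechet_derivative h (at (t + s)) 1) = 0"
      using per[of s] by (simp add: integral_unique add.commute)
    show ?thesis
      using has_derivative_parametric_integral[OF open_UNIV C, of 0 "2*pi" UNIV s] 0 by (simp add: F)
  qed
  have "\<exists>k. \<forall>s\<in>UNIV. integral {0..2*pi} (\<lambda>t. h (t + s)) = k"
    by (rule has_derivative_zero_constant[OF convex_UNIV]) (rule K)
  then obtain k where "\<And>s. integral {0..2*pi} (\<lambda>t. h (t + s)) = k" by auto
  from this[of s] this[of 0] show ?thesis by simp
qed

section \<open>Smooth torus actions\<close>

lemma torus_exp_in: "\<xi> \<in> coord_space I \<Longrightarrow> torus_exp \<xi> \<in> carrier (torus I)"
  by (auto simp: torus_def torus_exp_def coord_space_def)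

lemma torus_exp_add: "torus_exp (\<xi> + \<eta>) = torus_exp \<xi> * torus_exp \<eta>"
  by (simp add: torus_exp_def vec_eq_iff cis_mult)

lemma torus_exp_0: "torus_exp 0 = 1"
  by (simp add: torus_exp_def vec_eq_iff)

text \<open>The entries outside \<open>I\<close> are 1, so their arguments may be taken to be 0.\<close>

lemma torus_exp_surj:
  assumes "g \<in> carrier (torus I)"
  obtains \<xi> where "\<xi> \<in> coord_space I" "g = torus_exp \<xi>"
proof
  show "(\<chi> i. if i \<in> I then Arg (g $ i) else 0) \<in> coord_space I"
    by (simp add: coord_space_def)
  have "g $ i = cis (Arg (g $ i))" for i
  proof -
    have "norm (g $ i) = 1" using assms by (simp add: torus_def)
    then have "sgn (g $ i) = g $ i" "g $ i \<noteq> 0" by (auto simp: sgn_div_norm)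
    then show ?thesis using cis_Arg[of "g $ i"] by simp
  qed
  then show "g = torus_exp (\<chi> i. if i \<in> I then Arg (g $ i) else 0)"
    using assms by (auto simp: torus_exp_def vec_eq_iff torus_def)
qed

lemma Cinf_torus_exp: "Cinf UNIV (\<lambda>t. torus_exp (t *\<^sub>R \<xi>))"
proof (rule Cinf_componentwise[OF open_UNIV])
  fix b :: "complex^'a" assume "b \<in> Basis"
  have "Cinf UNIV (\<lambda>t. cis (t * \<xi> $ i))" for i
    by (rule Cinf_compose[OF Cinf_cis Cinf_bounded_linear[OF bounded_linear_mult_left] open_UNIV]) simp
  then have "Cinf UNIV (\<lambda>t. cis (t * \<xi> $ i) \<bullet> u)" for i u
    by (rule Cinf_bounded_linear_compose[OF bounded_linear_inner_left open_UNIV])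
  with \<open>b \<in> Basis\<close> show "Cinf UNIV (\<lambda>t. torus_exp (t *\<^sub>R \<xi>) \<bullet> b)"
    by (auto simp: Basis_vec_def inner_axis torus_exp_def)
qed

locale torus_manifold = manifold J \<A>
  for J :: "'n::finite set" and \<A> :: "('m::{t2_space, second_countable_topology}, 'n) chart set" +
  fixes I :: "'k::finite set" and act :: "complex^'k \<Rightarrow> 'm \<Rightarrow> 'm"
  assumes action: "smooth_torus_action I \<A> act"
begin

definition exp_act :: "real^'k \<Rightarrow> 'm \<Rightarrow> 'm" where "exp_act \<xi> = act (torus_exp \<xi>)"

lemma act_mult: "g \<in> carrier (torus I) \<Longrightarrow> h \<in> carrier (torus I) \<Longrightarrow> act (g * h) m = act g (act h m)"
  using group_action.composition_rule[of "torus I" UNIV act m g h] action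
  by (simp add: smooth_torus_action_def torus_def)

lemma act_1: "act 1 m = m"
proof -
  have "group_action (torus I) UNIV act" using action by (simp add: smooth_torus_action_def)
  from fun_cong[OF group_action.id_eq_one[OF this], of m] show ?thesis by (simp add: torus_def)
qed

lemma exp_act_add: "\<xi> \<in> coord_space I \<Longrightarrow> \<eta> \<in> coord_space I \<Longrightarrow> exp_act (\<xi> + \<eta>) m = exp_act \<xi> (exp_act \<eta> m)"
  by (simp add: exp_act_def torus_exp_add act_mult torus_exp_in)

lemma exp_act_0: "exp_act 0 m = m" by (simp add: exp_act_def torus_exp_0 act_1)

lemma scale_coord: "\<xi> \<in> coord_space I \<Longrightarrow> t *\<^sub>R \<xi> \<in> coord_space I"
  by (simp add: coord_space_def)

lemma add_coord: "\<xi> \<in> coord_space I \<Longrightarrow> \<eta> \<in> coord_space I \<Longrightarrow> \<xi> + \<eta> \<in> coord_space I"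
  by (simp add: coord_space_def)

lemma action_chart:
  assumes f: "f \<in> C_infinity \<A>" and c: "c \<in> \<A>"
  shows "smooth_on (carrier (torus I) \<times> snd c ` fst c) (\<lambda>(g, x). f (act g (inv_into (fst c) (snd c) x)))"
proof -
  have "\<forall>(U, \<phi>)\<in>\<A>. smooth_on (carrier (torus I) \<times> \<phi> ` U) (\<lambda>(g, x). f (act g (inv_into U \<phi> x)))"
    using action f unfolding smooth_torus_action_def by blast
  from bspec[OF this c] show ?thesis by (simp add: case_prod_unfold)
qed

text \<open>Smoothness of the action is given by local extensions from the embedded torus; composing with a
  smooth map into the torus yields a function on an open set.\<close>

lemma Cinf_path_action_real:
  fixes \<gamma> :: "'b::euclidean_space \<Rightarrow> complex^'k" and f :: "'m \<Rightarrow> real"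
  assumes f: "msmooth f" and c: "c \<in> \<A>" and \<gamma>: "Cinf UNIV \<gamma>" "\<And>t. \<gamma> t \<in> carrier (torus I)"
  shows "Cinf (UNIV \<times> cdom J c) (\<lambda>(t, y). f (act (\<gamma> t) (cpar J c y)))"
proof (rule Cinf_local)
  have o: "open (UNIV \<times> cdom J c :: ('b \<times> _) set)" using open_cdom[OF c] by (simp add: open_Times)
  fix p :: "'b \<times> (real^'n)" assume p: "p \<in> UNIV \<times> cdom J c"
  let ?S = "carrier (torus I) \<times> snd c ` fst c" and ?g = "\<lambda>p. (\<gamma> (fst p), proj J (snd p))"
  have "?g p \<in> ?S" using p \<gamma>(2) by (auto simp: cdom_def)
  then obtain T F where T: "open T" "?g p \<in> T" "Cinf T F"
    and F: "\<And>y. y \<in> ?S \<inter> T \<Longrightarrow> F y = (\<lambda>(g, x). f (act g (inv_into (fst c) (snd c) x))) y"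
    using action_chart[OF f[folded C_infinity_iff] c] unfolding smooth_on_Cinf by meson
  have g: "Cinf UNIV ?g"
  proof (rule Cinf_Pair[OF open_UNIV])
    show "Cinf UNIV (\<lambda>p. \<gamma> (fst p))"
      by (rule Cinf_compose[OF \<gamma>(1) Cinf_bounded_linear[OF bounded_linear_fst] open_UNIV]) simp
    show "Cinf UNIV (\<lambda>p. proj J (snd p))"
      by (rule Cinf_compose[OF Cinf_proj Cinf_bounded_linear[OF bounded_linear_snd] open_UNIV subset_UNIV])
  qed
  let ?U = "?g -` T"
  have U: "open ?U"
    using continuous_open_preimage[OF Cinf_continuous[OF g] open_UNIV T(1)] by simp
  have o': "open ((UNIV \<times> cdom J c) \<inter> ?U)" using o U by blast
  have "Cinf ((UNIV \<times> cdom J c) \<inter> ?U) (\<lambda>p. F (?g p))"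
    by (rule Cinf_compose[OF T(3) Cinf_subset[OF g] o']) auto
  then have "Cinf ((UNIV \<times> cdom J c) \<inter> ?U) (\<lambda>(t, y). f (act (\<gamma> t) (cpar J c y)))"
  proof (rule Cinf_cong[OF _ o'])
    fix q assume q: "q \<in> (UNIV \<times> cdom J c) \<inter> ?U"
    then have "?g q \<in> ?S \<inter> T" using \<gamma>(2) by (auto simp: cdom_def)
    from F[OF this] show "F (?g q) = (case q of (t, y) \<Rightarrow> f (act (\<gamma> t) (cpar J c y)))"
      by (simp add: case_prod_unfold cpar_def)
  qed
  then show "\<exists>U. open U \<and> p \<in> U \<and> Cinf ((UNIV \<times> cdom J c) \<inter> U) (\<lambda>(t, y). f (act (\<gamma> t) (cpar J c y)))"
    using U T(2) by (intro exI[of _ ?U]) auto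
qed

lemma Cinf_path_action:
  fixes \<gamma> :: "'b::euclidean_space \<Rightarrow> complex^'k" and f :: "'m \<Rightarrow> 'd::euclidean_space"
  assumes f: "msmooth f" and c: "c \<in> \<A>" and \<gamma>: "Cinf UNIV \<gamma>" "\<And>t. \<gamma> t \<in> carrier (torus I)"
  shows "Cinf (UNIV \<times> cdom J c) (\<lambda>(t, y). f (act (\<gamma> t) (cpar J c y)))"
proof (rule Cinf_componentwise)
  show "open (UNIV \<times> cdom J c :: ('b \<times> _) set)" using open_cdom[OF c] by (simp add: open_Times)
  fix b :: 'd
  from Cinf_path_action_real[OF msmooth_linear[OF bounded_linear_inner_left f] c \<gamma>, of b]
  show "Cinf (UNIV \<times> cdom J c) (\<lambda>p. (case p of (t, y) \<Rightarrow> f (act (\<gamma> t) (cpar J c y))) \<bullet> b)"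
    by (simp add: case_prod_unfold)
qed

lemma Cinf_flow:
  fixes f :: "'m \<Rightarrow> 'd::euclidean_space"
  assumes "msmooth f" "c \<in> \<A>" "\<xi> \<in> coord_space I"
  shows "Cinf (UNIV \<times> cdom J c) (\<lambda>(t::real, y). f (exp_act (t *\<^sub>R \<xi>) (cpar J c y)))"
  unfolding exp_act_def
  by (rule Cinf_path_action[OF assms(1,2) Cinf_torus_exp torus_exp_in[OF scale_coord[OF assms(3)]]])

lemma msmooth_act:
  fixes f :: "'m \<Rightarrow> 'd::euclidean_space"
  assumes f: "msmooth f" and g: "g \<in> carrier (torus I)"
  shows "msmooth (\<lambda>m. f (act g m))"
  unfolding msmooth_def
proof
  fix m
  obtain c where c: "c \<in> \<A>" "m \<in> fst c" by (rule chart_ex)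
  have "Cinf (UNIV \<times> cdom J c) (\<lambda>(t::real, y). f (act g (cpar J c y)))"
    by (rule Cinf_path_action[OF f c(1) Cinf_const g])
  from Cinf_compose[OF this Cinf_Pair[OF open_cdom[OF c(1)] Cinf_const[of _ 0] Cinf_bounded_linear[OF bounded_linear_ident]] open_cdom[OF c(1)]]
  have "Cinf (cdom J c) (\<lambda>y. f (act g (cpar J c y)))" by auto
  then show "smooth_at (\<lambda>m. f (act g m)) m"
    by (rule smooth_atI[OF c open_cdom[OF c(1)] chart_in_cdom[OF c] order_refl])
qed

lemma msmooth_exp_act:
  fixes f :: "'m \<Rightarrow> 'd::euclidean_space"
  shows "msmooth f \<Longrightarrow> \<xi> \<in> coord_space I \<Longrightarrow> msmooth (\<lambda>m. f (exp_act \<xi> m))"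
  unfolding exp_act_def by (rule msmooth_act[OF _ torus_exp_in])

lemma Cinf_orbit:
  fixes f :: "'m \<Rightarrow> 'd::euclidean_space"
  assumes f: "msmooth f" and \<xi>: "\<xi> \<in> coord_space I"
  shows "Cinf UNIV (\<lambda>t. f (exp_act (t *\<^sub>R \<xi>) m))"
proof -
  obtain c where c: "c \<in> \<A>" "m \<in> fst c" by (rule chart_ex)
  have "Cinf UNIV (\<lambda>t. (\<lambda>(t::real, y). f (exp_act (t *\<^sub>R \<xi>) (cpar J c y))) (t, snd c m))"
    by (rule Cinf_compose[OF Cinf_flow[OF f c(1) \<xi>] Cinf_Pair[OF open_UNIV Cinf_bounded_linear[OF bounded_linear_ident] Cinf_const] open_UNIV])
       (use chart_in_cdom[OF c] in auto)
  then show ?thesis by (simp add: cpar_chart[OF c])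
qed

section \<open>Generating vector fields\<close>

abbreviation gf :: "real^'k \<Rightarrow> 'm \<Rightarrow> 'm tvec" where "gf \<equiv> generating_field \<A> act"

lemma gf_has_derivative:
  assumes f: "msmooth f" and \<xi>: "\<xi> \<in> coord_space I"
  shows "((\<lambda>t. f (exp_act (t *\<^sub>R \<xi>) m)) has_real_derivative gf \<xi> m f) (at 0)"
proof -
  have "(\<lambda>t. f (exp_act (t *\<^sub>R \<xi>) m)) differentiable (at 0)"
    using Cinf_has_derivative[OF Cinf_orbit[OF f \<xi>] UNIV_I] by (auto simp: differentiable_def)
  then have "(\<lambda>t. f (exp_act (t *\<^sub>R \<xi>) m)) field_differentiable (at 0)"
    by (rule real_differentiableE) (auto simp: field_differentiable_def)
  then have "((\<lambda>t. f (exp_act (t *\<^sub>R \<xi>) m)) has_real_derivative deriv (\<lambda>t. f (exp_act (t *\<^sub>R \<xi>) m)) 0) (at 0)"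
    by (simp add: DERIV_deriv_iff_field_differentiable)
  then show ?thesis using f by (simp add: generating_field_def C_infinity_iff exp_act_def)
qed

lemma gf_tangent:
  assumes \<xi>: "\<xi> \<in> coord_space I"
  shows "gf \<xi> m \<in> tangent_space \<A> m"
proof -
  have d: "(\<lambda>t. f (exp_act (t *\<^sub>R \<xi>) m)) differentiable (at 0)" if "msmooth f" for f :: "'m \<Rightarrow> real"
    using Cinf_has_derivative[OF Cinf_orbit[OF that \<xi>] UNIV_I] by (auto simp: differentiable_def)
  have "gf \<xi> m f = frechet_derivative (\<lambda>t. f (exp_act (t *\<^sub>R \<xi>) m)) (at 0) 1" if "msmooth f" for f
    using frechet_derivative_eq[OF gf_has_derivative[OF that \<xi>, unfolded has_field_derivative_def], where v = 1] by simp
  then have "gf \<xi> m = (\<lambda>f. if f \<in> C_infinity \<A> then frechet_derivative (\<lambda>t. f (exp_act (t *\<^sub>R \<xi>) m)) (at 0) 1 else 0)"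
    by (auto simp: fun_eq_iff C_infinity_iff generating_field_def)
  then show ?thesis
    using tangent_of_map[of "\<lambda>t. exp_act (t *\<^sub>R \<xi>) m" 0 1, OF d] by (simp add: exp_act_0)
qed

text \<open>In a chart this is the partial derivative at time 0 of a jointly smooth function.\<close>

lemma msmooth_gf:
  assumes f: "msmooth f" and \<xi>: "\<xi> \<in> coord_space I"
  shows "msmooth (\<lambda>m. gf \<xi> m f)"
  unfolding msmooth_def
proof
  fix m
  obtain c where c: "c \<in> \<A>" "m \<in> fst c" by (rule chart_ex)
  let ?F = "\<lambda>(t::real, y). f (exp_act (t *\<^sub>R \<xi>) (cpar J c y))"
  note F = Cinf_flow[OF f c(1) \<xi>]
  have e: "frechet_derivative ?F (at (0, y)) (1, 0) = gf \<xi> (cpar J c y) f" if y: "y \<in> cdom J c" for y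
  proof -
    have 1: "((\<lambda>t. (t, y)) has_derivative (\<lambda>t. (t, 0))) (at (0::real))"
      by (auto intro!: derivative_eq_intros)
    have "((\<lambda>t. f (exp_act (t *\<^sub>R \<xi>) (cpar J c y))) has_derivative (\<lambda>t. frechet_derivative ?F (at (0, y)) (t, 0))) (at 0)"
      using diff_chain_at[OF 1 Cinf_has_derivative[OF F]] y by (simp add: o_def)
    from frechet_derivative_eq[OF this, where v = 1] frechet_derivative_eq[OF gf_has_derivative[OF f \<xi>, unfolded has_field_derivative_def], where v = 1]
    show ?thesis by simp
  qed
  have "Cinf (cdom J c) (\<lambda>y. frechet_derivative ?F (at (0, y)) (1, 0))"
    by (rule Cinf_compose[OF Cinf_frechet_derivative[OF F] Cinf_Pair[OF open_cdom[OF c(1)] Cinf_const Cinf_bounded_linear[OF bounded_linear_ident]] open_cdom[OF c(1)]])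
       auto
  then have "Cinf (cdom J c) (\<lambda>y. gf \<xi> (cpar J c y) f)"
    by (rule Cinf_cong[OF _ open_cdom[OF c(1)] e])
  then show "smooth_at (\<lambda>m. gf \<xi> m f) m"
    by (rule smooth_atI[OF c open_cdom[OF c(1)] chart_in_cdom[OF c] order_refl])
qed

section \<open>Equivariant functions\<close>

text \<open>The functions on which the circles with index in \<open>K\<close> act by the weight \<beta>. The set \<open>K\<close> is kept
  variable so that the circles can be treated one after another.\<close>

definition eqv :: "'k set \<Rightarrow> real^'k \<Rightarrow> ('m \<Rightarrow> complex) \<Rightarrow> bool" where
  "eqv K \<beta> z \<longleftrightarrow> msmooth z \<and> (\<forall>i\<in>K. \<beta> $ i \<in> \<int> \<and>
     (\<forall>t m. z (exp_act (t *\<^sub>R axis i 1) m) = cis (t * \<beta> $ i) * z m))"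

lemma axis_coord: "i \<in> I \<Longrightarrow> axis i x \<in> coord_space I"
  by (simp add: coord_space_def axis_def)

text \<open>A torus element is a product of elements of the circle factors.\<close>

lemma eqv_exp_act:
  assumes z: "eqv I \<beta> z" and \<xi>: "\<xi> \<in> coord_space I"
  shows "z (exp_act \<xi> m) = cis (\<beta> \<bullet> \<xi>) * z m"
proof -
  have K: "(\<Sum>i\<in>K. (\<xi> $ i) *\<^sub>R axis i 1) \<in> coord_space I \<and>
      z (exp_act (\<Sum>i\<in>K. (\<xi> $ i) *\<^sub>R axis i 1) m) = cis (\<Sum>i\<in>K. \<beta> $ i * \<xi> $ i) * z m" if "finite K" "K \<subseteq> I" for K
    using that
  proof (induction K rule: finite_induct)
    case empty
    then show ?case by (simp add: exp_act_0 coord_space_def)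
  next
    case (insert i K)
    have i: "(\<xi> $ i) *\<^sub>R axis i 1 \<in> coord_space I" using insert.prems by (intro scale_coord axis_coord) auto
    show ?case
      using insert i z unfolding eqv_def
      by (simp add: exp_act_add add_coord mult.assoc[symmetric] cis_mult mult.commute[of "\<xi> $ i"])
  qed
  have "\<xi> = (\<Sum>i\<in>UNIV. (\<xi> $ i) *\<^sub>R axis i 1)"
    using basis_expansion[of \<xi>] by (simp add: scalar_mult_eq_scaleR)
  also have "\<dots> = (\<Sum>i\<in>I. (\<xi> $ i) *\<^sub>R axis i 1)"
    by (rule sum.mono_neutral_right) (use \<xi> in \<open>auto simp: coord_space_def\<close>)
  finally have 1: "\<xi> = (\<Sum>i\<in>I. (\<xi> $ i) *\<^sub>R axis i 1)" .
  have 2: "\<beta> \<bullet> \<xi> = (\<Sum>i\<in>I. \<beta> $ i * \<xi> $ i)"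
    unfolding inner_vec_def inner_real_def
    by (rule sum.mono_neutral_right) (use \<xi> in \<open>auto simp: coord_space_def\<close>)
  show ?thesis using K[of I] 2 1[symmetric] by simp
qed

lemma vc_gf:
  assumes z: "eqv I \<beta> z" and \<xi>: "\<xi> \<in> coord_space I"
  shows "vc (gf \<xi> m) z = \<i> * of_real (\<beta> \<bullet> \<xi>) * z m"
proof -
  have s: "msmooth (\<lambda>m. Re (z m))" "msmooth (\<lambda>m. Im (z m))" using z by (auto simp: eqv_def msmooth_complex)
  have e: "z (exp_act (t *\<^sub>R \<xi>) m) = cis (t * (\<beta> \<bullet> \<xi>)) * z m" for t
    using eqv_exp_act[OF z scale_coord[OF \<xi>]] by simp
  have "((\<lambda>t. Re (z (exp_act (t *\<^sub>R \<xi>) m))) has_real_derivative Re (\<i> * of_real (\<beta> \<bullet> \<xi>) * z m)) (at 0)"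
    unfolding e by (auto intro!: derivative_eq_intros)
  then have 1: "gf \<xi> m (\<lambda>m. Re (z m)) = Re (\<i> * of_real (\<beta> \<bullet> \<xi>) * z m)"
    using gf_has_derivative[OF s(1) \<xi>] DERIV_unique by blast
  have "((\<lambda>t. Im (z (exp_act (t *\<^sub>R \<xi>) m))) has_real_derivative Im (\<i> * of_real (\<beta> \<bullet> \<xi>) * z m)) (at 0)"
    unfolding e by (auto intro!: derivative_eq_intros)
  then have 2: "gf \<xi> m (\<lambda>m. Im (z m)) = Im (\<i> * of_real (\<beta> \<bullet> \<xi>) * z m)"
    using gf_has_derivative[OF s(2) \<xi>] DERIV_unique by blast
  show ?thesis using 1 2 by (simp add: vc_def complex_eq_iff)
qed

text \<open>The Fourier coefficient of weight \<open>b\<close> under the \<open>i\<close>-th circle.\<close>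

definition avg :: "'k \<Rightarrow> real \<Rightarrow> ('m \<Rightarrow> complex) \<Rightarrow> 'm \<Rightarrow> complex" where
  "avg i b f m = (1 / (2*pi)) *\<^sub>R integral {0..2*pi} (\<lambda>t. cis (- (t * b)) * f (exp_act (t *\<^sub>R axis i 1) m))"

lemma avg_chart:
  assumes f: "msmooth f" and i: "i \<in> I" and c: "c \<in> \<A>"
  shows "Cinf (UNIV \<times> cdom J c) (\<lambda>(t, y). cis (- (t * b)) * f (exp_act (t *\<^sub>R axis i 1) (cpar J c y)))"
proof -
  have o: "open (UNIV \<times> cdom J c :: (real \<times> _) set)" using open_cdom[OF c] by (simp add: open_Times)
  have "bounded_linear (\<lambda>p::real \<times> (real^'n). - (fst p * b))"
    by (intro bounded_linear_minus bounded_linear_mult_const bounded_linear_fst)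
  from Cinf_compose[OF Cinf_cis Cinf_bounded_linear[OF this] o]
  have "Cinf (UNIV \<times> cdom J c) (\<lambda>p::real \<times> (real^'n). cis (- (fst p * b)))" by simp
  from Cinf_mult[OF o this Cinf_flow[OF f c axis_coord[OF i, of 1]]] show ?thesis
    by (simp add: case_prod_unfold)
qed

lemma msmooth_avg:
  assumes f: "msmooth f" and i: "i \<in> I"
  shows "msmooth (avg i b f)"
  unfolding msmooth_def
proof
  fix m
  obtain c where c: "c \<in> \<A>" "m \<in> fst c" by (rule chart_ex)
  have o: "open (UNIV \<times> cdom J c :: (real \<times> _) set)" using open_cdom[OF c(1)] by (simp add: open_Times)
  have "Cinf (cdom J c) (\<lambda>y. integral {0..2*pi} (\<lambda>t. cis (- (t * b)) * f (exp_act (t *\<^sub>R axis i 1) (cpar J c y))))"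
    by (rule Cinf_parametric_integral[OF o avg_chart[OF f i c(1)] _ open_cdom[OF c(1)]]) auto
  from Cinf_bounded_linear_compose[OF bounded_linear_scaleR_right open_cdom[OF c(1)] this]
  have "Cinf (cdom J c) (\<lambda>y. avg i b f (cpar J c y))" by (simp add: avg_def)
  then show "smooth_at (avg i b f) m"
    by (rule smooth_atI[OF c open_cdom[OF c(1)] chart_in_cdom[OF c] order_refl])
qed

text \<open>Differentiating under the integral sign that defines the Fourier coefficient.\<close>

lemma vc_avg:
  assumes f: "msmooth f" and i: "i \<in> I" and v: "v \<in> tangent_space \<A> m"
  shows "vc v (avg i b f) =
    (1 / (2*pi)) *\<^sub>R integral {0..2*pi} (\<lambda>t. cis (- (t * b)) * vc v (\<lambda>q. f (exp_act (t *\<^sub>R axis i 1) q)))"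
    and "Cinf UNIV (\<lambda>t. vc v (\<lambda>q. f (exp_act (t *\<^sub>R axis i 1) q)))"
proof -
  obtain c where c: "c \<in> \<A>" "m \<in> fst c" by (rule chart_ex)
  define y where "y = snd c m"
  have y: "y \<in> cdom J c" "cpar J c y = m" using chart_in_cdom[OF c] cpar_chart[OF c] by (auto simp: y_def)
  obtain w where w: "\<And>f. msmooth f \<Longrightarrow> v f = frechet_derivative (\<lambda>y. f (cpar J c y)) (at y) w"
    using tangent_repr[OF v[folded y(2)] c(1) y(1)] by blast
  note vr = vc_repr[OF c(1) y(1) _ w]
  have o: "open (UNIV \<times> cdom J c :: (real \<times> _) set)" using open_cdom[OF c(1)] by (simp add: open_Times)
  have s: "{0..2*pi} \<times> cdom J c \<subseteq> UNIV \<times> cdom J c" by auto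
  have fe: "msmooth (\<lambda>q. f (exp_act (t *\<^sub>R axis i 1) q))" for t by (rule msmooth_exp_act[OF f scale_coord[OF axis_coord[OF i]]])
  have fd: "frechet_derivative (\<lambda>y. a * f (exp_act (t *\<^sub>R axis i 1) (cpar J c y))) (at y) w =
      a * vc v (\<lambda>q. f (exp_act (t *\<^sub>R axis i 1) q))" for a t
    using frechet_derivative_bounded_linear_compose[OF bounded_linear_mult_right[of a] msmooth_Cinf[OF fe c(1)] y(1), of t w]
    by (simp add: vr[OF fe])
  have "vc v (avg i b f) = frechet_derivative (\<lambda>y. avg i b f (cpar J c y)) (at y) w"
    by (rule vr[OF msmooth_avg[OF f i]])
  also have "\<dots> = (1 / (2*pi)) *\<^sub>R frechet_derivative (\<lambda>y. integral {0..2*pi} (\<lambda>t. cis (- (t * b)) * f (exp_act (t *\<^sub>R axis i 1) (cpar J c y)))) (at y) w"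
    unfolding avg_def
    by (rule frechet_derivative_bounded_linear_compose[OF bounded_linear_scaleR_right
          Cinf_parametric_integral[OF o avg_chart[OF f i c(1)] s open_cdom[OF c(1)]] y(1)])
  also have "\<dots> = (1 / (2*pi)) *\<^sub>R integral {0..2*pi} (\<lambda>t. cis (- (t * b)) * vc v (\<lambda>q. f (exp_act (t *\<^sub>R axis i 1) q)))"
    unfolding frechet_derivative_parametric_integral[OF o avg_chart[OF f i c(1)] s open_cdom[OF c(1)] y(1)] fd ..
  finally show "vc v (avg i b f) =
    (1 / (2*pi)) *\<^sub>R integral {0..2*pi} (\<lambda>t. cis (- (t * b)) * vc v (\<lambda>q. f (exp_act (t *\<^sub>R axis i 1) q)))" .
  let ?F = "\<lambda>(t::real, y). f (exp_act (t *\<^sub>R axis i 1) (cpar J c y))"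
  note F = Cinf_flow[OF f c(1) axis_coord[OF i, of 1]]
  have "vc v (\<lambda>q. f (exp_act (t *\<^sub>R axis i 1) q)) = frechet_derivative ?F (at (t, y)) (0, w)" for t
  proof -
    have 1: "((\<lambda>y. (t, y)) has_derivative (\<lambda>v. (0, v))) (at y)"
      by (auto intro!: derivative_eq_intros)
    have "(?F \<circ> (\<lambda>y. (t, y)) has_derivative frechet_derivative ?F (at (t, y)) \<circ> (\<lambda>v. (0, v))) (at y)"
      by (rule diff_chain_at[OF 1 Cinf_has_derivative[OF F]]) (use y in auto)
    from frechet_derivative_eq[OF this, of w] show ?thesis by (simp add: vr[OF fe] o_def)
  qed
  moreover have "Cinf UNIV (\<lambda>t. frechet_derivative ?F (at (t, y)) (0, w))"
    by (rule Cinf_compose[OF Cinf_frechet_derivative[OF F] Cinf_Pair[OF open_UNIV Cinf_bounded_linear[OF bounded_linear_ident] Cinf_const] open_UNIV])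
       (use y in auto)
  ultimately show "Cinf UNIV (\<lambda>t. vc v (\<lambda>q. f (exp_act (t *\<^sub>R axis i 1) q)))" by simp
qed

lemma exp_act_period:
  assumes i: "i \<in> I" shows "exp_act ((t + 2*pi) *\<^sub>R axis i 1) m = exp_act (t *\<^sub>R axis i 1) m"
proof -
  have "torus_exp ((2*pi) *\<^sub>R axis i 1) = 1" by (auto simp: torus_exp_def vec_eq_iff axis_def)
  then show ?thesis
    using exp_act_add[OF scale_coord[OF axis_coord[OF i]] scale_coord[OF axis_coord[OF i]], of t 1 "2*pi" 1 m]
    by (simp add: scaleR_add_left exp_act_def act_1)
qed

text \<open>Translation along the circle shifts the integrand, which is periodic because the weight is an
  integer.\<close>

lemma avg_equivariant:
  assumes f: "msmooth f" and i: "i \<in> I" and b: "b \<in> \<int>"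
  shows "avg i b f (exp_act (s *\<^sub>R axis i 1) m) = cis (s * b) * avg i b f m"
proof -
  let ?h = "\<lambda>t. cis (- (t * b)) * f (exp_act (t *\<^sub>R axis i 1) m)"
  note ax = scale_coord[OF axis_coord[OF i]]
  have h: "Cinf UNIV ?h"
  proof (rule Cinf_mult[OF open_UNIV _ Cinf_orbit[OF f axis_coord[OF i]]])
    have "bounded_linear (\<lambda>t::real. - (t * b))" by (intro bounded_linear_minus bounded_linear_mult_const bounded_linear_ident)
    from Cinf_compose[OF Cinf_cis Cinf_bounded_linear[OF this] open_UNIV]
    show "Cinf UNIV (\<lambda>t. cis (- (t * b)))" by simp
  qed
  have per: "?h (t + 2*pi) = ?h t" for t
  proof -
    obtain n :: int where n: "b = of_int n" using b by (auto elim: Ints_cases)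
    have "cis (- ((t + 2*pi) * b)) = cis (- (t * b)) * cis (2*pi * of_int (- n))"
      by (simp add: cis_mult n algebra_simps)
    also have "cis (2*pi * of_int (- n)) = 1" by (rule cis_multiple_2pi) simp
    finally show ?thesis by (simp add: exp_act_period[OF i])
  qed
  have "(\<lambda>t. cis (- (t * b)) * f (exp_act (t *\<^sub>R axis i 1) (exp_act (s *\<^sub>R axis i 1) m))) = (\<lambda>t. cis (s * b) * ?h (t + s))"
    by (simp add: fun_eq_iff exp_act_add[OF ax ax, symmetric] scaleR_add_left[symmetric] mult.assoc[symmetric] cis_mult distrib_right)
  then have "integral {0..2*pi} (\<lambda>t. cis (- (t * b)) * f (exp_act (t *\<^sub>R axis i 1) (exp_act (s *\<^sub>R axis i 1) m))) =
      cis (s * b) * integral {0..2*pi} (\<lambda>t. ?h (t + s))"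
    by (simp only: integral_mult_right)
  then show ?thesis
    unfolding avg_def integral_periodic_shift[OF h per] by simp
qed

lemma avg_commute:
  assumes i: "i \<in> I" and \<xi>: "\<xi> \<in> coord_space I" and f: "\<And>m. f (exp_act \<xi> m) = a * f m"
  shows "avg i b f (exp_act \<xi> m) = a * avg i b f m"
proof -
  note ax = scale_coord[OF axis_coord[OF i]]
  have "f (exp_act (t *\<^sub>R axis i 1) (exp_act \<xi> m)) = a * f (exp_act (t *\<^sub>R axis i 1) m)" for t
    using f[of "exp_act (t *\<^sub>R axis i 1) m"] exp_act_add[OF ax \<xi>] exp_act_add[OF \<xi> ax] by (metis add.commute)
  then have "(\<lambda>t. cis (- (t * b)) * f (exp_act (t *\<^sub>R axis i 1) (exp_act \<xi> m))) =
      (\<lambda>t. a * (cis (- (t * b)) * f (exp_act (t *\<^sub>R axis i 1) m)))" by (simp add: fun_eq_iff)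
  then show ?thesis unfolding avg_def by (simp only: integral_mult_right mult_scaleR_right)
qed

text \<open>Averaging over one circle keeps the weights for the other circles, since the torus is commutative;
  so equivariance is acquired circle by circle.\<close>

lemma eqv_avg:
  assumes z: "eqv K \<beta> z" and K: "K \<subseteq> I" "i \<in> I" "i \<notin> K" and b: "b \<in> \<int>"
  shows "eqv (insert i K) (\<chi> j. if j = i then b else \<beta> $ j) (avg i b z)"
  using assms msmooth_avg[of z i b] avg_equivariant[of z i b] avg_commute[of i _ z _ b]
  unfolding eqv_def by (auto intro!: avg_commute scale_coord axis_coord)

text \<open>Suppose that \<open>v\<close> kills all functions that are equivariant under one more circle than \<open>z\<close>. The
  derivatives of the translates of \<open>z\<close> along that circle form a smooth periodic function, whose
  Fourier coefficients are the derivatives of the Fourier coefficients of \<open>z\<close> and hence zero. So this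
  function is zero, and \<open>v\<close> kills \<open>z\<close>. Dropping the circles one by one, one reaches all functions.\<close>

lemma equivariant_functions_separate:
  assumes v: "v \<in> tangent_space \<A> m" and 0: "\<And>\<beta> z. eqv I \<beta> z \<Longrightarrow> vc v z = 0"
  shows "v = (\<lambda>f. 0)"
proof -
  \<comment> \<open>\<open>D\<close> is the set of circles that are no longer required to act by a weight.\<close>
  have D: "\<forall>\<beta> z. eqv (I - D) \<beta> z \<longrightarrow> vc v z = 0" if "finite D" for D
    using that
  proof (induction D rule: finite_induct)
    case empty
    then show ?case using 0 by simp
  next
    case (insert i D)
    show ?case
    proof (cases "i \<in> I")
      case False
      then show ?thesis using insert.IH by (metis Diff_insert0)
    next
      case True
      have K: "insert i (I - insert i D) = I - D" using True insert.hyps by auto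
      show ?thesis
      proof (intro allI impI)
        fix \<beta> z assume z: "eqv (I - insert i D) \<beta> z"
        then have sz: "msmooth z" by (simp add: eqv_def)
        let ?u = "\<lambda>t. vc v (\<lambda>q. z (exp_act (t *\<^sub>R axis i 1) q))"
        note va = vc_avg[OF sz True v]
        have "integral {0..2*pi} (\<lambda>t. cis (- (t * b)) * ?u t) = 0" if b: "b \<in> \<int>" for b
        proof -
          have "eqv (I - D) (\<chi> j. if j = i then b else \<beta> $ j) (avg i b z)"
            using eqv_avg[OF z _ True _ b] K by auto
          then have "vc v (avg i b z) = 0" using insert.IH by blast
          then show ?thesis using va(1)[of b] by simp
        qed
        then have "fourier_null ?u"
          using continuous_on_subset[OF Cinf_continuous[OF va(2)] subset_UNIV] by (simp add: fourier_null_def)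
        then have "?u 0 = 0"
          by (rule fourier_null_imp_0) (use exp_act_period[OF True, of 0] in auto)
        then show "vc v z = 0" by (simp add: exp_act_0)
      qed
    qed
  qed
  have "v f = 0" for f
  proof (cases "msmooth f")
    case True
    have "eqv (I - I) 0 (\<lambda>q. complex_of_real (f q))"
      using msmooth_linear[OF bounded_linear_of_real True] by (simp add: eqv_def)
    then have "vc v (\<lambda>q. complex_of_real (f q)) = 0" using D[of I] finite by blast
    then show ?thesis by (simp add: vc_def complex_eq_iff)
  qed (simp add: tan_not_smooth[OF v])
  then show ?thesis by auto
qed

text \<open>On an equivariant function $\xi_M$ acts as multiplication by $i \langle\beta, \xi\rangle$, and these
  functions determine tangent vectors.\<close>

lemma inf_stabilizer_iff:
  "\<xi> \<in> inf_stabilizer I \<A> act m \<longleftrightarrow>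
    \<xi> \<in> coord_space I \<and> (\<forall>\<beta> z. eqv I \<beta> z \<longrightarrow> z m \<noteq> 0 \<longrightarrow> \<beta> \<bullet> \<xi> = 0)" (is "?L \<longleftrightarrow> ?R")
proof
  assume L: ?L
  then have \<xi>: "\<xi> \<in> coord_space I" "gf \<xi> m = (\<lambda>f. 0)" by (auto simp: inf_stabilizer_def)
  have "vc (gf \<xi> m) z = 0" for z using \<xi>(2) by (simp add: vc_def complex_eq_iff)
  then have "\<beta> \<bullet> \<xi> = 0" if "eqv I \<beta> z" "z m \<noteq> 0" for \<beta> z
    using vc_gf[OF that(1) \<xi>(1), of m] that(2) by simp
  then show ?R using \<xi> by blast
next
  assume R: ?R
  then have "gf \<xi> m = (\<lambda>f. 0)"
    by (intro equivariant_functions_separate[OF gf_tangent]) (auto simp: vc_gf)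
  then show ?L using R by (simp add: inf_stabilizer_def)
qed

lemma subspace_inf_stabilizer: "subspace (inf_stabilizer I \<A> act m)"
  by (auto simp: subspace_def inf_stabilizer_iff coord_space_def inner_add_right)

lemma inf_stabilizer_exp_act:
  assumes "\<eta> \<in> coord_space I"
  shows "inf_stabilizer I \<A> act (exp_act \<eta> m) = inf_stabilizer I \<A> act m"
proof -
  have "z (exp_act \<eta> m) \<noteq> 0 \<longleftrightarrow> z m \<noteq> 0" if "eqv I \<beta> z" for \<beta> z
    using eqv_exp_act[OF that assms] by simp
  then show ?thesis by (auto simp: set_eq_iff inf_stabilizer_iff)
qed

text \<open>The smooth functions are constant along the orbit of the one-parameter group, and they separate
  points.\<close>

lemma inf_stabilizer_fixes:
  assumes \<xi>: "\<xi> \<in> inf_stabilizer I \<A> act m"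
  shows "exp_act (t *\<^sub>R \<xi>) m = m"
proof -
  have c: "\<xi> \<in> coord_space I" using \<xi> by (simp add: inf_stabilizer_def)
  have const: "f (exp_act (t *\<^sub>R \<xi>) m) = f m" if f: "msmooth f" for f :: "'m \<Rightarrow> real"
  proof -
    have "((\<lambda>t. f (exp_act (t *\<^sub>R \<xi>) m)) has_real_derivative 0) (at s)" for s
    proof -
      have "gf \<xi> (exp_act (s *\<^sub>R \<xi>) m) f = 0"
        using \<xi>[folded inf_stabilizer_exp_act[OF scale_coord[OF c], of s m]] by (simp add: inf_stabilizer_def)
      then have "((\<lambda>t. f (exp_act (t *\<^sub>R \<xi>) (exp_act (s *\<^sub>R \<xi>) m))) has_real_derivative 0) (at (s + - s))"
        using gf_has_derivative[OF f c, of "exp_act (s *\<^sub>R \<xi>) m"] by simp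
      then have "((\<lambda>t. f (exp_act ((t + - s) *\<^sub>R \<xi>) (exp_act (s *\<^sub>R \<xi>) m))) has_real_derivative 0) (at s)"
        by (simp only: DERIV_shift)
      then show ?thesis
        by (simp add: exp_act_add[OF scale_coord[OF c] scale_coord[OF c], symmetric] scaleR_add_left[symmetric])
    qed
    then have "f (exp_act (t *\<^sub>R \<xi>) m) = f (exp_act (0 *\<^sub>R \<xi>) m)"
      by (intro DERIV_isconst_all[of "\<lambda>t. f (exp_act (t *\<^sub>R \<xi>) m)"]) auto
    then show ?thesis by (simp add: exp_act_0)
  qed
  show ?thesis
  proof (rule ccontr)
    assume "exp_act (t *\<^sub>R \<xi>) m \<noteq> m"
    then obtain W where W: "open W" "m \<in> W" "exp_act (t *\<^sub>R \<xi>) m \<notin> W" by (metis t1_space)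
    obtain \<eta> :: "'m \<Rightarrow> real" and N where "msmooth \<eta>" "m \<in> N" "\<And>q. q \<in> N \<Longrightarrow> \<eta> q = 1"
      "\<And>q. q \<notin> W \<Longrightarrow> \<exists>N'. open N' \<and> q \<in> N' \<and> (\<forall>q'\<in>N'. \<eta> q' = 0)"
      by (rule bump[OF W(1,2)]) blast
    then show False using const[of \<eta>] W(3) by force
  qed
qed

end

section \<open>Linear algebra\<close>

text \<open>Functionals that vanish on a common kernel are combinations of those that cut it out, with
  coefficients that depend linearly on the functional. The linear dependence matters when the
  functional varies smoothly with a point: the same \<eta> serves everywhere.\<close>

lemma functionals_dual_family:
  fixes \<beta> :: "'i \<Rightarrow> 'v::euclidean_space"
  assumes "finite T" "subspace h"
  shows "\<exists>\<eta>. (\<forall>t\<in>T. \<eta> t \<in> h) \<and> (\<forall>\<theta>. (\<forall>\<xi>\<in>h. (\<forall>t\<in>T. \<beta> t \<bullet> \<xi> = 0) \<longrightarrow> \<theta> \<bullet> \<xi> = 0) \<longrightarrow>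
     (\<forall>\<xi>\<in>h. \<theta> \<bullet> \<xi> = (\<Sum>t\<in>T. (\<beta> t \<bullet> \<xi>) * (\<theta> \<bullet> \<eta> t))))"
  using assms
proof (induction T arbitrary: h rule: finite_induct)
  case empty
  then show ?case by simp
next
  case (insert t T)
  show ?case
  proof (cases "\<exists>\<eta>0\<in>h. \<beta> t \<bullet> \<eta>0 \<noteq> 0")
    case False
    obtain \<eta> where \<eta>: "\<forall>t\<in>T. \<eta> t \<in> h" "\<forall>\<theta>. (\<forall>\<xi>\<in>h. (\<forall>t\<in>T. \<beta> t \<bullet> \<xi> = 0) \<longrightarrow> \<theta> \<bullet> \<xi> = 0) \<longrightarrow>
       (\<forall>\<xi>\<in>h. \<theta> \<bullet> \<xi> = (\<Sum>t\<in>T. (\<beta> t \<bullet> \<xi>) * (\<theta> \<bullet> \<eta> t)))"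
      using insert.IH[OF insert.prems] by blast
    show ?thesis
    proof (intro exI[of _ "\<eta>(t := 0)"] conjI allI impI ballI)
      fix s assume "s \<in> insert t T"
      then show "(\<eta>(t := 0)) s \<in> h" using \<eta>(1) insert.prems by (auto simp: subspace_0)
    next
      fix \<theta> \<xi> assume \<theta>: "\<forall>\<xi>\<in>h. (\<forall>t\<in>insert t T. \<beta> t \<bullet> \<xi> = 0) \<longrightarrow> \<theta> \<bullet> \<xi> = 0" and \<xi>: "\<xi> \<in> h"
      have "\<theta> \<bullet> \<xi> = (\<Sum>t\<in>T. (\<beta> t \<bullet> \<xi>) * (\<theta> \<bullet> \<eta> t))"
        using \<eta>(2)[rule_format, of \<theta> \<xi>] \<theta> \<xi> False by auto
      also have "\<dots> = (\<Sum>s\<in>T. (\<beta> s \<bullet> \<xi>) * (\<theta> \<bullet> (\<eta>(t := 0)) s))"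
        by (rule sum.cong) (use insert.hyps in auto)
      finally show "\<theta> \<bullet> \<xi> = (\<Sum>s\<in>insert t T. (\<beta> s \<bullet> \<xi>) * (\<theta> \<bullet> (\<eta>(t := 0)) s))"
        using insert.hyps by simp
    qed
  next
    case True
    then obtain \<eta>1 where \<eta>1: "\<eta>1 \<in> h" "\<beta> t \<bullet> \<eta>1 \<noteq> 0" by blast
    define \<eta>0 where "\<eta>0 = (1 / (\<beta> t \<bullet> \<eta>1)) *\<^sub>R \<eta>1"
    have \<eta>0: "\<eta>0 \<in> h" "\<beta> t \<bullet> \<eta>0 = 1" using \<eta>1 insert.prems by (auto simp: \<eta>0_def subspace_scale)
    let ?h = "{\<xi>\<in>h. \<beta> t \<bullet> \<xi> = 0}"
    have h: "subspace ?h" using insert.prems by (auto simp: subspace_def inner_add_right)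
    obtain \<eta> where \<eta>: "\<forall>t\<in>T. \<eta> t \<in> ?h" "\<forall>\<theta>. (\<forall>\<xi>\<in>?h. (\<forall>t\<in>T. \<beta> t \<bullet> \<xi> = 0) \<longrightarrow> \<theta> \<bullet> \<xi> = 0) \<longrightarrow>
       (\<forall>\<xi>\<in>?h. \<theta> \<bullet> \<xi> = (\<Sum>t\<in>T. (\<beta> t \<bullet> \<xi>) * (\<theta> \<bullet> \<eta> t)))"
      using insert.IH[OF h] by blast
    define \<eta>' where "\<eta>' = \<eta>(t := \<eta>0 - (\<Sum>s\<in>T. (\<beta> s \<bullet> \<eta>0) *\<^sub>R \<eta> s))"
    show ?thesis
    proof (intro exI[of _ \<eta>'] conjI allI impI ballI)
      fix s assume "s \<in> insert t T"
      then show "\<eta>' s \<in> h" using \<eta>(1) \<eta>0 insert.prems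
        by (auto simp: \<eta>'_def intro!: subspace_diff subspace_sum subspace_scale)
    next
      fix \<theta> \<xi> assume \<theta>: "\<forall>\<xi>\<in>h. (\<forall>t\<in>insert t T. \<beta> t \<bullet> \<xi> = 0) \<longrightarrow> \<theta> \<bullet> \<xi> = 0" and \<xi>: "\<xi> \<in> h"
      let ?x = "\<xi> - (\<beta> t \<bullet> \<xi>) *\<^sub>R \<eta>0"
      have "?x \<in> ?h" using \<xi> \<eta>0 insert.prems by (auto simp: inner_diff_right intro!: subspace_diff subspace_scale)
      moreover have "\<forall>\<xi>\<in>?h. (\<forall>t\<in>T. \<beta> t \<bullet> \<xi> = 0) \<longrightarrow> \<theta> \<bullet> \<xi> = 0" using \<theta> by auto
      ultimately have "\<theta> \<bullet> ?x = (\<Sum>s\<in>T. (\<beta> s \<bullet> ?x) * (\<theta> \<bullet> \<eta> s))" using \<eta>(2) by blast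
      then have "\<theta> \<bullet> \<xi> = (\<beta> t \<bullet> \<xi>) * (\<theta> \<bullet> \<eta>0) + (\<Sum>s\<in>T. (\<beta> s \<bullet> \<xi>) * (\<theta> \<bullet> \<eta> s)) -
          (\<beta> t \<bullet> \<xi>) * (\<Sum>s\<in>T. (\<beta> s \<bullet> \<eta>0) * (\<theta> \<bullet> \<eta> s))"
        by (simp add: inner_diff_right left_diff_distrib sum_subtractf sum_distrib_left mult.assoc)
      also have "\<dots> = (\<beta> t \<bullet> \<xi>) * (\<theta> \<bullet> \<eta>' t) + (\<Sum>s\<in>T. (\<beta> s \<bullet> \<xi>) * (\<theta> \<bullet> \<eta> s))"
        by (simp add: \<eta>'_def inner_diff_right inner_sum_right right_diff_distrib)
      also have "(\<Sum>s\<in>T. (\<beta> s \<bullet> \<xi>) * (\<theta> \<bullet> \<eta> s)) = (\<Sum>s\<in>T. (\<beta> s \<bullet> \<xi>) * (\<theta> \<bullet> \<eta>' s))"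
        by (rule sum.cong) (use insert.hyps in \<open>auto simp: \<eta>'_def\<close>)
      finally show "\<theta> \<bullet> \<xi> = (\<Sum>s\<in>insert t T. (\<beta> s \<bullet> \<xi>) * (\<theta> \<bullet> \<eta>' s))"
        using insert.hyps by simp
    qed
  qed
qed

text \<open>Infinitely many equivariant functions may be nonzero at a point; finitely many weights suffice to
  determine the stabilizer.\<close>

lemma finite_subfamily_annihilator:
  fixes \<beta> :: "'i \<Rightarrow> 'v::euclidean_space"
  obtains F where "finite F" "F \<subseteq> Z" "\<And>\<xi>. (\<forall>j\<in>F. \<beta> j \<bullet> \<xi> = 0) \<Longrightarrow> (\<forall>j\<in>Z. \<beta> j \<bullet> \<xi> = 0)"
proof -
  obtain B where B: "B \<subseteq> \<beta> ` Z" "independent B" "\<beta> ` Z \<subseteq> span B"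
    using maximal_independent_subset[of "\<beta> ` Z"] by blast
  obtain F where F: "F \<subseteq> Z" "finite F" "B = \<beta> ` F"
    using finite_subset_image[OF independent_imp_finite[OF B(2)] B(1)] by blast
  have "\<forall>j\<in>Z. \<beta> j \<bullet> \<xi> = 0" if 0: "\<forall>j\<in>F. \<beta> j \<bullet> \<xi> = 0" for \<xi>
  proof
    fix j assume "j \<in> Z"
    then have "\<beta> j \<in> span B" using B(3) by blast
    moreover have "span B \<subseteq> {x. x \<bullet> \<xi> = 0}"
      by (rule span_minimal) (use 0 F(3) in \<open>auto simp: subspace_def inner_add_left\<close>)
    ultimately show "\<beta> j \<bullet> \<xi> = 0" by blast
  qed
  then show ?thesis using that F by blast
qed

text \<open>The functionals are chosen greedily: as long as the common kernel is nonzero, some functional does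
  not vanish on it. A complex one is even onto \<open>\<complex>\<close> there, because some rotation acts on
  it by a nonzero imaginary factor; without the rotations its image could be a real line, and its real
  and imaginary part would not be independent coordinates.\<close>

lemma adapted_coordinates:
  fixes K :: "'v::euclidean_space set" and \<zeta> :: "'i \<Rightarrow> 'v \<Rightarrow> complex" and \<omega> :: "'j \<Rightarrow> 'v \<Rightarrow> real"
    and b :: "'x \<Rightarrow> 'i \<Rightarrow> real"
  assumes K: "subspace K"
    and lin: "\<And>i. i \<in> C \<Longrightarrow> linear (\<zeta> i)" "\<And>j. j \<in> R \<Longrightarrow> linear (\<omega> j)"
    and inv: "\<And>x c. x \<in> X \<Longrightarrow> c \<in> K \<Longrightarrow>
      \<exists>c'\<in>K. (\<forall>i\<in>C. \<zeta> i c' = \<i> * of_real (b x i) * \<zeta> i c) \<and> (\<forall>j\<in>R. \<omega> j c' = 0)"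
    and b: "\<And>i. i \<in> C \<Longrightarrow> \<exists>x\<in>X. b x i \<noteq> 0"
    and sep: "\<And>c. c \<in> K \<Longrightarrow> \<forall>i\<in>C. \<zeta> i c = 0 \<Longrightarrow> \<forall>j\<in>R. \<omega> j c = 0 \<Longrightarrow> c = 0"
  shows "\<exists>S\<subseteq>C. \<exists>R'\<subseteq>R. finite S \<and> finite R' \<and>
    (\<forall>y r. \<exists>!c. c \<in> K \<and> (\<forall>s\<in>S. \<zeta> s c = y s) \<and> (\<forall>j\<in>R'. \<omega> j c = r j))"
  using K inv sep
proof (induction "dim K" arbitrary: K rule: less_induct)
  case less
  have unique: "c1 = c2" if K': "K' \<subseteq> K" "subspace K'" and ex: "\<forall>y r. \<exists>!c. c \<in> K' \<and> (\<forall>s\<in>S. \<zeta> s c = y s) \<and> (\<forall>j\<in>R'. \<omega> j c = r j)"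
    and SR: "S \<subseteq> C" "R' \<subseteq> R"
    and c: "c1 - c2 \<in> K'" "\<forall>s\<in>S. \<zeta> s c1 = \<zeta> s c2" "\<forall>j\<in>R'. \<omega> j c1 = \<omega> j c2" for c1 c2 K' S R'
  proof -
    have l: "\<zeta> s (c1 - c2) = 0" "\<zeta> s 0 = 0" if "s \<in> S" for s
      using linear_diff[OF lin(1), of s c1 c2] linear_0[OF lin(1), of s] c(2) SR that by auto
    have r: "\<omega> j (c1 - c2) = 0" "\<omega> j 0 = 0" if "j \<in> R'" for j
      using linear_diff[OF lin(2), of j c1 c2] linear_0[OF lin(2), of j] c(3) SR that by auto
    have "\<exists>!c. c \<in> K' \<and> (\<forall>s\<in>S. \<zeta> s c = 0) \<and> (\<forall>j\<in>R'. \<omega> j c = 0)"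
      using spec[OF spec[OF ex, of "\<lambda>s. 0"], of "\<lambda>j. 0"] .
    moreover have "c1 - c2 \<in> K' \<and> (\<forall>s\<in>S. \<zeta> s (c1 - c2) = 0) \<and> (\<forall>j\<in>R'. \<omega> j (c1 - c2) = 0)"
      using c(1) l(1) r(1) by blast
    moreover have "0 \<in> K' \<and> (\<forall>s\<in>S. \<zeta> s 0 = 0) \<and> (\<forall>j\<in>R'. \<omega> j 0 = 0)"
      using subspace_0[OF K'(2)] l(2) r(2) by blast
    ultimately have "c1 - c2 = 0" by blast
    then show ?thesis by simp
  qed
  have smaller: "dim K' < dim K" if "subspace K'" "K' \<subseteq> K" "v \<in> K" "v \<notin> K'" for K' v
    using that less.prems(1) by (intro dim_psubset) (auto simp: span_eq_iff[THEN iffD2])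
  show ?case
  proof (cases "K = {0}")
    case True
    have "0 \<in> K \<and> (\<forall>s\<in>{}. \<zeta> s 0 = y s) \<and> (\<forall>j\<in>{}. \<omega> j 0 = r j)" for y r using True by simp
    then show ?thesis using True by (intro exI[of _ "{}"]) auto
  next
    case False
    then obtain v where v: "v \<in> K" "v \<noteq> 0" using subspace_0[OF less.prems(1)] by blast
    show ?thesis
    proof (cases "\<exists>i\<in>C. \<zeta> i v \<noteq> 0")
      case True
      then obtain i where i: "i \<in> C" "\<zeta> i v \<noteq> 0" by blast
      let ?K = "{c\<in>K. \<zeta> i c = 0}"
      note li = lin(1)[OF i(1)]
      have sK: "subspace ?K"
        using less.prems(1) by (auto simp: subspace_def linear_add[OF li] linear_scale[OF li] linear_0[OF li])
      have inv': "\<exists>c'\<in>?K. (\<forall>i\<in>C. \<zeta> i c' = \<i> * of_real (b x i) * \<zeta> i c) \<and> (\<forall>j\<in>R. \<omega> j c' = 0)"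
        if "x \<in> X" "c \<in> ?K" for x c
      proof -
        have "c \<in> K" "\<zeta> i c = 0" using that(2) by auto
        from less.prems(2)[OF that(1) this(1)] obtain c' where
          c': "c' \<in> K" "\<forall>i\<in>C. \<zeta> i c' = \<i> * of_real (b x i) * \<zeta> i c" "\<forall>j\<in>R. \<omega> j c' = 0" by blast
        then have "\<zeta> i c' = 0" using i(1) \<open>\<zeta> i c = 0\<close> by simp
        then show ?thesis using c' by blast
      qed
      have "\<exists>S\<subseteq>C. \<exists>R'\<subseteq>R. finite S \<and> finite R' \<and>
          (\<forall>y r. \<exists>!c. c \<in> ?K \<and> (\<forall>s\<in>S. \<zeta> s c = y s) \<and> (\<forall>j\<in>R'. \<omega> j c = r j))"
      proof (rule less.hyps[OF smaller[OF sK _ v(1)] sK inv'])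
        show "c = 0" if "c \<in> ?K" "\<forall>i\<in>C. \<zeta> i c = 0" "\<forall>j\<in>R. \<omega> j c = 0" for c
          using less.prems(3) that by blast
      qed (use i in auto)
      then obtain S R' where S: "S \<subseteq> C" "R' \<subseteq> R" "finite S" "finite R'"
        and ex: "\<forall>y r. \<exists>!c. c \<in> ?K \<and> (\<forall>s\<in>S. \<zeta> s c = y s) \<and> (\<forall>j\<in>R'. \<omega> j c = r j)" by blast
      have onto: "\<exists>u\<in>K. \<zeta> i u = a" for a
      proof -
        obtain x where x: "x \<in> X" "b x i \<noteq> 0" using b[OF i(1)] by blast
        obtain v' where v': "v' \<in> K" "\<zeta> i v' = \<i> * of_real (b x i) * \<zeta> i v"
          using less.prems(2)[OF x(1) v(1)] i(1) by blast
        \<comment> \<open>\<open>v\<close> and its rotated copy \<open>v'\<close> have values that span \<open>\<complex>\<close> over the reals.\<close>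
        let ?u = "Re (a / \<zeta> i v) *\<^sub>R v + (Im (a / \<zeta> i v) / b x i) *\<^sub>R v'"
        have "\<zeta> i ?u = of_real (Re (a / \<zeta> i v)) * \<zeta> i v + \<i> * of_real (Im (a / \<zeta> i v)) * \<zeta> i v"
          using x(2) by (simp add: linear_add[OF li] linear_scale[OF li] v'(2) scaleR_conv_of_real)
        also have "\<dots> = (of_real (Re (a / \<zeta> i v)) + \<i> * of_real (Im (a / \<zeta> i v))) * \<zeta> i v"
          by (simp only: distrib_right)
        also have "\<dots> = a" using i(2) by (simp only: complex_eq[symmetric]) simp
        finally show ?thesis
          using v(1) v'(1) less.prems(1) by (intro bexI[of _ ?u]) (auto intro: subspace_add subspace_scale)
      qed
      have iS: "i \<notin> S"
      proof
        assume "i \<in> S"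
        with spec[OF spec[OF ex, of "\<lambda>s. 1"], of "\<lambda>j. 0"] show False by auto
      qed
      have "\<exists>!c. c \<in> K \<and> (\<forall>s\<in>insert i S. \<zeta> s c = y s) \<and> (\<forall>j\<in>R'. \<omega> j c = r j)" for y r
      proof -
        obtain u where u: "u \<in> K" "\<zeta> i u = y i" using onto by blast
        obtain c where c: "c \<in> ?K" "\<forall>s\<in>S. \<zeta> s c = y s - \<zeta> s u" "\<forall>j\<in>R'. \<omega> j c = r j - \<omega> j u"
          using spec[OF spec[OF ex, of "\<lambda>s. y s - \<zeta> s u"], of "\<lambda>j. r j - \<omega> j u"] by blast
        have 1: "u + c \<in> K" using u c less.prems(1) by (auto intro: subspace_add)
        have 2: "\<zeta> s (u + c) = y s" if "s \<in> insert i S" for s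
          using that c u S(1) i(1) by (auto simp: linear_add[OF lin(1)] subset_iff)
        have 3: "\<omega> j (u + c) = r j" if "j \<in> R'" for j
          using that c S(2) by (auto simp: linear_add[OF lin(2)] subset_iff)
        have "c1 = c2" if c1: "c1 \<in> K" "\<forall>s\<in>insert i S. \<zeta> s c1 = y s" "\<forall>j\<in>R'. \<omega> j c1 = r j"
          and c2: "c2 \<in> K" "\<forall>s\<in>insert i S. \<zeta> s c2 = y s" "\<forall>j\<in>R'. \<omega> j c2 = r j" for c1 c2
        proof (rule unique[OF _ sK ex S(1,2)])
          show "c1 - c2 \<in> ?K" using c1(1,2) c2(1,2) less.prems(1) by (simp add: subspace_diff linear_diff[OF li])
        qed (use c1 c2 in auto)
        then show ?thesis using 1 2 3 by (intro ex1I[of _ "u + c"]) auto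
      qed
      then show ?thesis using S i(1) by (intro exI[of _ "insert i S"] conjI exI[of _ R']) auto
    next
      case False
      then obtain i where i: "i \<in> R" "\<omega> i v \<noteq> 0" using less.prems(3) v by blast
      let ?K = "{c\<in>K. \<omega> i c = 0}"
      note li = lin(2)[OF i(1)]
      have sK: "subspace ?K"
        using less.prems(1) by (auto simp: subspace_def linear_add[OF li] linear_scale[OF li] linear_0[OF li])
      have inv': "\<exists>c'\<in>?K. (\<forall>i\<in>C. \<zeta> i c' = \<i> * of_real (b x i) * \<zeta> i c) \<and> (\<forall>j\<in>R. \<omega> j c' = 0)"
        if "x \<in> X" "c \<in> ?K" for x c
      proof -
        have "c \<in> K" using that(2) by auto
        from less.prems(2)[OF that(1) this(1)] show ?thesis using i(1) by blast
      qed
      have "\<exists>S\<subseteq>C. \<exists>R'\<subseteq>R. finite S \<and> finite R' \<and>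
          (\<forall>y r. \<exists>!c. c \<in> ?K \<and> (\<forall>s\<in>S. \<zeta> s c = y s) \<and> (\<forall>j\<in>R'. \<omega> j c = r j))"
      proof (rule less.hyps[OF smaller[OF sK _ v(1)] sK inv'])
        show "c = 0" if "c \<in> ?K" "\<forall>i\<in>C. \<zeta> i c = 0" "\<forall>j\<in>R. \<omega> j c = 0" for c
          using less.prems(3) that by blast
      qed (use i in auto)
      then obtain S R' where S: "S \<subseteq> C" "R' \<subseteq> R" "finite S" "finite R'"
        and ex: "\<forall>y r. \<exists>!c. c \<in> ?K \<and> (\<forall>s\<in>S. \<zeta> s c = y s) \<and> (\<forall>j\<in>R'. \<omega> j c = r j)" by blast
      have iS: "i \<notin> R'"
      proof
        assume "i \<in> R'"
        with spec[OF spec[OF ex, of "\<lambda>s. 0"], of "\<lambda>j. 1"] show False by auto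
      qed
      have "\<exists>!c. c \<in> K \<and> (\<forall>s\<in>S. \<zeta> s c = y s) \<and> (\<forall>j\<in>insert i R'. \<omega> j c = r j)" for y r
      proof -
        let ?u = "(r i / \<omega> i v) *\<^sub>R v"
        have u: "?u \<in> K" "\<omega> i ?u = r i" using v(1) i(2) less.prems(1) by (auto simp: subspace_scale linear_scale[OF li])
        obtain c where c: "c \<in> ?K" "\<forall>s\<in>S. \<zeta> s c = y s - \<zeta> s ?u" "\<forall>j\<in>R'. \<omega> j c = r j - \<omega> j ?u"
          using spec[OF spec[OF ex, of "\<lambda>s. y s - \<zeta> s ?u"], of "\<lambda>j. r j - \<omega> j ?u"] by blast
        have 1: "?u + c \<in> K" using u c less.prems(1) by (auto intro: subspace_add)
        have 2: "\<zeta> s (?u + c) = y s" if "s \<in> S" for s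
          using that c S(1) by (simp add: linear_add[OF lin(1)] subset_iff)
        have 3: "\<omega> j (?u + c) = r j" if "j \<in> insert i R'" for j
          using that c u S(2) i(1) by (auto simp: linear_add[OF lin(2)] subset_iff)
        have "c1 = c2" if c1: "c1 \<in> K" "\<forall>s\<in>S. \<zeta> s c1 = y s" "\<forall>j\<in>insert i R'. \<omega> j c1 = r j"
          and c2: "c2 \<in> K" "\<forall>s\<in>S. \<zeta> s c2 = y s" "\<forall>j\<in>insert i R'. \<omega> j c2 = r j" for c1 c2
        proof (rule unique[OF _ sK ex S(1,2)])
          show "c1 - c2 \<in> ?K" using c1(1,3) c2(1,3) less.prems(1) by (simp add: subspace_diff linear_diff[OF li])
        qed (use c1 c2 in auto)
        then show ?thesis using 1 2 3 by (intro ex1I[of _ "?u + c"]) auto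
      qed
      then show ?thesis using S i(1) by (intro exI[of _ S] conjI exI[of _ "insert i R'"]) auto
    qed
  qed
qed

text \<open>The basis dual to the real coordinates given by the real and imaginary parts of the \<open>\<zeta> s\<close> and
  by the \<open>\<omega> j\<close>.\<close>

lemma adapted_frame:
  fixes K :: "'v::euclidean_space set" and \<zeta> :: "'i \<Rightarrow> 'v \<Rightarrow> complex" and \<omega> :: "'j \<Rightarrow> 'v \<Rightarrow> real"
  assumes K: "subspace K" and fin: "finite S" "finite R"
    and lin: "\<And>i. i \<in> S \<Longrightarrow> linear (\<zeta> i)" "\<And>j. j \<in> R \<Longrightarrow> linear (\<omega> j)"
    and ex: "\<forall>y r. \<exists>!c. c \<in> K \<and> (\<forall>s\<in>S. \<zeta> s c = y s) \<and> (\<forall>j\<in>R. \<omega> j c = r j)"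
  obtains e f g where "\<And>s. e s \<in> K" "\<And>s. f s \<in> K" "\<And>j. g j \<in> K"
    "\<And>s s'. s \<in> S \<Longrightarrow> \<zeta> s (e s') = (if s = s' then 1 else 0)"
    "\<And>s s'. s \<in> S \<Longrightarrow> \<zeta> s (f s') = (if s = s' then \<i> else 0)"
    "\<And>s j. s \<in> S \<Longrightarrow> \<zeta> s (g j) = 0"
    "\<And>s j. j \<in> R \<Longrightarrow> \<omega> j (e s) = 0" "\<And>s j. j \<in> R \<Longrightarrow> \<omega> j (f s) = 0"
    "\<And>j j'. j \<in> R \<Longrightarrow> \<omega> j (g j') = (if j = j' then 1 else 0)"
    "\<And>c. c \<in> K \<Longrightarrow> c = (\<Sum>s\<in>S. Re (\<zeta> s c) *\<^sub>R e s + Im (\<zeta> s c) *\<^sub>R f s) + (\<Sum>j\<in>R. \<omega> j c *\<^sub>R g j)"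
proof -
  define e where "e s = (THE c. c \<in> K \<and> (\<forall>s'\<in>S. \<zeta> s' c = (if s' = s then 1 else 0)) \<and> (\<forall>j\<in>R. \<omega> j c = 0))" for s
  define f where "f s = (THE c. c \<in> K \<and> (\<forall>s'\<in>S. \<zeta> s' c = (if s' = s then \<i> else 0)) \<and> (\<forall>j\<in>R. \<omega> j c = 0))" for s
  define g where "g j = (THE c. c \<in> K \<and> (\<forall>s'\<in>S. \<zeta> s' c = 0) \<and> (\<forall>j'\<in>R. \<omega> j' c = (if j' = j then 1 else 0)))" for j
  have e: "e s \<in> K \<and> (\<forall>s'\<in>S. \<zeta> s' (e s) = (if s' = s then 1 else 0)) \<and> (\<forall>j\<in>R. \<omega> j (e s) = 0)" for s
    unfolding e_def by (rule theI') (rule spec[OF spec[OF ex], of "\<lambda>s'. if s' = s then 1 else 0" "\<lambda>j. 0"])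
  have f: "f s \<in> K \<and> (\<forall>s'\<in>S. \<zeta> s' (f s) = (if s' = s then \<i> else 0)) \<and> (\<forall>j\<in>R. \<omega> j (f s) = 0)" for s
    unfolding f_def by (rule theI') (rule spec[OF spec[OF ex], of "\<lambda>s'. if s' = s then \<i> else 0" "\<lambda>j. 0"])
  have g: "g j \<in> K \<and> (\<forall>s'\<in>S. \<zeta> s' (g j) = 0) \<and> (\<forall>j'\<in>R. \<omega> j' (g j) = (if j' = j then 1 else 0))" for j
    unfolding g_def by (rule theI') (rule spec[OF spec[OF ex], of "\<lambda>s'. 0" "\<lambda>j'. if j' = j then 1 else 0"])
  have exp: "c = (\<Sum>s\<in>S. Re (\<zeta> s c) *\<^sub>R e s + Im (\<zeta> s c) *\<^sub>R f s) + (\<Sum>j\<in>R. \<omega> j c *\<^sub>R g j)" (is "c = ?c") if c: "c \<in> K" for c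
  proof -
    have 1: "?c \<in> K"
      using e f g by (intro subspace_add[OF K] subspace_sum[OF K] subspace_scale[OF K]) auto
    have 2: "\<zeta> s ?c = \<zeta> s c" if s: "s \<in> S" for s
    proof -
      note l = lin(1)[OF s]
      have "\<zeta> s ?c = (\<Sum>s'\<in>S. Re (\<zeta> s' c) *\<^sub>R \<zeta> s (e s') + Im (\<zeta> s' c) *\<^sub>R \<zeta> s (f s')) + (\<Sum>j\<in>R. \<omega> j c *\<^sub>R \<zeta> s (g j))"
        by (simp only: linear_add[OF l] linear_sum[OF l] linear_scale[OF l])
      also have "(\<Sum>s'\<in>S. Re (\<zeta> s' c) *\<^sub>R \<zeta> s (e s') + Im (\<zeta> s' c) *\<^sub>R \<zeta> s (f s')) =
          (\<Sum>s'\<in>S. if s = s' then Re (\<zeta> s c) *\<^sub>R 1 + Im (\<zeta> s c) *\<^sub>R \<i> else 0)"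
        by (rule sum.cong) (use e f s in auto)
      also have "\<dots> = \<zeta> s c" using s fin by (simp add: complex_eq_iff)
      finally show ?thesis using g s by simp
    qed
    have 3: "\<omega> j ?c = \<omega> j c" if j: "j \<in> R" for j
    proof -
      note l = lin(2)[OF j]
      have "\<omega> j ?c = (\<Sum>s'\<in>S. Re (\<zeta> s' c) *\<^sub>R \<omega> j (e s') + Im (\<zeta> s' c) *\<^sub>R \<omega> j (f s')) + (\<Sum>j'\<in>R. \<omega> j' c *\<^sub>R \<omega> j (g j'))"
        by (simp only: linear_add[OF l] linear_sum[OF l] linear_scale[OF l])
      also have "(\<Sum>j'\<in>R. \<omega> j' c *\<^sub>R \<omega> j (g j')) = (\<Sum>j'\<in>R. if j = j' then \<omega> j c else 0)"
        by (rule sum.cong) (use g j in auto)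
      finally show ?thesis using e f j fin by simp
    qed
    have "\<exists>!c'. c' \<in> K \<and> (\<forall>s\<in>S. \<zeta> s c' = \<zeta> s c) \<and> (\<forall>j\<in>R. \<omega> j c' = \<omega> j c)"
      using spec[OF spec[OF ex], of "\<lambda>s. \<zeta> s c" "\<lambda>j. \<omega> j c"] .
    moreover have "?c \<in> K \<and> (\<forall>s\<in>S. \<zeta> s ?c = \<zeta> s c) \<and> (\<forall>j\<in>R. \<omega> j ?c = \<omega> j c)" using 1 2 3 by blast
    moreover have "c \<in> K \<and> (\<forall>s\<in>S. \<zeta> s c = \<zeta> s c) \<and> (\<forall>j\<in>R. \<omega> j c = \<omega> j c)" using c by blast
    ultimately show ?thesis by blast
  qed
  show ?thesis
    by (rule that[of e f g]) (use e f g exp in auto)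
qed

section \<open>Linear coordinates at a point\<close>

context manifold begin

text \<open>The coordinate functions of the chart, extended from a neighbourhood, detect every direction.\<close>

lemma chart_direction_zero:
  assumes c: "c \<in> \<A>" "y \<in> cdom J c" and w: "w \<in> coord_space J"
    and 0: "\<And>f. msmooth f \<Longrightarrow> frechet_derivative (\<lambda>y. f (cpar J c y)) (at y) w = (0::real)"
  shows "w = 0"
proof -
  let ?m = "cpar J c y"
  note m = cpar_in[OF c]
  have "w $ i = 0" for i
  proof -
    have C: "Cinf UNIV (\<lambda>y. y $ i)" by (rule Cinf_bounded_linear[OF bounded_linear_vec_nth])
    have "smooth_at (\<lambda>q. snd c q $ i) q" if "q \<in> fst c" for q
      by (rule smooth_at_chart_function[OF c(1) that open_UNIV UNIV_I C])
    then obtain f N where f: "msmooth f" "open N" "?m \<in> N" "N \<subseteq> fst c" "\<And>q. q \<in> N \<Longrightarrow> f q = snd c q $ i"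
      using extend_smooth[OF chart(1)[OF c(1)] m, of "\<lambda>q. snd c q $ i"] by metis
    let ?T = "cdom J c \<inter> cpar J c -` N"
    have "((\<lambda>y. proj J y $ i) has_derivative (\<lambda>w. proj J w $ i)) (at y)"
      by (rule bounded_linear_imp_has_derivative[OF bounded_linear_compose[OF bounded_linear_vec_nth bounded_linear_proj]])
    then have "((\<lambda>y. f (cpar J c y)) has_derivative (\<lambda>w. proj J w $ i)) (at y)"
    proof (rule has_derivative_transform_within_open)
      show "open ?T" by (rule open_cpar_preimage[OF c(1) f(2)])
      show "y \<in> ?T" using c f(3) by simp
      show "proj J x $ i = f (cpar J c x)" if "x \<in> ?T" for x
        using that f(5) chart_cpar[OF c(1)] by simp
    qed
    from frechet_derivative_eq[OF this, of w] 0[OF f(1)] show ?thesis by (simp add: proj_id[OF w])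
  qed
  then show ?thesis by (simp add: vec_eq_iff)
qed

lemma tangent_of_direction:
  assumes c: "c \<in> \<A>" "y \<in> cdom J c"
  shows "(\<lambda>f. if f \<in> C_infinity \<A> then frechet_derivative (\<lambda>y. f (cpar J c y)) (at y) w else 0)
    \<in> tangent_space \<A> (cpar J c y)"
  by (rule tangent_of_map) (use Cinf_has_derivative[OF msmooth_Cinf[OF _ c(1)] c(2)] in \<open>auto simp: differentiable_def\<close>)

end

context torus_manifold begin

text \<open>A substitute for the linear normal form of the action near \<open>p\<close>. The differentials at \<open>p\<close> of the
  equivariant functions whose weight is nonzero on the stabilizer algebra of \<open>p\<close>, together with those
  of the functions invariant under that algebra, separate tangent vectors; and the linearised action
  rotates the former and kills the latter. So by \<open>adapted_coordinates\<close> linear coordinates of the tangent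
  space can be chosen among these differentials, and by the inverse function theorem the functions
  themselves become linear in a suitable parametrisation \<tau> with inverse \<kappa>.

  The generating field of an element of the stabilizer algebra is zero as soon as it kills the
  coordinate functions. It kills the invariant ones anyway and multiplies each equivariant one by its
  weight; this is why its zeros form a coordinate subspace.

  The set \<open>B\<close> is a box, so that it is stable under shrinking all coordinates and under
  shrinking a single complex coordinate. It is open in the full coordinate space, where the
  directions outside \<open>coord_space J\<close> are dummies.\<close>

lemma local_coordinates:
  obtains S :: "((real^'k) \<times> ('m \<Rightarrow> complex)) set" and Z and e f :: "_ \<Rightarrow> real^'n" and B \<tau> W \<kappa> where
    "finite S" "\<And>s. s \<in> S \<Longrightarrow> eqv I (fst s) (snd s)"
    "\<And>s. s \<in> S \<Longrightarrow> linear (Z s)"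
    "\<And>s s'. s \<in> S \<Longrightarrow> Z s (e s') = (if s = s' then 1 else 0)"
    "\<And>s s'. s \<in> S \<Longrightarrow> Z s (f s') = (if s = s' then \<i> else 0)"
    "open B" "0 \<in> B" "\<And>x t. x \<in> B \<Longrightarrow> t \<in> {0..1} \<Longrightarrow> t *\<^sub>R x \<in> B"
    "\<And>x s t. x \<in> B \<Longrightarrow> s \<in> S \<Longrightarrow> t \<in> {0..1} \<Longrightarrow>
       x - t *\<^sub>R (Re (Z s x) *\<^sub>R e s + Im (Z s x) *\<^sub>R f s) \<in> B"
    "\<tau> 0 = p" "\<And>u :: 'm \<Rightarrow> real. msmooth u \<Longrightarrow> Cinf B (\<lambda>x. u (\<tau> x))"
    "\<And>s x. s \<in> S \<Longrightarrow> x \<in> B \<Longrightarrow> snd s (\<tau> x) = Z s x"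
    "\<And>\<xi> x. \<xi> \<in> inf_stabilizer I \<A> act p \<Longrightarrow> x \<in> B \<Longrightarrow> \<forall>s\<in>S. fst s \<bullet> \<xi> = 0 \<or> Z s x = 0 \<Longrightarrow>
       \<xi> \<in> inf_stabilizer I \<A> act (\<tau> x)"
    "open W" "p \<in> W" "\<And>q. q \<in> W \<Longrightarrow> \<kappa> q \<in> B" "\<And>q. q \<in> W \<Longrightarrow> \<tau> (\<kappa> q) = q" "\<And>q. q \<in> W \<Longrightarrow> smooth_at \<kappa> q"
proof -
  obtain c where c: "c \<in> \<A>" "p \<in> fst c" by (rule chart_ex)
  define y0 where "y0 = snd c p"
  have y0: "y0 \<in> cdom J c" "cpar J c y0 = p" "proj J y0 = y0"
    using chart_in_cdom[OF c] cpar_chart[OF c] proj_id[OF chart_coord[OF c]] by (auto simp: y0_def)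
  let ?V = "coord_space J"
  let ?h = "inf_stabilizer I \<A> act p"
  have hc: "\<xi> \<in> coord_space I" "gf \<xi> p = (\<lambda>f. 0)" if "\<xi> \<in> ?h" for \<xi>
    using that by (auto simp: inf_stabilizer_def)
  define \<zeta> where "\<zeta> s = frechet_derivative (\<lambda>y. snd s (cpar J c y)) (at y0)" for s :: "(real^'k) \<times> ('m \<Rightarrow> complex)"
  define \<omega> where "\<omega> u = frechet_derivative (\<lambda>y. u (cpar J c y)) (at y0)" for u :: "'m \<Rightarrow> real"
  define C where "C = {s :: (real^'k) \<times> ('m \<Rightarrow> complex). eqv I (fst s) (snd s) \<and> (\<exists>\<xi>\<in>?h. fst s \<bullet> \<xi> \<noteq> 0)}"
  define R where "R = {u :: 'm \<Rightarrow> real. msmooth u \<and> (\<forall>\<xi>\<in>?h. \<forall>m. gf \<xi> m u = 0)}"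
  have lz: "linear (\<zeta> s)" if "msmooth (snd s)" for s
    unfolding \<zeta>_def by (rule has_derivative_linear[OF Cinf_has_derivative[OF msmooth_Cinf[OF that c(1)] y0(1)]])
  have lw: "linear (\<omega> u)" if "msmooth u" for u
    unfolding \<omega>_def by (rule has_derivative_linear[OF Cinf_has_derivative[OF msmooth_Cinf[OF that c(1)] y0(1)]])
  have ms: "msmooth (snd s)" if "s \<in> C" for s using that by (auto simp: C_def eqv_def)
  define tv where "tv w = (\<lambda>f. if f \<in> C_infinity \<A> then \<omega> f w else 0)" for w
  have tv: "tv w \<in> tangent_space \<A> p" for w
    using tangent_of_direction[OF c(1) y0(1), of w, unfolded y0(2)] unfolding tv_def \<omega>_def .
  have tv_eq: "tv w u = frechet_derivative (\<lambda>y. u (cpar J c y)) (at y0) w" if "msmooth u" for u w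
    using that by (simp add: tv_def \<omega>_def C_infinity_iff)
  have vctv: "vc (tv w) z = frechet_derivative (\<lambda>y. z (cpar J c y)) (at y0) w" if "msmooth z" for w z
    by (rule vc_repr[OF c(1) y0(1) that tv_eq])

  \<comment> \<open>The linearised action: as \<open>gf \<xi>\<close> vanishes at \<open>p\<close>, composing it with a derivation at \<open>p\<close> gives a
    derivation again.\<close>
  have inv: "\<exists>w'\<in>?V. (\<forall>s\<in>C. \<zeta> s w' = \<i> * of_real (fst s \<bullet> \<xi>) * \<zeta> s w) \<and> (\<forall>u\<in>R. \<omega> u w' = 0)"
    if \<xi>: "\<xi> \<in> ?h" and "w \<in> ?V" for \<xi> w
  proof -
    define v where "v = (\<lambda>f. if f \<in> C_infinity \<A> then tv w (\<lambda>m. gf \<xi> m f) else 0)"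
    note g = gf_tangent[OF hc(1)[OF \<xi>]]
    note sg = msmooth_gf[OF _ hc(1)[OF \<xi>]]
    have v: "v \<in> tangent_space \<A> p"
    proof (rule tangentI)
      fix f g' :: "'m \<Rightarrow> real" and a :: real
      assume f: "msmooth f" and g': "msmooth g'"
      show "v (\<lambda>p. f p + g' p) = v f + v g'"
        using f g' tan_add[OF tv sg[OF f] sg[OF g']]
        by (simp add: v_def C_infinity_iff msmooth_add tan_add[OF g])
      show "v (\<lambda>p. a * f p) = a * v f"
        using f tan_scale[OF tv sg[OF f]]
        by (simp add: v_def C_infinity_iff msmooth_mult msmooth_const tan_scale[OF g])
      have "v (\<lambda>p. f p * g' p) = tv w (\<lambda>m. f m * gf \<xi> m g' + g' m * gf \<xi> m f)"
        using f g' by (simp add: v_def C_infinity_iff msmooth_mult tan_mult[OF g])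
      also have "\<dots> = f p * tv w (\<lambda>m. gf \<xi> m g') + gf \<xi> p g' * tv w f + (g' p * tv w (\<lambda>m. gf \<xi> m f) + gf \<xi> p f * tv w g')"
        using f g' by (simp add: tan_add[OF tv] tan_mult[OF tv] msmooth_mult sg)
      also have "\<dots> = f p * v g' + g' p * v f"
        using f g' hc(2)[OF \<xi>] by (simp add: v_def C_infinity_iff)
      finally show "v (\<lambda>p. f p * g' p) = f p * v g' + g' p * v f" .
    qed (simp add: v_def C_infinity_iff)
    obtain w' where w': "w' \<in> ?V" "\<And>f. msmooth f \<Longrightarrow> v f = frechet_derivative (\<lambda>y. f (cpar J c y)) (at y0) w'"
      using tangent_repr[OF v[folded y0(2)] c(1) y0(1)] by blast
    show ?thesis
    proof (intro bexI[OF _ w'(1)] conjI ballI)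
      fix s assume s: "s \<in> C"
      then have es: "eqv I (fst s) (snd s)" by (simp add: C_def)
      have sRI: "msmooth (\<lambda>q. Re (snd s q))" "msmooth (\<lambda>q. Im (snd s q))" using ms[OF s] by (auto simp: msmooth_complex)
      have "\<zeta> s w' = vc v (snd s)" unfolding \<zeta>_def using vc_repr[OF c(1) y0(1) ms[OF s] w'(2)] by simp
      also have "\<dots> = vc (tv w) (\<lambda>m. vc (gf \<xi> m) (snd s))"
        using sRI by (simp add: vc_def v_def C_infinity_iff)
      also have "\<dots> = vc (tv w) (\<lambda>m. \<i> * of_real (fst s \<bullet> \<xi>) * snd s m)"
        by (simp only: vc_gf[OF es hc(1)[OF \<xi>]])
      also have "\<dots> = \<i> * of_real (fst s \<bullet> \<xi>) * \<zeta> s w"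
        by (simp only: vc_scale[OF tv ms[OF s]] vctv[OF ms[OF s]] \<zeta>_def)
      finally show "\<zeta> s w' = \<i> * of_real (fst s \<bullet> \<xi>) * \<zeta> s w" .
    next
      fix u assume u: "u \<in> R"
      then have "\<omega> u w' = v u" unfolding \<omega>_def using w'(2) by (simp add: R_def)
      also have "\<dots> = tv w (\<lambda>m. 0)" using u \<xi> by (simp add: v_def C_infinity_iff R_def)
      finally show "\<omega> u w' = 0" by (simp add: tan_const[OF tv])
    qed
  qed
  have RI: "(\<lambda>q. Re (z q)) \<in> R \<and> (\<lambda>q. Im (z q)) \<in> R" if z: "eqv I \<beta> z" "\<forall>\<xi>\<in>?h. \<beta> \<bullet> \<xi> = 0" for \<beta> z
  proof -
    have "gf \<xi> m (\<lambda>q. Re (z q)) = 0 \<and> gf \<xi> m (\<lambda>q. Im (z q)) = 0" if "\<xi> \<in> ?h" for \<xi> m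
      using vc_gf[OF z(1) hc(1)[OF that], of m] z(2) that by (simp add: vc_def complex_eq_iff)
    then show ?thesis using z(1) by (simp add: R_def eqv_def msmooth_complex)
  qed
  have sep: "w = 0" if w: "w \<in> ?V" "\<forall>s\<in>C. \<zeta> s w = 0" "\<forall>u\<in>R. \<omega> u w = 0" for w
  proof -
    have "vc (tv w) z = 0" if z: "eqv I \<beta> z" for \<beta> z
    proof (cases "\<forall>\<xi>\<in>?h. \<beta> \<bullet> \<xi> = 0")
      case True
      from RI[OF z True] w(3) show ?thesis
        by (auto simp: vc_def tv_def complex_eq_iff)
    next
      case False
      then have "(\<beta>, z) \<in> C" using z by (auto simp: C_def)
      with w(2) show ?thesis using vctv[of z w] z by (force simp: \<zeta>_def eqv_def)
    qed
    then have "tv w = (\<lambda>f. 0)" by (rule equivariant_functions_separate[OF tv])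
    then show ?thesis
      by (intro chart_direction_zero[OF c(1) y0(1) w(1)]) (metis tv_eq)
  qed
  have linC: "\<And>s. s \<in> C \<Longrightarrow> linear (\<zeta> s)" using lz ms by blast
  have linR: "\<And>u. u \<in> R \<Longrightarrow> linear (\<omega> u)" using lw by (simp add: R_def)
  have nz: "\<And>s. s \<in> C \<Longrightarrow> \<exists>\<xi>\<in>?h. fst s \<bullet> \<xi> \<noteq> 0" by (simp add: C_def)
  have "\<exists>S\<subseteq>C. \<exists>R'\<subseteq>R. finite S \<and> finite R' \<and>
    (\<forall>y r. \<exists>!c. c \<in> ?V \<and> (\<forall>s\<in>S. \<zeta> s c = y s) \<and> (\<forall>j\<in>R'. \<omega> j c = r j))"
    by (rule adapted_coordinates[where b = "\<lambda>\<xi> s. fst s \<bullet> \<xi>" and X = ?h, OF subspace_coord_space linC linR inv nz sep])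
  then obtain S R' where S: "S \<subseteq> C" "R' \<subseteq> R" "finite S" "finite R'"
    and ex1: "\<forall>y r. \<exists>!c. c \<in> ?V \<and> (\<forall>s\<in>S. \<zeta> s c = y s) \<and> (\<forall>j\<in>R'. \<omega> j c = r j)" by blast
  have linS: "\<And>s. s \<in> S \<Longrightarrow> linear (\<zeta> s)" "\<And>u. u \<in> R' \<Longrightarrow> linear (\<omega> u)" using S linC linR by blast+
  have smS: "\<And>s. s \<in> S \<Longrightarrow> msmooth (snd s)" "\<And>u. u \<in> R' \<Longrightarrow> msmooth u" using S ms by (auto simp: R_def)
  obtain e f g where ef: "\<And>s. e s \<in> ?V" "\<And>s. f s \<in> ?V" "\<And>j. g j \<in> ?V"
    and \<zeta>: "\<And>s s'. s \<in> S \<Longrightarrow> \<zeta> s (e s') = (if s = s' then 1 else 0)"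
    "\<And>s s'. s \<in> S \<Longrightarrow> \<zeta> s (f s') = (if s = s' then \<i> else 0)"
    "\<And>s j. s \<in> S \<Longrightarrow> \<zeta> s (g j) = 0"
    and \<omega>: "\<And>s j. j \<in> R' \<Longrightarrow> \<omega> j (e s) = 0" "\<And>s j. j \<in> R' \<Longrightarrow> \<omega> j (f s) = 0"
    "\<And>j j'. j \<in> R' \<Longrightarrow> \<omega> j (g j') = (if j = j' then 1 else 0)"
    and exp: "\<And>c. c \<in> ?V \<Longrightarrow> c = (\<Sum>s\<in>S. Re (\<zeta> s c) *\<^sub>R e s + Im (\<zeta> s c) *\<^sub>R f s) + (\<Sum>j\<in>R'. \<omega> j c *\<^sub>R g j)"
    by (rule adapted_frame[OF subspace_coord_space S(3,4) linS ex1], assumption, assumption, rule that)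
  note lp = bounded_linear.linear[OF bounded_linear_proj[of J]]
  have pz: "\<zeta> s (proj J x) = \<zeta> s x" if "s \<in> S" for s x
    using frechet_cpar_proj[OF c(1) smS(1)[OF that] y0(1), of x] y0(3) by (simp add: \<zeta>_def)
  have pw: "\<omega> u (proj J x) = \<omega> u x" if "u \<in> R'" for u x
    using frechet_cpar_proj[OF c(1) smS(2)[OF that] y0(1), of x] y0(3) by (simp add: \<omega>_def)
  have pp: "proj J (proj J x) = proj J x" for x by (simp add: proj_id proj_in)

  define lc where "lc a r = (\<Sum>s\<in>S. Re (a s) *\<^sub>R e s + Im (a s) *\<^sub>R f s) + (\<Sum>u\<in>R'. r u *\<^sub>R g u)"
    for a :: "_ \<Rightarrow> complex" and r :: "_ \<Rightarrow> real"
  have lcV: "lc a r \<in> ?V" for a r unfolding lc_def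
    by (intro subspace_add[OF subspace_coord_space] subspace_sum[OF subspace_coord_space] subspace_scale[OF subspace_coord_space] ef)
  have z_lc: "\<zeta> s (lc a r) = a s" if s: "s \<in> S" for s a r
  proof -
    note l = linS(1)[OF s]
    have "\<zeta> s (lc a r) = (\<Sum>s'\<in>S. Re (a s') *\<^sub>R \<zeta> s (e s') + Im (a s') *\<^sub>R \<zeta> s (f s')) + (\<Sum>u\<in>R'. r u *\<^sub>R \<zeta> s (g u))"
      unfolding lc_def by (simp only: linear_add[OF l] linear_sum[OF l] linear_scale[OF l])
    also have "(\<Sum>s'\<in>S. Re (a s') *\<^sub>R \<zeta> s (e s') + Im (a s') *\<^sub>R \<zeta> s (f s')) =
        (\<Sum>s'\<in>S. if s = s' then Re (a s) *\<^sub>R 1 + Im (a s) *\<^sub>R \<i> else 0)"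
      by (rule sum.cong) (use \<zeta> s in auto)
    also have "\<dots> = a s" using s S(3) by (simp add: complex_eq_iff)
    finally show ?thesis using \<zeta>(3)[OF s] by simp
  qed
  have w_lc: "\<omega> u (lc a r) = r u" if u: "u \<in> R'" for u a r
  proof -
    note l = linS(2)[OF u]
    have "\<omega> u (lc a r) = (\<Sum>s'\<in>S. Re (a s') *\<^sub>R \<omega> u (e s') + Im (a s') *\<^sub>R \<omega> u (f s')) + (\<Sum>u'\<in>R'. r u' *\<^sub>R \<omega> u (g u'))"
      unfolding lc_def by (simp only: linear_add[OF l] linear_sum[OF l] linear_scale[OF l])
    also have "(\<Sum>u'\<in>R'. r u' *\<^sub>R \<omega> u (g u')) = (\<Sum>u'\<in>R'. if u = u' then r u else 0)"
      by (rule sum.cong) (use \<omega> u in auto)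
    finally show ?thesis using \<omega>(1,2)[OF u] u S(4) by simp
  qed
  have split: "x = lc (\<lambda>s. \<zeta> s x) (\<lambda>u. \<omega> u x) + (x - proj J x)" for x
  proof -
    have "lc (\<lambda>s. \<zeta> s x) (\<lambda>u. \<omega> u x) = lc (\<lambda>s. \<zeta> s (proj J x)) (\<lambda>u. \<omega> u (proj J x))"
      unfolding lc_def by (simp add: pz pw cong: sum.cong)
    also have "\<dots> = proj J x" using exp[OF proj_in, of x] by (simp add: lc_def)
    finally show ?thesis by simp
  qed

  \<comment> \<open>The last summand makes \<psi> a map of the full coordinate space whose derivative at \<open>y0\<close> is the identity.\<close>
  define \<psi> where "\<psi> y = lc (\<lambda>s. snd s (cpar J c y)) (\<lambda>u. u (cpar J c y) - u p) + (y - proj J y)" for y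
  have z_psi: "\<zeta> s (\<psi> y) = snd s (cpar J c y)" if "s \<in> S" for s y
    unfolding \<psi>_def linear_add[OF linS(1)[OF that]] z_lc[OF that]
    using pz[OF that, of "y - proj J y"]
    by (simp add: linear_diff[OF lp] pp linear_0[OF linS(1)[OF that]])
  have C\<psi>: "Cinf (cdom J c) \<psi>"
  proof -
    note o = open_cdom[OF c(1)]
    have "Cinf (cdom J c) (\<lambda>y. Re (snd s (cpar J c y)))" "Cinf (cdom J c) (\<lambda>y. Im (snd s (cpar J c y)))" if "s \<in> S" for s
      using smS(1)[OF that] by (auto intro!: msmooth_Cinf[OF _ c(1)] simp: msmooth_complex)
    moreover have "Cinf (cdom J c) (\<lambda>y. u (cpar J c y) - u p)" if "u \<in> R'" for u
      by (rule Cinf_diff[OF o msmooth_Cinf[OF smS(2)[OF that] c(1)] Cinf_const])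
    moreover have "Cinf (cdom J c) (\<lambda>y. y - proj J y)"
      by (rule Cinf_diff[OF o Cinf_bounded_linear[OF bounded_linear_ident] Cinf_proj])
    ultimately show ?thesis unfolding \<psi>_def lc_def
      by (intro Cinf_add[OF o] Cinf_sum[OF o] Cinf_scaleR[OF o] Cinf_const)
  qed
  have D\<psi>: "frechet_derivative \<psi> (at y) w =
      lc (\<lambda>s. frechet_derivative (\<lambda>y. snd s (cpar J c y)) (at y) w)
         (\<lambda>u. frechet_derivative (\<lambda>y. u (cpar J c y)) (at y) w) + (w - proj J w)" if y: "y \<in> cdom J c" for y w
  proof -
    have 1: "((\<lambda>y. Re (snd s (cpar J c y))) has_derivative (\<lambda>w. Re (frechet_derivative (\<lambda>y. snd s (cpar J c y)) (at y) w))) (at y)"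
      "((\<lambda>y. Im (snd s (cpar J c y))) has_derivative (\<lambda>w. Im (frechet_derivative (\<lambda>y. snd s (cpar J c y)) (at y) w))) (at y)" if "s \<in> S" for s
      by (rule bounded_linear.has_derivative[OF bounded_linear_Re Cinf_has_derivative[OF msmooth_Cinf[OF smS(1)[OF that] c(1)] y]],
          rule bounded_linear.has_derivative[OF bounded_linear_Im Cinf_has_derivative[OF msmooth_Cinf[OF smS(1)[OF that] c(1)] y]])
    have 2: "((\<lambda>y. u (cpar J c y) - u p) has_derivative frechet_derivative (\<lambda>y. u (cpar J c y)) (at y)) (at y)" if "u \<in> R'" for u
      using has_derivative_diff[OF Cinf_has_derivative[OF msmooth_Cinf[OF smS(2)[OF that] c(1)] y] has_derivative_const[of "u p"]] by simp
    have 3: "((\<lambda>y. y - proj J y) has_derivative (\<lambda>w. w - proj J w)) (at y)"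
      by (rule has_derivative_diff[OF has_derivative_ident bounded_linear_imp_has_derivative[OF bounded_linear_proj]])
    have "(\<psi> has_derivative (\<lambda>w. lc (\<lambda>s. frechet_derivative (\<lambda>y. snd s (cpar J c y)) (at y) w)
         (\<lambda>u. frechet_derivative (\<lambda>y. u (cpar J c y)) (at y) w) + (w - proj J w))) (at y)"
      unfolding \<psi>_def lc_def
      by (intro has_derivative_add has_derivative_sum has_derivative_scaleR_left 1 2 3)
    then show ?thesis by (rule frechet_derivative_eq)
  qed
  have id: "frechet_derivative \<psi> (at y0) w = w" for w
    using D\<psi>[OF y0(1), of w] split[of w] by (simp add: \<zeta>_def \<omega>_def)
  obtain N V k where N: "open N" "N \<subseteq> cdom J c" "y0 \<in> N" "open V" "homeomorphism N V \<psi> k" "Cinf V k"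
    "\<And>y. y \<in> N \<Longrightarrow> inj (frechet_derivative \<psi> (at y))"
    by (rule Cinf_inverse_function[OF open_cdom[OF c(1)] C\<psi> y0(1) id]) (rule that)
  have Vk: "k x \<in> N" "\<psi> (k x) = x" if "x \<in> V" for x using N(5) that by (auto simp: homeomorphism_def)
  have Nk: "\<psi> y \<in> V" "k (\<psi> y) = y" if "y \<in> N" for y using N(5) that by (auto simp: homeomorphism_def)
  have \<psi>0: "\<psi> y0 = 0"
  proof -
    have "snd s p = 0" if "s \<in> S" for s
    proof -
      have "s \<in> C" using S(1) that by blast
      then obtain \<xi> where "eqv I (fst s) (snd s)" "\<xi> \<in> ?h" "fst s \<bullet> \<xi> \<noteq> 0" by (auto simp: C_def)
      then show ?thesis unfolding inf_stabilizer_iff by blast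
    qed
    then show ?thesis by (simp add: \<psi>_def y0 lc_def)
  qed
  have V0: "0 \<in> V" using Nk(1)[OF N(3)] \<psi>0 by simp
  obtain r where r: "r > 0" "ball 0 r \<subseteq> V" using N(4) V0 open_contains_ball by blast
  \<comment> \<open>A vector whose coordinates are all smaller than \<epsilon> has norm at most \<open>\<epsilon> * M\<close>.\<close>
  define M where "M = (\<Sum>s\<in>S. norm (e s) + norm (f s)) + (\<Sum>u\<in>R'. norm (g u)) + 1"
  have M: "M \<ge> 1" unfolding M_def by (simp add: sum_nonneg)
  define \<epsilon> where "\<epsilon> = r / (2 * M)"
  have \<epsilon>: "\<epsilon> > 0" "\<epsilon> * M < r" using r M by (auto simp: \<epsilon>_def)
  define B where "B = {x. (\<forall>s\<in>S. norm (\<zeta> s x) < \<epsilon>) \<and> (\<forall>u\<in>R'. \<bar>\<omega> u x\<bar> < \<epsilon>) \<and> norm (x - proj J x) < \<epsilon>}"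
  have oB: "open B"
  proof -
    have "open {x. norm (\<zeta> s x) < \<epsilon>}" if "s \<in> S" for s
      using linS(1)[OF that] by (intro open_Collect_less continuous_intros) (simp add: linear_continuous_on linear_conv_bounded_linear)
    moreover have "open {x. \<bar>\<omega> u x\<bar> < \<epsilon>}" if "u \<in> R'" for u
      using linS(2)[OF that] by (intro open_Collect_less continuous_intros) (simp add: linear_continuous_on linear_conv_bounded_linear)
    moreover have "open {x. norm (x - proj J x) < \<epsilon>}"
      by (intro open_Collect_less continuous_intros continuous_on_proj)
    moreover have "B = (\<Inter>s\<in>S. {x. norm (\<zeta> s x) < \<epsilon>}) \<inter> (\<Inter>u\<in>R'. {x. \<bar>\<omega> u x\<bar> < \<epsilon>}) \<inter> {x. norm (x - proj J x) < \<epsilon>}"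
      by (auto simp: B_def)
    ultimately show ?thesis using S(3,4) by (auto intro!: open_Int open_INT)
  qed
  have BV: "x \<in> V" if x: "x \<in> B" for x
  proof -
    have "norm (\<Sum>s\<in>S. Re (\<zeta> s x) *\<^sub>R e s + Im (\<zeta> s x) *\<^sub>R f s) \<le> (\<Sum>s\<in>S. \<epsilon> * (norm (e s) + norm (f s)))"
    proof (rule sum_norm_le)
      fix s assume "s \<in> S"
      then have "norm (\<zeta> s x) \<le> \<epsilon>" using x by (auto simp: B_def less_imp_le)
      then have "\<bar>Re (\<zeta> s x)\<bar> \<le> \<epsilon>" "\<bar>Im (\<zeta> s x)\<bar> \<le> \<epsilon>"
        using abs_Re_le_cmod[of "\<zeta> s x"] abs_Im_le_cmod[of "\<zeta> s x"] by linarith+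
      then have "\<bar>Re (\<zeta> s x)\<bar> * norm (e s) + \<bar>Im (\<zeta> s x)\<bar> * norm (f s) \<le> \<epsilon> * norm (e s) + \<epsilon> * norm (f s)"
        by (intro add_mono mult_right_mono) auto
      then show "norm (Re (\<zeta> s x) *\<^sub>R e s + Im (\<zeta> s x) *\<^sub>R f s) \<le> \<epsilon> * (norm (e s) + norm (f s))"
        using norm_triangle_ineq[of "Re (\<zeta> s x) *\<^sub>R e s" "Im (\<zeta> s x) *\<^sub>R f s"] by (simp add: distrib_left)
    qed
    moreover have "norm (\<Sum>u\<in>R'. \<omega> u x *\<^sub>R g u) \<le> (\<Sum>u\<in>R'. \<epsilon> * norm (g u))"
      by (rule sum_norm_le) (use x in \<open>auto simp: B_def intro!: mult_right_mono intro: order.strict_implies_order\<close>)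
    moreover have "norm (x - proj J x) \<le> \<epsilon>" using x by (simp add: B_def)
    ultimately have "norm (lc (\<lambda>s. \<zeta> s x) (\<lambda>u. \<omega> u x) + (x - proj J x)) \<le> \<epsilon> * M"
      unfolding lc_def M_def distrib_left sum_distrib_left mult_1_right
      by (intro norm_triangle_le add_mono)
    then show ?thesis using split[of x] \<epsilon>(2) r(2) by (auto simp: subset_iff)
  qed
  define \<tau> where "\<tau> x = cpar J c (k x)" for x
  define W where "W = fst c \<inter> snd c -` (N \<inter> \<psi> -` B)"
  have oN: "open (N \<inter> \<psi> -` B)"
    by (rule continuous_open_preimage[OF continuous_on_subset[OF Cinf_continuous[OF C\<psi>] N(2)] N(1) oB])
  have B0: "0 \<in> B"
    using \<epsilon> linear_0[OF linS(1)] linear_0[OF linS(2)] linear_0[OF lp] by (auto simp: B_def)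
  show ?thesis
  proof (rule that[of S \<zeta> e f B \<tau> W "\<lambda>q. \<psi> (snd c q)"])
    show "eqv I (fst s) (snd s)" if "s \<in> S" for s using S(1) that by (auto simp: C_def)
    show "t *\<^sub>R x \<in> B" if x: "x \<in> B" and t: "t \<in> {0..1}" for x t
    proof -
      have le: "t * a < \<epsilon>" if "0 \<le> a" "a < \<epsilon>" for a
        using that t mult_left_le_one_le[of a t] by auto
      show ?thesis
        using x t linear_scale[OF linS(1)] linear_scale[OF linS(2)]
        by (auto simp: B_def abs_mult linear_scale[OF lp] scaleR_diff_right[symmetric] intro!: le)
    qed
    show "x - t *\<^sub>R (Re (\<zeta> s x) *\<^sub>R e s + Im (\<zeta> s x) *\<^sub>R f s) \<in> B" (is "?x \<in> B")
      if x: "x \<in> B" and s: "s \<in> S" and t: "t \<in> {0..1}" for x s t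
    proof -
      have "norm (\<zeta> s' ?x) < \<epsilon>" if s': "s' \<in> S" for s'
      proof (cases "s' = s")
        case True
        note l = linS(1)[OF s]
        have "\<zeta> s ?x = \<zeta> s x - t *\<^sub>R (Re (\<zeta> s x) *\<^sub>R 1 + Im (\<zeta> s x) *\<^sub>R \<i>)"
          using \<zeta>(1,2)[OF s, of s] by (simp only: linear_diff[OF l] linear_scale[OF l] linear_add[OF l] simp_thms if_True)
        also have "\<dots> = (1 - t) *\<^sub>R \<zeta> s x" by (simp add: complex_eq_iff algebra_simps)
        finally have "norm (\<zeta> s ?x) = (1 - t) * norm (\<zeta> s x)" using t by simp
        moreover have "norm (\<zeta> s x) < \<epsilon>" using x s by (simp add: B_def)
        ultimately show ?thesis using t True mult_left_le_one_le[of "norm (\<zeta> s x)" "1 - t"] by simp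
      next
        case False
        note l = linS(1)[OF s']
        have "\<zeta> s' ?x = \<zeta> s' x"
          using \<zeta>(1,2)[OF s', of s] False by (simp add: linear_diff[OF l] linear_scale[OF l] linear_add[OF l])
        then show ?thesis using x s' by (simp add: B_def)
      qed
      moreover have "\<omega> u ?x = \<omega> u x" if "u \<in> R'" for u
        using \<omega>(1,2)[OF that] by (simp add: linear_diff[OF linS(2)[OF that]] linear_scale[OF linS(2)[OF that]] linear_add[OF linS(2)[OF that]])
      moreover have "?x - proj J ?x = x - proj J x"
        using ef by (simp add: linear_diff[OF lp] linear_scale[OF lp] linear_add[OF lp] proj_id)
      then have "norm (?x - proj J ?x) < \<epsilon>" using x by (simp only: B_def mem_Collect_eq)
      ultimately show ?thesis using x unfolding B_def mem_Collect_eq by simp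
    qed
    show "\<tau> 0 = p" using Nk(2)[OF N(3)] \<psi>0 y0 by (simp add: \<tau>_def)
    show "Cinf B (\<lambda>x. u (\<tau> x))" if "msmooth u" for u :: "'m \<Rightarrow> real"
      unfolding \<tau>_def
      by (rule Cinf_compose[OF msmooth_Cinf[OF that c(1)] Cinf_subset[OF N(6)] oB]) (use BV Vk N(2) in auto)
    show z\<tau>: "snd s (\<tau> x) = \<zeta> s x" if "s \<in> S" "x \<in> B" for s x
      using z_psi[OF that(1), of "k x"] Vk(2)[OF BV[OF that(2)]] by (simp add: \<tau>_def)
    show "\<xi> \<in> inf_stabilizer I \<A> act (\<tau> x)"
      if \<xi>: "\<xi> \<in> ?h" and x: "x \<in> B" and 0: "\<forall>s\<in>S. fst s \<bullet> \<xi> = 0 \<or> \<zeta> s x = 0" for \<xi> x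
    proof -
      note kx = Vk(1)[OF BV[OF x]]
      have y: "k x \<in> cdom J c" using kx N(2) by blast
      note gt = gf_tangent[OF hc(1)[OF \<xi>]]
      obtain w where w: "w \<in> ?V" "\<And>f. msmooth f \<Longrightarrow> gf \<xi> (\<tau> x) f = frechet_derivative (\<lambda>y. f (cpar J c y)) (at (k x)) w"
        using tangent_repr[OF gt c(1) y] unfolding \<tau>_def by metis
      have 1: "frechet_derivative (\<lambda>y. snd s (cpar J c y)) (at (k x)) w = 0" if s: "s \<in> S" for s
      proof -
        have "eqv I (fst s) (snd s)" using S(1) s by (auto simp: C_def)
        then have "vc (gf \<xi> (\<tau> x)) (snd s) = 0"
          using bspec[OF 0 s] z\<tau>[OF s x] by (auto simp: vc_gf[OF _ hc(1)[OF \<xi>]])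
        then show ?thesis using vc_repr[OF c(1) y smS(1)[OF s] w(2)] by simp
      qed
      have 2: "frechet_derivative (\<lambda>y. u (cpar J c y)) (at (k x)) w = 0" if u: "u \<in> R'" for u
        using w(2)[OF smS(2)[OF u]] S(2) u \<xi> by (auto simp: R_def)
      have "frechet_derivative \<psi> (at (k x)) w = 0"
        unfolding D\<psi>[OF y] lc_def using 1 2 by (simp add: proj_id[OF w(1)])
      also have "\<dots> = frechet_derivative \<psi> (at (k x)) 0"
        using linear_0[OF has_derivative_linear[OF Cinf_has_derivative[OF C\<psi> y]]] by simp
      finally have "w = 0" by (rule injD[OF N(7)[OF kx]])
      have "gf \<xi> (\<tau> x) f = 0" for f
      proof (cases "msmooth f")
        case True
        then show ?thesis
          using w(2)[OF True] linear_0[OF has_derivative_linear[OF Cinf_has_derivative[OF msmooth_Cinf[OF True c(1)] y]]]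
          by (simp add: \<open>w = 0\<close>)
      qed (simp add: tan_not_smooth[OF gt])
      then show ?thesis using hc(1)[OF \<xi>] by (simp add: inf_stabilizer_def fun_eq_iff)
    qed
    show "open W" unfolding W_def by (rule open_chart_preimage[OF c(1) oN])
    show "p \<in> W" using c(2) N(3) \<psi>0 B0 by (simp add: W_def y0_def)
    show "\<psi> (snd c q) \<in> B" if "q \<in> W" for q using that by (simp add: W_def)
    show "\<tau> (\<psi> (snd c q)) = q" if "q \<in> W" for q
      using that Nk(2)[of "snd c q"] cpar_chart[OF c(1)] by (simp add: W_def \<tau>_def)
    show "smooth_at (\<lambda>q. \<psi> (snd c q)) q" if "q \<in> W" for q
    proof -
      have q: "q \<in> fst c" using that by (simp add: W_def)
      show ?thesis by (rule smooth_at_chart_function[OF c(1) q open_cdom[OF c(1)] chart_in_cdom[OF c(1) q] C\<psi>])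
    qed
  qed (use S(3) linS \<zeta> oB B0 in auto)
qed

end

section \<open>Decomposition along weights\<close>

text \<open>In the case that matters, \<open>T\<close> is empty and \<open>S\<close> is everything. For \<xi> in \<open>h\<close>, the function $\langle\theta, \xi\rangle$ vanishes where all coordinates
  with $\langle\beta_s, \xi\rangle \neq 0$ vanish, and the claim is that it lies in the ideal generated
  by the functions $\langle\beta_s, \xi\rangle z_s$ and $\langle\beta_s, \xi\rangle \bar z_s$, with
  coefficients that do not depend on \<xi>.

  The induction treats the coordinates one at a time. The set \<open>S\<close> contains those still to be treated,
  and \<theta> vanishes whenever one of the coordinates in \<open>T\<close> does. For a coordinate \<open>s\<close> in \<open>S\<close>, split \<theta>
  into its restriction to the hyperplane $z_s = 0$, which leaves \<open>s\<close> out altogether, and the rest,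
  which vanishes for $z_s = 0$ and so has \<open>s\<close> moved to \<open>T\<close>. At the end \<open>S\<close> is empty, the values of \<theta>
  are combinations of the \<open>\<beta> t\<close> with \<open>t\<close> in \<open>T\<close>, and each coefficient is divisible by its coordinate
  by Hadamard's lemma.\<close>

lemma weight_decomposition:
  fixes B :: "'a::euclidean_space set" and Z :: "'s \<Rightarrow> 'a \<Rightarrow> complex" and e f :: "'s \<Rightarrow> 'a"
    and \<beta> :: "'s \<Rightarrow> 'v::euclidean_space" and \<theta> :: "'a \<Rightarrow> 'v"
  assumes fin: "finite S0"
    and lin: "\<And>s. s \<in> S0 \<Longrightarrow> linear (Z s)"
    and Ze: "\<And>s s'. s \<in> S0 \<Longrightarrow> Z s (e s') = (if s = s' then 1 else 0)"
    and Zf: "\<And>s s'. s \<in> S0 \<Longrightarrow> Z s (f s') = (if s = s' then \<i> else 0)"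
    and B: "open B"
    and shrink: "\<And>x s t. x \<in> B \<Longrightarrow> s \<in> S0 \<Longrightarrow> t \<in> {0..1} \<Longrightarrow>
       x - t *\<^sub>R (Re (Z s x) *\<^sub>R e s + Im (Z s x) *\<^sub>R f s) \<in> B"
    and h: "subspace h"
    and S: "S \<subseteq> S0" "T \<subseteq> S0" "S \<inter> T = {}"
    and \<theta>: "Cinf B \<theta>"
      "\<And>x t \<xi>. x \<in> B \<Longrightarrow> t \<in> T \<Longrightarrow> Z t x = 0 \<Longrightarrow> \<xi> \<in> h \<Longrightarrow> \<theta> x \<bullet> \<xi> = 0"
      "\<And>x \<xi>. x \<in> B \<Longrightarrow> \<xi> \<in> h \<Longrightarrow> \<forall>s\<in>S. Z s x \<noteq> 0 \<longrightarrow> \<beta> s \<bullet> \<xi> = 0 \<Longrightarrow> \<forall>t\<in>T. \<beta> t \<bullet> \<xi> = 0 \<Longrightarrow> \<theta> x \<bullet> \<xi> = 0"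
  shows "\<exists>b c. (\<forall>s\<in>S0. Cinf B (b s) \<and> Cinf B (c s)) \<and>
    (\<forall>x\<in>B. \<forall>\<xi>\<in>h. \<theta> x \<bullet> \<xi> = (\<Sum>s\<in>S0. (\<beta> s \<bullet> \<xi>) * (b s x * Re (Z s x) + c s x * Im (Z s x))))"
proof -
  \<comment> \<open>The projection along the \<open>s\<close>-th complex coordinate, onto the set of its zeros.\<close>
  define r where "r s x = x - (Re (Z s x) *\<^sub>R e s + Im (Z s x) *\<^sub>R f s)" for s x
  have rB: "r s x \<in> B" if "x \<in> B" "s \<in> S0" for s x
    using shrink[OF that, of 1] by (simp add: r_def)
  have Zr: "Z s' (r s x) = (if s' = s then 0 else Z s' x)" if "s' \<in> S0" for s s' x
    using Ze[OF that, of s] Zf[OF that, of s] complex_eq[of "Z s x"]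
    by (auto simp: r_def linear_diff[OF lin[OF that]] linear_add[OF lin[OF that]] linear_scale[OF lin[OF that]]
        scaleR_conv_of_real mult.commute)
  have CZ: "Cinf B (\<lambda>x. Re (Z s x))" "Cinf B (\<lambda>x. Im (Z s x))" if "s \<in> S0" for s
  proof -
    have "bounded_linear (Z s)" using lin[OF that] by (simp add: linear_conv_bounded_linear)
    then show "Cinf B (\<lambda>x. Re (Z s x))" "Cinf B (\<lambda>x. Im (Z s x))"
      by (auto intro!: Cinf_bounded_linear bounded_linear_compose[OF bounded_linear_Re] bounded_linear_compose[OF bounded_linear_Im])
  qed
  have Cu: "Cinf B (\<lambda>x. Re (Z s x) *\<^sub>R e s + Im (Z s x) *\<^sub>R f s)" if "s \<in> S0" for s
    by (intro Cinf_add[OF B] Cinf_scaleR[OF B] CZ[OF that] Cinf_const)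
  have Cr: "Cinf B (r s)" if "s \<in> S0" for s
    using Cinf_diff[OF B Cinf_bounded_linear[OF bounded_linear_ident] Cu[OF that]] by (simp add: r_def[abs_def])
  have "finite S" using S(1) fin by (rule finite_subset)
  then show ?thesis using S \<theta>
  proof (induction S arbitrary: T \<theta> rule: finite_induct)
    case empty
    have T: "finite T" using empty.prems(2) fin by (rule finite_subset)
    obtain \<eta> where \<eta>: "\<And>t. t \<in> T \<Longrightarrow> \<eta> t \<in> h"
      "\<forall>\<theta>. (\<forall>\<xi>\<in>h. (\<forall>t\<in>T. \<beta> t \<bullet> \<xi> = 0) \<longrightarrow> \<theta> \<bullet> \<xi> = 0) \<longrightarrow>
         (\<forall>\<xi>\<in>h. \<theta> \<bullet> \<xi> = (\<Sum>t\<in>T. (\<beta> t \<bullet> \<xi>) * (\<theta> \<bullet> \<eta> t)))"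
      using functionals_dual_family[OF T h, of \<beta>] by blast
    define D where "D v s x = (if s \<in> T then integral {0..1} (\<lambda>t. frechet_derivative (\<lambda>x. \<theta> x \<bullet> \<eta> s)
       (at (r s x + t *\<^sub>R (Re (Z s x) *\<^sub>R e s + Im (Z s x) *\<^sub>R f s))) v) else 0)" for v s x
    have C\<theta>: "Cinf B (\<lambda>x. \<theta> x \<bullet> \<eta> s)" for s
      by (rule Cinf_bounded_linear_compose[OF bounded_linear_inner_left B empty.prems(4)])
    have seg: "r s x + t *\<^sub>R (Re (Z s x) *\<^sub>R e s + Im (Z s x) *\<^sub>R f s) \<in> B"
      if "x \<in> B" "s \<in> S0" "t \<in> {0..1}" for x s t
      using shrink[OF that(1,2), of "1 - t"] that(3) by (simp add: r_def algebra_simps)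
    have CD: "Cinf B (D v s)" if "s \<in> S0" for v s
    proof (cases "s \<in> T")
      case True
      have "Cinf B (\<lambda>x. integral {0..1} (\<lambda>t. frechet_derivative (\<lambda>x. \<theta> x \<bullet> \<eta> s)
          (at (r s x + t *\<^sub>R (Re (Z s x) *\<^sub>R e s + Im (Z s x) *\<^sub>R f s))) v))"
        by (rule Cinf_segment_integral[OF B C\<theta> Cr[OF that] Cu[OF that] seg[OF _ that]])
      with True show ?thesis by (simp add: D_def[abs_def])
    qed (simp add: D_def[abs_def] Cinf_const)
    have "\<theta> x \<bullet> \<xi> = (\<Sum>s\<in>S0. (\<beta> s \<bullet> \<xi>) * (D (e s) s x * Re (Z s x) + D (f s) s x * Im (Z s x)))"
      if x: "x \<in> B" and \<xi>: "\<xi> \<in> h" for x \<xi>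
    proof -
      have had: "\<theta> x \<bullet> \<eta> s = D (e s) s x * Re (Z s x) + D (f s) s x * Im (Z s x)" if s: "s \<in> T" for s
      proof -
        have s0: "s \<in> S0" using s empty.prems(2) by blast
        let ?u = "Re (Z s x) *\<^sub>R e s + Im (Z s x) *\<^sub>R f s"
        have u: "?u = (\<Sum>i\<in>UNIV. (if i then Re (Z s x) else Im (Z s x)) *\<^sub>R (if i then e s else f s))"
          by (simp add: UNIV_bool add.commute)
        have "\<theta> (r s x + ?u) \<bullet> \<eta> s = \<theta> (r s x) \<bullet> \<eta> s + (\<Sum>i\<in>UNIV. (if i then Re (Z s x) else Im (Z s x)) *\<^sub>R
            integral {0..1} (\<lambda>t. frechet_derivative (\<lambda>x. \<theta> x \<bullet> \<eta> s) (at (r s x + t *\<^sub>R ?u)) (if i then e s else f s)))"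
          by (rule segment_integral[OF B C\<theta> seg[OF x s0] u]) auto
        moreover have "\<theta> (r s x) \<bullet> \<eta> s = 0"
          by (rule empty.prems(5)[OF rB[OF x s0] s _ \<eta>(1)[OF s]]) (simp add: Zr[OF s0])
        moreover have "r s x + ?u = x" by (simp add: r_def)
        ultimately show ?thesis using s by (simp add: UNIV_bool D_def mult.commute add.commute)
      qed
      have "\<forall>\<xi>\<in>h. (\<forall>t\<in>T. \<beta> t \<bullet> \<xi> = 0) \<longrightarrow> \<theta> x \<bullet> \<xi> = 0" using empty.prems(6)[OF x] by blast
      then have "\<theta> x \<bullet> \<xi> = (\<Sum>t\<in>T. (\<beta> t \<bullet> \<xi>) * (\<theta> x \<bullet> \<eta> t))" using \<eta>(2) \<xi> by blast
      also have "\<dots> = (\<Sum>s\<in>T. (\<beta> s \<bullet> \<xi>) * (D (e s) s x * Re (Z s x) + D (f s) s x * Im (Z s x)))"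
        by (rule sum.cong) (simp_all add: had)
      also have "\<dots> = (\<Sum>s\<in>S0. (\<beta> s \<bullet> \<xi>) * (D (e s) s x * Re (Z s x) + D (f s) s x * Im (Z s x)))"
        by (rule sum.mono_neutral_left[OF fin empty.prems(2)]) (simp add: D_def)
      finally show ?thesis .
    qed
    with CD show ?case
      by - (rule exI[of _ "\<lambda>s. D (e s) s"], rule exI[of _ "\<lambda>s. D (f s) s"], blast)
  next
    case (insert s S)
    have s: "s \<in> S0" "S \<subseteq> S0" "s \<notin> T" "S \<inter> T = {}" "S \<inter> insert s T = {}" "insert s T \<subseteq> S0"
      using insert.prems insert.hyps by auto
    have ts: "t \<noteq> s" "t \<in> S0" if "t \<in> T" for t using that s(3) insert.prems(2) by auto
    have Ss: "t \<noteq> s" "t \<in> S0" if "t \<in> S" for t using that s(2) insert.hyps by auto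
    have C1: "Cinf B (\<lambda>x. \<theta> (r s x))"
      by (rule Cinf_compose[OF insert.prems(4) Cr[OF s(1)] B]) (use rB s(1) in auto)
    \<comment> \<open>the part that does not depend on the coordinate \<open>s\<close>\<close>
    have "\<exists>b c. (\<forall>s\<in>S0. Cinf B (b s) \<and> Cinf B (c s)) \<and>
      (\<forall>x\<in>B. \<forall>\<xi>\<in>h. \<theta> (r s x) \<bullet> \<xi> = (\<Sum>s\<in>S0. (\<beta> s \<bullet> \<xi>) * (b s x * Re (Z s x) + c s x * Im (Z s x))))"
    proof (rule insert.IH[OF s(2) insert.prems(2) s(4) C1])
      fix x t \<xi> assume "x \<in> B" "t \<in> T" "Z t x = 0" "\<xi> \<in> h"
      then show "\<theta> (r s x) \<bullet> \<xi> = 0"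
        using insert.prems(5)[OF rB[OF _ s(1)], of x t \<xi>] Zr[OF ts(2), of t s x] by simp
    next
      fix x \<xi> assume x: "x \<in> B" and \<xi>: "\<xi> \<in> h" and a: "\<forall>s\<in>S. Z s x \<noteq> 0 \<longrightarrow> \<beta> s \<bullet> \<xi> = 0" "\<forall>t\<in>T. \<beta> t \<bullet> \<xi> = 0"
      show "\<theta> (r s x) \<bullet> \<xi> = 0"
        by (rule insert.prems(6)[OF rB[OF x s(1)] \<xi> _ a(2)]) (use a(1) Zr s Ss in auto)
    qed
    then obtain b c where bc: "\<And>s. s \<in> S0 \<Longrightarrow> Cinf B (b s)" "\<And>s. s \<in> S0 \<Longrightarrow> Cinf B (c s)"
      "\<And>x \<xi>. x \<in> B \<Longrightarrow> \<xi> \<in> h \<Longrightarrow> \<theta> (r s x) \<bullet> \<xi> = (\<Sum>s\<in>S0. (\<beta> s \<bullet> \<xi>) * (b s x * Re (Z s x) + c s x * Im (Z s x)))"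
      by blast
    \<comment> \<open>the part that vanishes with the coordinate \<open>s\<close>\<close>
    have "\<exists>b c. (\<forall>s\<in>S0. Cinf B (b s) \<and> Cinf B (c s)) \<and>
      (\<forall>x\<in>B. \<forall>\<xi>\<in>h. (\<theta> x - \<theta> (r s x)) \<bullet> \<xi> = (\<Sum>s\<in>S0. (\<beta> s \<bullet> \<xi>) * (b s x * Re (Z s x) + c s x * Im (Z s x))))"
    proof (rule insert.IH[OF s(2) s(6) s(5) Cinf_diff[OF B insert.prems(4) C1]])
      fix x t \<xi> assume x: "x \<in> B" and t: "t \<in> insert s T" and Z: "Z t x = 0" and \<xi>: "\<xi> \<in> h"
      show "(\<theta> x - \<theta> (r s x)) \<bullet> \<xi> = 0"
      proof (cases "t = s")
        case True
        then have "r s x = x" using Z by (simp add: r_def)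
        then show ?thesis by simp
      next
        case False
        then have tT: "t \<in> T" using t by simp
        then show ?thesis
          using insert.prems(5)[OF x tT Z \<xi>] insert.prems(5)[OF rB[OF x s(1)] tT _ \<xi>] Zr[OF ts(2)[OF tT], of s x] Z False
          by (simp add: inner_diff_left)
      qed
    next
      fix x \<xi> assume x: "x \<in> B" and \<xi>: "\<xi> \<in> h" and a: "\<forall>s\<in>S. Z s x \<noteq> 0 \<longrightarrow> \<beta> s \<bullet> \<xi> = 0" "\<forall>t\<in>insert s T. \<beta> t \<bullet> \<xi> = 0"
      have "\<theta> x \<bullet> \<xi> = 0" by (rule insert.prems(6)[OF x \<xi>]) (use a in auto)
      moreover have "\<theta> (r s x) \<bullet> \<xi> = 0"
        by (rule insert.prems(6)[OF rB[OF x s(1)] \<xi>]) (use a Zr s Ss in auto)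
      ultimately show "(\<theta> x - \<theta> (r s x)) \<bullet> \<xi> = 0" by (simp add: inner_diff_left)
    qed
    then obtain b' c' where bc': "\<And>s. s \<in> S0 \<Longrightarrow> Cinf B (b' s)" "\<And>s. s \<in> S0 \<Longrightarrow> Cinf B (c' s)"
      "\<And>x \<xi>. x \<in> B \<Longrightarrow> \<xi> \<in> h \<Longrightarrow> (\<theta> x - \<theta> (r s x)) \<bullet> \<xi> = (\<Sum>s\<in>S0. (\<beta> s \<bullet> \<xi>) * (b' s x * Re (Z s x) + c' s x * Im (Z s x)))"
      by blast
    show ?case
    proof (rule exI[of _ "\<lambda>s x. b s x + b' s x"], rule exI[of _ "\<lambda>s x. c s x + c' s x"], intro conjI ballI)
      fix x \<xi> assume x: "x \<in> B" and \<xi>: "\<xi> \<in> h"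
      have "\<theta> x \<bullet> \<xi> = \<theta> (r s x) \<bullet> \<xi> + (\<theta> x - \<theta> (r s x)) \<bullet> \<xi>" by (simp add: inner_diff_left)
      also have "\<dots> = (\<Sum>s\<in>S0. (\<beta> s \<bullet> \<xi>) * ((b s x + b' s x) * Re (Z s x) + (c s x + c' s x) * Im (Z s x)))"
        unfolding bc(3)[OF x \<xi>] bc'(3)[OF x \<xi>] by (simp add: sum.distrib[symmetric] algebra_simps)
      finally show "\<theta> x \<bullet> \<xi> = (\<Sum>s\<in>S0. (\<beta> s \<bullet> \<xi>) * ((b s x + b' s x) * Re (Z s x) + (c s x + c' s x) * Im (Z s x)))" .
    qed (auto intro: Cinf_add[OF B] bc bc')
  qed
qed

context torus_manifold begin

section \<open>Local consequences of linear coordinates\<close>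

text \<open>In linear coordinates at \<open>p\<close> the zeros of the generating field of \<xi> contain with each point the
  segment to \<open>p\<close>, along which the derivative of \<Phi> vanishes.\<close>

lemma constant_on_zeros_near:
  fixes \<Phi> :: "'m \<Rightarrow> real"
  assumes \<Phi>: "msmooth \<Phi>" and \<xi>: "\<xi> \<in> inf_stabilizer I \<A> act p"
    and 0: "\<And>m v. \<xi> \<in> inf_stabilizer I \<A> act m \<Longrightarrow> v \<in> tangent_space \<A> m \<Longrightarrow> v \<Phi> = 0"
  obtains W where "open W" "p \<in> W" "\<And>q. q \<in> W \<Longrightarrow> \<xi> \<in> inf_stabilizer I \<A> act q \<Longrightarrow> \<Phi> q = \<Phi> p"
proof -
  obtain S Z and e f :: "_ \<Rightarrow> real^'n" and B \<tau> W \<kappa> where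
    S: "finite S" "\<And>s. s \<in> S \<Longrightarrow> eqv I (fst s) (snd s)" "\<And>s. s \<in> S \<Longrightarrow> linear (Z s)"
    "\<And>s s'. s \<in> S \<Longrightarrow> Z s (e s') = (if s = s' then 1 else 0)"
    "\<And>s s'. s \<in> S \<Longrightarrow> Z s (f s') = (if s = s' then \<i> else 0)"
    and B: "open B" "0 \<in> B" "\<And>x t. x \<in> B \<Longrightarrow> t \<in> {0..1} \<Longrightarrow> t *\<^sub>R x \<in> B"
    "\<And>x s t. x \<in> B \<Longrightarrow> s \<in> S \<Longrightarrow> t \<in> {0..1} \<Longrightarrow>
       x - t *\<^sub>R (Re (Z s x) *\<^sub>R e s + Im (Z s x) *\<^sub>R f s) \<in> B"
    and \<tau>: "\<tau> 0 = p" "\<And>u :: 'm \<Rightarrow> real. msmooth u \<Longrightarrow> Cinf B (\<lambda>x. u (\<tau> x))"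
    "\<And>s x. s \<in> S \<Longrightarrow> x \<in> B \<Longrightarrow> snd s (\<tau> x) = Z s x"
    "\<And>\<xi> x. \<xi> \<in> inf_stabilizer I \<A> act p \<Longrightarrow> x \<in> B \<Longrightarrow> \<forall>s\<in>S. fst s \<bullet> \<xi> = 0 \<or> Z s x = 0 \<Longrightarrow>
       \<xi> \<in> inf_stabilizer I \<A> act (\<tau> x)"
    and W: "open W" "p \<in> W" "\<And>q. q \<in> W \<Longrightarrow> \<kappa> q \<in> B" "\<And>q. q \<in> W \<Longrightarrow> \<tau> (\<kappa> q) = q"
      "\<And>q. q \<in> W \<Longrightarrow> smooth_at \<kappa> q"
    by (rule local_coordinates[of p]) (rule that)
  have "\<Phi> q = \<Phi> p" if q: "q \<in> W" "\<xi> \<in> inf_stabilizer I \<A> act q" for q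
  proof -
    define x where "x = \<kappa> q"
    have x: "x \<in> B" "\<tau> x = q" using W(3,4) q(1) by (auto simp: x_def)
    have zero: "fst s \<bullet> \<xi> = 0 \<or> Z s x = 0" if "s \<in> S" for s
      using q(2) S(2)[OF that] \<tau>(3)[OF that x(1)] x(2) unfolding inf_stabilizer_iff by metis
    have tB: "t *\<^sub>R x \<in> B" if "t \<in> {0..1}" for t using B(3)[OF x(1) that] .
    have stab: "\<xi> \<in> inf_stabilizer I \<A> act (\<tau> (t *\<^sub>R x))" if "t \<in> {0..1}" for t
      by (rule \<tau>(4)[OF \<xi> tB[OF that]]) (use zero linear_scale[OF S(3)] in auto)
    have D: "((\<lambda>t. \<Phi> (\<tau> (t *\<^sub>R x))) has_real_derivative 0) (at t within {0..1})" if t: "t \<in> {0..1}" for t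
    proof -
      let ?D = "\<lambda>u. frechet_derivative (\<lambda>x. u (\<tau> x)) (at (t *\<^sub>R x))"
      have "(\<lambda>f. if f \<in> C_infinity \<A> then ?D f x else 0) \<in> tangent_space \<A> (\<tau> (t *\<^sub>R x))"
        by (rule tangent_of_map) (use Cinf_has_derivative[OF \<tau>(2) tB[OF t]] in \<open>auto simp: differentiable_def\<close>)
      from 0[OF stab[OF t] this] have 0: "?D \<Phi> x = 0" using \<Phi> by (simp add: C_infinity_iff)
      have 1: "((\<lambda>t. t *\<^sub>R x) has_derivative (\<lambda>s. s *\<^sub>R x)) (at t)"
        by (auto intro!: derivative_eq_intros)
      have dd: "((\<lambda>x. \<Phi> (\<tau> x)) has_derivative ?D \<Phi>) (at (t *\<^sub>R x))"
        by (rule Cinf_has_derivative[OF \<tau>(2)[OF \<Phi>] tB[OF t]])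
      have "((\<lambda>t. \<Phi> (\<tau> (t *\<^sub>R x))) has_derivative (\<lambda>s. ?D \<Phi> (s *\<^sub>R x))) (at t)"
        using diff_chain_at[OF 1 dd] by (simp add: o_def)
      moreover have "?D \<Phi> (s *\<^sub>R x) = 0 * s" for s
        using linear_scale[OF has_derivative_linear[OF dd], of s x] 0 by simp
      ultimately have "((\<lambda>t. \<Phi> (\<tau> (t *\<^sub>R x))) has_derivative (\<lambda>s. 0 * s)) (at t)" by simp
      then have "((\<lambda>t. \<Phi> (\<tau> (t *\<^sub>R x))) has_real_derivative 0) (at t)"
        by (simp only: has_field_derivative_def)
      then show ?thesis by (rule has_field_derivative_at_within)
    qed
    have "\<exists>k. \<forall>t\<in>{0..1}. \<Phi> (\<tau> (t *\<^sub>R x)) = k"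
      by (rule has_field_derivative_zero_constant) (use D in auto)
    then obtain k where k: "\<And>t. t \<in> {0..1} \<Longrightarrow> \<Phi> (\<tau> (t *\<^sub>R x)) = k" by blast
    from k[of 0] k[of 1] show ?thesis using x(2) \<tau>(1) by simp
  qed
  then show ?thesis using that W by blast
qed

text \<open>The quotient $\phi / \bar z$, written without complex division.\<close>

lemma smooth_at_cdiv:
  assumes "smooth_at \<phi> q" "smooth_at z q" "z q \<noteq> (0::complex)"
  shows "smooth_at (\<lambda>q. of_real (\<phi> q) * (z q * of_real (inverse ((Re (z q))\<^sup>2 + (Im (z q))\<^sup>2)))) q"
proof -
  have r: "smooth_at (\<lambda>q. Re (z q)) q" "smooth_at (\<lambda>q. Im (z q)) q"
    by (rule smooth_at_linear[OF bounded_linear_Re assms(2)], rule smooth_at_linear[OF bounded_linear_Im assms(2)])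
  have n: "smooth_at (\<lambda>q. (Re (z q))\<^sup>2 + (Im (z q))\<^sup>2) q"
    unfolding power2_eq_square by (intro smooth_at_add smooth_at_mult r)
  have "(Re (z q))\<^sup>2 + (Im (z q))\<^sup>2 \<noteq> 0" using assms(3) by (simp add: complex_eq_iff sum_power2_eq_zero_iff)
  then have "smooth_at (\<lambda>q. inverse ((Re (z q))\<^sup>2 + (Im (z q))\<^sup>2)) q"
    by (intro smooth_at_compose[OF n _ _ Cinf_inverse]) (auto simp: open_Collect_neq)
  then show ?thesis
    by (intro smooth_at_mult smooth_at_linear[OF bounded_linear_of_real] assms)
qed

text \<open>On the stabilizer algebra of \<open>p\<close>, \<Theta> is handled by \<open>weight_decomposition\<close> with coordinates that
  vanish at \<open>p\<close>. The rest is handled with equivariant functions that do not vanish at \<open>p\<close>, whose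
  weights cut out this algebra.\<close>

lemma local_solution:
  fixes \<Theta> :: "'m \<Rightarrow> real^'k"
  assumes \<Theta>: "msmooth \<Theta>"
    and van: "\<And>m \<xi>. \<xi> \<in> inf_stabilizer I \<A> act m \<Longrightarrow> \<Theta> m \<bullet> \<xi> = 0"
  obtains F a N where "finite F" "\<And>s. s \<in> F \<Longrightarrow> eqv I (fst s) (snd s)" "\<And>s. s \<in> F \<Longrightarrow> msmooth (a s)"
    "open N" "p \<in> N" "\<And>q \<xi>. q \<in> N \<Longrightarrow> \<xi> \<in> coord_space I \<Longrightarrow>
       \<Theta> q \<bullet> \<xi> = (\<Sum>s\<in>F. (fst s \<bullet> \<xi>) * Re (\<i> * cnj (a s q) * snd s q))"
proof -
  let ?h = "inf_stabilizer I \<A> act p"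
  obtain S Z and e f :: "_ \<Rightarrow> real^'n" and B \<tau> W \<kappa> where
    S: "finite S" "\<And>s. s \<in> S \<Longrightarrow> eqv I (fst s) (snd s)" "\<And>s. s \<in> S \<Longrightarrow> linear (Z s)"
    "\<And>s s'. s \<in> S \<Longrightarrow> Z s (e s') = (if s = s' then 1 else 0)"
    "\<And>s s'. s \<in> S \<Longrightarrow> Z s (f s') = (if s = s' then \<i> else 0)"
    and B: "open B" "0 \<in> B" "\<And>x t. x \<in> B \<Longrightarrow> t \<in> {0..1} \<Longrightarrow> t *\<^sub>R x \<in> B"
    "\<And>x s t. x \<in> B \<Longrightarrow> s \<in> S \<Longrightarrow> t \<in> {0..1} \<Longrightarrow>
       x - t *\<^sub>R (Re (Z s x) *\<^sub>R e s + Im (Z s x) *\<^sub>R f s) \<in> B"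
    and \<tau>: "\<tau> 0 = p" "\<And>u :: 'm \<Rightarrow> real. msmooth u \<Longrightarrow> Cinf B (\<lambda>x. u (\<tau> x))"
    "\<And>s x. s \<in> S \<Longrightarrow> x \<in> B \<Longrightarrow> snd s (\<tau> x) = Z s x"
    "\<And>\<xi> x. \<xi> \<in> inf_stabilizer I \<A> act p \<Longrightarrow> x \<in> B \<Longrightarrow> \<forall>s\<in>S. fst s \<bullet> \<xi> = 0 \<or> Z s x = 0 \<Longrightarrow>
       \<xi> \<in> inf_stabilizer I \<A> act (\<tau> x)"
    and W: "open W" "p \<in> W" "\<And>q. q \<in> W \<Longrightarrow> \<kappa> q \<in> B" "\<And>q. q \<in> W \<Longrightarrow> \<tau> (\<kappa> q) = q"
      "\<And>q. q \<in> W \<Longrightarrow> smooth_at \<kappa> q"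
    by (rule local_coordinates[of p]) (rule that)
  have C\<theta>: "Cinf B (\<lambda>x. \<Theta> (\<tau> x))"
    by (rule Cinf_componentwise[OF B(1) \<tau>(2)[OF msmooth_linear[OF bounded_linear_inner_left \<Theta>]]])
  have "\<exists>b c. (\<forall>s\<in>S. Cinf B (b s) \<and> Cinf B (c s)) \<and>
    (\<forall>x\<in>B. \<forall>\<xi>\<in>?h. \<Theta> (\<tau> x) \<bullet> \<xi> = (\<Sum>s\<in>S. (fst s \<bullet> \<xi>) * (b s x * Re (Z s x) + c s x * Im (Z s x))))"
  proof (rule weight_decomposition[OF S(1,3,4,5) B(1,4) subspace_inf_stabilizer order_refl empty_subsetI Int_empty_right C\<theta>])
    fix x \<xi> assume "x \<in> B" "\<xi> \<in> ?h" "\<forall>s\<in>S. Z s x \<noteq> 0 \<longrightarrow> fst s \<bullet> \<xi> = 0"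
    then show "\<Theta> (\<tau> x) \<bullet> \<xi> = 0" by (intro van \<tau>(4)) auto
  qed auto
  then obtain b c where bc: "\<And>s. s \<in> S \<Longrightarrow> Cinf B (b s)" "\<And>s. s \<in> S \<Longrightarrow> Cinf B (c s)"
    "\<And>x \<xi>. x \<in> B \<Longrightarrow> \<xi> \<in> ?h \<Longrightarrow> \<Theta> (\<tau> x) \<bullet> \<xi> = (\<Sum>s\<in>S. (fst s \<bullet> \<xi>) * (b s x * Re (Z s x) + c s x * Im (Z s x)))"
    by blast
  \<comment> \<open>Chosen such that $\mathrm{Re}(i \bar a_1 z) = b \, \mathrm{Re}\, z + c \, \mathrm{Im}\, z$.\<close>
  define a1 where "a1 s q = of_real (- c s (\<kappa> q)) + \<i> * of_real (b s (\<kappa> q))" for s q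
  have a1: "smooth_at (a1 s) q" if "s \<in> S" "q \<in> W" for s q
  proof -
    have "smooth_at (\<lambda>q. c s (\<kappa> q)) q" "smooth_at (\<lambda>q. b s (\<kappa> q)) q"
      using bc(1,2)[OF that(1)] W(3,5)[OF that(2)] by (auto intro: smooth_at_compose[OF _ B(1)])
    then show ?thesis unfolding a1_def
      by (intro smooth_at_add smooth_at_mult smooth_at_const smooth_at_linear[OF bounded_linear_of_real] smooth_at_minus)
  qed
  have eq1: "\<Theta> q \<bullet> \<xi> = (\<Sum>s\<in>S. (fst s \<bullet> \<xi>) * Re (\<i> * cnj (a1 s q) * snd s q))" if "q \<in> W" "\<xi> \<in> ?h" for q \<xi>
  proof -
    have "b s (\<kappa> q) * Re (Z s (\<kappa> q)) + c s (\<kappa> q) * Im (Z s (\<kappa> q)) = Re (\<i> * cnj (a1 s q) * snd s q)" if "s \<in> S" for s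
      using \<tau>(3)[OF that W(3)[OF \<open>q \<in> W\<close>]] W(4)[OF \<open>q \<in> W\<close>] by (simp add: a1_def)
    then show ?thesis using bc(3)[OF W(3)[OF that(1)] that(2)] W(4)[OF that(1)] by simp
  qed
  define \<Theta>1 where "\<Theta>1 q = \<Theta> q - (\<Sum>s\<in>S. Re (\<i> * cnj (a1 s q) * snd s q) *\<^sub>R fst s)" for q
  have \<Theta>1: "smooth_at \<Theta>1 q" if q: "q \<in> W" for q
    unfolding \<Theta>1_def
  proof (intro smooth_at_diff smooth_at_sum smooth_at_scaleR smooth_at_const)
    show "smooth_at \<Theta> q" using \<Theta> by (simp add: msmooth_def)
    fix s assume s: "s \<in> S"
    have "smooth_at (snd s) q" using S(2)[OF s] by (simp add: eqv_def msmooth_def)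
    then show "smooth_at (\<lambda>q. Re (\<i> * cnj (a1 s q) * snd s q)) q"
      by (intro smooth_at_linear[OF bounded_linear_Re] smooth_at_mult smooth_at_const smooth_at_linear[OF bounded_linear_cnj] a1[OF s q])
  qed
  \<comment> \<open>What is left vanishes on the stabilizer algebra of \<open>p\<close>, the annihilator of the weights of
    equivariant functions that do not vanish at \<open>p\<close>.\<close>
  obtain F0 where F0: "finite F0" "F0 \<subseteq> {s. eqv I (fst s) (snd s) \<and> snd s p \<noteq> 0}"
    "\<And>\<xi>. (\<forall>s\<in>F0. fst s \<bullet> \<xi> = 0) \<Longrightarrow> (\<forall>s\<in>{s. eqv I (fst s) (snd s) \<and> snd s p \<noteq> 0}. fst s \<bullet> \<xi> = 0)"
    by (rule finite_subfamily_annihilator[where \<beta> = "fst :: (real^'k) \<times> ('m \<Rightarrow> complex) \<Rightarrow> _"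
        and Z = "{s. eqv I (fst s) (snd s) \<and> snd s p \<noteq> 0}"]) (rule that)
  have h0: "\<xi> \<in> ?h" if "\<xi> \<in> coord_space I" "\<forall>s\<in>F0. fst s \<bullet> \<xi> = 0" for \<xi>
    using that(1) F0(3)[OF that(2)] unfolding inf_stabilizer_iff by force
  obtain \<eta> where \<eta>: "\<forall>\<theta>. (\<forall>\<xi>\<in>coord_space I. (\<forall>s\<in>F0. fst s \<bullet> \<xi> = 0) \<longrightarrow> \<theta> \<bullet> \<xi> = 0) \<longrightarrow>
     (\<forall>\<xi>\<in>coord_space I. \<theta> \<bullet> \<xi> = (\<Sum>s\<in>F0. (fst s \<bullet> \<xi>) * (\<theta> \<bullet> \<eta> s)))"
    using functionals_dual_family[OF F0(1) subspace_coord_space[of I], of fst] by blast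
  have eq2: "\<Theta>1 q \<bullet> \<xi> = (\<Sum>s\<in>F0. (fst s \<bullet> \<xi>) * (\<Theta>1 q \<bullet> \<eta> s))" if "q \<in> W" "\<xi> \<in> coord_space I" for q \<xi>
  proof -
    have "\<Theta>1 q \<bullet> \<xi> = 0" if "\<xi> \<in> ?h" for \<xi>
      using eq1[OF \<open>q \<in> W\<close> that] by (simp add: \<Theta>1_def inner_diff_left inner_sum_left mult.commute)
    then show ?thesis using \<eta> h0 that(2) by blast
  qed
  \<comment> \<open>Chosen such that $\mathrm{Re}(i \bar a_2 z)$ is the coefficient of the weight in \<open>eq2\<close>.\<close>
  define a2 where "a2 s q = \<i> * (of_real (\<Theta>1 q \<bullet> \<eta> s) * (snd s q * of_real (inverse ((Re (snd s q))\<^sup>2 + (Im (snd s q))\<^sup>2))))" for s q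
  define W2 where "W2 = W \<inter> (\<Inter>s\<in>F0. snd s -` (- {0}))"
  have W2: "open W2" "p \<in> W2"
  proof -
    have "open (snd s -` (- {0}))" if "s \<in> F0" for s
      using F0(2) that continuous_open_preimage[OF continuous_on_msmooth[of "snd s"] open_UNIV, of "- {0}"]
      by (auto simp: eqv_def)
    then show "open W2" unfolding W2_def using F0(1) W(1) by (intro open_Int open_INT) auto
    show "p \<in> W2" using W(2) F0(2) by (auto simp: W2_def)
  qed
  have a2: "smooth_at (a2 s) q" if s: "s \<in> F0" and q: "q \<in> W2" for s q
  proof -
    have "smooth_at (snd s) q" using s F0(2) by (auto simp: eqv_def msmooth_def)
    moreover have "snd s q \<noteq> 0" using s q by (auto simp: W2_def)
    moreover have "smooth_at (\<lambda>q. \<Theta>1 q \<bullet> \<eta> s) q"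
      using q by (intro smooth_at_linear[OF bounded_linear_inner_left \<Theta>1]) (simp add: W2_def)
    ultimately show ?thesis unfolding a2_def
      by (intro smooth_at_mult[OF smooth_at_const smooth_at_cdiv])
  qed
  have eq3: "Re (\<i> * cnj (a2 s q) * snd s q) = \<Theta>1 q \<bullet> \<eta> s" if s: "s \<in> F0" and q: "q \<in> W2" for s q
  proof -
    have "snd s q \<noteq> 0" using s q by (auto simp: W2_def)
    then have "(Re (snd s q))\<^sup>2 + (Im (snd s q))\<^sup>2 \<noteq> 0" by (simp add: complex_eq_iff sum_power2_eq_zero_iff)
    then show ?thesis by (simp add: a2_def field_simps power2_eq_square)
  qed
  have disj: "S \<inter> F0 = {}"
  proof -
    have "snd s p = 0" if "s \<in> S" for s
      using \<tau>(3)[OF that B(2)] \<tau>(1) linear_0[OF S(3)[OF that]] by simp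
    then show ?thesis using F0(2) by auto
  qed
  define a0 where "a0 s q = (if s \<in> S then a1 s q else a2 s q)" for s q
  have "\<exists>g N. msmooth g \<and> open N \<and> p \<in> N \<and> N \<subseteq> W2 \<and> (\<forall>q\<in>N. g q = a0 s q)" if s: "s \<in> S \<union> F0" for s
  proof -
    have sm: "smooth_at (a0 s) q" if "q \<in> W2" for q
      using s a1[of s q] a2[of s q] that by (cases "s \<in> S") (auto simp: a0_def[abs_def] W2_def)
    obtain g N where "msmooth g" "open N" "p \<in> N" "N \<subseteq> W2" "\<And>q. q \<in> N \<Longrightarrow> g q = a0 s q"
      by (rule extend_smooth[OF W2 sm], assumption, rule that)
    then show ?thesis by blast
  qed
  then obtain a N where a: "\<And>s. s \<in> S \<union> F0 \<Longrightarrow> msmooth (a s) \<and> open (N s) \<and> p \<in> N s \<and> N s \<subseteq> W2 \<and> (\<forall>q\<in>N s. a s q = a0 s q)"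
    by metis
  show ?thesis
  proof (rule that[of "S \<union> F0" a "W2 \<inter> (\<Inter>s\<in>S \<union> F0. N s)"])
    show "eqv I (fst s) (snd s)" if "s \<in> S \<union> F0" for s using that S(2) F0(2) by auto
    show "open (W2 \<inter> (\<Inter>s\<in>S \<union> F0. N s))" using a S(1) F0(1) W2 by (intro open_Int open_INT) auto
    fix q \<xi> assume q: "q \<in> W2 \<inter> (\<Inter>s\<in>S \<union> F0. N s)" and \<xi>: "\<xi> \<in> coord_space I"
    have qW: "q \<in> W" using q by (auto simp: W2_def)
    have "\<Theta> q \<bullet> \<xi> = (\<Sum>s\<in>S. (fst s \<bullet> \<xi>) * Re (\<i> * cnj (a1 s q) * snd s q)) + \<Theta>1 q \<bullet> \<xi>"
      by (simp add: \<Theta>1_def inner_diff_left inner_sum_left mult.commute)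
    also have "(\<Sum>s\<in>S. (fst s \<bullet> \<xi>) * Re (\<i> * cnj (a1 s q) * snd s q)) = (\<Sum>s\<in>S. (fst s \<bullet> \<xi>) * Re (\<i> * cnj (a s q) * snd s q))"
      by (rule sum.cong) (use a q in \<open>auto simp: a0_def\<close>)
    also have "\<Theta>1 q \<bullet> \<xi> = (\<Sum>s\<in>F0. (fst s \<bullet> \<xi>) * Re (\<i> * cnj (a s q) * snd s q))"
      unfolding eq2[OF qW \<xi>]
    proof (rule sum.cong)
      fix s assume s: "s \<in> F0"
      then have "a s q = a2 s q" using a[of s] q disj by (auto simp: a0_def)
      then show "(fst s \<bullet> \<xi>) * (\<Theta>1 q \<bullet> \<eta> s) = (fst s \<bullet> \<xi>) * Re (\<i> * cnj (a s q) * snd s q)"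
        using eq3[OF s, of q] q by simp
    qed simp
    finally show "\<Theta> q \<bullet> \<xi> = (\<Sum>s\<in>S \<union> F0. (fst s \<bullet> \<xi>) * Re (\<i> * cnj (a s q) * snd s q))"
      using S(1) F0(1) disj by (simp add: sum.union_disjoint)
  qed (use S(1) F0(1) a W2 in auto)
qed

section \<open>Averaging and gluing\<close>

text \<open>An invariant function is an equivariant function of weight 0.\<close>

lemma exp_act_axis_invariant:
  fixes u :: "'m \<Rightarrow> real"
  assumes u: "msmooth u" "\<And>i t m. i \<in> I \<Longrightarrow> u (exp_act (t *\<^sub>R axis i 1) m) = u m" and \<xi>: "\<xi> \<in> coord_space I"
  shows "u (exp_act \<xi> m) = u m"
proof -
  have "eqv I 0 (\<lambda>q. complex_of_real (u q))"
    using u msmooth_linear[OF bounded_linear_of_real u(1)] by (simp add: eqv_def)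
  from eqv_exp_act[OF this \<xi>, of m] show ?thesis by simp
qed

text \<open>Multiply the local solution by a bump function \<open>u\<close>, and take Fourier coefficients: of weight 0 of \<open>u\<close>,
  and of the weight of \<open>z\<close> for the coefficient \<open>a\<close> of \<open>z\<close>. As \<Theta> is invariant, the identity persists;
  and \<open>u\<close> stays positive at \<open>p\<close> as an average of a nonnegative function.\<close>

lemma averaged_solution:
  fixes \<Theta> :: "'m \<Rightarrow> real^'k"
  assumes \<Theta>: "msmooth \<Theta>"
    and inv: "\<And>m \<xi>. \<xi> \<in> coord_space I \<Longrightarrow> \<Theta> (exp_act \<xi> m) = \<Theta> m"
    and van: "\<And>m \<xi>. \<xi> \<in> inf_stabilizer I \<A> act m \<Longrightarrow> \<Theta> m \<bullet> \<xi> = 0"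
  obtains F :: "((real^'k) \<times> ('m \<Rightarrow> complex)) set" and a and u :: "'m \<Rightarrow> real"
  where "finite F" "\<And>s. s \<in> F \<Longrightarrow> eqv I (fst s) (snd s)" "\<And>s. s \<in> F \<Longrightarrow> eqv I (fst s) (a s)"
    "msmooth u" "u p > 0" "\<And>m \<xi>. \<xi> \<in> coord_space I \<Longrightarrow> u (exp_act \<xi> m) = u m"
    "\<And>m \<xi>. \<xi> \<in> coord_space I \<Longrightarrow>
       u m * (\<Theta> m \<bullet> \<xi>) = (\<Sum>s\<in>F. (fst s \<bullet> \<xi>) * Re (\<i> * cnj (a s m) * snd s m))"
proof -
  obtain F :: "((real^'k) \<times> ('m \<Rightarrow> complex)) set" and a0 N where
    F: "finite F" "\<And>s. s \<in> F \<Longrightarrow> eqv I (fst s) (snd s)" "\<And>s. s \<in> F \<Longrightarrow> msmooth (a0 s)"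
    and N: "open N" "p \<in> N" "\<And>q \<xi>. q \<in> N \<Longrightarrow> \<xi> \<in> coord_space I \<Longrightarrow>
       \<Theta> q \<bullet> \<xi> = (\<Sum>s\<in>F. (fst s \<bullet> \<xi>) * Re (\<i> * cnj (a0 s q) * snd s q))"
    by (rule local_solution[OF \<Theta> van, of p], assumption) (rule that)
  obtain \<eta> :: "'m \<Rightarrow> real" and N1 where \<eta>: "msmooth \<eta>" "\<And>q. 0 \<le> \<eta> q \<and> \<eta> q \<le> 1" "p \<in> N1" "\<And>q. q \<in> N1 \<Longrightarrow> \<eta> q = 1"
    "\<And>q. q \<notin> N \<Longrightarrow> \<exists>N'. open N' \<and> q \<in> N' \<and> (\<forall>q'\<in>N'. \<eta> q' = 0)"
    by (rule bump[OF N(1,2)]) (rule that)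
  have out: "\<eta> q = 0" if "q \<notin> N" for q using \<eta>(5)[OF that] by blast
  \<comment> \<open>average over the circles in \<open>K\<close>, one after the other\<close>
  have "\<exists>a u. (\<forall>s\<in>F. eqv K (fst s) (a s)) \<and> msmooth u \<and> u p > (0::real) \<and> (\<forall>m. u m \<ge> 0) \<and>
      (\<forall>i\<in>K. \<forall>t m. u (exp_act (t *\<^sub>R axis i 1) m) = u m) \<and>
      (\<forall>m. \<forall>\<xi>\<in>coord_space I. u m * (\<Theta> m \<bullet> \<xi>) = (\<Sum>s\<in>F. (fst s \<bullet> \<xi>) * Re (\<i> * cnj (a s m) * snd s m)))"
    if "finite K" "K \<subseteq> I" for K
    using that
  proof (induction K rule: finite_induct)
    case empty
    define a where "a s q = of_real (\<eta> q) * a0 s q" for s q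
    have "eqv {} (fst s) (a s)" if "s \<in> F" for s
      using msmooth_mult[OF msmooth_linear[OF bounded_linear_of_real \<eta>(1)] F(3)[OF that]] by (simp add: eqv_def a_def[abs_def])
    moreover have "\<eta> m * (\<Theta> m \<bullet> \<xi>) = (\<Sum>s\<in>F. (fst s \<bullet> \<xi>) * Re (\<i> * cnj (a s m) * snd s m))"
      if \<xi>: "\<xi> \<in> coord_space I" for m \<xi>
    proof (cases "m \<in> N")
      case True
      have "Re (\<i> * cnj (a s m) * snd s m) = \<eta> m * Re (\<i> * cnj (a0 s m) * snd s m)" for s
        by (simp add: a_def algebra_simps)
      then show ?thesis using N(3)[OF True \<xi>] by (simp add: sum_distrib_left mult.left_commute)
    next
      case False
      then show ?thesis using out[OF False] by (simp add: a_def)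
    qed
    moreover have "\<eta> p > 0" using \<eta>(3,4) by simp
    ultimately show ?case using \<eta>(1,2) by (intro exI[of _ a] exI[of _ \<eta>]) auto
  next
    case (insert i K)
    have i: "i \<in> I" "K \<subseteq> I" using insert.prems by auto
    note ax = scale_coord[OF axis_coord[OF i(1), of 1]]
    obtain a u where a: "\<And>s. s \<in> F \<Longrightarrow> eqv K (fst s) (a s)" and u: "msmooth u" "u p > (0::real)" "\<And>m. u m \<ge> 0"
      "\<And>j t m. j \<in> K \<Longrightarrow> u (exp_act (t *\<^sub>R axis j 1) m) = u m"
      "\<And>m \<xi>. \<xi> \<in> coord_space I \<Longrightarrow> u m * (\<Theta> m \<bullet> \<xi>) = (\<Sum>s\<in>F. (fst s \<bullet> \<xi>) * Re (\<i> * cnj (a s m) * snd s m))"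
      using insert.IH[OF i(2)] by blast
    let ?w = "\<lambda>q. complex_of_real (u q)"
    have w: "msmooth ?w" by (rule msmooth_linear[OF bounded_linear_of_real u(1)])
    define u' where "u' m = Re (avg i 0 ?w m)" for m
    define a' where "a' s = avg i (fst s $ i) (a s)" for s
    have cont: "continuous_on {0..2*pi} (\<lambda>t. u (exp_act (t *\<^sub>R axis i 1) m))" for m
      by (rule continuous_on_subset[OF Cinf_continuous[OF Cinf_orbit[OF u(1) axis_coord[OF i(1)]]] subset_UNIV])
    have u': "u' m = (1 / (2*pi)) * integral {0..2*pi} (\<lambda>t. u (exp_act (t *\<^sub>R axis i 1) m))" for m
      using integral_linear[OF integrable_continuous_interval[OF cont[of m]] bounded_linear_of_real[where 'a = complex]]
      by (simp add: u'_def avg_def o_def)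
    have sm: "msmooth u'" unfolding u'_def by (rule msmooth_linear[OF bounded_linear_Re msmooth_avg[OF w i(1)]])
    have nonneg: "u' m \<ge> 0" for m
      unfolding u' using integral_nonneg[OF integrable_continuous_interval[OF cont[of m]]] u(3) by simp
    have pos: "u' p > 0"
    proof -
      have "integral {0..2*pi} (\<lambda>t. u (exp_act (t *\<^sub>R axis i 1) p)) \<noteq> 0"
      proof
        assume "integral {0..2*pi} (\<lambda>t. u (exp_act (t *\<^sub>R axis i 1) p)) = 0"
        then have "\<forall>t\<in>{0..2*pi}. u (exp_act (t *\<^sub>R axis i 1) p) = 0"
          using integral_eq_0_iff[OF cont[of p]] u(3) by simp
        from bspec[OF this, of 0] show False using u(2) by (simp add: exp_act_0)
      qed
      then have "u' p \<noteq> 0" by (simp add: u')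
      then show ?thesis using nonneg[of p] by simp
    qed
    have invu: "u' (exp_act (t *\<^sub>R axis j 1) m) = u' m" if "j \<in> insert i K" for j t m
    proof (cases "j = i")
      case True
      then show ?thesis using avg_equivariant[OF w i(1) Ints_0, of t m] by (simp add: u'_def)
    next
      case False
      then have j: "j \<in> K" using that by simp
      then have "t *\<^sub>R axis j 1 \<in> coord_space I" using i(2) by (intro scale_coord axis_coord) auto
      from avg_commute[OF i(1) this, of ?w 1 0 m] u(4)[OF j, of t] show ?thesis by (simp add: u'_def)
    qed
    have eqva: "eqv (insert i K) (fst s) (a' s)" if s: "s \<in> F" for s
    proof -
      have b: "fst s $ i \<in> \<int>" using F(2)[OF s] i(1) by (simp add: eqv_def)
      have "(\<chi> j. if j = i then fst s $ i else fst s $ j) = fst s" by (simp add: vec_eq_iff)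
      then show ?thesis using eqv_avg[OF a[OF s] i(2,1) insert.hyps(2) b] by (simp add: a'_def)
    qed
    have eq: "u' m * (\<Theta> m \<bullet> \<xi>) = (\<Sum>s\<in>F. (fst s \<bullet> \<xi>) * Re (\<i> * cnj (a' s m) * snd s m))"
      if \<xi>: "\<xi> \<in> coord_space I" for m \<xi>
    proof -
      let ?g = "\<lambda>t. exp_act (t *\<^sub>R axis i 1)"
      let ?L = "\<lambda>s c. Re (\<i> * cnj c * snd s m)"
      have L: "bounded_linear (?L s)" for s
        by (intro bounded_linear_compose[OF bounded_linear_Re] bounded_linear_mult_const bounded_linear_const_mult bounded_linear_cnj)
      let ?c = "\<lambda>s t. cis (- (t * fst s $ i)) * a s (?g t m)"
      have cc: "(\<lambda>t. ?c s t) integrable_on {0..2*pi}" if "s \<in> F" for s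
      proof -
        have "msmooth (a s)" using a[OF that] by (simp add: eqv_def)
        from continuous_on_subset[OF Cinf_continuous[OF Cinf_orbit[OF this axis_coord[OF i(1)]]] subset_UNIV]
        have "continuous_on {0..2*pi} (\<lambda>t. a s (?g t m))" .
        then show ?thesis by (intro integrable_continuous_interval continuous_intros)
      qed
      have pt: "u (?g t m) * (\<Theta> m \<bullet> \<xi>) = (\<Sum>s\<in>F. (fst s \<bullet> \<xi>) * ?L s (?c s t))" for t
      proof -
        have "u (?g t m) * (\<Theta> m \<bullet> \<xi>) = (\<Sum>s\<in>F. (fst s \<bullet> \<xi>) * Re (\<i> * cnj (a s (?g t m)) * snd s (?g t m)))"
          using u(5)[OF \<xi>, of "?g t m"] inv[OF ax] by simp
        also have "\<dots> = (\<Sum>s\<in>F. (fst s \<bullet> \<xi>) * ?L s (?c s t))"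
        proof (rule sum.cong)
          fix s assume s: "s \<in> F"
          have "snd s (?g t m) = cis (t * fst s $ i) * snd s m" using F(2)[OF s] i(1) by (simp add: eqv_def)
          moreover have "cnj (?c s t) = cis (t * fst s $ i) * cnj (a s (?g t m))" by (simp add: cis_cnj)
          ultimately show "(fst s \<bullet> \<xi>) * Re (\<i> * cnj (a s (?g t m)) * snd s (?g t m)) = (fst s \<bullet> \<xi>) * ?L s (?c s t)"
            by (simp only: mult.assoc mult.left_commute)
        qed simp
        finally show ?thesis .
      qed
      have "integral {0..2*pi} (\<lambda>t. u (?g t m)) * (\<Theta> m \<bullet> \<xi>) = integral {0..2*pi} (\<lambda>t. u (?g t m) * (\<Theta> m \<bullet> \<xi>))"
        by simp
      also have "\<dots> = integral {0..2*pi} (\<lambda>t. \<Sum>s\<in>F. (fst s \<bullet> \<xi>) * ?L s (?c s t))"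
        by (simp only: pt)
      also have "\<dots> = (\<Sum>s\<in>F. integral {0..2*pi} (\<lambda>t. (fst s \<bullet> \<xi>) * ?L s (?c s t)))"
      proof (rule integral_sum[OF F(1)])
        fix s assume "s \<in> F"
        from integrable_linear[OF cc[OF this] L[of s]]
        show "(\<lambda>t. (fst s \<bullet> \<xi>) * ?L s (?c s t)) integrable_on {0..2*pi}"
          by (intro integrable_on_mult_right) (simp add: o_def)
      qed
      also have "\<dots> = (\<Sum>s\<in>F. (fst s \<bullet> \<xi>) * ?L s (integral {0..2*pi} (?c s)))"
      proof (rule sum.cong)
        fix s assume "s \<in> F"
        from integral_linear[OF cc[OF this] L[of s]]
        show "integral {0..2*pi} (\<lambda>t. (fst s \<bullet> \<xi>) * ?L s (?c s t)) = (fst s \<bullet> \<xi>) * ?L s (integral {0..2*pi} (?c s))"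
          by (simp add: o_def)
      qed simp
      finally have 1: "integral {0..2*pi} (\<lambda>t. u (?g t m)) * (\<Theta> m \<bullet> \<xi>) = \<dots>" .
      have "?L s (a' s m) = (1 / (2*pi)) * ?L s (integral {0..2*pi} (?c s))" for s
        using linear_scale[OF bounded_linear.linear[OF L[of s]], of "1 / (2*pi)" "integral {0..2*pi} (?c s)"]
        by (simp add: a'_def avg_def)
      then have "(\<Sum>s\<in>F. (fst s \<bullet> \<xi>) * ?L s (a' s m)) =
          (1 / (2*pi)) * (\<Sum>s\<in>F. (fst s \<bullet> \<xi>) * ?L s (integral {0..2*pi} (?c s)))"
        by (simp only: sum_distrib_left mult.left_commute)
      then show ?thesis using 1 by (simp only: u' mult.assoc)
    qed
    show ?case
      by (rule exI[of _ a'], rule exI[of _ u']) (use eqva sm pos nonneg invu eq in blast)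
  qed
  from this[OF finite order_refl] obtain a u where a: "\<And>s. s \<in> F \<Longrightarrow> eqv I (fst s) (a s)"
    and u: "msmooth u" "u p > (0::real)"
    "\<And>j t m. j \<in> I \<Longrightarrow> u (exp_act (t *\<^sub>R axis j 1) m) = u m"
    "\<And>m \<xi>. \<xi> \<in> coord_space I \<Longrightarrow> u m * (\<Theta> m \<bullet> \<xi>) = (\<Sum>s\<in>F. (fst s \<bullet> \<xi>) * Re (\<i> * cnj (a s m) * snd s m))"
    by blast
  show ?thesis
    by (rule that[OF F(1,2) a u(1,2) exp_act_axis_invariant[OF u(1,3)] u(4)])
qed

text \<open>The cutoff vanishes near 0.\<close>

lemma Cinf_cutoff_quotient:
  assumes "k > 0" shows "Cinf UNIV (\<lambda>x. cutoff (x / k) / x)"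
proof (rule Cinf_local)
  fix x :: real
  show "\<exists>U. open U \<and> x \<in> U \<and> Cinf (UNIV \<inter> U) (\<lambda>x. cutoff (x / k) / x)"
  proof (cases "x = 0")
    case True
    have "Cinf {..<k/3} (\<lambda>x. cutoff (x / k) / x)"
      by (rule Cinf_cong[OF Cinf_const[of _ 0]]) (use assms in \<open>auto simp: cutoff_eq_0 divide_simps\<close>)
    then show ?thesis using True assms by (intro exI[of _ "{..<k/3}"]) auto
  next
    case False
    have o: "open {x::real. x \<noteq> 0}" by (simp add: open_Collect_neq)
    have "Cinf {x. x \<noteq> 0} (\<lambda>x. cutoff (x / k) / x)"
      by (rule Cinf_divide[OF o Cinf_compose[OF Cinf_cutoff Cinf_bounded_linear[OF bounded_linear_divide] o]
            Cinf_bounded_linear[OF bounded_linear_ident]]) auto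
    then show ?thesis using False o by (intro exI[of _ "{x. x \<noteq> 0}"]) auto
  qed
qed

lemma eqv_scale_invariant:
  fixes u :: "'m \<Rightarrow> real"
  assumes a: "eqv I \<beta> a" and u: "msmooth u" "\<And>m \<xi>. \<xi> \<in> coord_space I \<Longrightarrow> u (exp_act \<xi> m) = u m"
  shows "eqv I \<beta> (\<lambda>q. of_real (u q) * a q)"
  using a u(2)[OF scale_coord[OF axis_coord]] msmooth_mult[OF msmooth_linear[OF bounded_linear_of_real u(1)], of a]
  by (auto simp: eqv_def)

text \<open>Composing \<open>u\<close> with a cutoff $\chi$ makes it 1 near \<open>p\<close> and keeps it invariant; the coefficients are
  multiplied by the smooth function $\chi(u) / u$ accordingly.\<close>

lemma normalized_solution:
  fixes \<Theta> :: "'m \<Rightarrow> real^'k"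
  assumes \<Theta>: "msmooth \<Theta>"
    and inv: "\<And>m \<xi>. \<xi> \<in> coord_space I \<Longrightarrow> \<Theta> (exp_act \<xi> m) = \<Theta> m"
    and van: "\<And>m \<xi>. \<xi> \<in> inf_stabilizer I \<A> act m \<Longrightarrow> \<Theta> m \<bullet> \<xi> = 0"
  obtains F :: "((real^'k) \<times> ('m \<Rightarrow> complex)) set" and a and u :: "'m \<Rightarrow> real" and N
  where "finite F" "\<And>s. s \<in> F \<Longrightarrow> eqv I (fst s) (snd s)" "\<And>s. s \<in> F \<Longrightarrow> eqv I (fst s) (a s)"
    "msmooth u" "\<And>m \<xi>. \<xi> \<in> coord_space I \<Longrightarrow> u (exp_act \<xi> m) = u m"
    "open N" "p \<in> N" "\<And>q. q \<in> N \<Longrightarrow> u q = 1"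
    "\<And>m \<xi>. \<xi> \<in> coord_space I \<Longrightarrow>
       u m * (\<Theta> m \<bullet> \<xi>) = (\<Sum>s\<in>F. (fst s \<bullet> \<xi>) * Re (\<i> * cnj (a s m) * snd s m))"
proof -
  obtain F :: "((real^'k) \<times> ('m \<Rightarrow> complex)) set" and a and u :: "'m \<Rightarrow> real" where
    F: "finite F" "\<And>s. s \<in> F \<Longrightarrow> eqv I (fst s) (snd s)" "\<And>s. s \<in> F \<Longrightarrow> eqv I (fst s) (a s)"
    and u: "msmooth u" "u p > 0" "\<And>m \<xi>. \<xi> \<in> coord_space I \<Longrightarrow> u (exp_act \<xi> m) = u m"
    "\<And>m \<xi>. \<xi> \<in> coord_space I \<Longrightarrow>
       u m * (\<Theta> m \<bullet> \<xi>) = (\<Sum>s\<in>F. (fst s \<bullet> \<xi>) * Re (\<i> * cnj (a s m) * snd s m))"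
    by (rule averaged_solution[OF \<Theta> inv van, of p], assumption, assumption, rule that)
  let ?k = "u p"
  define g where "g x = cutoff (x / ?k) / x" for x
  have g: "Cinf UNIV g" using Cinf_cutoff_quotient[OF u(2)] by (simp add: g_def[abs_def])
  have gx: "g x * x = cutoff (x / ?k)" for x by (simp add: g_def cutoff_eq_0)
  have C: "Cinf UNIV (\<lambda>x. cutoff (x / ?k))"
    by (rule Cinf_compose[OF Cinf_cutoff Cinf_bounded_linear[OF bounded_linear_divide] open_UNIV]) simp
  let ?N = "u -` {2/3 * ?k<..}"
  show ?thesis
  proof (rule that[of F "\<lambda>s q. of_real (g (u q)) * a s q" "\<lambda>q. cutoff (u q / ?k)" ?N, OF F(1,2)])
    show "eqv I (fst s) (\<lambda>q. of_real (g (u q)) * a s q)" if "s \<in> F" for s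
      by (rule eqv_scale_invariant[OF F(3)[OF that] msmooth_compose[OF u(1) g]]) (simp add: u(3))
    show "msmooth (\<lambda>q. cutoff (u q / ?k))" by (rule msmooth_compose[OF u(1) C])
    show "open ?N"
      using continuous_open_preimage[OF continuous_on_msmooth[OF u(1)] open_UNIV open_greaterThan] by simp
    show "cutoff (u m / ?k) * (\<Theta> m \<bullet> \<xi>) = (\<Sum>s\<in>F. (fst s \<bullet> \<xi>) * Re (\<i> * cnj (of_real (g (u m)) * a s m) * snd s m))"
      if \<xi>: "\<xi> \<in> coord_space I" for m \<xi>
    proof -
      have "cutoff (u m / ?k) * (\<Theta> m \<bullet> \<xi>) = g (u m) * (\<Sum>s\<in>F. (fst s \<bullet> \<xi>) * Re (\<i> * cnj (a s m) * snd s m))"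
        using u(4)[OF \<xi>, of m] gx[of "u m"] by (metis mult.assoc)
      also have "\<dots> = (\<Sum>s\<in>F. (fst s \<bullet> \<xi>) * Re (\<i> * cnj (of_real (g (u m)) * a s m) * snd s m))"
        unfolding sum_distrib_left by (rule sum.cong) (simp_all add: algebra_simps)
      finally show ?thesis .
    qed
  qed (use u in \<open>auto simp: cutoff_eq_1 divide_simps\<close>)
qed

text \<open>By the Lindelof property countably many sets, on which functions $u_l$ as above are 1, cover the
  manifold. The products $\rho_l = u_l \prod_{i<l} (1 - u_i)$ telescope to a partition of unity that is
  locally finite, since all $\rho_l$ with $l > i$ vanish where $u_i = 1$. They are invariant, so that
  multiplication by $\prod_{i<l} (1 - u_i)$ keeps the coefficients equivariant.\<close>

lemma global_solution:
  fixes \<Theta> :: "'m \<Rightarrow> real^'k"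
  assumes \<Theta>: "msmooth \<Theta>"
    and inv: "\<And>m \<xi>. \<xi> \<in> coord_space I \<Longrightarrow> \<Theta> (exp_act \<xi> m) = \<Theta> m"
    and van: "\<And>m \<xi>. \<xi> \<in> inf_stabilizer I \<A> act m \<Longrightarrow> \<Theta> m \<bullet> \<xi> = 0"
  obtains F :: "nat \<Rightarrow> ((real^'k) \<times> ('m \<Rightarrow> complex)) set" and a and n :: "'m \<Rightarrow> nat" and W
  where "\<And>l. finite (F l)" "\<And>l s. s \<in> F l \<Longrightarrow> eqv I (fst s) (snd s)" "\<And>l s. s \<in> F l \<Longrightarrow> eqv I (fst s) (a l s)"
    "\<And>m. open (W m)" "\<And>m. m \<in> W m" "\<And>m q l s. q \<in> W m \<Longrightarrow> n m \<le> l \<Longrightarrow> a l s q = 0"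
    "\<And>m q \<xi>. q \<in> W m \<Longrightarrow> \<xi> \<in> coord_space I \<Longrightarrow>
       \<Theta> q \<bullet> \<xi> = (\<Sum>l<n m. \<Sum>s\<in>F l. (fst s \<bullet> \<xi>) * Re (\<i> * cnj (a l s q) * snd s q))"
proof -
  \<comment> \<open>\<open>Q\<close> collects the properties of a normalized solution at \<open>p\<close>, so that one can be chosen for every \<open>p\<close>.\<close>
  define Q where "Q p F a u N \<longleftrightarrow> finite F \<and> (\<forall>s\<in>F. eqv I (fst s) (snd s)) \<and> (\<forall>s\<in>F. eqv I (fst s) (a s)) \<and>
      msmooth u \<and> (\<forall>m. \<forall>\<xi>\<in>coord_space I. u (exp_act \<xi> m) = u m) \<and> open N \<and> p \<in> N \<and> (\<forall>q\<in>N. u q = (1::real)) \<and>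
      (\<forall>m. \<forall>\<xi>\<in>coord_space I. u m * (\<Theta> m \<bullet> \<xi>) = (\<Sum>s\<in>F. (fst s \<bullet> \<xi>) * Re (\<i> * cnj (a s m) * snd s m)))"
    for p and F :: "((real^'k) \<times> ('m \<Rightarrow> complex)) set" and a u N
  have "\<exists>x. Q p (fst x) (fst (snd x)) (fst (snd (snd x))) (snd (snd (snd x)))" for p
  proof -
    obtain F :: "((real^'k) \<times> ('m \<Rightarrow> complex)) set" and a and u :: "'m \<Rightarrow> real" and N
      where "finite F" "\<And>s. s \<in> F \<Longrightarrow> eqv I (fst s) (snd s)" "\<And>s. s \<in> F \<Longrightarrow> eqv I (fst s) (a s)"
        "msmooth u" "\<And>m \<xi>. \<xi> \<in> coord_space I \<Longrightarrow> u (exp_act \<xi> m) = u m"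
        "open N" "p \<in> N" "\<And>q. q \<in> N \<Longrightarrow> u q = 1"
        "\<And>m \<xi>. \<xi> \<in> coord_space I \<Longrightarrow>
           u m * (\<Theta> m \<bullet> \<xi>) = (\<Sum>s\<in>F. (fst s \<bullet> \<xi>) * Re (\<i> * cnj (a s m) * snd s m))"
      by (rule normalized_solution[OF \<Theta> inv van, of p], assumption, assumption, rule that)
    then have "Q p F a u N" unfolding Q_def by (intro conjI ballI allI)
    then show ?thesis by (intro exI[of _ "(F, a, u, N)"]) simp
  qed
  from choice[OF allI[OF this]] obtain X
    where X: "\<forall>p. Q p (fst (X p)) (fst (snd (X p))) (fst (snd (snd (X p)))) (snd (snd (snd (X p))))" ..
  define F where "F p = fst (X p)" for p
  define a where "a p = fst (snd (X p))" for p
  define u where "u p = fst (snd (snd (X p)))" for p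
  define N where "N p = snd (snd (snd (X p)))" for p
  have Q: "Q p (F p) (a p) (u p) (N p)" for p using X by (simp add: F_def a_def u_def N_def)
  have P: "\<And>p. finite (F p)" "\<And>p. \<forall>s\<in>F p. eqv I (fst s) (snd s)" "\<And>p. \<forall>s\<in>F p. eqv I (fst s) (a p s)"
    "\<And>p. msmooth (u p)" "\<And>p m. \<forall>\<xi>\<in>coord_space I. u p (exp_act \<xi> m) = u p m" "\<And>p. open (N p)" "\<And>p. p \<in> N p" "\<And>p. \<forall>q\<in>N p. u p q = (1::real)"
    "\<And>p m. \<forall>\<xi>\<in>coord_space I. u p m * (\<Theta> m \<bullet> \<xi>) = (\<Sum>s\<in>F p. (fst s \<bullet> \<xi>) * Re (\<i> * cnj (a p s m) * snd s m))"
    using Q unfolding Q_def by simp_all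
  have oN: "open V" if "V \<in> range N" for V using that P(6) by auto
  obtain \<N> where \<N>: "\<N> \<subseteq> range N" "countable \<N>" "\<Union>\<N> = \<Union>(range N)"
    by (rule Lindelof[OF oN], assumption, rule that)
  have UN: "m \<in> \<Union>\<N>" for m unfolding \<N>(3) using P(7)[of m] by (rule UnionI[OF rangeI])
  have ne: "\<N> \<noteq> {}" using UN by auto
  have "\<forall>l. \<exists>p. N p = from_nat_into \<N> l"
  proof
    fix l
    have "from_nat_into \<N> l \<in> range N" using from_nat_into[OF ne, of l] \<N>(1) by blast
    then obtain p where "from_nat_into \<N> l = N p" by (rule rangeE)
    then show "\<exists>p. N p = from_nat_into \<N> l" by (intro exI[of _ p]) simp
  qed
  from choice[OF this] obtain pt where pt: "\<And>l. N (pt l) = from_nat_into \<N> l" by blast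
  have cover: "\<exists>l. m \<in> N (pt l)" for m
  proof -
    obtain V where V: "V \<in> \<N>" "m \<in> V" using UN[of m] by (rule UnionE)
    obtain l where l: "from_nat_into \<N> l = V" using from_nat_into_surj[OF \<N>(2) V(1)] by blast
    show ?thesis using pt[of l] l V by (intro exI[of _ l]) simp
  qed
  define i0 where "i0 m = (SOME l. m \<in> N (pt l))" for m
  have i0: "m \<in> N (pt (i0 m))" for m unfolding i0_def by (rule someI_ex[OF cover])
  define r where "r l q = (\<Prod>i<l. 1 - u (pt i) q)" for l q
  have r: "msmooth (r l)" for l
    unfolding r_def by (intro msmooth_prod msmooth_diff msmooth_const P)
  have rinv: "r l (exp_act \<xi> m) = r l m" if "\<xi> \<in> coord_space I" for l \<xi> m using P(5) that by (simp add: r_def)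
  have r0: "r l q = 0" if "q \<in> N (pt (i0 m))" "Suc (i0 m) \<le> l" for q m l
    unfolding r_def using P(8) that by (intro prod_zero bexI[of _ "i0 m"]) auto
  have tele: "(\<Sum>l<n. r l q * u (pt l) q) = 1 - r n q" for n q
    by (induction n) (simp_all add: r_def algebra_simps)
  show ?thesis
  proof (rule that[of "\<lambda>l. F (pt l)" "\<lambda>l s q. of_real (r l q) * a (pt l) s q" "\<lambda>m. N (pt (i0 m))" "\<lambda>m. Suc (i0 m)"])
    show "eqv I (fst s) (\<lambda>q. of_real (r l q) * a (pt l) s q)" if "s \<in> F (pt l)" for l s
      by (rule eqv_scale_invariant[OF _ r rinv]) (use P(3) that in auto)
    fix m q \<xi> assume q: "q \<in> N (pt (i0 m))" and \<xi>: "\<xi> \<in> coord_space I"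
    let ?n = "Suc (i0 m)"
    have "(\<Sum>l<?n. \<Sum>s\<in>F (pt l). (fst s \<bullet> \<xi>) * Re (\<i> * cnj (of_real (r l q) * a (pt l) s q) * snd s q)) =
        (\<Sum>l<?n. r l q * (u (pt l) q * (\<Theta> q \<bullet> \<xi>)))"
    proof (rule sum.cong)
      fix l
      have "u (pt l) q * (\<Theta> q \<bullet> \<xi>) = (\<Sum>s\<in>F (pt l). (fst s \<bullet> \<xi>) * Re (\<i> * cnj (a (pt l) s q) * snd s q))"
        using P(9) \<xi> by blast
      then show "(\<Sum>s\<in>F (pt l). (fst s \<bullet> \<xi>) * Re (\<i> * cnj (of_real (r l q) * a (pt l) s q) * snd s q)) =
          r l q * (u (pt l) q * (\<Theta> q \<bullet> \<xi>))"
        by (simp only: sum_distrib_left) (rule sum.cong, simp_all add: algebra_simps)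
    qed simp
    also have "\<dots> = (\<Sum>l<?n. r l q * u (pt l) q) * (\<Theta> q \<bullet> \<xi>)"
      by (simp only: sum_distrib_right mult.assoc)
    also have "\<dots> = \<Theta> q \<bullet> \<xi>" unfolding tele using r0[OF q, of ?n] by simp
    finally show "\<Theta> q \<bullet> \<xi> = (\<Sum>l<?n. \<Sum>s\<in>F (pt l). (fst s \<bullet> \<xi>) * Re (\<i> * cnj (of_real (r l q) * a (pt l) s q) * snd s q))" ..
  qed (use P i0 r0 in auto)
qed

end

section \<open>Closed two-forms as locally finite sums\<close>

text \<open>The value of $da \wedge db$ on two tangent vectors at the same point.\<close>

definition wedge :: "('m \<Rightarrow> real) \<Rightarrow> ('m \<Rightarrow> real) \<Rightarrow> 'm tvec \<Rightarrow> 'm tvec \<Rightarrow> real" where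
  "wedge a b v w = v a * w b - w a * v b"

context manifold begin

lemma vector_field_tangent: "vector_field \<A> X \<Longrightarrow> X m \<in> tangent_space \<A> m"
  by (simp add: vector_field_def)

lemma msmooth_vector_field: "vector_field \<A> X \<Longrightarrow> msmooth f \<Longrightarrow> msmooth (\<lambda>m. X m f)"
  by (simp add: vector_field_def C_infinity_iff)

lemma msmooth_wedge:
  assumes "msmooth a" "msmooth b" "vector_field \<A> X" "vector_field \<A> Y"
  shows "msmooth (\<lambda>p. wedge a b (X p) (Y p))"
  unfolding wedge_def
  by (rule msmooth_diff[OF msmooth_mult[OF msmooth_vector_field[OF assms(3,1)] msmooth_vector_field[OF assms(4,2)]]
        msmooth_mult[OF msmooth_vector_field[OF assms(4,1)] msmooth_vector_field[OF assms(3,2)]]])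

lemma tan_wedge:
  assumes v: "v \<in> tangent_space \<A> m" and a: "msmooth a" "msmooth b"
    and X: "vector_field \<A> X" and Y: "vector_field \<A> Y"
  shows "v (\<lambda>p. wedge a b (X p) (Y p)) =
    X m a * v (\<lambda>p. Y p b) + Y m b * v (\<lambda>p. X p a) - (Y m a * v (\<lambda>p. X p b) + X m b * v (\<lambda>p. Y p a))"
proof -
  note x = msmooth_vector_field[OF X a(1)] msmooth_vector_field[OF X a(2)]
  note y = msmooth_vector_field[OF Y a(1)] msmooth_vector_field[OF Y a(2)]
  show ?thesis
    unfolding wedge_def tan_diff[OF v msmooth_mult[OF x(1) y(2)] msmooth_mult[OF y(1) x(2)]]
      tan_mult[OF v x(1) y(2)] tan_mult[OF v y(1) x(2)] ..
qed

text \<open>$d(da \wedge db) = 0$: in the coordinate-free formula the second derivatives cancel against the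
  bracket terms.\<close>

lemma d_two_form_sum_wedge:
  assumes a: "\<And>i. i \<in> N \<Longrightarrow> msmooth (a i)" "\<And>i. i \<in> N \<Longrightarrow> msmooth (b i)"
    and X: "vector_field \<A> X" and Y: "vector_field \<A> Y" and Z: "vector_field \<A> Z"
  shows "d_two_form (\<lambda>p v w. \<Sum>i\<in>N. wedge (a i) (b i) v w) X Y Z m = 0"
proof -
  have sw: "msmooth (\<lambda>p. wedge (a i) (b i) (X p) (Y p))"
    if "i \<in> N" "vector_field \<A> X" "vector_field \<A> Y" for i X Y
    by (rule msmooth_wedge[OF a(1)[OF that(1)] a(2)[OF that(1)] that(2,3)])
  have s: "v (\<lambda>p. \<Sum>i\<in>N. wedge (a i) (b i) (X p) (Y p)) =
    (\<Sum>i\<in>N. X m (a i) * v (\<lambda>p. Y p (b i)) + Y m (b i) * v (\<lambda>p. X p (a i)) -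
      (Y m (a i) * v (\<lambda>p. X p (b i)) + X m (b i) * v (\<lambda>p. Y p (a i))))"
    if v: "v \<in> tangent_space \<A> m" and X: "vector_field \<A> X" and Y: "vector_field \<A> Y" for v X Y
  proof -
    have "v (\<lambda>p. \<Sum>i\<in>N. wedge (a i) (b i) (X p) (Y p)) = (\<Sum>i\<in>N. v (\<lambda>p. wedge (a i) (b i) (X p) (Y p)))"
      by (rule tan_sum[OF v sw[OF _ X Y]])
    also have "\<dots> = (\<Sum>i\<in>N. X m (a i) * v (\<lambda>p. Y p (b i)) + Y m (b i) * v (\<lambda>p. X p (a i)) -
      (Y m (a i) * v (\<lambda>p. X p (b i)) + X m (b i) * v (\<lambda>p. Y p (a i))))"
      by (rule sum.cong[OF refl tan_wedge[OF v a(1) a(2) X Y]])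
    finally show ?thesis .
  qed
  show ?thesis
    unfolding d_two_form_def s[OF vector_field_tangent[OF X] Y Z] s[OF vector_field_tangent[OF Y] X Z]
      s[OF vector_field_tangent[OF Z] X Y]
    unfolding wedge_def lie_bracket_def sum_subtractf[symmetric] sum.distrib[symmetric]
    by (rule sum.neutral) (simp add: algebra_simps)
qed

text \<open>Closedness at a point only involves the values of the form near that point, where it agrees with a
  finite sum. The index sets \<open>N k\<close> grow, and \<open>N (n m)\<close> suffices on the neighbourhood \<open>W m\<close>; a summand
  vanishes where its first function is locally zero.\<close>

lemma locally_finite_closed_two_form:
  fixes a b :: "'i \<Rightarrow> 'm \<Rightarrow> real" and N :: "nat \<Rightarrow> 'i set" and n :: "'m \<Rightarrow> nat"
  assumes N: "\<And>k. finite (N k)" "mono N"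
    and sm: "\<And>k i. i \<in> N k \<Longrightarrow> msmooth (a i)" "\<And>k i. i \<in> N k \<Longrightarrow> msmooth (b i)"
    and W: "\<And>m. open (W m)" "\<And>m. m \<in> W m"
      "\<And>m q k i. q \<in> W m \<Longrightarrow> i \<in> N k \<Longrightarrow> i \<notin> N (n m) \<Longrightarrow> a i q = 0"
  defines "\<omega> \<equiv> \<lambda>m v w. \<Sum>i\<in>N (n m). wedge (a i) (b i) v w"
  shows "closed_two_form \<A> \<omega>"
    and "\<And>m q v w k. q \<in> W m \<Longrightarrow> n m \<le> k \<Longrightarrow> v \<in> tangent_space \<A> q \<Longrightarrow> w \<in> tangent_space \<A> q \<Longrightarrow>
      \<omega> q v w = (\<Sum>i\<in>N k. wedge (a i) (b i) v w)"
proof -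
  have zero: "wedge (a i) (b i) v w = 0"
    if q: "q \<in> W m" and i: "i \<in> N k" "i \<notin> N (n m)" and v: "v \<in> tangent_space \<A> q" and w: "w \<in> tangent_space \<A> q"
    for m q i k v w
  proof -
    have "v (a i) = v (\<lambda>q. 0)" "w (a i) = w (\<lambda>q. 0)"
      using tan_local[OF v sm(1)[OF i(1)] msmooth_const W(1) q W(3)[OF _ i]]
        tan_local[OF w sm(1)[OF i(1)] msmooth_const W(1) q W(3)[OF _ i]] by auto
    then show ?thesis by (simp add: wedge_def tan_const[OF v] tan_const[OF w])
  qed
  have up: "(\<Sum>i\<in>N (n m). wedge (a i) (b i) v w) = (\<Sum>i\<in>N k. wedge (a i) (b i) v w)"
    if q: "q \<in> W m" and k: "n m \<le> k" and v: "v \<in> tangent_space \<A> q" "w \<in> tangent_space \<A> q" for m q k v w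
    by (rule sum.mono_neutral_left[OF N(1) monoD[OF N(2) k]]) (use zero[OF q _ _ v] in auto)
  show ex: "\<omega> q v w = (\<Sum>i\<in>N k. wedge (a i) (b i) v w)"
    if q: "q \<in> W m" and k: "n m \<le> k" and v: "v \<in> tangent_space \<A> q" "w \<in> tangent_space \<A> q" for m q v w k
  proof -
    have "\<omega> q v w = (\<Sum>i\<in>N (max k (n q)). wedge (a i) (b i) v w)"
      unfolding \<omega>_def by (rule up[OF W(2) _ v]) simp
    also have "\<dots> = (\<Sum>i\<in>N (n m). wedge (a i) (b i) v w)"
      by (rule up[OF q _ v, symmetric]) (use k in simp)
    finally show ?thesis using up[OF q k v] by simp
  qed
  have fs: "msmooth (\<lambda>p. \<Sum>i\<in>N k. wedge (a i) (b i) (X p) (Y p))"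
    if "vector_field \<A> X" "vector_field \<A> Y" for X Y k
  proof (rule msmooth_sum)
    fix i assume i: "i \<in> N k"
    show "msmooth (\<lambda>p. wedge (a i) (b i) (X p) (Y p))"
      by (rule msmooth_wedge[OF sm(1)[OF i] sm(2)[OF i] that])
  qed
  have smooth: "msmooth (\<lambda>m. \<omega> m (X m) (Y m))" if X: "vector_field \<A> X" and Y: "vector_field \<A> Y" for X Y
    unfolding msmooth_def
  proof
    fix m
    have "smooth_at (\<lambda>p. \<Sum>i\<in>N (n m). wedge (a i) (b i) (X p) (Y p)) m"
      using fs[OF X Y] by (simp add: msmooth_def)
    then show "smooth_at (\<lambda>m. \<omega> m (X m) (Y m)) m"
      by (rule smooth_at_cong[OF _ W(1,2)]) (simp add: ex[OF _ order_refl] vector_field_tangent[OF X] vector_field_tangent[OF Y])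
  qed
  have "two_form \<A> \<omega>"
    unfolding two_form_def
  proof (intro conjI allI ballI impI)
    fix m and u v w :: "'m tvec" and t :: real
    show "\<omega> m (\<lambda>f. u f + v f) w = \<omega> m u w + \<omega> m v w"
      unfolding \<omega>_def sum.distrib[symmetric] by (rule sum.cong) (simp_all add: wedge_def algebra_simps)
    show "\<omega> m (\<lambda>f. t * v f) w = t * \<omega> m v w"
      unfolding \<omega>_def sum_distrib_left by (rule sum.cong) (simp_all add: wedge_def algebra_simps)
    show "\<omega> m v w = - \<omega> m w v"
      unfolding \<omega>_def sum_negf[symmetric] by (rule sum.cong) (simp_all add: wedge_def)
  next
    fix X Y assume "vector_field \<A> X \<and> vector_field \<A> Y"
    then show "(\<lambda>m. \<omega> m (X m) (Y m)) \<in> C_infinity \<A>" using smooth by (simp add: C_infinity_iff)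
  qed
  moreover have "d_two_form \<omega> X Y Z m = 0"
    if X: "vector_field \<A> X" and Y: "vector_field \<A> Y" and Z: "vector_field \<A> Z" for X Y Z m
  proof -
    have loc: "v (\<lambda>p. \<omega> p (X p) (Y p)) = v (\<lambda>p. \<Sum>i\<in>N (n m). wedge (a i) (b i) (X p) (Y p))"
      if v: "v \<in> tangent_space \<A> m" and X: "vector_field \<A> X" and Y: "vector_field \<A> Y" for v X Y
      by (rule tan_local[OF v smooth[OF X Y] fs[OF X Y] W(1,2)])
         (simp_all add: ex[OF _ order_refl] vector_field_tangent[OF X] vector_field_tangent[OF Y])
    have "d_two_form \<omega> X Y Z m = d_two_form (\<lambda>p v w. \<Sum>i\<in>N (n m). wedge (a i) (b i) v w) X Y Z m"
      unfolding d_two_form_def loc[OF vector_field_tangent[OF X] Y Z] loc[OF vector_field_tangent[OF Y] X Z]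
        loc[OF vector_field_tangent[OF Z] X Y]
      by (simp add: \<omega>_def)
    also have "\<dots> = 0" by (rule d_two_form_sum_wedge[OF sm(1) sm(2) X Y Z])
    finally show ?thesis .
  qed
  ultimately show "closed_two_form \<A> \<omega>" by (simp add: closed_two_form_def)
qed

lemma two_formD:
  assumes "two_form \<A> \<omega>"
  shows "u \<in> tangent_space \<A> m \<Longrightarrow> v \<in> tangent_space \<A> m \<Longrightarrow> w \<in> tangent_space \<A> m \<Longrightarrow>
      \<omega> m (\<lambda>f. u f + v f) w = \<omega> m u w + \<omega> m v w"
    and "v \<in> tangent_space \<A> m \<Longrightarrow> w \<in> tangent_space \<A> m \<Longrightarrow> \<omega> m (\<lambda>f. k * v f) w = k * \<omega> m v w"
    and "v \<in> tangent_space \<A> m \<Longrightarrow> w \<in> tangent_space \<A> m \<Longrightarrow> \<omega> m v w = - \<omega> m w v"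
    and "vector_field \<A> X \<Longrightarrow> vector_field \<A> Y \<Longrightarrow> msmooth (\<lambda>m. \<omega> m (X m) (Y m))"
proof -
  note t = assms[unfolded two_form_def]
  note t2 = conjunct2[OF t]
  note t3 = conjunct2[OF t2]
  show "u \<in> tangent_space \<A> m \<Longrightarrow> v \<in> tangent_space \<A> m \<Longrightarrow> w \<in> tangent_space \<A> m \<Longrightarrow>
      \<omega> m (\<lambda>f. u f + v f) w = \<omega> m u w + \<omega> m v w"
    by (rule conjunct1[OF t, rule_format])
  show "v \<in> tangent_space \<A> m \<Longrightarrow> w \<in> tangent_space \<A> m \<Longrightarrow> \<omega> m (\<lambda>f. k * v f) w = k * \<omega> m v w"
    by (rule conjunct1[OF t2, rule_format])
  show "v \<in> tangent_space \<A> m \<Longrightarrow> w \<in> tangent_space \<A> m \<Longrightarrow> \<omega> m v w = - \<omega> m w v"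
    by (rule conjunct1[OF t3, rule_format])
  show "vector_field \<A> X \<Longrightarrow> vector_field \<A> Y \<Longrightarrow> msmooth (\<lambda>m. \<omega> m (X m) (Y m))"
    using conjunct2[OF t3, rule_format, of X Y] by (simp add: C_infinity_iff)
qed

text \<open>The exterior derivative is additive because vector fields act additively on smooth functions.\<close>

lemma closed_two_form_add:
  assumes "closed_two_form \<A> \<omega>" "closed_two_form \<A> \<omega>'"
  shows "closed_two_form \<A> (\<lambda>m v w. \<omega> m v w + \<omega>' m v w)"
proof -
  have t: "two_form \<A> \<omega>" "two_form \<A> \<omega>'" using assms by (auto simp: closed_two_form_def)
  note s = two_formD(4)[OF t(1)] two_formD(4)[OF t(2)]
  have "two_form \<A> (\<lambda>m v w. \<omega> m v w + \<omega>' m v w)"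
    unfolding two_form_def
  proof (intro conjI allI ballI impI)
    fix m u v w
    assume T: "u \<in> tangent_space \<A> m" "v \<in> tangent_space \<A> m" "w \<in> tangent_space \<A> m"
    show "\<omega> m (\<lambda>f. u f + v f) w + \<omega>' m (\<lambda>f. u f + v f) w = \<omega> m u w + \<omega>' m u w + (\<omega> m v w + \<omega>' m v w)"
      using two_formD(1)[OF t(1) T] two_formD(1)[OF t(2) T] by simp
  next
    fix m v w and k :: real
    assume T: "v \<in> tangent_space \<A> m" "w \<in> tangent_space \<A> m"
    show "\<omega> m (\<lambda>f. k * v f) w + \<omega>' m (\<lambda>f. k * v f) w = k * (\<omega> m v w + \<omega>' m v w)"
      using two_formD(2)[OF t(1) T, of k] two_formD(2)[OF t(2) T, of k] by (simp add: distrib_left)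
    show "\<omega> m v w + \<omega>' m v w = - (\<omega> m w v + \<omega>' m w v)"
      using two_formD(3)[OF t(1) T] two_formD(3)[OF t(2) T] by simp
  next
    fix X Y assume "vector_field \<A> X \<and> vector_field \<A> Y"
    then show "(\<lambda>m. \<omega> m (X m) (Y m) + \<omega>' m (X m) (Y m)) \<in> C_infinity \<A>"
      using msmooth_add[OF s(1) s(2), of X Y X Y] by (simp add: C_infinity_iff)
  qed
  moreover have "d_two_form (\<lambda>m v w. \<omega> m v w + \<omega>' m v w) X Y Z m = 0"
    if X: "vector_field \<A> X" and Y: "vector_field \<A> Y" and Z: "vector_field \<A> Z" for X Y Z m
  proof -
    have "d_two_form \<omega> X Y Z m = 0" "d_two_form \<omega>' X Y Z m = 0"
      using assms X Y Z by (auto simp: closed_two_form_def)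
    then show ?thesis
      unfolding d_two_form_def tan_add[OF vector_field_tangent[OF X] s(1)[OF Y Z] s(2)[OF Y Z]]
        tan_add[OF vector_field_tangent[OF Y] s(1)[OF X Z] s(2)[OF X Z]]
        tan_add[OF vector_field_tangent[OF Z] s(1)[OF X Y] s(2)[OF X Y]]
      by linarith
  qed
  ultimately show ?thesis by (simp add: closed_two_form_def)
qed

lemma push_forward_tangent:
  assumes F: "\<And>f :: 'm \<Rightarrow> real. msmooth f \<Longrightarrow> msmooth (\<lambda>q. f (F q))" and v: "v \<in> tangent_space \<A> m"
  shows "push_forward \<A> F v \<in> tangent_space \<A> (F m)"
proof (rule tangentI)
  fix f g :: "'m \<Rightarrow> real" and k :: real assume f: "msmooth f" and g: "msmooth g"
  show "push_forward \<A> F v (\<lambda>p. f p + g p) = push_forward \<A> F v f + push_forward \<A> F v g"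
    using f g tan_add[OF v F[OF f] F[OF g]] by (simp add: push_forward_def C_infinity_iff msmooth_add o_def)
  show "push_forward \<A> F v (\<lambda>p. f p * g p) = f (F m) * push_forward \<A> F v g + g (F m) * push_forward \<A> F v f"
    using f g tan_mult[OF v F[OF f] F[OF g]] by (simp add: push_forward_def C_infinity_iff msmooth_mult o_def)
  show "push_forward \<A> F v (\<lambda>p. k * f p) = k * push_forward \<A> F v f"
    using f tan_scale[OF v F[OF f]] by (simp add: push_forward_def C_infinity_iff msmooth_mult msmooth_const o_def)
qed (simp add: push_forward_def C_infinity_iff)

end

context torus_manifold begin

text \<open>The value of $d \, \mathrm{Re}(\bar a \, dz) = \mathrm{Re}(d \bar a \wedge dz)$.\<close>

lemma wedge_complex:
  "wedge (\<lambda>q. Re (a q)) (\<lambda>q. Re (z q)) v w + wedge (\<lambda>q. Im (a q)) (\<lambda>q. Im (z q)) v w =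
   Re (cnj (vc v a) * vc w z) - Re (cnj (vc w a) * vc v z)"
  by (simp add: wedge_def vc_def)

text \<open>The form is $d\mu$ for $\mu = \sum \mathrm{Re}(\bar a \, dz)$ with the functions of
  \<open>global_solution\<close>. It is written down directly as $\sum \mathrm{Re}(d\bar a \wedge dz)$. It is
  invariant since \<open>a\<close> and \<open>z\<close> pick up the same unitary factor, and contracting it with $\xi_M$ yields
  the differential of $- \mathrm{Re}(\bar a \, dz(\xi_M)) = - \langle\beta, \xi\rangle \, \mathrm{Re}(i \bar a z)$.\<close>

lemma exists_exact_form:
  fixes \<Theta> :: "'m \<Rightarrow> real^'k"
  assumes \<Theta>: "msmooth \<Theta>"
    and inv: "\<And>m \<xi>. \<xi> \<in> coord_space I \<Longrightarrow> \<Theta> (exp_act \<xi> m) = \<Theta> m"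
    and van: "\<And>m \<xi>. \<xi> \<in> inf_stabilizer I \<A> act m \<Longrightarrow> \<Theta> m \<bullet> \<xi> = 0"
  obtains \<omega> where "closed_two_form \<A> \<omega>"
    "\<And>g m v w. g \<in> carrier (torus I) \<Longrightarrow> v \<in> tangent_space \<A> m \<Longrightarrow> w \<in> tangent_space \<A> m \<Longrightarrow>
        \<omega> (act g m) (push_forward \<A> (act g) v) (push_forward \<A> (act g) w) = \<omega> m v w"
    "\<And>\<xi> m v. \<xi> \<in> coord_space I \<Longrightarrow> v \<in> tangent_space \<A> m \<Longrightarrow> \<omega> m (gf \<xi> m) v = - v (\<lambda>p. \<Theta> p \<bullet> \<xi>)"
proof -
  obtain F :: "nat \<Rightarrow> ((real^'k) \<times> ('m \<Rightarrow> complex)) set" and a and n :: "'m \<Rightarrow> nat" and W where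
    F: "\<And>l. finite (F l)" "\<And>l s. s \<in> F l \<Longrightarrow> eqv I (fst s) (snd s)" "\<And>l s. s \<in> F l \<Longrightarrow> eqv I (fst s) (a l s)"
    and W: "\<And>m. open (W m)" "\<And>m. m \<in> W m" "\<And>m q l s. q \<in> W m \<Longrightarrow> n m \<le> l \<Longrightarrow> a l s q = 0"
    "\<And>m q \<xi>. q \<in> W m \<Longrightarrow> \<xi> \<in> coord_space I \<Longrightarrow>
       \<Theta> q \<bullet> \<xi> = (\<Sum>l<n m. \<Sum>s\<in>F l. (fst s \<bullet> \<xi>) * Re (\<i> * cnj (a l s q) * snd s q))"
    by (rule global_solution[OF \<Theta> inv van], assumption, assumption, rule that)
  have sma: "msmooth (a l s)" "msmooth (snd s)" if "s \<in> F l" for l s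
    using F(2,3)[OF that] by (auto simp: eqv_def)
  define N where "N k = (SIGMA l:{..<k}. F l \<times> (UNIV :: bool set))" for k
  \<comment> \<open>The Boolean selects the real or the imaginary part, so that \<open>\<omega>\<close> becomes a sum of forms \<open>wedge\<close>.\<close>
  define A where "A = (\<lambda>(l, s, c) q. if c then Re (a l s q) else Im (a l s q))"
  define B where "B = (\<lambda>(l :: nat, s :: (real^'k) \<times> ('m \<Rightarrow> complex), c) q. if c then Re (snd s q) else Im (snd s q))"
  define \<omega> where "\<omega> m v w = (\<Sum>i\<in>N (n m). wedge (A i) (B i) v w)" for m v w
  have N1: "finite (N k)" for k unfolding N_def using F(1) by (intro finite_SigmaI) auto
  have N2: "mono N" by (auto simp: N_def mono_def)
  have smA: "msmooth (A i) \<and> msmooth (B i)" if "i \<in> N k" for i k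
  proof -
    obtain l s c where i: "i = (l, s, c)" by (cases i) auto
    then have "s \<in> F l" using that by (simp add: N_def)
    then have "msmooth (\<lambda>q. Re (a l s q)) \<and> msmooth (\<lambda>q. Im (a l s q))" "msmooth (\<lambda>q. Re (snd s q)) \<and> msmooth (\<lambda>q. Im (snd s q))"
      using sma by (auto simp: msmooth_complex)
    then show ?thesis by (cases c) (simp_all add: i A_def B_def)
  qed
  have zA: "A i q = 0" if q: "q \<in> W m" and i: "i \<in> N k" "i \<notin> N (n m)" for m q k i
  proof -
    obtain l s c where l: "i = (l, s, c)" by (cases i) auto
    then have "n m \<le> l" using i by (auto simp: N_def)
    from W(3)[OF q this] show ?thesis by (simp add: l A_def)
  qed
  have smA': "msmooth (A i)" "msmooth (B i)" if "i \<in> N k" for i k using smA[OF that] by auto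
  have closed: "closed_two_form \<A> \<omega>"
    unfolding \<omega>_def
    by (rule locally_finite_closed_two_form(1)[where W = W, OF N1 N2 smA' W(1,2) zA]; assumption)
  have sumN: "\<omega> m v w = (\<Sum>i\<in>N k. wedge (A i) (B i) v w)"
    if "n m \<le> k" "v \<in> tangent_space \<A> m" "w \<in> tangent_space \<A> m" for m v w k
    unfolding \<omega>_def
    by (rule locally_finite_closed_two_form(2)[where W = W and q = m and m = m and n = n and a = A and b = B and N = N])
       (rule N1 | rule N2 | rule W(1) | rule W(2) | (rule zA; assumption) | (rule smA'; assumption) | rule that)+
  have ex: "\<omega> m v w = (\<Sum>l<k. \<Sum>s\<in>F l. Re (cnj (vc v (a l s)) * vc w (snd s)) - Re (cnj (vc w (a l s)) * vc v (snd s)))"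
    if "n m \<le> k" "v \<in> tangent_space \<A> m" "w \<in> tangent_space \<A> m" for m v w k
  proof -
    let ?g = "\<lambda>i. wedge (A i) (B i) v w"
    have "\<omega> m v w = sum ?g (N k)" by (rule sumN[OF that])
    also have "\<dots> = (\<Sum>l<k. \<Sum>y\<in>F l \<times> UNIV. ?g (l, y))"
      unfolding N_def by (subst sum.Sigma) (use F(1) in \<open>auto simp: case_prod_unfold\<close>)
    also have "\<dots> = (\<Sum>l<k. \<Sum>s\<in>F l. \<Sum>c\<in>UNIV. ?g (l, s, c))"
      by (simp add: sum.cartesian_product case_prod_unfold)
    also have "\<dots> = (\<Sum>l<k. \<Sum>s\<in>F l. Re (cnj (vc v (a l s)) * vc w (snd s)) - Re (cnj (vc w (a l s)) * vc v (snd s)))"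
      unfolding wedge_complex[symmetric] by (simp add: UNIV_bool A_def B_def add.commute)
    finally show ?thesis .
  qed
  show ?thesis
  proof (rule that[of \<omega>])
    show "closed_two_form \<A> \<omega>" by (rule closed)
  next
    fix g m v w assume g: "g \<in> carrier (torus I)" and v: "v \<in> tangent_space \<A> m" and w: "w \<in> tangent_space \<A> m"
    let ?P = "push_forward \<A> (act g)"
    obtain \<xi> where \<xi>: "\<xi> \<in> coord_space I" "g = torus_exp \<xi>" using g by (rule torus_exp_surj)
    have P: "?P v \<in> tangent_space \<A> (act g m)" if "v \<in> tangent_space \<A> m" for v
      by (rule push_forward_tangent[OF msmooth_act[OF _ g] that])
    have vcP: "vc (?P v) z = cis (\<beta> \<bullet> \<xi>) * vc v z" if z: "eqv I \<beta> z" and v: "v \<in> tangent_space \<A> m" for \<beta> z v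
    proof -
      have "vc (?P v) z = vc v (\<lambda>q. z (act g q))"
        using z by (simp add: vc_def push_forward_def C_infinity_iff eqv_def msmooth_complex o_def)
      also have "\<dots> = vc v (\<lambda>q. cis (\<beta> \<bullet> \<xi>) * z q)"
        using eqv_exp_act[OF z \<xi>(1)] by (simp add: exp_act_def \<xi>(2))
      also have "\<dots> = cis (\<beta> \<bullet> \<xi>) * vc v z" using z by (intro vc_scale[OF v]) (simp add: eqv_def)
      finally show ?thesis .
    qed
    have unit: "cnj (cis x * p) * (cis x * q) = cnj p * q" for x p q
    proof -
      have "cnj (cis x) * cis x = 1" by (simp add: cis_cnj cis_mult)
      moreover have "cnj (cis x * p) * (cis x * q) = (cnj (cis x) * cis x) * (cnj p * q)"
        by (simp only: complex_cnj_mult mult_ac)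
      ultimately show ?thesis by simp
    qed
    let ?k = "max (n m) (n (act g m))"
    have "\<omega> (act g m) (?P v) (?P w) = (\<Sum>l<?k. \<Sum>s\<in>F l. Re (cnj (vc (?P v) (a l s)) * vc (?P w) (snd s)) - Re (cnj (vc (?P w) (a l s)) * vc (?P v) (snd s)))"
      by (rule ex[OF _ P[OF v] P[OF w]]) simp
    also have "\<dots> = (\<Sum>l<?k. \<Sum>s\<in>F l. Re (cnj (vc v (a l s)) * vc w (snd s)) - Re (cnj (vc w (a l s)) * vc v (snd s)))"
    proof (intro sum.cong refl)
      fix l s assume s: "s \<in> F l"
      show "Re (cnj (vc (?P v) (a l s)) * vc (?P w) (snd s)) - Re (cnj (vc (?P w) (a l s)) * vc (?P v) (snd s)) =
          Re (cnj (vc v (a l s)) * vc w (snd s)) - Re (cnj (vc w (a l s)) * vc v (snd s))"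
        unfolding vcP[OF F(2)[OF s] v] vcP[OF F(2)[OF s] w] vcP[OF F(3)[OF s] v] vcP[OF F(3)[OF s] w] unit ..
    qed
    also have "\<dots> = \<omega> m v w" by (rule ex[OF _ v w, symmetric]) simp
    finally show "\<omega> (act g m) (?P v) (?P w) = \<omega> m v w" .
  next
    fix \<xi> m v assume \<xi>: "\<xi> \<in> coord_space I" and v: "v \<in> tangent_space \<A> m"
    let ?t = "\<lambda>l s q. (fst s \<bullet> \<xi>) * Re (\<i> * cnj (a l s q) * snd s q)"
    have smt: "msmooth (?t l s)" if "s \<in> F l" for l s
      by (intro msmooth_mult msmooth_const msmooth_linear[OF bounded_linear_Re] msmooth_linear[OF bounded_linear_cnj] sma[OF that])
    have "v (\<lambda>p. \<Theta> p \<bullet> \<xi>) = v (\<lambda>p. \<Sum>l<n m. \<Sum>s\<in>F l. ?t l s p)"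
      by (rule tan_local[OF v msmooth_linear[OF bounded_linear_inner_left \<Theta>] msmooth_sum[OF msmooth_sum[OF smt]] W(1,2) W(4)[OF _ \<xi>]])
    also have "\<dots> = (\<Sum>l<n m. \<Sum>s\<in>F l. v (?t l s))"
    proof -
      have "v (\<lambda>p. \<Sum>l<n m. \<Sum>s\<in>F l. ?t l s p) = (\<Sum>l<n m. v (\<lambda>p. \<Sum>s\<in>F l. ?t l s p))"
        by (rule tan_sum[OF v]) (rule msmooth_sum, rule smt)
      also have "\<dots> = (\<Sum>l<n m. \<Sum>s\<in>F l. v (?t l s))"
        by (rule sum.cong[OF refl tan_sum[OF v smt]])
      finally show ?thesis .
    qed
    also have "\<dots> = (\<Sum>l<n m. \<Sum>s\<in>F l. - (Re (cnj (vc (gf \<xi> m) (a l s)) * vc v (snd s)) - Re (cnj (vc v (a l s)) * vc (gf \<xi> m) (snd s))))"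
    proof (intro sum.cong refl)
      fix l s assume s: "s \<in> F l"
      have r: "msmooth (\<lambda>q. Re (a l s q))" "msmooth (\<lambda>q. Im (a l s q))" "msmooth (\<lambda>q. Re (snd s q))" "msmooth (\<lambda>q. Im (snd s q))"
        using sma[OF s] by (auto simp: msmooth_complex)
      have "v (?t l s) = (fst s \<bullet> \<xi>) * v (\<lambda>q. Im (a l s q) * Re (snd s q) - Re (a l s q) * Im (snd s q))"
        using tan_scale[OF v msmooth_diff[OF msmooth_mult[OF r(2,3)] msmooth_mult[OF r(1,4)]], of "fst s \<bullet> \<xi>"] by simp
      also have "\<dots> = (fst s \<bullet> \<xi>) * (Im (a l s m) * v (\<lambda>q. Re (snd s q)) + Re (snd s m) * v (\<lambda>q. Im (a l s q))
          - (Re (a l s m) * v (\<lambda>q. Im (snd s q)) + Im (snd s m) * v (\<lambda>q. Re (a l s q))))"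
        by (simp only: tan_diff[OF v msmooth_mult[OF r(2,3)] msmooth_mult[OF r(1,4)]] tan_mult[OF v r(2,3)] tan_mult[OF v r(1,4)])
      also have "\<dots> = - (Re (cnj (vc (gf \<xi> m) (a l s)) * vc v (snd s)) - Re (cnj (vc v (a l s)) * vc (gf \<xi> m) (snd s)))"
        unfolding vc_gf[OF F(2)[OF s] \<xi>] vc_gf[OF F(3)[OF s] \<xi>] by (simp add: vc_def algebra_simps)
      finally show "v (?t l s) = \<dots>" .
    qed
    also have "\<dots> = - \<omega> m (gf \<xi> m) v"
      unfolding ex[OF order_refl gf_tangent[OF \<xi>] v] by (simp only: sum_negf)
    finally show "\<omega> m (gf \<xi> m) v = - v (\<lambda>p. \<Theta> p \<bullet> \<xi>)" by simp
  qed
qed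

section \<open>Assignments\<close>

lemma locally_constant_imp_constant:
  assumes X: "connected X" and loc: "\<And>p. p \<in> X \<Longrightarrow> \<exists>W. open W \<and> p \<in> W \<and> (\<forall>q\<in>W \<inter> X. f q = f p)"
    and m: "m \<in> X" "m' \<in> X"
  shows "f m = f m'"
proof (rule connected_local_const[OF X m])
  show "\<forall>p\<in>X. \<forall>\<^sub>F q in at p within X. f p = f q"
  proof
    fix p assume "p \<in> X"
    from loc[OF this] obtain W where W: "open W" "p \<in> W" "\<forall>q\<in>W \<inter> X. f q = f p" by blast
    then show "\<forall>\<^sub>F q in at p within X. f p = f q"
      unfolding eventually_at_topological by (intro exI[of _ W]) auto
  qed
qed

lemma stratumD:
  assumes "X \<in> strata I \<A> act"
  shows "connected X" "X \<noteq> {}" "m \<in> X \<Longrightarrow> inf_stabilizer I \<A> act m = stratum_stabilizer I \<A> act X"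
proof -
  obtain h where h: "X \<in> components {m. inf_stabilizer I \<A> act m = h}" using assms by (auto simp: strata_def)
  show "connected X" "X \<noteq> {}" using in_components_connected[OF h] in_components_nonempty[OF h] by auto
  moreover have s: "inf_stabilizer I \<A> act m = h" if "m \<in> X" for m using in_components_subset[OF h] that by auto
  ultimately have "inf_stabilizer I \<A> act ` X = {h}" by auto
  then have "stratum_stabilizer I \<A> act X = h" by (simp add: stratum_stabilizer_def)
  then show "m \<in> X \<Longrightarrow> inf_stabilizer I \<A> act m = stratum_stabilizer I \<A> act X" using s by simp
qed

lemma stratum_ex: obtains X where "X \<in> strata I \<A> act" "m \<in> X"
proof
  let ?h = "inf_stabilizer I \<A> act m"
  let ?X = "connected_component_set {m. inf_stabilizer I \<A> act m = ?h} m"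
  have "?X \<in> components {m. inf_stabilizer I \<A> act m = ?h}" by (rule componentsI) simp
  moreover have "subspace ?h \<and> ?h \<subseteq> coord_space I"
    using subspace_inf_stabilizer by (auto simp: inf_stabilizer_def)
  ultimately show "?X \<in> strata I \<A> act" unfolding strata_def by blast
  show "m \<in> ?X" by simp
qed

text \<open>On a stratum only the values on the common stabilizer enter.\<close>

lemma assignment_of_cong:
  assumes "\<And>m \<xi>. \<xi> \<in> inf_stabilizer I \<A> act m \<Longrightarrow> \<Phi> m \<xi> = \<Phi>' m \<xi>"
  shows "assignment_of I \<A> act \<Phi> = assignment_of I \<A> act \<Phi>'"
  unfolding assignment_of_def
proof (rule restrict_ext)
  fix X assume X: "X \<in> strata I \<A> act"
  have "restrict (\<Phi> m) (stratum_stabilizer I \<A> act X) = restrict (\<Phi>' m) (stratum_stabilizer I \<A> act X)" if "m \<in> X" for m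
    using assms stratumD(3)[OF X that] by (auto intro!: restrict_ext)
  then have "(\<lambda>m. restrict (\<Phi> m) (stratum_stabilizer I \<A> act X)) ` X = (\<lambda>m. restrict (\<Phi>' m) (stratum_stabilizer I \<A> act X)) ` X"
    by (rule image_cong[OF refl])
  then show "the_elem ((\<lambda>m. restrict (\<Phi> m) (stratum_stabilizer I \<A> act X)) ` X) =
      the_elem ((\<lambda>m. restrict (\<Phi>' m) (stratum_stabilizer I \<A> act X)) ` X)"
    by simp
qed

text \<open>Local constancy of $\Phi^\xi$ on the zero set of $\xi_M$, for each \<xi>. Abstract moment maps and the
  moment maps of closed forms have it in common, and it makes assignments well defined.\<close>

definition locally_constant_on_zeros :: "('m \<Rightarrow> real^'k \<Rightarrow> real) \<Rightarrow> bool" where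
  "locally_constant_on_zeros \<Phi> \<longleftrightarrow> (\<forall>p. \<forall>\<xi>\<in>inf_stabilizer I \<A> act p.
     \<exists>W. open W \<and> p \<in> W \<and> (\<forall>q\<in>W. \<xi> \<in> inf_stabilizer I \<A> act q \<longrightarrow> \<Phi> q \<xi> = \<Phi> p \<xi>))"

text \<open>Strata are connected, so the locally constant functions $\Phi^\xi$ are constant on them, and
  the singleton in the definition of the assignment is what it should be.\<close>

lemma assignment_of_value:
  assumes lc: "locally_constant_on_zeros \<Phi>" and X: "X \<in> strata I \<A> act" and m: "m \<in> X"
  shows "assignment_of I \<A> act \<Phi> X = restrict (\<Phi> m) (inf_stabilizer I \<A> act m)"
proof -
  let ?h = "stratum_stabilizer I \<A> act X"
  have "restrict (\<Phi> q) ?h = restrict (\<Phi> m) ?h" if q: "q \<in> X" for q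
  proof (rule restrict_ext)
    fix \<xi> assume \<xi>: "\<xi> \<in> ?h"
    show "\<Phi> q \<xi> = \<Phi> m \<xi>"
    proof (rule locally_constant_imp_constant[where f = "\<lambda>p. \<Phi> p \<xi>", OF stratumD(1)[OF X] _ q m])
      fix p assume p: "p \<in> X"
      then have "\<xi> \<in> inf_stabilizer I \<A> act p" using stratumD(3)[OF X p] \<xi> by simp
      then obtain W where W: "open W" "p \<in> W" "\<forall>q\<in>W. \<xi> \<in> inf_stabilizer I \<A> act q \<longrightarrow> \<Phi> q \<xi> = \<Phi> p \<xi>"
        using lc[unfolded locally_constant_on_zeros_def, rule_format, of \<xi> p] by auto
      have "\<Phi> q \<xi> = \<Phi> p \<xi>" if "q \<in> W" "q \<in> X" for q
        using W(3) that(1) \<xi> stratumD(3)[OF X that(2)] by simp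
      then show "\<exists>W. open W \<and> p \<in> W \<and> (\<forall>q\<in>W \<inter> X. \<Phi> q \<xi> = \<Phi> p \<xi>)"
        using W(1,2) by (intro exI[of _ W]) simp
    qed
  qed
  then have "(\<lambda>m. restrict (\<Phi> m) ?h) ` X = (\<lambda>_. restrict (\<Phi> m) ?h) ` X" by (rule image_cong[OF refl])
  also have "\<dots> = {restrict (\<Phi> m) ?h}" using m by (simp add: image_constant[OF m])
  finally show ?thesis using X stratumD(3)[OF X m] by (simp add: assignment_of_def)
qed

lemma assignment_of_eqD:
  assumes "locally_constant_on_zeros \<Phi>" "locally_constant_on_zeros \<Phi>'"
    and eq: "assignment_of I \<A> act \<Phi> = assignment_of I \<A> act \<Phi>'"
    and \<xi>: "\<xi> \<in> inf_stabilizer I \<A> act m"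
  shows "\<Phi> m \<xi> = \<Phi>' m \<xi>"
proof -
  obtain X where X: "X \<in> strata I \<A> act" "m \<in> X" by (rule stratum_ex)
  have "restrict (\<Phi> m) (inf_stabilizer I \<A> act m) = restrict (\<Phi>' m) (inf_stabilizer I \<A> act m)"
    using assignment_of_value[OF assms(1) X] assignment_of_value[OF assms(2) X] eq by simp
  from fun_cong[OF this, of \<xi>] show ?thesis using \<xi> by simp
qed

section \<open>Local constancy of moment maps\<close>

lemma two_form_zero:
  assumes "two_form \<A> \<omega>" "v \<in> tangent_space \<A> m" shows "\<omega> m (\<lambda>f. 0) v = 0"
  using two_formD(2)[OF assms(1) zero_tangent assms(2), of 0] by simp

text \<open>By the moment equation the differential of $\Phi^\xi$ vanishes at the zeros of $\xi_M$.\<close>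

lemma eq_closed_locally_constant:
  assumes "(\<omega>, \<Phi>) \<in> eq_closed_two_forms I \<A> act"
  shows "locally_constant_on_zeros \<Phi>"
  unfolding locally_constant_on_zeros_def
proof (intro allI ballI)
  fix p \<xi> assume \<xi>: "\<xi> \<in> inf_stabilizer I \<A> act p"
  have c: "\<xi> \<in> coord_space I" using \<xi> by (simp add: inf_stabilizer_def)
  have a: "two_form \<A> \<omega>" "smooth_equivariant_map I \<A> act \<Phi>" "moment_equation I \<A> act \<omega> \<Phi>"
    using assms by (auto simp: eq_closed_two_forms_def closed_two_form_def)
  have s: "msmooth (\<lambda>m. \<Phi> m \<xi>)" using a(2) c by (simp add: smooth_equivariant_map_def C_infinity_iff)
  have 0: "v (\<lambda>m. \<Phi> m \<xi>) = 0" if "\<xi> \<in> inf_stabilizer I \<A> act m" "v \<in> tangent_space \<A> m" for m v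
  proof -
    have "\<omega> m (gf \<xi> m) v = - v (\<lambda>m. \<Phi> m \<xi>)" using a(3) c that(2) by (simp add: moment_equation_def)
    then show ?thesis using that two_form_zero[OF a(1) that(2)] by (simp add: inf_stabilizer_def)
  qed
  obtain W where W: "open W" "p \<in> W" "\<And>q. q \<in> W \<Longrightarrow> \<xi> \<in> inf_stabilizer I \<A> act q \<Longrightarrow> \<Phi> q \<xi> = \<Phi> p \<xi>"
    by (rule constant_on_zeros_near[of "\<lambda>m. \<Phi> m \<xi>", OF s \<xi>]) (rule 0, assumption, assumption, rule that)
  then show "\<exists>W. open W \<and> p \<in> W \<and> (\<forall>q\<in>W. \<xi> \<in> inf_stabilizer I \<A> act q \<longrightarrow> \<Phi> q \<xi> = \<Phi> p \<xi>)"
    by (intro exI[of _ W]) simp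
qed

lemma subgroup_one_parameter:
  assumes \<xi>: "\<xi> \<in> coord_space I"
  shows "subgroup (range (\<lambda>t. torus_exp (t *\<^sub>R \<xi>))) (torus I)"
proof -
  interpret group "torus I" by (rule group_torus)
  have inv: "inv\<^bsub>torus I\<^esub> torus_exp (t *\<^sub>R \<xi>) = torus_exp ((- t) *\<^sub>R \<xi>)" for t
  proof (rule inv_equality)
    have "torus_exp ((- t) *\<^sub>R \<xi>) * torus_exp (t *\<^sub>R \<xi>) = 1"
      by (simp only: torus_exp_add[symmetric] scaleR_add_left[symmetric]) (simp add: torus_exp_0)
    then show "torus_exp ((- t) *\<^sub>R \<xi>) \<otimes>\<^bsub>torus I\<^esub> torus_exp (t *\<^sub>R \<xi>) = \<one>\<^bsub>torus I\<^esub>" by (simp add: torus_def)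
  qed (rule torus_exp_in[OF scale_coord[OF \<xi>]])+
  have r: "torus_exp (t *\<^sub>R \<xi>) \<in> range (\<lambda>t. torus_exp (t *\<^sub>R \<xi>))" for t by (rule rangeI)
  show ?thesis
  proof (rule subgroup.intro)
    show "range (\<lambda>t. torus_exp (t *\<^sub>R \<xi>)) \<subseteq> carrier (torus I)"
      using torus_exp_in[OF scale_coord[OF \<xi>]] by auto
    show "x \<otimes>\<^bsub>torus I\<^esub> y \<in> range (\<lambda>t. torus_exp (t *\<^sub>R \<xi>))"
      if xy: "x \<in> range (\<lambda>t. torus_exp (t *\<^sub>R \<xi>))" "y \<in> range (\<lambda>t. torus_exp (t *\<^sub>R \<xi>))" for x y
    proof -
      obtain s t where st: "x = torus_exp (s *\<^sub>R \<xi>)" "y = torus_exp (t *\<^sub>R \<xi>)" using xy by blast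
      have "x \<otimes>\<^bsub>torus I\<^esub> y = torus_exp ((s + t) *\<^sub>R \<xi>)"
        unfolding st scaleR_add_left torus_exp_add by (simp add: torus_def)
      then show ?thesis using r by simp
    qed
    have "\<one>\<^bsub>torus I\<^esub> = torus_exp (0 *\<^sub>R \<xi>)" by (simp add: torus_def torus_exp_0)
    then show "\<one>\<^bsub>torus I\<^esub> \<in> range (\<lambda>t. torus_exp (t *\<^sub>R \<xi>))" using r by metis
    show "inv\<^bsub>torus I\<^esub> x \<in> range (\<lambda>t. torus_exp (t *\<^sub>R \<xi>))" if "x \<in> range (\<lambda>t. torus_exp (t *\<^sub>R \<xi>))" for x
    proof -
      obtain t where "x = torus_exp (t *\<^sub>R \<xi>)" using \<open>x \<in> _\<close> by blast
      then show ?thesis using r[of "- t"] by (simp only: inv)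
    qed
  qed
qed

text \<open>Apply the definition to the one-parameter subgroup generated by \<xi>, which may fail to be closed: its
  fixed points include the zeros of $\xi_M$, and its Lie algebra contains \<xi>.\<close>

lemma moment_map_locally_constant:
  assumes "abstract_moment_map I \<A> act \<Psi>"
  shows "locally_constant_on_zeros \<Psi>"
  unfolding locally_constant_on_zeros_def
proof (intro allI ballI)
  fix p \<xi> assume \<xi>: "\<xi> \<in> inf_stabilizer I \<A> act p"
  have c: "\<xi> \<in> coord_space I" using \<xi> by (simp add: inf_stabilizer_def)
  define H where "H = range (\<lambda>t. torus_exp (t *\<^sub>R \<xi>))"
  have fixd: "q \<in> fixed_set act H" if "\<xi> \<in> inf_stabilizer I \<A> act q" for q
    using inf_stabilizer_fixes[OF that] by (auto simp: fixed_set_def H_def exp_act_def)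
  have lie: "\<xi> \<in> lie_algebra_of I H" using c by (auto simp: lie_algebra_of_def H_def)
  have "locally (\<lambda>W. (\<lambda>m. restrict (\<Psi> m) (lie_algebra_of I H)) constant_on W) (fixed_set act H)"
    using assms[unfolded abstract_moment_map_def, THEN conjunct2, rule_format, OF subgroup_one_parameter[OF c]]
    unfolding H_def .
  note lc = this
  obtain U V where
    UV: "openin (top_of_set (fixed_set act H)) U" "(\<lambda>m. restrict (\<Psi> m) (lie_algebra_of I H)) constant_on V" "p \<in> U" "U \<subseteq> V"
    by (rule locallyE[OF lc openin_subtopology_self fixd[OF \<xi>]], rule that)
  from UV(2) obtain y where y: "\<forall>m\<in>V. restrict (\<Psi> m) (lie_algebra_of I H) = y" unfolding constant_on_def by (elim exE)
  from UV(1) obtain W where W: "open W" "U = fixed_set act H \<inter> W" unfolding openin_open by (elim exE conjE)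
  have "\<Psi> q \<xi> = \<Psi> p \<xi>" if "q \<in> W" "\<xi> \<in> inf_stabilizer I \<A> act q" for q
  proof -
    have "q \<in> V" "p \<in> V" using fixd[OF that(2)] that(1) W(2) UV(3,4) by blast+
    then have "restrict (\<Psi> q) (lie_algebra_of I H) = restrict (\<Psi> p) (lie_algebra_of I H)"
      using y[rule_format, of q] y[rule_format, of p] by (simp only:)
    from fun_cong[OF this, of \<xi>] show ?thesis using lie by simp
  qed
  then show "\<exists>W. open W \<and> p \<in> W \<and> (\<forall>q\<in>W. \<xi> \<in> inf_stabilizer I \<A> act q \<longrightarrow> \<Psi> q \<xi> = \<Psi> p \<xi>)"
    using W UV(3) by (intro exI[of _ W]) simp
qed

section \<open>Changing the two-form of a moment map\<close>

lemma dual_space_expansion: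
  assumes l: "l \<in> dual_space (coord_space I)" and \<xi>: "\<xi> \<in> coord_space I"
  shows "l \<xi> = (\<Sum>i\<in>I. \<xi> $ i * l (axis i 1))"
proof -
  have add: "l (x + y) = l x + l y" if "x \<in> coord_space I" "y \<in> coord_space I" for x y
    using l that by (simp add: dual_space_def)
  have sc: "l (k *\<^sub>R x) = k * l x" if "x \<in> coord_space I" for k x
    using l that by (simp add: dual_space_def)
  have K: "(\<Sum>i\<in>K. \<xi> $ i *\<^sub>R axis i 1) \<in> coord_space I \<and> l (\<Sum>i\<in>K. \<xi> $ i *\<^sub>R axis i 1) = (\<Sum>i\<in>K. \<xi> $ i * l (axis i 1))"
    if "finite K" "K \<subseteq> I" for K
    using that
  proof (induction K rule: finite_induct)
    case empty
    have "l (0 *\<^sub>R 0) = 0 * l 0" by (rule sc) (simp add: coord_space_def)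
    then show ?case by (simp add: coord_space_def)
  next
    case (insert i K)
    have "axis i 1 \<in> coord_space I" using insert.prems by (intro axis_coord) auto
    then show ?case using insert by (simp add: add sc scale_coord add_coord)
  qed
  have "\<xi> = (\<Sum>i\<in>UNIV. (\<xi> $ i) *\<^sub>R axis i 1)"
    using basis_expansion[of \<xi>] by (simp add: scalar_mult_eq_scaleR)
  also have "\<dots> = (\<Sum>i\<in>I. (\<xi> $ i) *\<^sub>R axis i 1)"
    by (rule sum.mono_neutral_right) (use \<xi> in \<open>auto simp: coord_space_def\<close>)
  finally show ?thesis using K[of I] by simp
qed

text \<open>The difference \<Theta> of the two moment maps, as a vector-valued function, satisfies the hypotheses of
  \<open>exists_exact_form\<close>; adding the form found there to \<omega> corrects \<Phi> to \<Psi>.\<close>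

lemma hamiltonian_of_equal_assignment:
  assumes \<Psi>: "smooth_equivariant_map I \<A> act \<Psi>"
    and cl: "(\<omega>, \<Phi>) \<in> eq_closed_two_forms I \<A> act"
    and eq: "\<And>m \<xi>. \<xi> \<in> inf_stabilizer I \<A> act m \<Longrightarrow> \<Psi> m \<xi> = \<Phi> m \<xi>"
  shows "hamiltonian I \<A> act \<Psi>"
proof -
  have \<Phi>: "smooth_equivariant_map I \<A> act \<Phi>" and \<omega>: "closed_two_form \<A> \<omega>" "invariant_two_form I \<A> act \<omega>" "moment_equation I \<A> act \<omega> \<Phi>"
    using cl by (auto simp: eq_closed_two_forms_def)
  define \<Theta> :: "'m \<Rightarrow> real^'k" where "\<Theta> m = (\<Sum>i\<in>I. (\<Psi> m (axis i 1) - \<Phi> m (axis i 1)) *\<^sub>R axis i 1)" for m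
  have \<Theta>: "\<Theta> m \<bullet> \<xi> = \<Psi> m \<xi> - \<Phi> m \<xi>" if \<xi>: "\<xi> \<in> coord_space I" for m \<xi>
  proof -
    have "\<Psi> m \<in> dual_space (coord_space I)" "\<Phi> m \<in> dual_space (coord_space I)"
      using \<Psi>[unfolded smooth_equivariant_map_def, THEN conjunct1] \<Phi>[unfolded smooth_equivariant_map_def, THEN conjunct1]
      by simp_all
    from dual_space_expansion[OF this(1) \<xi>] dual_space_expansion[OF this(2) \<xi>]
    show ?thesis
      by (simp add: \<Theta>_def inner_sum_left inner_axis' right_diff_distrib left_diff_distrib sum_subtractf mult.commute)
  qed
  have sm: "msmooth (\<lambda>m. \<Psi> m \<xi>)" "msmooth (\<lambda>m. \<Phi> m \<xi>)" if "\<xi> \<in> coord_space I" for \<xi>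
    using bspec[OF \<Psi>[unfolded smooth_equivariant_map_def, THEN conjunct2, THEN conjunct1] that]
      bspec[OF \<Phi>[unfolded smooth_equivariant_map_def, THEN conjunct2, THEN conjunct1] that]
    unfolding C_infinity_iff .
  have s\<Theta>: "msmooth \<Theta>"
    unfolding \<Theta>_def
  proof (rule msmooth_sum)
    fix i assume "i \<in> I"
    then have c: "axis i 1 \<in> coord_space I" by (rule axis_coord)
    have "msmooth (\<lambda>q. \<Psi> q (axis i 1) - \<Phi> q (axis i 1))" by (rule msmooth_diff[OF sm(1)[OF c] sm(2)[OF c]])
    then show "msmooth (\<lambda>q. (\<Psi> q (axis i 1) - \<Phi> q (axis i 1)) *\<^sub>R axis i 1)"
      by (rule msmooth_linear[OF bounded_linear_scaleR_left])
  qed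
  have inv: "\<Theta> (exp_act \<xi> m) = \<Theta> m" if "\<xi> \<in> coord_space I" for \<xi> m
  proof -
    have "\<Psi> (exp_act \<xi> m) = \<Psi> m" "\<Phi> (exp_act \<xi> m) = \<Phi> m"
      using bspec[OF \<Psi>[unfolded smooth_equivariant_map_def, THEN conjunct2, THEN conjunct2] torus_exp_in[OF that]]
        bspec[OF \<Phi>[unfolded smooth_equivariant_map_def, THEN conjunct2, THEN conjunct2] torus_exp_in[OF that]]
      unfolding exp_act_def by simp_all
    then show ?thesis by (simp add: \<Theta>_def)
  qed
  have van: "\<Theta> m \<bullet> \<xi> = 0" if "\<xi> \<in> inf_stabilizer I \<A> act m" for m \<xi>
    using \<Theta>[of \<xi> m] eq[OF that] that by (simp add: inf_stabilizer_def)
  obtain \<omega>' where \<omega>': "closed_two_form \<A> \<omega>'"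
    "\<And>g m v w. g \<in> carrier (torus I) \<Longrightarrow> v \<in> tangent_space \<A> m \<Longrightarrow> w \<in> tangent_space \<A> m \<Longrightarrow>
        \<omega>' (act g m) (push_forward \<A> (act g) v) (push_forward \<A> (act g) w) = \<omega>' m v w"
    "\<And>\<xi> m v. \<xi> \<in> coord_space I \<Longrightarrow> v \<in> tangent_space \<A> m \<Longrightarrow> \<omega>' m (gf \<xi> m) v = - v (\<lambda>p. \<Theta> p \<bullet> \<xi>)"
    by (rule exists_exact_form[OF s\<Theta> inv van], assumption, assumption, rule that)
  let ?\<omega> = "\<lambda>m v w. \<omega> m v w + \<omega>' m v w"
  have c: "closed_two_form \<A> ?\<omega>" by (rule closed_two_form_add[OF \<omega>(1) \<omega>'(1)])
  moreover have "invariant_two_form I \<A> act ?\<omega>"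
    unfolding invariant_two_form_def
  proof (intro conjI ballI allI)
    show "two_form \<A> ?\<omega>" using c by (simp add: closed_two_form_def)
    fix g m v w assume "g \<in> carrier (torus I)" "v \<in> tangent_space \<A> m" "w \<in> tangent_space \<A> m"
    then show "\<omega> (act g m) (push_forward \<A> (act g) v) (push_forward \<A> (act g) w) +
        \<omega>' (act g m) (push_forward \<A> (act g) v) (push_forward \<A> (act g) w) = \<omega> m v w + \<omega>' m v w"
      using \<omega>(2) \<omega>'(2) by (simp add: invariant_two_form_def)
  qed
  moreover have "moment_equation I \<A> act ?\<omega> \<Psi>"
    unfolding moment_equation_def
  proof (intro ballI allI)
    fix \<xi> m v assume \<xi>: "\<xi> \<in> coord_space I" and v: "v \<in> tangent_space \<A> m"
    have "\<omega> m (gf \<xi> m) v = - v (\<lambda>p. \<Phi> p \<xi>)" using \<omega>(3) \<xi> v by (simp add: moment_equation_def)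
    moreover have "\<omega>' m (gf \<xi> m) v = - v (\<lambda>p. \<Psi> p \<xi> - \<Phi> p \<xi>)" using \<omega>'(3)[OF \<xi> v] \<Theta>[OF \<xi>] by simp
    ultimately show "\<omega> m (gf \<xi> m) v + \<omega>' m (gf \<xi> m) v = - v (\<lambda>p. \<Psi> p \<xi>)"
      using tan_diff[OF v sm(1)[OF \<xi>] sm(2)[OF \<xi>]] by simp
  qed
  ultimately show ?thesis unfolding hamiltonian_def by (intro exI[of _ ?\<omega>] conjI)
qed

section \<open>Cohomology classes and their assignments\<close>

text \<open>The difference of the moment maps is $\mu(\xi_M)$, which vanishes with $\xi_M$.\<close>

lemma cohomologous_assignment:
  assumes "eq_exact_two_form I \<A> act (eq_diff I (\<omega>, \<Phi>) (\<omega>', \<Phi>'))"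
  shows "assignment_of I \<A> act \<Phi> = assignment_of I \<A> act \<Phi>'"
proof (rule assignment_of_cong)
  fix m \<xi> assume \<xi>: "\<xi> \<in> inf_stabilizer I \<A> act m"
  then have c: "\<xi> \<in> coord_space I" "gf \<xi> m = (\<lambda>f. 0)" by (auto simp: inf_stabilizer_def)
  obtain \<mu> where \<mu>: "one_form \<A> \<mu>"
    "\<forall>\<xi>\<in>coord_space I. \<forall>m. restrict (\<lambda>\<xi>. \<Phi> m \<xi> - \<Phi>' m \<xi>) (coord_space I) \<xi> = \<mu> m (gf \<xi> m)"
    using assms unfolding eq_exact_two_form_def eq_diff_def invariant_one_form_def prod.case
    by (elim exE conjE)
  have "\<mu> m (\<lambda>f. 0 * (0::real)) = 0 * \<mu> m (\<lambda>f. 0)"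
    using \<mu>(1)[unfolded one_form_def, THEN conjunct2, THEN conjunct1, rule_format, OF zero_tangent] .
  then show "\<Phi> m \<xi> = \<Phi>' m \<xi>" using spec[OF bspec[OF \<mu>(2) c(1)], of m] c by simp
qed

lemma cohomologous_refl: "eq_exact_two_form I \<A> act (eq_diff I \<alpha> \<alpha>)"
proof -
  obtain \<omega> \<Phi> where \<alpha>: "\<alpha> = (\<omega>, \<Phi>)" by (cases \<alpha>)
  have "invariant_one_form I \<A> act (\<lambda>m v. 0)"
    by (simp add: invariant_one_form_def one_form_def C_infinity_iff msmooth_const)
  moreover have "0 = d_one_form (\<lambda>m v. 0) X Y m" if "vector_field \<A> X" "vector_field \<A> Y" for X Y m
    using tan_const[OF vector_field_tangent[OF that(1)], of m 0] tan_const[OF vector_field_tangent[OF that(2)], of m 0]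
    by (simp add: d_one_form_def)
  ultimately show ?thesis
    unfolding eq_exact_two_form_def eq_diff_def \<alpha> prod.case
    by (intro exI[of _ "\<lambda>m v. 0"] conjI allI impI ballI) simp_all
qed

text \<open>All representatives have the same assignment, so the choice of one does not matter.\<close>

lemma rho_class:
  assumes \<alpha>: "(\<omega>, \<Phi>) \<in> eq_closed_two_forms I \<A> act"
  defines "R \<equiv> {(\<alpha>, \<beta>). \<alpha> \<in> eq_closed_two_forms I \<A> act \<and> \<beta> \<in> eq_closed_two_forms I \<A> act \<and>
        eq_exact_two_form I \<A> act (eq_diff I \<alpha> \<beta>)}"
  shows "rho I \<A> act (R `` {(\<omega>, \<Phi>)}) = assignment_of I \<A> act \<Phi>"
proof -
  let ?a = "\<lambda>(\<omega>, \<Phi>). assignment_of I \<A> act \<Phi>"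
  have v: "?a \<beta> = assignment_of I \<A> act \<Phi>" if "\<beta> \<in> R `` {(\<omega>, \<Phi>)}" for \<beta>
  proof -
    obtain \<omega>' \<Phi>' where \<beta>: "\<beta> = (\<omega>', \<Phi>')" by (cases \<beta>)
    have "eq_exact_two_form I \<A> act (eq_diff I (\<omega>, \<Phi>) (\<omega>', \<Phi>'))"
      using that unfolding R_def Image_singleton_iff \<beta> mem_Collect_eq prod.case by (elim conjE)
    from cohomologous_assignment[OF this] show ?thesis unfolding \<beta> prod.case by (rule sym)
  qed
  have "(\<omega>, \<Phi>) \<in> R `` {(\<omega>, \<Phi>)}"
    unfolding R_def Image_singleton_iff mem_Collect_eq prod.case by (intro conjI \<alpha> cohomologous_refl)
  then have "(\<lambda>_. assignment_of I \<A> act \<Phi>) ` (R `` {(\<omega>, \<Phi>)}) = {assignment_of I \<A> act \<Phi>}"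
    by (rule image_constant)
  with image_cong[OF refl v] have "?a ` (R `` {(\<omega>, \<Phi>)}) = {assignment_of I \<A> act \<Phi>}" by (rule trans)
  then show ?thesis unfolding rho_def by (simp only: the_elem_eq)
qed

lemma hamiltonian_iff_assignment_in_image_rho:
  assumes mm: "abstract_moment_map I \<A> act \<Psi>" and A: "A = assignment_of I \<A> act \<Psi>"
  shows "hamiltonian I \<A> act \<Psi> \<longleftrightarrow> A \<in> rho I \<A> act ` H2_equivariant I \<A> act"
proof -
  let ?C = "eq_closed_two_forms I \<A> act"
  let ?R = "{(\<alpha>, \<beta>). \<alpha> \<in> ?C \<and> \<beta> \<in> ?C \<and> eq_exact_two_form I \<A> act (eq_diff I \<alpha> \<beta>)}"
  have \<Psi>: "smooth_equivariant_map I \<A> act \<Psi>" using mm unfolding abstract_moment_map_def by (rule conjunct1)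
  show ?thesis
  proof
    assume "hamiltonian I \<A> act \<Psi>"
    then obtain \<omega> where h: "closed_two_form \<A> \<omega>" "invariant_two_form I \<A> act \<omega>" "moment_equation I \<A> act \<omega> \<Psi>"
      unfolding hamiltonian_def by (elim exE conjE)
    have \<omega>: "(\<omega>, \<Psi>) \<in> ?C"
      unfolding eq_closed_two_forms_def mem_Collect_eq prod.case by (intro conjI h \<Psi>)
    show "A \<in> rho I \<A> act ` H2_equivariant I \<A> act"
    proof (rule image_eqI)
      show "A = rho I \<A> act (?R `` {(\<omega>, \<Psi>)})" unfolding A by (rule rho_class[OF \<omega>, symmetric])
      show "?R `` {(\<omega>, \<Psi>)} \<in> H2_equivariant I \<A> act"
        unfolding H2_equivariant_def by (rule quotientI[OF \<omega>])
    qed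
  next
    assume "A \<in> rho I \<A> act ` H2_equivariant I \<A> act"
    then obtain c where c: "A = rho I \<A> act c" "c \<in> ?C // ?R" unfolding H2_equivariant_def by (rule imageE)
    obtain \<omega> \<Phi> where \<alpha>: "(\<omega>, \<Phi>) \<in> ?C" "c = ?R `` {(\<omega>, \<Phi>)}"
    proof -
      from c(2) obtain x where "c = ?R `` {x}" "x \<in> ?C" by (rule quotientE)
      then show thesis using that[of "fst x" "snd x"] by (simp only: prod.collapse)
    qed
    have eq: "assignment_of I \<A> act \<Psi> = assignment_of I \<A> act \<Phi>"
      using c(1) unfolding \<alpha>(2) rho_class[OF \<alpha>(1)] A .
    have vals: "\<Psi> m \<xi> = \<Phi> m \<xi>" if "\<xi> \<in> inf_stabilizer I \<A> act m" for m \<xi>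
      by (rule assignment_of_eqD[where \<Phi> = \<Psi> and \<Phi>' = \<Phi> and m = m and \<xi> = \<xi>,
            OF moment_map_locally_constant[OF mm] eq_closed_locally_constant[OF \<alpha>(1)] eq that])
    show "hamiltonian I \<A> act \<Psi>"
      by (rule hamiltonian_of_equal_assignment[OF \<Psi> \<alpha>(1)]) (rule vals)
  qed
qed


end

theorem theorem5p6:
  fixes J :: "'n::finite set"
    and \<A> :: "('m::{t2_space, second_countable_topology}, 'n) chart set"
    and I :: "'k::finite set"
    and act :: "complex^'k \<Rightarrow> 'm \<Rightarrow> 'm"
    and \<Psi> :: "'m \<Rightarrow> real^'k \<Rightarrow> real"
    and A :: "'m set \<Rightarrow> real^'k \<Rightarrow> real"
  assumes "smooth_atlas J \<A>"
    and "smooth_torus_action I \<A> act"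
    and "abstract_moment_map I \<A> act \<Psi>"
    and "A \<in> assignments I \<A> act"
    and "A = assignment_of I \<A> act \<Psi>"
  shows "hamiltonian I \<A> act \<Psi> \<longleftrightarrow> A \<in> rho I \<A> act ` H2_equivariant I \<A> act"
  by (rule torus_manifold.hamiltonian_iff_assignment_in_image_rho[OF
        torus_manifold.intro[OF manifold.intro[OF assms(1)] torus_manifold_axioms.intro[OF assms(2)]]
        assms(3) assms(5)])

end
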